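(* Let $(\mathcal S,h;\mathscr S)$ be an $\mathscr S$-exhausted Hermitian Riemann surface of $\mathscr S$-radius $R^{\mathscr S}$ with respect to $o$. Let $\gamma$ be a positive measurable function on $(0,R^{\mathscr S})$, integrable on $(0,r)$ for every $r<R^{\mathscr S}$, with $\int_0^{R^{\mathscr S}}\gamma(r)\,dr=\infty$. Let $f$ be a nonconstant meromorphic function on $\mathcal S$ and let $a_1,\dots,a_q$ be distinct values in $\overline{\mathbb C}=\mathbb P^1(\mathbb C)$. Then for any $\delta>0$ $$(q-2)T^{\mathscr S}_f(r)+T^{\mathscr S}(r,\mathscr R)\le \sum_{j=1}^q\overline N^{\mathscr S}_f(r,a_j)+O\Big(\log T^{\mathscr S}_f(r)+\log\|\mathscr S\|_{r,\sup}+\log\gamma(r)+\delta\log r\Big)$$ holds for all $r\in(0,R^{\mathscr S})$ outside a set $E_\delta$ with $\int_{E_\delta}\gamma(r)\,dr<\infty$, where $\|\mathscr S\|_{r,\sup}=\sup\{\|\mathscr S_x\|_h:\ |\hat x|<r\}$.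
   Context: $\mathcal S$ is a non-compact (connected) Riemann surface with a fixed point $o$. $\mathscr S$ is a holomorphic 1-form on $\mathcal S$ such that: (a) $\mathscr S$ has no zeros; (b) $\int_c\mathscr S=0$ for every smooth simple closed curve $c$ in $\mathcal S$, so that $L(x)=\hat x:=\int_o^x\mathscr S$ is a well-defined holomorphic function on $\mathcal S$; (c) $L(x)=0$ if and only if $x=o$. Put $D^{\mathscr S}(r)=\{x\in\mathcal S:|\hat x|<r\}$ and $C^{\mathscr S}(r)=\{x\in\mathcal S:|\hat x|=r\}$. $\mathcal S$ is called $\mathscr S$-exhausted if, whenever $0<r_1<r_2<\cdots$, $r_n\to+\infty$, one has $\mathcal S=\bigcup_n D^{\mathscr S}(r_n)$ and either (i) $D^{\mathscr S}(r_1)\subset\overline{D^{\mathscr S}(r_1)}\subset D^{\mathscr S}(r_2)\subset\overline{D^{\mathscr S}(r_2)}\subset\cdots\subset\mathcal S$, or (ii) there is $k\ge1$ with $D^{\mathscr S}(r_1)\subset\overline{D^{\mathscr S}(r_1)}\subset\cdots\subset D^{\mathscr S}(r_k)=D^{\mathscr S}(r_{k+1})=\cdots=\mathcal S$. The $\mathscr S$-radius is $R^{\mathscr S}=\sup\{r>0: C^{\mathscr S}(r)\neq\emptyset\}\in(0,\infty]$; as usual for exhaustions, $D^{\mathscr S}(r)$ is relatively compact in $\mathcal S$ for $0<r<R^{\mathscr S}$. $h$ is a (smooth) Hermitian metric on $\mathcal S$; in a local coordinate $z$ it is given by a positive function, also denoted $h$, normalized so that the Riemannian area element is $dV=\sqrt{-1}\,h\,dz\wedge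 d\bar z$ (Riemannian metric $2h|dz|^2$). $\|\mathscr S\|_h$ is the pointwise norm with respect to this Riemannian metric: $\|\mathscr S\|_h=|\phi|/\sqrt{2h}$ if $\mathscr S=\phi\,dz$ (so $\|dz\|=1$ for the Euclidean metric). $d^c=\frac{\sqrt{-1}}{4\pi}(\bar\partial-\partial)$, $dd^c=\frac{\sqrt{-1}}{2\pi}\partial\bar\partial$. The Fubini–Study form on $\mathbb P^1(\mathbb C)$ is $\omega_{FS}=dd^c\log(|\zeta_0|^2+|\zeta_1|^2)$. The Ricci form of $(\mathcal S,h)$ is $\mathscr R=-dd^c\log h$. Fix $0<r_0<R^{\mathscr S}$. For $r_0<r<R^{\mathscr S}$, viewing $f$ as a holomorphic map to $\mathbb P^1(\mathbb C)$, $$T^{\mathscr S}_f(r)=\int_{r_0}^r\frac{dt}{t}\int_{D^{\mathscr S}(t)}f^*\omega_{FS},\quad T^{\mathscr S}(r,\mathscr R)=\int_{r_0}^r\frac{dt}{t}\int_{D^{\mathscr S}(t)}\mathscr R,\quad \overline N^{\mathscr S}_f(r,a)=\int_{r_0}^r\frac{\overline n^{\mathscr S}_f(t,a)}{t}dt,$$ where $\overline n^{\mathscr S}_f(t,a)$ is the number of points of $D^{\mathscr S}(t)$ where $f=a$, counted without multiplicity. Convention: the error term $O(A_1+\cdots+A_m)$ denotes a quantity bounded above by $C(1+A_1^++\cdots+A_m^+)$ with $A^+=\max(A,0)$ and $C$ a constant independent of $r$ and $\delta$; the interval $(0,r_0]$, where the functions are not defined, is understood to be contained in $E_\delta$. 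*)

theory Defs
  imports "HOL-Analysis.Analysis"
begin

section \<open>Riemann surfaces\<close>

text \<open>
  The surface is the whole type \<open>'a\<close>. A chart is a pair of its domain and its coordinate
  function; values of the coordinate function outside the domain are irrelevant.
\<close>

type_synonym 'a chart = "'a set \<times> ('a \<Rightarrow> complex)"

definition chart_inv :: "'a chart \<Rightarrow> complex \<Rightarrow> 'a" where
  "chart_inv c = inv_into (fst c) (snd c)"

definition is_chart :: "'a::topological_space chart \<Rightarrow> bool" where
  "is_chart c \<longleftrightarrow> open (fst c) \<and> open (snd c ` fst c) \<and> inj_on (snd c) (fst c) \<and>
     homeomorphism (fst c) (snd c ` fst c) (snd c) (chart_inv c)"

definition complex_atlas :: "'a::topological_space chart set \<Rightarrow> bool" where
  "complex_atlas A \<longleftrightarrow> (\<forall>c\<in>A. is_chart c) \<and> (\<Union>c\<in>A. fst c) = UNIV \<and>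
     (\<forall>c\<in>A. \<forall>d\<in>A. (snd d \<circ> chart_inv c) holomorphic_on (snd c ` (fst c \<inter> fst d)))"

definition riemann_surface :: "'a::t2_space chart set \<Rightarrow> bool" where
  "riemann_surface A \<longleftrightarrow> complex_atlas A \<and> connected (UNIV :: 'a set)"

text \<open>
  An arbitrary chart around a point. It is used only for quantities which do not depend on
  the chart.
\<close>

definition chart_at :: "'a chart set \<Rightarrow> 'a \<Rightarrow> 'a chart" where
  "chart_at A x = (SOME c. c \<in> A \<and> x \<in> fst c)"

text \<open>The derivative at \<open>x\<close> of the coordinate of \<open>d\<close> with respect to that of \<open>c\<close>.\<close>

definition transition_deriv :: "'a chart \<Rightarrow> 'a chart \<Rightarrow> 'a \<Rightarrow> complex" where
  "transition_deriv c d x = deriv (snd d \<circ> chart_inv c) (snd c x)"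

definition holomorphic_fun_on :: "'a chart set \<Rightarrow> 'a set \<Rightarrow> ('a \<Rightarrow> complex) \<Rightarrow> bool" where
  "holomorphic_fun_on A V F \<longleftrightarrow>
     (\<forall>c\<in>A. (F \<circ> chart_inv c) holomorphic_on (snd c ` (V \<inter> fst c)))"


section \<open>Holomorphic 1-forms and their integrals\<close>

text \<open>
  A 1-form is given by its coefficients: it equals \<open>S c x\<close> times \<open>dz\<close> at the point \<open>x\<close>,
  where \<open>z\<close> is the coordinate of the chart \<open>c\<close>.
\<close>

type_synonym 'a one_form = "'a chart \<Rightarrow> 'a \<Rightarrow> complex"

definition holomorphic_one_form :: "'a chart set \<Rightarrow> 'a one_form \<Rightarrow> bool" where
  "holomorphic_one_form A S \<longleftrightarrow>
     (\<forall>c\<in>A. (S c \<circ> chart_inv c) holomorphic_on (snd c ` fst c)) \<and>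
     (\<forall>c\<in>A. \<forall>d\<in>A. \<forall>x \<in> fst c \<inter> fst d. S c x = S d x * transition_deriv c d x)"

text \<open>
  Infinitely differentiable curves with parameter interval \<open>I\<close>; \<open>G n\<close> is the \<open>n\<close>-th
  derivative of the curve in a chart (one-sided at end points of \<open>I\<close>).
\<close>

definition smooth_curve_on :: "'a chart set \<Rightarrow> real set \<Rightarrow> (real \<Rightarrow> 'a) \<Rightarrow> bool" where
  "smooth_curve_on A I g \<longleftrightarrow>
     (\<forall>t\<in>I. \<forall>c\<in>A. g t \<in> fst c \<longrightarrow>
        (\<exists>e>0. \<exists>G :: nat \<Rightarrow> real \<Rightarrow> complex.
           \<forall>s \<in> I \<inter> {t - e<..<t + e}.
             g s \<in> fst c \<and> G 0 s = snd c (g s) \<and>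
             (\<forall>n. (G n has_vector_derivative G (Suc n) s) (at s within I))))"

definition smooth_path :: "'a chart set \<Rightarrow> 'a \<Rightarrow> 'a \<Rightarrow> (real \<Rightarrow> 'a) \<Rightarrow> bool" where
  "smooth_path A x y g \<longleftrightarrow> smooth_curve_on A {0..1} g \<and> g 0 = x \<and> g 1 = y"

text \<open>Smooth maps from the circle, seen as 1-periodic maps on the line.\<close>

definition smooth_simple_closed_curve :: "'a chart set \<Rightarrow> (real \<Rightarrow> 'a) \<Rightarrow> bool" where
  "smooth_simple_closed_curve A g \<longleftrightarrow>
     smooth_curve_on A UNIV g \<and> (\<forall>t. g (t + 1) = g t) \<and> inj_on g {0..<1}"

definition curve_integral :: "'a chart set \<Rightarrow> 'a one_form \<Rightarrow> (real \<Rightarrow> 'a) \<Rightarrow> complex" where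
  "curve_integral A S g =
     integral {0..1}
       (\<lambda>t. let c = chart_at A (g t)
            in S c (g t) * vector_derivative (snd c \<circ> g) (at t within {0..1}))"

definition primitive_from :: "'a chart set \<Rightarrow> 'a one_form \<Rightarrow> 'a \<Rightarrow> 'a \<Rightarrow> complex" where
  "primitive_from A S b x = (THE w. \<forall>g. smooth_path A b x g \<longrightarrow> curve_integral A S g = w)"

definition admissible_form :: "'a chart set \<Rightarrow> 'a one_form \<Rightarrow> 'a \<Rightarrow> bool" where
  "admissible_form A S b \<longleftrightarrow>
     holomorphic_one_form A S \<and>
     (\<forall>c\<in>A. \<forall>x\<in>fst c. S c x \<noteq> 0) \<and>
     (\<forall>g. smooth_simple_closed_curve A g \<longrightarrow> curve_integral A S g = 0) \<and>
     (\<forall>x. primitive_from A S b x = 0 \<longleftrightarrow> x = b)"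


section \<open>Exhaustion by the discs of a 1-form\<close>

definition disc :: "'a chart set \<Rightarrow> 'a one_form \<Rightarrow> 'a \<Rightarrow> real \<Rightarrow> 'a set" where
  "disc A S b r = {x. norm (primitive_from A S b x) < r}"

definition circ :: "'a chart set \<Rightarrow> 'a one_form \<Rightarrow> 'a \<Rightarrow> real \<Rightarrow> 'a set" where
  "circ A S b r = {x. norm (primitive_from A S b x) = r}"

definition form_radius :: "'a chart set \<Rightarrow> 'a one_form \<Rightarrow> 'a \<Rightarrow> ereal" where
  "form_radius A S b = Sup (ereal ` {r. r > 0 \<and> circ A S b r \<noteq> {}})"

text \<open>
  The two alternatives for sequences are stated with non-strict inclusions, which is the
  weaker condition; the last conjunct is the relative compactness required of an exhaustion.
\<close>

definition exhausted ::
  "'a::topological_space chart set \<Rightarrow> 'a one_form \<Rightarrow> 'a \<Rightarrow> bool" where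
  "exhausted A S b \<longleftrightarrow>
     (\<forall>r :: nat \<Rightarrow> real. 0 < r 0 \<and> strict_mono r \<and> filterlim r at_top sequentially \<longrightarrow>
        (\<Union>n. disc A S b (r n)) = UNIV \<and>
        ((\<forall>n. disc A S b (r n) \<subseteq> closure (disc A S b (r n)) \<and>
              closure (disc A S b (r n)) \<subseteq> disc A S b (r (Suc n))) \<or>
         (\<exists>k. (\<forall>n<k. disc A S b (r n) \<subseteq> closure (disc A S b (r n)) \<and>
                     closure (disc A S b (r n)) \<subseteq> disc A S b (r (Suc n))) \<and>
              (\<forall>n\<ge>k. disc A S b (r n) = UNIV)))) \<and>
     (\<forall>r. 0 < r \<and> ereal r < form_radius A S b \<longrightarrow> compact (closure (disc A S b r)))"


section \<open>Hermitian metrics\<close>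

text \<open>
  Infinite differentiability of a real function on an open subset of the plane; \<open>H m n\<close> is
  the mixed partial derivative of order \<open>m\<close> in \<open>x\<close> and \<open>n\<close> in \<open>y\<close>.
\<close>

definition smooth_fun_on :: "complex set \<Rightarrow> (complex \<Rightarrow> real) \<Rightarrow> bool" where
  "smooth_fun_on U u \<longleftrightarrow>
     (\<exists>H :: nat \<Rightarrow> nat \<Rightarrow> complex \<Rightarrow> real. \<forall>z\<in>U. H 0 0 z = u z \<and>
        (\<forall>m n. (H m n has_derivative (\<lambda>v. Re v * H (Suc m) n z + Im v * H m (Suc n) z)) (at z)))"

text \<open>
  A metric is given by its coefficients: the area form is \<open>\<i> * h c\<close> times
  \<open>dz \<and> d(cnj z)\<close> in the coordinate \<open>z\<close> of \<open>c\<close>, and the Riemannian metric is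
  \<open>2 * h c\<close> times \<open>\<bar>dz\<bar>\<^sup>2\<close>.
\<close>

type_synonym 'a metric_coeff = "'a chart \<Rightarrow> 'a \<Rightarrow> real"

definition hermitian_metric :: "'a chart set \<Rightarrow> 'a metric_coeff \<Rightarrow> bool" where
  "hermitian_metric A h \<longleftrightarrow>
     (\<forall>c\<in>A. (\<forall>x\<in>fst c. h c x > 0) \<and> smooth_fun_on (snd c ` fst c) (h c \<circ> chart_inv c)) \<and>
     (\<forall>c\<in>A. \<forall>d\<in>A. \<forall>x \<in> fst c \<inter> fst d. h c x = h d x * (norm (transition_deriv c d x))\<^sup>2)"

definition form_norm :: "'a chart set \<Rightarrow> 'a metric_coeff \<Rightarrow> 'a one_form \<Rightarrow> 'a \<Rightarrow> real" where
  "form_norm A h S x = (let c = chart_at A x in norm (S c x) / sqrt (2 * h c x))"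


section \<open>Real 2-forms\<close>

text \<open>A 2-form is given by its coefficients with respect to \<open>dx \<and> dy\<close>, where \<open>z = x + \<i> y\<close>.\<close>

type_synonym 'a two_form = "'a chart \<Rightarrow> 'a \<Rightarrow> real"

text \<open>
  Lebesgue integral over \<open>D\<close>: cut \<open>D\<close> into countably many measurable pieces lying in charts.
  For a form with the usual transformation law, neither integrability nor the value depends on
  the partition.
\<close>

definition has_form_integral ::
  "'a chart set \<Rightarrow> 'a two_form \<Rightarrow> 'a set \<Rightarrow> real \<Rightarrow> bool" where
  "has_form_integral A \<eta> D I \<longleftrightarrow>
     (\<exists>(c :: nat \<Rightarrow> 'a chart) P.
        (\<forall>n. c n \<in> A \<and> P n \<subseteq> fst (c n) \<and> snd (c n) ` P n \<in> sets lebesgue \<and>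
             set_integrable lebesgue (snd (c n) ` P n) (\<eta> (c n) \<circ> chart_inv (c n))) \<and>
        disjoint_family P \<and> (\<Union>n. P n) = D \<and>
        summable (\<lambda>n. LINT z:snd (c n) ` P n|lebesgue. \<bar>(\<eta> (c n) \<circ> chart_inv (c n)) z\<bar>) \<and>
        I = (\<Sum>n. LINT z:snd (c n) ` P n|lebesgue. (\<eta> (c n) \<circ> chart_inv (c n)) z))"

definition form_integral :: "'a chart set \<Rightarrow> 'a two_form \<Rightarrow> 'a set \<Rightarrow> real" where
  "form_integral A \<eta> D = (THE I. has_form_integral A \<eta> D I)"

definition dz :: "(complex \<Rightarrow> complex) \<Rightarrow> complex \<Rightarrow> complex" where
  "dz F z = (vector_derivative (\<lambda>t. F (z + of_real t)) (at 0)
             - \<i> * vector_derivative (\<lambda>t. F (z + \<i> * of_real t)) (at 0)) / 2"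

definition dzbar :: "(complex \<Rightarrow> complex) \<Rightarrow> complex \<Rightarrow> complex" where
  "dzbar F z = (vector_derivative (\<lambda>t. F (z + of_real t)) (at 0)
             + \<i> * vector_derivative (\<lambda>t. F (z + \<i> * of_real t)) (at 0)) / 2"

text \<open>
  The form \<open>dd\<^sup>c u = (\<i> / 2\<pi>) u\<^bsub>z zbar\<^esub> dz \<and> d(cnj z)\<close>. Since
  \<open>dz \<and> d(cnj z) = -2\<i> dx \<and> dy\<close>, its coefficient is \<open>u\<^bsub>z zbar\<^esub> / \<pi>\<close>.
\<close>

definition ddc :: "('a chart \<Rightarrow> 'a \<Rightarrow> real) \<Rightarrow> 'a two_form" where
  "ddc u c x =
     Re ((\<i> / (2 * of_real pi)) * dz (dzbar (\<lambda>w. of_real (u c (chart_inv c w)))) (snd c x)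
         * (- 2 * \<i>))"

definition ricci_form :: "'a metric_coeff \<Rightarrow> 'a two_form" where
  "ricci_form h c x = - ddc (\<lambda>d y. ln (h d y)) c x"


section \<open>Meromorphic functions as maps to the projective line\<close>

datatype p1 = Fin complex | Infty

text \<open>The point with homogeneous coordinates \<open>[\<zeta>\<^sub>0 : \<zeta>\<^sub>1]\<close>.\<close>

definition p1_point :: "complex \<Rightarrow> complex \<Rightarrow> p1" where
  "p1_point \<zeta>0 \<zeta>1 = (if \<zeta>0 = 0 then Infty else Fin (\<zeta>1 / \<zeta>0))"

definition p1_lift :: "'a::topological_space chart set \<Rightarrow> ('a \<Rightarrow> p1) \<Rightarrow> 'a set \<Rightarrow>
    ('a \<Rightarrow> complex) \<Rightarrow> ('a \<Rightarrow> complex) \<Rightarrow> bool" where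
  "p1_lift A f V F0 F1 \<longleftrightarrow>
     open V \<and> holomorphic_fun_on A V F0 \<and> holomorphic_fun_on A V F1 \<and>
     (\<forall>x\<in>V. (F0 x \<noteq> 0 \<or> F1 x \<noteq> 0) \<and> f x = p1_point (F0 x) (F1 x))"

definition meromorphic_fun :: "'a::topological_space chart set \<Rightarrow> ('a \<Rightarrow> p1) \<Rightarrow> bool" where
  "meromorphic_fun A f \<longleftrightarrow>
     (\<forall>x. \<exists>V F0 F1. x \<in> V \<and> p1_lift A f V F0 F1) \<and> (\<exists>x. f x \<noteq> Infty)"

text \<open>
  The pull-back of the Fubini--Study form, computed with any local holomorphic lift to
  homogeneous coordinates.
\<close>

definition fs_pullback :: "'a::topological_space chart set \<Rightarrow> ('a \<Rightarrow> p1) \<Rightarrow> 'a two_form" where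
  "fs_pullback A f c x =
     (THE d. \<exists>V F0 F1. x \<in> V \<and> p1_lift A f V F0 F1 \<and>
        d = ddc (\<lambda>_ y. ln ((norm (F0 y))\<^sup>2 + (norm (F1 y))\<^sup>2)) c x)"


section \<open>Nevanlinna functions\<close>

definition char_form :: "'a chart set \<Rightarrow> 'a one_form \<Rightarrow> 'a \<Rightarrow> real \<Rightarrow> 'a two_form \<Rightarrow> real \<Rightarrow> real" where
  "char_form A S b r0 \<eta> r = integral {r0..r} (\<lambda>t. form_integral A \<eta> (disc A S b t) / t)"

definition nevanlinna_T :: "'a::topological_space chart set \<Rightarrow> 'a one_form \<Rightarrow> 'a \<Rightarrow> real \<Rightarrow>
    ('a \<Rightarrow> p1) \<Rightarrow> real \<Rightarrow> real" where
  "nevanlinna_T A S b r0 f r = char_form A S b r0 (fs_pullback A f) r"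

definition ricci_T :: "'a chart set \<Rightarrow> 'a one_form \<Rightarrow> 'a \<Rightarrow> real \<Rightarrow> 'a metric_coeff \<Rightarrow>
    real \<Rightarrow> real" where
  "ricci_T A S b r0 h r = char_form A S b r0 (ricci_form h) r"

definition nbar :: "'a chart set \<Rightarrow> 'a one_form \<Rightarrow> 'a \<Rightarrow> ('a \<Rightarrow> p1) \<Rightarrow> p1 \<Rightarrow> real \<Rightarrow> nat" where
  "nbar A S b f a t = card {x \<in> disc A S b t. f x = a}"

definition Nbar :: "'a chart set \<Rightarrow> 'a one_form \<Rightarrow> 'a \<Rightarrow> real \<Rightarrow> ('a \<Rightarrow> p1) \<Rightarrow> p1 \<Rightarrow>
    real \<Rightarrow> real" where
  "Nbar A S b r0 f a r = integral {r0..r} (\<lambda>t. real (nbar A S b f a t) / t)"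

definition sup_norm :: "'a chart set \<Rightarrow> 'a metric_coeff \<Rightarrow> 'a one_form \<Rightarrow> 'a \<Rightarrow> real \<Rightarrow> real" where
  "sup_norm A h S b r = (SUP x\<in>disc A S b r. form_norm A h S x)"

definition pos_part :: "real \<Rightarrow> real" where
  "pos_part x = max x 0"

end

theory Submission
  imports Defs "HOL-Complex_Analysis.Complex_Analysis"
begin

text \<open>
  The form has no zeros, so its primitive \<open>L\<close> is a local coordinate at every point of the surface. The
  discs of radius less than the radius \<open>R\<close> of the surface are relatively compact, hence \<open>L\<close> is proper
  over every closed disc inside \<open>\<Omega> = {w. \<bar>w\<bar> < R}\<close>. A proper local homeomorphism has a locally constant
  number of preimages, and over the origin there is exactly one. So \<open>L\<close> maps the surface
  biholomorphically onto \<open>\<Omega>\<close> (\<open>preimage_unique\<close>), takes the discs of the form to round discs and the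
  form to \<open>dw\<close>. Before that one has to know that the primitive, a definite description over all smooth
  paths, is what it should be (\<open>path_integrals_unique\<close>). The theorem becomes one about the map
  \<open>F = f \<circ> L\<inverse>\<close> from a plane disc to the sphere, and about the metric in the coordinate \<open>L\<close>.

  All characteristic functions are iterated integrals of Laplacians over discs, and these are
  differences of circle means (\<open>circle_mean_laplacian\<close>). Let \<open>(G0, G1)\<close> be global homogeneous coordinates
  of \<open>F\<close> (\<open>lift_on_disc\<close>), let \<open>rho\<close> be the density of the pull-back of the Fubini--Study form, which is
  the squared modulus of the Wronskian of \<open>G0\<close> and \<open>G1\<close> divided by \<open>pi\<close> times the fourth power of the norm
  of the pair, and let \<open>x\<^sub>j\<close> be the squared chordal distance from \<open>F w\<close> to \<open>a j\<close>. Multiply the Wronskian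
  by \<open>w - z\<close> for every point \<open>z\<close> where one of the values is taken, and divide by the linear forms in the
  coordinates which define the values. The quotient is holomorphic, since at a zero of order \<open>n\<close> of a
  form the Wronskian vanishes to order at least \<open>n - 1\<close>. So the means of its logarithm increase, and this says
  (\<open>truncated_main_inequality\<close>) that \<open>(q - 2) T\<close> is at most the sum of the truncated counting functions
  plus half the increase of the mean of \<open>\<Phi> = ln rho - (\<Sum>j. ln x\<^sub>j)\<close>.

  It remains to bound the mean of \<open>\<Phi>\<close> on most circles. By concavity of the logarithm it suffices to bound
  the mean of \<open>rho * (\<Prod>j. 1 / (x\<^sub>j (2 - ln x\<^sub>j)\<^sup>2))\<close>, apart from the means of \<open>ln (2 - ln x\<^sub>j)\<close>, which are at
  most of order \<open>ln T\<close> by the first main theorem (\<open>proximity_bound\<close>). As the values are distinct, the product is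
  dominated by a sum over \<open>j\<close> (\<open>prod_singular_le_sum\<close>). The resulting weight is, up to a multiple of \<open>rho\<close>,
  the Laplacian of a function bounded above, so that its iterated integral is at most a multiple of
  \<open>T + 1\<close> (\<open>spike_bound\<close>). The growth lemma, applied once for each of the two integrations, turns
  this into a bound for the circle means, outside a set on which \<open>\<gamma>\<close> has finite integral
  (\<open>growth_of_density\<close>). The logarithm of this bound consists of the terms in \<open>ln T\<close>, \<open>ln \<gamma>\<close> and \<open>\<delta> ln r\<close>.

  Finally the Ricci term is half the decrease of the circle means of \<open>ln H\<close>, where \<open>H\<close> is the coefficient of
  the metric in the coordinate \<open>L\<close>. The norm of the form is \<open>1 / sqrt (2 H)\<close>, which gives the term with the
  supremum of the norm (\<open>ricci_T_le\<close>).
\<close>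

section \<open>Change of variables and polar coordinates in the plane\<close>

lemma lebesgue_distr_of_lborel:
  fixes T :: "'a::euclidean_space \<Rightarrow> 'b::euclidean_space"
  assumes T: "T \<in> borel_measurable borel" and eq: "distr lborel borel T = lborel"
  shows "T \<in> lebesgue \<rightarrow>\<^sub>M lebesgue" and "distr lebesgue lebesgue T = lebesgue"
proof -
  have Tl: "T \<in> lebesgue \<rightarrow>\<^sub>M lborel"
    using T by (intro measurable_completion) auto
  have d: "distr lebesgue lborel T = lborel"
    using distr_completion[of T lborel lborel] T eq by (simp cong: distr_cong)
  have null: "null_sets (distr lebesgue lborel T) = null_sets lborel"
    by (simp add: d)
  show m: "T \<in> lebesgue \<rightarrow>\<^sub>M lebesgue"
    by (rule completion.measurable_completion2) (use Tl d in auto)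
  show "distr lebesgue lebesgue T = lebesgue"
    using completion.completion_distr_eq[OF Tl null] d by simp
qed

text \<open>
  The change of variables theorem is about maps of \<open>real^'n\<close>. The plane \<open>complex\<close> is
  identified with \<open>real^2\<close> by a linear map which preserves Lebesgue measure.
\<close>

definition vec_of_complex :: "complex \<Rightarrow> real^2" where
  "vec_of_complex z = vector [Re z, Im z]"

definition complex_of_vec :: "real^2 \<Rightarrow> complex" where
  "complex_of_vec x = Complex (vec_nth x 1) (vec_nth x 2)"

lemma complex_of_vec_inverse [simp]: "complex_of_vec (vec_of_complex z) = z"
  by (simp add: complex_of_vec_def vec_of_complex_def)

lemma vec_of_complex_inverse [simp]: "vec_of_complex (complex_of_vec z) = z"
  by (simp add: complex_of_vec_def vec_of_complex_def vec_eq_iff forall_2)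

lemma linear_vec_of_complex: "linear vec_of_complex"
  by (rule linearI) (simp_all add: vec_of_complex_def vec_eq_iff forall_2)

lemma linear_complex_of_vec: "linear complex_of_vec"
  by (rule linearI) (simp_all add: complex_of_vec_def complex_eq_iff)

lemma complex_of_vec_vimage_box: "complex_of_vec -` box l u = box (vec_of_complex l) (vec_of_complex u)"
  by (auto simp: mem_box_cart forall_2 vec_of_complex_def complex_of_vec_def mem_box Basis_complex_def)

lemma bounded_linear_complex_of_vec: "bounded_linear complex_of_vec"
  using linear_complex_of_vec linear_conv_bounded_linear by blast

lemma bounded_linear_vec_of_complex: "bounded_linear vec_of_complex"
  using linear_vec_of_complex linear_conv_bounded_linear by blast

lemma borel_complex_of_vec: "complex_of_vec \<in> borel_measurable borel"
  by (intro borel_measurable_continuous_onI linear_continuous_on bounded_linear_complex_of_vec)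

lemma borel_vec_of_complex: "vec_of_complex \<in> borel_measurable borel"
  by (intro borel_measurable_continuous_onI linear_continuous_on bounded_linear_vec_of_complex)

lemma Basis_vec_2: "(Basis :: (real^2) set) = {axis 1 1, axis 2 1}"
  by (auto simp: Basis_vec_def UNIV_2)

lemma axis_1_2_neq: "(axis 1 1 :: real^2) \<noteq> axis 2 1"
  by (simp add: axis_eq_axis)

lemma distr_complex_of_vec: "distr lborel borel complex_of_vec = lborel"
proof (rule lborel_eqI[symmetric])
  fix l u :: complex
  assume *: "\<And>b. b \<in> Basis \<Longrightarrow> l \<bullet> b \<le> u \<bullet> b"
  have le: "Re l \<le> Re u" "Im l \<le> Im u" using *[of 1] *[of \<i>] by (auto simp: Basis_complex_def)
  then have "\<forall>b\<in>Basis. vec_of_complex l \<bullet> b \<le> vec_of_complex u \<bullet> b"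
    by (auto simp: Basis_vec_2 vec_of_complex_def inner_axis)
  then have "emeasure lborel (box (vec_of_complex l) (vec_of_complex u)) = (\<Prod>b\<in>Basis. (vec_of_complex u - vec_of_complex l) \<bullet> b)"
    by (subst emeasure_lborel_box) auto
  also have "\<dots> = (\<Prod>b\<in>Basis. (u - l) \<bullet> b)"
    using axis_1_2_neq by (simp add: Basis_vec_2 Basis_complex_def inner_axis vec_of_complex_def)
  finally show "emeasure (distr lborel borel complex_of_vec) (box l u) = (\<Prod>b\<in>Basis. (u - l) \<bullet> b)"
    by (subst emeasure_distr) (simp_all add: borel_complex_of_vec complex_of_vec_vimage_box)
qed simp

lemma distr_vec_of_complex: "distr lborel borel vec_of_complex = lborel"
proof -
  have "distr lborel borel vec_of_complex = distr (distr lborel borel complex_of_vec) borel vec_of_complex"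
    by (simp add: distr_complex_of_vec)
  also have "\<dots> = distr lborel borel (vec_of_complex \<circ> complex_of_vec)"
    by (rule distr_distr) (simp_all add: borel_complex_of_vec borel_vec_of_complex)
  also have "vec_of_complex \<circ> complex_of_vec = id" by auto
  also have "distr lborel borel id = (lborel :: (real^2) measure)"
    by (rule measure_eqI) (auto simp: emeasure_distr)
  finally show ?thesis .
qed

lemmas lebesgue_complex_of_vec = lebesgue_distr_of_lborel[OF borel_complex_of_vec distr_complex_of_vec]
lemmas lebesgue_vec_of_complex = lebesgue_distr_of_lborel[OF borel_vec_of_complex distr_vec_of_complex]

lemma vec_of_complex_image: "vec_of_complex ` S = complex_of_vec -` S"
  by (auto intro: image_eqI[of _ _ "complex_of_vec _"])

lemma absolutely_integrable_complex_of_vec: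
  fixes f :: "complex \<Rightarrow> real"
  shows "f absolutely_integrable_on S \<longleftrightarrow> (\<lambda>x. f (complex_of_vec x)) absolutely_integrable_on (vec_of_complex ` S)"
proof
  assume "f absolutely_integrable_on S"
  then have "integrable (distr lebesgue lebesgue complex_of_vec) (\<lambda>x. indicator S x *\<^sub>R f x)"
    by (simp add: set_integrable_def lebesgue_complex_of_vec)
  then have "integrable lebesgue (\<lambda>x. indicator S (complex_of_vec x) *\<^sub>R f (complex_of_vec x))"
    by (rule integrable_distr[OF lebesgue_complex_of_vec(1)])
  then show "(\<lambda>x. f (complex_of_vec x)) absolutely_integrable_on (vec_of_complex ` S)"
    by (simp add: set_integrable_def vec_of_complex_image indicator_def vimage_def)
next
  assume "(\<lambda>x. f (complex_of_vec x)) absolutely_integrable_on (vec_of_complex ` S)"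
  then have "integrable (distr lebesgue lebesgue vec_of_complex) (\<lambda>x. indicator (vec_of_complex ` S) x *\<^sub>R f (complex_of_vec x))"
    by (simp add: set_integrable_def lebesgue_vec_of_complex)
  then have "integrable lebesgue (\<lambda>x. indicator (vec_of_complex ` S) (vec_of_complex x) *\<^sub>R f (complex_of_vec (vec_of_complex x)))"
    by (rule integrable_distr[OF lebesgue_vec_of_complex(1)])
  then show "f absolutely_integrable_on S"
    by (simp add: set_integrable_def vec_of_complex_image indicator_def vimage_def)
qed

lemma integral_complex_of_vec:
  fixes f :: "complex \<Rightarrow> real"
  assumes "f absolutely_integrable_on S"
  shows "integral (vec_of_complex ` S) (\<lambda>x. f (complex_of_vec x)) = integral S f"
proof -
  have i: "integrable lebesgue (\<lambda>x. indicator S x *\<^sub>R f x)"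
    using assms by (simp add: set_integrable_def)
  have "integral S f = (LINT x|lebesgue. indicator S x *\<^sub>R f x)"
    using set_lebesgue_integral_eq_integral(2)[OF assms] by (simp add: set_lebesgue_integral_def)
  also have "\<dots> = (LINT x|distr lebesgue lebesgue complex_of_vec. indicator S x *\<^sub>R f x)"
    by (simp add: lebesgue_complex_of_vec)
  also have "\<dots> = (LINT x|lebesgue. indicator S (complex_of_vec x) *\<^sub>R f (complex_of_vec x))"
    by (rule integral_distr) (use i lebesgue_complex_of_vec in auto)
  also have "\<dots> = (LINT x:vec_of_complex ` S|lebesgue. f (complex_of_vec x))"
    by (simp add: set_lebesgue_integral_def vec_of_complex_image indicator_def vimage_def)
  also have "\<dots> = integral (vec_of_complex ` S) (\<lambda>x. f (complex_of_vec x))"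
    using assms by (intro set_lebesgue_integral_eq_integral) (simp add: absolutely_integrable_complex_of_vec[symmetric])
  finally show ?thesis by simp
qed

text \<open>
  The Jacobian of a map of the plane, in terms of its two Wirtinger derivatives \<open>a\<close> and \<open>b\<close>.
\<close>

lemma det_complex_real_linear:
  "det (matrix (\<lambda>x. vec_of_complex (a * complex_of_vec x + b * cnj (complex_of_vec x)))) = (norm a)\<^sup>2 - (norm b)\<^sup>2"
  unfolding cmod_power2
  by (simp add: det_2 matrix_def vec_of_complex_def complex_of_vec_def axis_def algebra_simps power2_eq_square)

text \<open>
  For holomorphic \<open>g\<close> one has \<open>b = 0\<close>; this case moves 2-forms between charts. Polar coordinates
  need \<open>b \<noteq> 0\<close>.
\<close>

theorem complex_change_of_variables:
  fixes f :: "complex \<Rightarrow> real" and g :: "complex \<Rightarrow> complex"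
  assumes S: "S \<in> sets lebesgue"
    and der: "\<And>z. z \<in> S \<Longrightarrow> (g has_derivative (\<lambda>v. a z * v + b z * cnj v)) (at z within S)"
    and inj: "inj_on g S"
  shows "(\<lambda>z. \<bar>(norm (a z))\<^sup>2 - (norm (b z))\<^sup>2\<bar> * f (g z)) absolutely_integrable_on S \<and>
      integral S (\<lambda>z. \<bar>(norm (a z))\<^sup>2 - (norm (b z))\<^sup>2\<bar> * f (g z)) = I
     \<longleftrightarrow> f absolutely_integrable_on (g ` S) \<and> integral (g ` S) f = I"
proof -
  let ?V = vec_of_complex and ?T = complex_of_vec
  let ?J = "\<lambda>z. \<bar>(norm (a z))\<^sup>2 - (norm (b z))\<^sup>2\<bar>"
  have S': "?V ` S \<in> sets lebesgue"
    using measurable_sets[OF lebesgue_complex_of_vec(1) S] by (simp add: vec_of_complex_image)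
  have der': "((\<lambda>x. ?V (g (?T x))) has_derivative (\<lambda>x. ?V (a (?T y) * ?T x + b (?T y) * cnj (?T x)))) (at y within ?V ` S)"
    if "y \<in> ?V ` S" for y
  proof -
    have y: "?T y \<in> S" using that by auto
    have 1: "(?T has_derivative ?T) (at y within ?V ` S)"
      by (rule bounded_linear_imp_has_derivative[OF bounded_linear_complex_of_vec])
    have im: "?T ` ?V ` S = S" by (auto simp: image_image)
    have 2: "((\<lambda>x. g (?T x)) has_derivative (\<lambda>x. a (?T y) * ?T x + b (?T y) * cnj (?T x))) (at y within ?V ` S)"
      using has_derivative_in_compose[OF 1, of g "\<lambda>v. a (?T y) * v + b (?T y) * cnj v"] der[OF y] by (simp add: im)
    show ?thesis
      by (rule bounded_linear.has_derivative[OF bounded_linear_vec_of_complex 2])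
  qed
  have inj': "inj_on (\<lambda>x. ?V (g (?T x))) (?V ` S)"
  proof (rule inj_onI, clarify)
    fix x y assume "x \<in> S" "y \<in> S" "?V (g (?T (?V x))) = ?V (g (?T (?V y)))"
    then have "g x = g y" by (metis complex_of_vec_inverse)
    then show "?V x = ?V y" using inj \<open>x \<in> S\<close> \<open>y \<in> S\<close> by (auto dest: inj_onD)
  qed
  have im: "(\<lambda>x. ?V (g (?T x))) ` ?V ` S = ?V ` g ` S" by (auto simp: image_image)
  have main: "(\<lambda>x. ?J (?T x) * f (g (?T x))) absolutely_integrable_on ?V ` S \<and>
          integral (?V ` S) (\<lambda>x. ?J (?T x) * f (g (?T x))) = I
    \<longleftrightarrow> (\<lambda>x. f (?T x)) absolutely_integrable_on ?V ` g ` S \<and> integral (?V ` g ` S) (\<lambda>x. f (?T x)) = I"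
    using has_absolute_integral_change_of_variables[OF S' der' inj', of "\<lambda>x. vec (f (?T x)) :: real^1" "vec I"]
    by (simp add: det_complex_real_linear absolutely_integrable_on_1_iff integral_on_1_eq im)
  have 1: "(\<lambda>z. ?J z * f (g z)) absolutely_integrable_on S \<and> integral S (\<lambda>z. ?J z * f (g z)) = I \<longleftrightarrow>
      (\<lambda>x. ?J (?T x) * f (g (?T x))) absolutely_integrable_on ?V ` S \<and>
          integral (?V ` S) (\<lambda>x. ?J (?T x) * f (g (?T x))) = I"
    using absolutely_integrable_complex_of_vec[where f="\<lambda>z. ?J z * f (g z)" and S=S] integral_complex_of_vec[where f="\<lambda>z. ?J z * f (g z)" and S=S] by auto
  have 2: "f absolutely_integrable_on (g ` S) \<and> integral (g ` S) f = I \<longleftrightarrow>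
     (\<lambda>x. f (?T x)) absolutely_integrable_on ?V ` g ` S \<and> integral (?V ` g ` S) (\<lambda>x. f (?T x)) = I"
    using absolutely_integrable_complex_of_vec[where f=f and S="g ` S"] integral_complex_of_vec[where f=f and S="g ` S"] by auto
  show ?thesis using 1 2 main by blast
qed

lemma absolutely_integrable_on_continuous_compact:
  fixes f :: "'a::euclidean_space \<Rightarrow> real"
  assumes "compact K" "continuous_on K f" "S \<subseteq> K" "S \<in> sets lebesgue"
  shows "f absolutely_integrable_on S"
proof -
  have "integrable lborel (\<lambda>x. indicator K x *\<^sub>R f x)"
    using assms by (intro borel_integrable_compact) auto
  then have "integrable lebesgue (\<lambda>x. indicator K x *\<^sub>R f x)"
    using integrable_completion[of "\<lambda>x. indicator K x *\<^sub>R f x" lborel] borel_measurable_integrable by blast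
  then have "set_integrable lebesgue K f" by (simp add: set_integrable_def)
  then show ?thesis by (rule set_integrable_subset) (use assms in auto)
qed

lemma integral_complex_cbox_iterated:
  fixes f :: "complex \<Rightarrow> real"
  assumes c: "continuous_on (cbox (Complex a c) (Complex b d)) f"
  shows "integral (cbox (Complex a c) (Complex b d)) f = integral {a..b} (\<lambda>x. integral {c..d} (\<lambda>y. f (Complex x y)))"
proof -
  let ?g = "\<lambda>p. Complex (fst p) (snd p)" and ?h = "\<lambda>z. (Re z, Im z)"
  have cg: "continuous (at x) ?g" for x
  proof -
    have "?g = (\<lambda>p. of_real (fst p) + \<i> * of_real (snd p))" by (auto simp: complex_eq_iff)
    then show ?thesis by (simp add: continuous_intros)
  qed
  have img: "?g ` cbox u v = cbox (?g u) (?g v)" for u v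
  proof -
    have "cbox u v = cbox (fst u) (fst v) \<times> cbox (snd u) (snd v)"
      by (metis cbox_Pair_eq prod.collapse)
    moreover have "?g = (\<lambda>(x,y). Complex x y)" by (simp add: split_def)
    ultimately show ?thesis
      by (simp only: cbox_Complex_eq)
  qed
  have imh: "?h ` cbox u v = cbox (?h u) (?h v)" for u v
  proof -
    have "cbox u v = ?g ` cbox (?h u) (?h v)" by (simp add: img)
    then have "?h ` cbox u v = ?h ` ?g ` cbox (?h u) (?h v)" by simp
    also have "\<dots> = cbox (?h u) (?h v)" by (simp add: image_image)
    finally show ?thesis .
  qed
  have "(f has_integral integral (cbox (Complex a c) (Complex b d)) f) (cbox (Complex a c) (Complex b d))"
    using c integrable_continuous by (rule_tac integrable_integral) blast
  then have "((\<lambda>p. f (?g p)) has_integral (1/1) *\<^sub>R integral (cbox (Complex a c) (Complex b d)) f) (?h ` cbox (Complex a c) (Complex b d))"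
  proof (rule has_integral_twiddle[rotated -1])
    show "measure lborel (?g ` cbox u v) = 1 * measure lborel (cbox u v)" for u v :: "real \<times> real"
    proof -
      have "measure lborel (cbox (?g u) (?g v)) = measure lborel (cbox (fst u) (fst v)) * measure lborel (cbox (snd u) (snd v))"
      proof (cases "fst u \<le> fst v \<and> snd u \<le> snd v")
        case True
        then show ?thesis by (subst content_cbox) (auto simp: Basis_complex_def)
      next
        case False
        then have "cbox (?g u) (?g v) = {}" by (auto simp: cbox_Complex_eq)
        then show ?thesis using False by auto
      qed
      also have "\<dots> = measure lborel (cbox u v)"
        by (metis content_Pair prod.collapse)
      finally show ?thesis by (simp add: img)
    qed
  qed (simp, simp, simp, rule cg, metis img, metis imh)
  then have 1: "integral (cbox (a, c) (b, d)) (\<lambda>p. f (?g p)) = integral (cbox (Complex a c) (Complex b d)) f"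
    by (simp add: imh integral_unique)
  have "continuous_on (cbox (a, c) (b, d)) (\<lambda>p. f (?g p))"
  proof (rule continuous_on_compose2[OF c])
    show "continuous_on (cbox (a, c) (b, d)) ?g" using cg continuous_at_imp_continuous_on by blast
    show "?g ` cbox (a, c) (b, d) \<subseteq> cbox (Complex a c) (Complex b d)" by (simp add: img)
  qed
  from integral_prod_continuous[OF this] 1 show ?thesis by simp
qed

lemma cos_eq_1_imp_0:
  assumes "cos u = 1" "\<bar>u\<bar> < 2 * pi" shows "u = (0::real)"
proof (rule ccontr)
  assume "u \<noteq> 0"
  have "cos \<bar>u\<bar> = 1" "0 < \<bar>u\<bar>" using assms \<open>u \<noteq> 0\<close> by auto
  then show False using assms(2)
    by (metis cos_one_sin_zero cos_pi less_numeral_extra(1,3)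
    linorder_neqE_linordered_idom neg_0_less_iff_less not_one_less_zero
    sin_gt_zero sin_lt_zero)
qed

lemma cis_inj_on_2pi:
  assumes "cis x = cis y" "\<bar>x - y\<bar> < 2 * pi" shows "x = y"
proof -
  have "cos x = cos y" "sin x = sin y" using assms(1) by (auto simp: complex_eq_iff)
  then have "cos (x - y) = 1" by (simp add: cos_diff flip: power2_eq_square)
  then show ?thesis using cos_eq_1_imp_0[of "x - y"] assms(2) by simp
qed

theorem polar_coordinates:
  fixes E :: "complex \<Rightarrow> real"
  assumes t: "0 < t" and E: "continuous_on (cball 0 t) E"
  shows "integral (ball 0 t) E = integral {0..t} (\<lambda>s. s * integral {0..2*pi} (\<lambda>\<theta>. E (of_real s * cis \<theta>)))"
proof -
  define S where "S = box 0 (Complex t (2*pi))"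
  define g where "g = (\<lambda>z. complex_of_real (Re z) * cis (Im z))"
  have S_iff: "z \<in> S \<longleftrightarrow> 0 < Re z \<and> Re z < t \<and> 0 < Im z \<and> Im z < 2*pi" for z
    by (auto simp: S_def in_box_complex_iff)
  have S: "S \<in> sets lebesgue" unfolding S_def by auto
  have inj: "inj_on g S"
  proof (rule inj_onI)
    fix x y assume xy: "x \<in> S" "y \<in> S" "g x = g y"
    have "norm (g x) = Re x" "norm (g y) = Re y" using xy(1,2) by (auto simp: g_def norm_mult S_iff)
    then have 1: "Re x = Re y" using xy(3) by simp
    then have "cis (Im x) = cis (Im y)" using xy by (auto simp: g_def S_iff)
    then have "Im x = Im y"
      using xy(1,2) by (intro cis_inj_on_2pi) (auto simp: S_iff)
    then show "x = y" using 1 by (simp add: complex_eq_iff)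
  qed
  have der: "(g has_derivative (\<lambda>v. (cis (Im z) * (1 + of_real (Re z)) / 2) * v + (cis (Im z) * (1 - of_real (Re z)) / 2) * cnj v)) (at z within S)" for z
  proof -
    have cis_eq: "cis x = of_real (cos x) + \<i> * of_real (sin x)" for x by (simp add: complex_eq_iff)
    show ?thesis unfolding g_def cis_eq
      apply (rule has_derivative_eq_rhs)
       apply (rule derivative_eq_intros refl)+
      apply (simp add: complex_eq_iff fun_eq_iff algebra_simps add_divide_distrib diff_divide_distrib)
      done
  qed
  have J: "(norm (cis (Im z) * (1 + of_real (Re z)) / 2))\<^sup>2 - (norm (cis (Im z) * (1 - of_real (Re z)) / 2))\<^sup>2 = Re z" for z
  proof -
    have "norm (1 + complex_of_real (Re z)) = \<bar>1 + Re z\<bar>" "norm (1 - complex_of_real (Re z)) = \<bar>1 - Re z\<bar>"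
      by (metis norm_of_real of_real_1 of_real_add, metis norm_of_real of_real_1 of_real_diff)
    then have "(norm (cis (Im z) * (1 + of_real (Re z)) / 2))\<^sup>2 = (1 + Re z)\<^sup>2 / 4"
      "(norm (cis (Im z) * (1 - of_real (Re z)) / 2))\<^sup>2 = (1 - Re z)\<^sup>2 / 4"
      by (simp_all add: norm_mult norm_divide power_divide)
    then show ?thesis by (simp add: power2_eq_square field_simps)
  qed
  have im: "g ` S = ball 0 t - {z. Im z = 0 \<and> 0 \<le> Re z}"
  proof (intro equalityI subsetI)
    fix w assume "w \<in> g ` S"
    then obtain z where z: "z \<in> S" "w = g z" by auto
    have "w \<in> ball 0 t" using z by (auto simp: g_def S_iff norm_mult)
    moreover have False if "Im w = 0" "0 \<le> Re w"
    proof -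
      have "sin (Im z) = 0" "0 \<le> cos (Im z)" using that z by (auto simp: g_def S_iff zero_le_mult_iff)
      then have "cos (Im z) = 1" using sin_cos_squared_add[of "Im z"] by (auto simp: power2_eq_1_iff)
      then have "Im z = 0" using z by (intro cos_eq_1_imp_0) (auto simp: S_iff)
      then show False using z by (auto simp: S_iff)
    qed
    ultimately show "w \<in> ball 0 t - {z. Im z = 0 \<and> 0 \<le> Re z}" by auto
  next
    fix w assume w: "w \<in> ball 0 t - {z. Im z = 0 \<and> 0 \<le> Re z}"
    then have w0: "w \<noteq> 0" by auto
    have "Arg2pi w \<noteq> 0" using w by (auto simp: Arg2pi_eq_0 complex_is_Real_iff)
    then have "0 < Arg2pi w" using Arg2pi_ge_0[of w] by simp
    moreover have "w = g (Complex (norm w) (Arg2pi w))"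
      using Arg2pi_eq[of w] by (simp add: g_def cis_conv_exp mult.commute)
    moreover have "Complex (norm w) (Arg2pi w) \<in> S" using w0 w calculation Arg2pi_lt_2pi by (auto simp: S_iff)
    ultimately show "w \<in> g ` S" by blast
  qed
  have neg: "negligible {z::complex. Im z = 0 \<and> 0 \<le> Re z}"
    by (rule negligible_subset[OF negligible_standard_hyperplane[of \<i> 0]]) (auto simp: Basis_complex_def)
  have "E absolutely_integrable_on ball 0 t"
    by (rule absolutely_integrable_on_continuous_compact[OF compact_cball E]) auto
  then have aE: "E absolutely_integrable_on (g ` S)"
    by (rule set_integrable_subset) (use im negligible_imp_sets[OF neg] in auto)
  have "integral (ball 0 t) E = integral (g ` S) E"
    by (rule integral_spike_set) (auto simp: im intro: negligible_subset[OF neg])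
  also have "\<dots> = integral S (\<lambda>z. \<bar>Re z\<bar> * E (g z))"
    using complex_change_of_variables[OF S der inj, of E "integral (g ` S) E"] aE unfolding J by auto
  also have "\<dots> = integral (cbox (Complex 0 0) (Complex t (2*pi))) (\<lambda>z. \<bar>Re z\<bar> * E (g z))"
    unfolding S_def by (metis integral_open_interval zero_complex.code)
  also have "\<dots> = integral {0..t} (\<lambda>x. integral {0..2*pi} (\<lambda>y. \<bar>Re (Complex x y)\<bar> * E (g (Complex x y))))"
  proof (rule integral_complex_cbox_iterated)
    have "continuous_on A g" for A unfolding g_def cis_conv_exp by (intro continuous_intros)
    then show "continuous_on (cbox (Complex 0 0) (Complex t (2*pi))) (\<lambda>z. \<bar>Re z\<bar> * E (g z))"
      by (intro continuous_intros continuous_on_compose2[OF E]) (auto simp: in_cbox_complex_iff g_def norm_mult)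
  qed
  also have "\<dots> = integral {0..t} (\<lambda>s. s * integral {0..2*pi} (\<lambda>\<theta>. E (of_real s * cis \<theta>)))"
    by (rule integral_cong) (auto simp: g_def)
  finally show ?thesis .
qed

section \<open>Growth of an integral outside a set of finite weighted length\<close>

lemma down_closed_cofinal_sequence:
  fixes X :: "real set"
  assumes "X \<noteq> {}" and gt: "\<And>x. x \<in> X \<Longrightarrow> r0 < x" and down: "\<And>x y. x \<in> X \<Longrightarrow> r0 < y \<Longrightarrow> y \<le> x \<Longrightarrow> y \<in> X"
  obtains f :: "nat \<Rightarrow> real" where "incseq f" "\<And>n. f n \<in> X" "\<And>x. x \<in> X \<Longrightarrow> \<exists>n. x \<le> f n"
proof -
  have "\<exists>g::nat \<Rightarrow> real. (\<forall>n. g n \<in> X) \<and> (\<forall>x\<in>X. \<exists>n. x \<le> g n)"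
  proof (cases "\<exists>m\<in>X. \<forall>x\<in>X. x \<le> m")
    case True
    then obtain m where "m \<in> X" "\<forall>x\<in>X. x \<le> m" by blast
    then show ?thesis by (intro exI[of _ "\<lambda>_. m"]) auto
  next
    case False
    have cof: "\<exists>q\<in>\<rat> \<inter> X. x \<le> q" if x: "x \<in> X" for x
    proof -
      obtain y where y: "y \<in> X" "x < y" using False x by (meson not_le)
      then obtain q where q: "q \<in> \<rat>" "x < q" "q < y" using Rats_dense_in_real by blast
      then have "q \<in> X" using down[OF y(1), of q] gt[OF x] by auto
      then show ?thesis using q by (intro bexI[of _ q]) auto
    qed
    have c: "countable (\<rat> \<inter> X)" by (rule countable_subset[OF _ countable_rat]) auto
    have ne: "\<rat> \<inter> X \<noteq> {}" using cof \<open>X \<noteq> {}\<close> by blast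
    show ?thesis
    proof (rule exI[of _ "from_nat_into (\<rat> \<inter> X)"], intro conjI allI ballI)
      show "from_nat_into (\<rat> \<inter> X) n \<in> X" for n using from_nat_into[OF ne, of n] by simp
      fix x assume "x \<in> X"
      then obtain q where q: "q \<in> \<rat> \<inter> X" "x \<le> q" using cof by blast
      then show "\<exists>n. x \<le> from_nat_into (\<rat> \<inter> X) n" by (metis c from_nat_into_surj)
    qed
  qed
  then obtain g :: "nat \<Rightarrow> real" where g: "\<And>n. g n \<in> X" "\<And>x. x \<in> X \<Longrightarrow> \<exists>n. x \<le> g n" by blast
  define f where "f n = Max (g ` {..n})" for n
  show ?thesis
  proof
    show "incseq f" unfolding f_def by (intro incseq_SucI Max_mono) auto
    show "f n \<in> X" for n
    proof -
      have "f n \<in> g ` {..n}" unfolding f_def by (intro Max_in) auto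
      then show ?thesis using g(1) by auto
    qed
    fix x assume "x \<in> X"
    then obtain n where "x \<le> g n" using g(2) by blast
    also have "g n \<le> f n" unfolding f_def by (intro Max_ge) auto
    finally show "\<exists>n. x \<le> f n" by blast
  qed
qed

lemma nn_integral_down_closed_le:
  fixes a :: "real \<Rightarrow> ennreal"
  assumes a: "a \<in> borel_measurable lebesgue" and X: "X \<in> sets lebesgue"
    and gt: "\<And>x. x \<in> X \<Longrightarrow> r0 < x" and down: "\<And>x y. x \<in> X \<Longrightarrow> r0 < y \<Longrightarrow> y \<le> x \<Longrightarrow> y \<in> X"
    and le: "\<And>r. r \<in> X \<Longrightarrow> (\<integral>\<^sup>+x\<in>{r0..r}. a x \<partial>lebesgue) \<le> c"
  shows "(\<integral>\<^sup>+x\<in>X. a x \<partial>lebesgue) \<le> c"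
proof (cases "X = {}")
  case True
  then show ?thesis by simp
next
  case False
  then obtain f :: "nat \<Rightarrow> real" where f: "incseq f" "\<And>n. f n \<in> X" "\<And>x. x \<in> X \<Longrightarrow> \<exists>n. x \<le> f n"
    using down_closed_cofinal_sequence[of X r0] gt down by blast
  let ?M = "density lebesgue a"
  have em: "emeasure ?M A = (\<integral>\<^sup>+x\<in>A. a x \<partial>lebesgue)" if "A \<in> sets lebesgue" for A
    using a that by (simp add: emeasure_density)
  have "emeasure ?M X \<le> emeasure ?M (\<Union>n. {r0..f n})"
    by (rule emeasure_mono) (use f(3) gt in \<open>force+\<close>)
  also have "\<dots> = (SUP n. emeasure ?M {r0..f n})"
    by (rule SUP_emeasure_incseq[symmetric]) (use f(1) in \<open>auto simp: incseq_def intro: order_trans\<close>)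
  also have "\<dots> \<le> c"
    by (rule SUP_least) (use le f(2) in \<open>simp add: em\<close>)
  finally show ?thesis using em[OF X] by simp
qed

text \<open>
  The classical statement is for a differentiable \<open>b\<close> with derivative \<open>a\<close>: on the exceptional set
  \<open>\<gamma> < b' / b powr (1 + \<delta>)\<close>, and the right-hand side is the derivative of a bounded function.
  Here \<open>a\<close> is only measurable and \<open>b\<close> need not be differentiable, so the substitution is done
  by hand: cut the line where \<open>b\<close> doubles. On the \<open>k\<close>-th piece \<open>a\<close> has integral at most
  \<open>2 ^ Suc k * B0\<close> and \<open>\<gamma>\<close> is at most \<open>a\<close> times \<open>(2 ^ k * B0) powr - (1 + \<delta>)\<close>, which leaves a
  geometric series.
\<close>

theorem growth_lemma:
  fixes a :: "real \<Rightarrow> ennreal" and \<gamma> b :: "real \<Rightarrow> real" and R :: ereal and r0 B0 \<delta> :: real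
  defines "J \<equiv> {r. r0 < r \<and> ereal r < R}"
  assumes a: "a \<in> borel_measurable lebesgue"
    and b: "\<And>r. r \<in> J \<Longrightarrow> ennreal (b r) = ennreal B0 + (\<integral>\<^sup>+x\<in>{r0..r}. a x \<partial>lebesgue)"
    and B0: "0 < B0" and \<delta>: "0 < \<delta>"
    and \<gamma>: "set_borel_measurable lebesgue J \<gamma>" and \<gamma>0: "\<And>r. r \<in> J \<Longrightarrow> 0 < \<gamma> r"
  defines "E \<equiv> {r \<in> J. ennreal (\<gamma> r * b r powr (1 + \<delta>)) < a r}"
  shows "E \<in> sets lebesgue" and "(\<integral>\<^sup>+r\<in>E. ennreal (\<gamma> r) \<partial>lebesgue) < \<infinity>"
proof -
  have J: "J \<in> sets lebesgue"
  proof -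
    have "J = {r0<..} \<inter> {r. ereal r < R}" by (auto simp: J_def)
    moreover have "{r. ereal r < R} \<in> sets borel" by measurable
    ultimately show ?thesis by auto
  qed
  have b_ge: "B0 \<le> b r" if "r \<in> J" for r
  proof -
    have "ennreal B0 \<le> ennreal (b r)" using b[OF that] by simp
    then show ?thesis using B0 by (metis ennreal_le_iff2 linorder_not_less order_le_less)
  qed
  have b_mono: "b r \<le> b s" if "r \<in> J" "s \<in> J" "r \<le> s" for r s
  proof -
    have "(\<integral>\<^sup>+x\<in>{r0..r}. a x \<partial>lebesgue) \<le> (\<integral>\<^sup>+x\<in>{r0..s}. a x \<partial>lebesgue)"
      using that by (intro nn_integral_mono) (auto simp: indicator_def)
    then have "ennreal (b r) \<le> ennreal (b s)" using b[OF that(1)] b[OF that(2)] by (simp add: add_left_mono)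
    then show ?thesis using b_ge[OF that(1)] b_ge[OF that(2)] B0 by (simp add: ennreal_le_iff)
  qed
  have Jconn: "is_interval J"
    unfolding is_interval_1 J_def by (auto intro: le_less_trans[of "ereal _" "ereal _"])
  have level: "{r \<in> J. b r < c} \<in> sets lebesgue" for c
  proof -
    have "is_interval {r \<in> J. b r < c}"
      unfolding is_interval_1
    proof (intro ballI allI impI)
      fix x y z assume "x \<in> {r \<in> J. b r < c}" "y \<in> {r \<in> J. b r < c}" and z: "x \<le> z \<and> z \<le> y"
      then have "z \<in> J" "y \<in> J" "b y < c" using Jconn unfolding is_interval_1 by blast+
      then show "z \<in> {r \<in> J. b r < c}" using b_mono[of z y] z by auto
    qed
    then have "{r \<in> J. b r < c} \<in> sets borel" by (rule real_interval_borel_measurable)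
    then show ?thesis by simp
  qed
  have [measurable]: "(\<lambda>r. indicator J r * b r) \<in> borel_measurable lebesgue"
  proof (rule borel_measurableI_less)
    fix c
    have "{r \<in> space lebesgue. indicator J r * b r < c} = {r \<in> J. b r < c} \<union> (if 0 < c then - J else {})"
      by (auto simp: indicator_def)
    then show "{r \<in> space lebesgue. indicator J r * b r < c} \<in> sets lebesgue"
      using level[of c] sets.compl_sets[OF J] by (auto simp: Compl_eq_Diff_UNIV)
  qed
  have [measurable]: "(\<lambda>r. indicator J r * \<gamma> r) \<in> borel_measurable lebesgue"
    using \<gamma> by (simp add: set_borel_measurable_def)
  note a[measurable] J[measurable]
  have E_eq: "E = {r \<in> space lebesgue. r \<in> J \<and> ennreal ((indicator J r * \<gamma> r) * (indicator J r * b r) powr (1 + \<delta>)) < a r}"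
    by (auto simp: E_def)
  show E: "E \<in> sets lebesgue" unfolding E_eq by measurable
  define I where "I k = {r \<in> J. 2 ^ k * B0 \<le> b r \<and> b r < 2 ^ Suc k * B0}" for k :: nat
  have I_eq: "I k = {r \<in> J. b r < 2 ^ Suc k * B0} - {r \<in> J. b r < 2 ^ k * B0}" for k
    by (auto simp: I_def)
  have I[measurable]: "I k \<in> sets lebesgue" for k unfolding I_eq using level by auto
  have I_int: "(\<integral>\<^sup>+x\<in>I k. a x \<partial>lebesgue) \<le> ennreal (2 ^ Suc k * B0)" for k
  proof -
    have "(\<integral>\<^sup>+x\<in>I k. a x \<partial>lebesgue) \<le> (\<integral>\<^sup>+x\<in>{r \<in> J. b r < 2 ^ Suc k * B0}. a x \<partial>lebesgue)"
      by (intro nn_integral_mono) (auto simp: indicator_def I_def)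
    also have "\<dots> \<le> ennreal (2 ^ Suc k * B0)"
    proof (rule nn_integral_down_closed_le[of a _ r0])
      fix r assume r: "r \<in> {r \<in> J. b r < 2 ^ Suc k * B0}"
      have "(\<integral>\<^sup>+x\<in>{r0..r}. a x \<partial>lebesgue) \<le> ennreal (b r)" using b[of r] r by simp
      also have "\<dots> \<le> ennreal (2 ^ Suc k * B0)" using r by (intro ennreal_leI) auto
      finally show "(\<integral>\<^sup>+x\<in>{r0..r}. a x \<partial>lebesgue) \<le> ennreal (2 ^ Suc k * B0)" .
    next
      fix x y assume x: "x \<in> {r \<in> J. b r < 2 ^ Suc k * B0}" and y: "r0 < y" "y \<le> x"
      then have "y \<in> J" using le_less_trans[of "ereal y" "ereal x" R] by (auto simp: J_def)
      then show "y \<in> {r \<in> J. b r < 2 ^ Suc k * B0}" using b_mono[of y x] x y by auto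
    qed (use level a in \<open>auto simp: J_def\<close>)
    finally show ?thesis .
  qed
  define w where "w k = (2 ^ k * B0) powr (- (1 + \<delta>))" for k :: nat
  have w0: "0 \<le> w k" for k by (simp add: w_def)
  have pt: "ennreal (\<gamma> r) * indicator E r \<le> (\<Sum>k. ennreal (w k) * (a r * indicator (I k) r))" for r
  proof (cases "r \<in> E")
    case True
    then have rJ: "r \<in> J" by (simp add: E_def)
    have "\<exists>k. b r < 2 ^ Suc k * B0"
    proof -
      obtain n where "b r / B0 < 2 ^ n" using real_arch_pow[of 2 "b r / B0"] by auto
      then have "b r < 2 ^ n * B0" using B0 by (simp add: field_simps)
      also have "\<dots> \<le> 2 ^ Suc n * B0" using B0 by simp
      finally show ?thesis by blast
    qed
    define k where "k = (LEAST k. b r < 2 ^ Suc k * B0)"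
    have k1: "b r < 2 ^ Suc k * B0" unfolding k_def by (rule LeastI_ex) fact
    have k2: "2 ^ k * B0 \<le> b r"
    proof (cases k)
      case 0 then show ?thesis using b_ge[OF rJ] by simp
    next
      case (Suc j)
      then have "\<not> b r < 2 ^ Suc j * B0" using not_less_Least[of j "\<lambda>k. b r < 2 ^ Suc k * B0"] k_def by auto
      then show ?thesis using Suc by simp
    qed
    have rI: "r \<in> I k" using k1 k2 rJ by (simp add: I_def)
    have "\<gamma> r = \<gamma> r * (2 ^ k * B0) powr (1 + \<delta>) * w k"
      unfolding w_def mult.assoc powr_add[symmetric] using B0 by simp
    also have "\<dots> \<le> \<gamma> r * b r powr (1 + \<delta>) * w k"
      using k2 \<gamma>0[OF rJ] B0 \<delta> w0 by (intro mult_right_mono mult_left_mono powr_mono2) auto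
    finally have "ennreal (\<gamma> r) \<le> ennreal (\<gamma> r * b r powr (1 + \<delta>)) * ennreal (w k)"
      using \<gamma>0[OF rJ] w0 by (simp add: ennreal_leI flip: ennreal_mult)
    also have "\<dots> \<le> a r * ennreal (w k)"
      using True by (intro mult_right_mono) (auto simp: E_def)
    also have "\<dots> = ennreal (w k) * (a r * indicator (I k) r)" using rI by (simp add: mult.commute)
    also have "\<dots> \<le> (\<Sum>k. ennreal (w k) * (a r * indicator (I k) r))"
      using sum_le_suminf[of "\<lambda>k. ennreal (w k) * (a r * indicator (I k) r)" "{k}"] by simp
    finally show ?thesis using True by simp
  qed simp
  have "(\<integral>\<^sup>+r\<in>E. ennreal (\<gamma> r) \<partial>lebesgue) \<le> (\<integral>\<^sup>+r. (\<Sum>k. ennreal (w k) * (a r * indicator (I k) r)) \<partial>lebesgue)"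
    by (intro nn_integral_mono pt)
  also have "\<dots> = (\<Sum>k. ennreal (w k) * (\<integral>\<^sup>+r\<in>I k. a r \<partial>lebesgue))"
    by (subst nn_integral_suminf) (auto simp: nn_integral_cmult)
  also have "\<dots> \<le> (\<Sum>k. ennreal (w k) * ennreal (2 ^ Suc k * B0))"
    by (intro suminf_le mult_left_mono I_int) auto
  also have "\<dots> = (\<Sum>k. ennreal (2 * B0 powr (- \<delta>) * (2 powr (- \<delta>)) ^ k))"
  proof (rule suminf_cong)
    fix k
    have "w k * (2 ^ Suc k * B0) = 2 * ((2 ^ k * B0) powr (- (1 + \<delta>)) * (2 ^ k * B0) powr 1)"
      using B0 by (simp add: w_def)
    also have "\<dots> = 2 * (2 ^ k * B0) powr (- \<delta>)" unfolding powr_add[symmetric] by simp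
    also have "\<dots> = 2 * B0 powr (- \<delta>) * (2 powr (- \<delta>)) ^ k"
      using B0 by (simp add: powr_mult powr_realpow[symmetric] powr_powr mult.commute)
    finally show "ennreal (w k) * ennreal (2 ^ Suc k * B0) = ennreal (2 * B0 powr (- \<delta>) * (2 powr (- \<delta>)) ^ k)"
      using w0 B0 by (simp flip: ennreal_mult)
  qed
  also have "\<dots> < \<infinity>"
  proof -
    have "(2::real) powr (- \<delta>) < 1" using \<delta> by (simp add: powr_less_one)
    then have "summable (\<lambda>k. 2 * B0 powr (- \<delta>) * (2 powr (- \<delta>)) ^ k)"
      by (intro summable_mult summable_geometric) simp
    then show ?thesis by (subst suminf_ennreal_eq[OF _ summable_sums]) auto
  qed
  finally show "(\<integral>\<^sup>+r\<in>E. ennreal (\<gamma> r) \<partial>lebesgue) < \<infinity>" .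
qed

section \<open>Laplacians of functions on the plane\<close>

text \<open>
  The Wirtinger derivative \<open>p\<close> of \<open>u\<close> and the Laplacian \<open>L\<close> are carried along as witnesses, so that
  the rules below compute them. With \<open>u\<close> real, the derivative of \<open>u\<close> is \<open>2 Re (p dz)\<close>, and the
  antiholomorphic derivative of \<open>p\<close> is a quarter of the Laplacian; continuity of both second
  derivatives allows differentiation under the integral sign.
\<close>

definition laplacian_on :: "complex set \<Rightarrow> (complex \<Rightarrow> real) \<Rightarrow> (complex \<Rightarrow> complex) \<Rightarrow> (complex \<Rightarrow> real) \<Rightarrow> bool" where
  "laplacian_on S u p L \<longleftrightarrow> open S \<and>
     (\<forall>z\<in>S. (u has_derivative (\<lambda>v. 2 * Re (p z * v))) (at z)) \<and>
     (\<exists>s. (\<forall>z\<in>S. (p has_derivative (\<lambda>v. s z * v + of_real (L z / 4) * cnj v)) (at z)) \<and>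
          continuous_on S s \<and> continuous_on S L)"

lemma laplacian_onI:
  assumes "open S" "\<And>z. z \<in> S \<Longrightarrow> (u has_derivative (\<lambda>v. 2 * Re (p z * v))) (at z)"
    "\<And>z. z \<in> S \<Longrightarrow> (p has_derivative (\<lambda>v. s z * v + of_real (L z / 4) * cnj v)) (at z)"
    "continuous_on S s" "continuous_on S L"
  shows "laplacian_on S u p L"
  using assms unfolding laplacian_on_def by blast

lemma laplacian_on_continuous:
  assumes "laplacian_on S u p L"
  shows "continuous_on S u" "continuous_on S p" "continuous_on S L"
  using assms unfolding laplacian_on_def
  by (meson continuous_at_imp_continuous_on has_derivative_continuous)+

lemma laplacian_on_cong:
  assumes "laplacian_on S u p L" "\<And>z. z \<in> S \<Longrightarrow> u z = u' z" "\<And>z. z \<in> S \<Longrightarrow> p z = p' z" "\<And>z. z \<in> S \<Longrightarrow> L z = L' z"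
  shows "laplacian_on S u' p' L'"
proof -
  obtain s where s: "open S" "\<And>z. z \<in> S \<Longrightarrow> (u has_derivative (\<lambda>v. 2 * Re (p z * v))) (at z)"
    "\<And>z. z \<in> S \<Longrightarrow> (p has_derivative (\<lambda>v. s z * v + of_real (L z / 4) * cnj v)) (at z)"
    "continuous_on S s" "continuous_on S L"
    using assms(1) unfolding laplacian_on_def by blast
  show ?thesis
  proof (rule laplacian_onI[of _ _ _ s])
    show "(u' has_derivative (\<lambda>v. 2 * Re (p' z * v))) (at z)" if "z \<in> S" for z
      using has_derivative_transform_within_open[OF s(2)[OF that] s(1) that, of u'] assms that by auto
    show "(p' has_derivative (\<lambda>v. s z * v + of_real (L' z / 4) * cnj v)) (at z)" if "z \<in> S" for z
      using has_derivative_transform_within_open[OF s(3)[OF that] s(1) that, of p'] assms that by auto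
    show "continuous_on S L'" using s(5) assms(4) by (simp cong: continuous_on_cong)
  qed (use s in auto)
qed

lemma laplacian_on_add:
  assumes "laplacian_on S u p L" "laplacian_on S u' p' L'"
  shows "laplacian_on S (\<lambda>z. u z + u' z) (\<lambda>z. p z + p' z) (\<lambda>z. L z + L' z)"
proof -
  obtain s where s: "open S" "\<And>z. z \<in> S \<Longrightarrow> (u has_derivative (\<lambda>v. 2 * Re (p z * v))) (at z)"
    "\<And>z. z \<in> S \<Longrightarrow> (p has_derivative (\<lambda>v. s z * v + of_real (L z / 4) * cnj v)) (at z)"
    "continuous_on S s" "continuous_on S L"
    using assms(1) unfolding laplacian_on_def by blast
  obtain s' where s': "\<And>z. z \<in> S \<Longrightarrow> (u' has_derivative (\<lambda>v. 2 * Re (p' z * v))) (at z)"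
    "\<And>z. z \<in> S \<Longrightarrow> (p' has_derivative (\<lambda>v. s' z * v + of_real (L' z / 4) * cnj v)) (at z)"
    "continuous_on S s'" "continuous_on S L'"
    using assms(2) unfolding laplacian_on_def by blast
  show ?thesis
    apply (rule laplacian_onI[of _ _ _ "\<lambda>z. s z + s' z"])
    subgoal by fact
    subgoal by (rule has_derivative_eq_rhs, rule has_derivative_add, erule s, erule s') (auto simp: algebra_simps)
    subgoal by (rule has_derivative_eq_rhs, rule has_derivative_add, erule s, erule s') (auto simp: algebra_simps add_divide_distrib)
    subgoal by (intro continuous_intros s s')
    subgoal by (intro continuous_intros s s')
    done
qed

lemma laplacian_on_mult:
  assumes "laplacian_on S u p L" "laplacian_on S u' p' L'"
  shows "laplacian_on S (\<lambda>z. u z * u' z) (\<lambda>z. of_real (u z) * p' z + of_real (u' z) * p z)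
           (\<lambda>z. u z * L' z + u' z * L z + 8 * Re (p z * cnj (p' z)))"
proof -
  obtain s where s: "open S" "\<And>z. z \<in> S \<Longrightarrow> (u has_derivative (\<lambda>v. 2 * Re (p z * v))) (at z)"
    "\<And>z. z \<in> S \<Longrightarrow> (p has_derivative (\<lambda>v. s z * v + of_real (L z / 4) * cnj v)) (at z)"
    "continuous_on S s" "continuous_on S L"
    using assms(1) unfolding laplacian_on_def by blast
  obtain s' where s': "\<And>z. z \<in> S \<Longrightarrow> (u' has_derivative (\<lambda>v. 2 * Re (p' z * v))) (at z)"
    "\<And>z. z \<in> S \<Longrightarrow> (p' has_derivative (\<lambda>v. s' z * v + of_real (L' z / 4) * cnj v)) (at z)"
    "continuous_on S s'" "continuous_on S L'"
    using assms(2) unfolding laplacian_on_def by blast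
  note c = laplacian_on_continuous[OF assms(1)] laplacian_on_continuous[OF assms(2)]
  show ?thesis
    apply (rule laplacian_onI[of _ _ _ "\<lambda>z. of_real (u z) * s' z + of_real (u' z) * s z + 2 * p z * p' z"])
    subgoal by fact
    subgoal by (rule has_derivative_eq_rhs, rule has_derivative_mult, erule s, erule s') (auto simp: algebra_simps)
    subgoal by (rule has_derivative_eq_rhs, (rule has_derivative_add has_derivative_mult has_derivative_of_real | erule s s')+)
               (auto simp: fun_eq_iff complex_eq_iff algebra_simps add_divide_distrib)
    subgoal by (intro continuous_intros s s' c)
    subgoal by (intro continuous_intros s s' c)
    done
qed

lemma laplacian_on_compose:
  assumes "laplacian_on S u p L"
    and k: "\<And>z. z \<in> S \<Longrightarrow> (k has_field_derivative k' (u z)) (at (u z))"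
    and k': "\<And>z. z \<in> S \<Longrightarrow> (k' has_field_derivative k'' (u z)) (at (u z))"
    and k'': "continuous_on S (\<lambda>z. k'' (u z))"
  shows "laplacian_on S (\<lambda>z. k (u z)) (\<lambda>z. of_real (k' (u z)) * p z) (\<lambda>z. k' (u z) * L z + 4 * k'' (u z) * (norm (p z))\<^sup>2)"
proof -
  obtain s where s: "open S" "\<And>z. z \<in> S \<Longrightarrow> (u has_derivative (\<lambda>v. 2 * Re (p z * v))) (at z)"
    "\<And>z. z \<in> S \<Longrightarrow> (p has_derivative (\<lambda>v. s z * v + of_real (L z / 4) * cnj v)) (at z)"
    "continuous_on S s" "continuous_on S L"
    using assms(1) unfolding laplacian_on_def by blast
  note c = laplacian_on_continuous[OF assms(1)]
  have dk': "((\<lambda>z. k' (u z)) has_derivative (\<lambda>v. k'' (u z) * (2 * Re (p z * v)))) (at z)" if "z \<in> S" for z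
    using has_derivative_compose[OF s(2)[OF that] has_field_derivative_imp_has_derivative[OF k'[OF that]]] by simp
  have ck': "continuous_on S (\<lambda>z. k' (u z))"
    using dk' by (intro continuous_at_imp_continuous_on ballI has_derivative_continuous) blast
  show ?thesis
    apply (rule laplacian_onI[of _ _ _ "\<lambda>z. of_real (k'' (u z)) * (p z)\<^sup>2 + of_real (k' (u z)) * s z"])
    subgoal by fact
    subgoal for z using has_derivative_compose[OF s(2) has_field_derivative_imp_has_derivative[OF k]] by (simp add: algebra_simps)
    subgoal for z
      apply (rule has_derivative_eq_rhs, rule has_derivative_mult, rule has_derivative_of_real, erule dk', erule s)
      apply (simp add: fun_eq_iff complex_eq_iff cmod_power2)
      apply (simp add: algebra_simps power2_eq_square add_divide_distrib)
      done
    subgoal by (intro continuous_intros s k'' c ck')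
    subgoal by (intro continuous_intros s k'' c ck')
    done
qed

lemma laplacian_on_norm2:
  assumes "H holomorphic_on S" "open S"
  shows "laplacian_on S (\<lambda>z. (norm (H z))\<^sup>2) (\<lambda>z. deriv H z * cnj (H z)) (\<lambda>z. 4 * (norm (deriv H z))\<^sup>2)"
proof -
  have dH: "(H has_derivative (\<lambda>v. deriv H z * v)) (at z)" if "z \<in> S" for z
    using holomorphic_derivI[OF assms that] by (simp add: has_field_derivative_imp_has_derivative)
  have h': "deriv H holomorphic_on S" using assms by (rule holomorphic_deriv)
  have dH': "(deriv H has_derivative (\<lambda>v. deriv (deriv H) z * v)) (at z)" if "z \<in> S" for z
    using holomorphic_derivI[OF h' assms(2) that] by (simp add: has_field_derivative_imp_has_derivative)
  have c: "continuous_on S H" "continuous_on S (deriv H)" "continuous_on S (deriv (deriv H))"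
    using assms h' holomorphic_deriv[OF h' assms(2)] by (auto simp: holomorphic_on_imp_continuous_on)
  have dR: "((\<lambda>z. (norm (H z))\<^sup>2) has_derivative (\<lambda>v. 2 * Re (deriv H z * cnj (H z) * v))) (at z)" if "z \<in> S" for z
    unfolding cmod_power2
    by (rule has_derivative_eq_rhs, (rule derivative_eq_intros refl dH[OF that])+)
       (auto simp: fun_eq_iff algebra_simps)
  show ?thesis
    apply (rule laplacian_onI[of _ _ _ "\<lambda>z. deriv (deriv H) z * cnj (H z)"])
    subgoal by fact
    subgoal by (erule dR)
    subgoal by (rule has_derivative_eq_rhs, rule has_derivative_mult, erule dH', rule has_derivative_cnj, erule dH)
               (auto simp: fun_eq_iff algebra_simps complex_norm_square simp flip: of_real_power)
    subgoal by (intro continuous_intros c)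
    subgoal by (intro continuous_intros c)
    done
qed

text \<open>
  The conformal covariance of the Laplacian: this is what makes \<open>dd\<^sup>c u\<close> a 2-form.
\<close>

lemma laplacian_on_holomorphic_compose:
  assumes "laplacian_on S u p L" "\<phi> holomorphic_on T" "open T" "\<phi> ` T \<subseteq> S"
  shows "laplacian_on T (\<lambda>z. u (\<phi> z)) (\<lambda>z. p (\<phi> z) * deriv \<phi> z) (\<lambda>z. L (\<phi> z) * (norm (deriv \<phi> z))\<^sup>2)"
proof -
  obtain s where s: "open S" "\<And>z. z \<in> S \<Longrightarrow> (u has_derivative (\<lambda>v. 2 * Re (p z * v))) (at z)"
    "\<And>z. z \<in> S \<Longrightarrow> (p has_derivative (\<lambda>v. s z * v + of_real (L z / 4) * cnj v)) (at z)"
    "continuous_on S s" "continuous_on S L"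
    using assms(1) unfolding laplacian_on_def by blast
  note c = laplacian_on_continuous[OF assms(1)]
  have d: "(\<phi> has_derivative (\<lambda>v. deriv \<phi> z * v)) (at z)" if "z \<in> T" for z
    using holomorphic_derivI[OF assms(2,3) that] by (simp add: has_field_derivative_imp_has_derivative)
  have h': "deriv \<phi> holomorphic_on T" using assms by (intro holomorphic_deriv)
  have d': "(deriv \<phi> has_derivative (\<lambda>v. deriv (deriv \<phi>) z * v)) (at z)" if "z \<in> T" for z
    using holomorphic_derivI[OF h' assms(3) that] by (simp add: has_field_derivative_imp_has_derivative)
  have cc: "continuous_on T \<phi>" "continuous_on T (deriv \<phi>)" "continuous_on T (deriv (deriv \<phi>))"
    using assms h' holomorphic_deriv[OF h' assms(3)] by (auto simp: holomorphic_on_imp_continuous_on)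
  have co: "continuous_on T (\<lambda>z. g (\<phi> z))" if "continuous_on S g" for g :: "complex \<Rightarrow> 'b::topological_space"
    using that cc(1) assms(4) by (rule continuous_on_compose2)
  show ?thesis
    apply (rule laplacian_onI[of _ _ _ "\<lambda>z. s (\<phi> z) * (deriv \<phi> z * deriv \<phi> z) + p (\<phi> z) * deriv (deriv \<phi>) z"])
    subgoal by fact
    subgoal for z using has_derivative_compose[OF d[of z] s(2)[of "\<phi> z"]] assms(4) by (auto simp: mult_ac)
    subgoal for z
      apply (rule has_derivative_eq_rhs, rule has_derivative_mult)
        apply (rule has_derivative_compose[OF d[of z] s(3)[of "\<phi> z"]], assumption, use assms(4) in blast)
       apply (erule d')
      apply (simp add: fun_eq_iff algebra_simps)
      apply (simp add: complex_norm_square[symmetric])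
      done
    subgoal by (intro continuous_intros co s c cc)
    subgoal by (intro continuous_intros co s c cc)
    done
qed

lemma laplacian_on_ln_norm2:
  assumes "H holomorphic_on S" "open S" "\<And>z. z \<in> S \<Longrightarrow> H z \<noteq> 0"
  shows "laplacian_on S (\<lambda>z. ln ((norm (H z))\<^sup>2)) (\<lambda>z. deriv H z / H z) (\<lambda>z. 0)"
proof -
  have c: "continuous_on S H" using assms holomorphic_on_imp_continuous_on by blast
  have "laplacian_on S (\<lambda>z. ln ((norm (H z))\<^sup>2)) (\<lambda>z. of_real (inverse ((norm (H z))\<^sup>2)) * (deriv H z * cnj (H z)))
    (\<lambda>z. inverse ((norm (H z))\<^sup>2) * (4 * (norm (deriv H z))\<^sup>2) + 4 * - (inverse ((norm (H z))\<^sup>2)^2) * (norm (deriv H z * cnj (H z)))\<^sup>2)"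
    apply (rule laplacian_on_compose[OF laplacian_on_norm2[OF assms(1,2)]])
    subgoal using assms by (auto intro!: derivative_eq_intros simp: field_simps)
    subgoal using assms by (auto intro!: derivative_eq_intros simp: field_simps power2_eq_square)
    subgoal using assms c by (auto intro!: continuous_intros)
    done
  then show ?thesis
    apply (rule laplacian_on_cong)
    subgoal by simp
    subgoal for z using assms(3)[of z] by (simp add: complex_norm_square field_simps flip: of_real_power)
    subgoal for z using assms(3)[of z] by (simp add: norm_mult field_simps power2_eq_square)
    done
qed

section \<open>Jensen formula for circle means\<close>

definition circle_mean :: "(complex \<Rightarrow> real) \<Rightarrow> real \<Rightarrow> real" where
  "circle_mean f t = integral {0..2*pi} (\<lambda>\<theta>. f (of_real t * cis \<theta>)) / (2 * pi)"

lemma continuous_on_circle_param: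
  assumes "continuous_on S f" "(\<lambda>(t,\<theta>). of_real t * cis \<theta>) ` A \<subseteq> S"
  shows "continuous_on A (\<lambda>(t,\<theta>). f (of_real t * cis \<theta>))"
proof -
  have "continuous_on A (\<lambda>(t,\<theta>). complex_of_real t * cis \<theta>)"
    unfolding cis_conv_exp split_def by (intro continuous_intros)
  then show ?thesis
    using continuous_on_compose2[OF assms(1) _ assms(2)] by (simp add: split_def)
qed

lemma has_vector_derivative_cis: "(cis has_vector_derivative (\<i> * cis \<theta>)) (at \<theta> within A)"
  unfolding cis_conv_exp
  by (rule has_vector_derivative_eq_rhs, (rule derivative_eq_intros refl has_vector_derivative_real_field | simp)+)

text \<open>
  The mean \<open>m\<close> of \<open>u\<close> over circles satisfies \<open>(t m')' = t * circle_mean L t\<close>, since the Laplacian in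
  polar coordinates is \<open>(t u\<^sub>t)\<^sub>t / t\<close> plus a derivative in the angle, whose mean vanishes. Two
  integrations give the formula. All first main theorems below are instances of it.
\<close>

theorem circle_mean_laplacian:
  assumes lap: "laplacian_on S u p L" and sub: "cball 0 r \<subseteq> S" and r0: "0 < r0" "r0 \<le> r"
  shows "continuous_on {0..r} (circle_mean L)"
    and "((\<lambda>t. integral {0..t} (\<lambda>s. s * circle_mean L s) / t) has_integral (circle_mean u r - circle_mean u r0)) {r0..r}"
proof -
  obtain s where s: "open S" "\<And>z. z \<in> S \<Longrightarrow> (u has_derivative (\<lambda>v. 2 * Re (p z * v))) (at z)"
    "\<And>z. z \<in> S \<Longrightarrow> (p has_derivative (\<lambda>v. s z * v + of_real (L z / 4) * cnj v)) (at z)"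
    "continuous_on S s" "continuous_on S L"
    using lap unfolding laplacian_on_def by blast
  note c = laplacian_on_continuous[OF lap]
  let ?z = "\<lambda>t \<theta>. complex_of_real t * cis \<theta>"
  let ?I = "{0..2*pi}"
  have zS: "?z t \<theta> \<in> S" if "t \<in> {0..r}" for t \<theta>
    using that sub by (auto simp: norm_mult)
  have cz: "continuous_on ({0..r} \<times> {0..2*pi}) (\<lambda>(t,\<theta>). g (?z t \<theta>))" if "continuous_on S g" for g :: "complex \<Rightarrow> 'b::topological_space"
    by (rule continuous_on_circle_param[OF that]) (use zS in auto)
  have c1: "continuous_on ?I (\<lambda>\<theta>. g (?z t \<theta>))" if "continuous_on S g" "t \<in> {0..r}" for g :: "complex \<Rightarrow> 'b::topological_space" and t
  proof -
    have "continuous_on ?I (\<lambda>\<theta>. ?z t \<theta>)" unfolding cis_conv_exp by (intro continuous_intros)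
    then show ?thesis using continuous_on_compose2[OF that(1)] zS[OF that(2)] by blast
  qed
  have int1: "(\<lambda>\<theta>. g (?z t \<theta>)) integrable_on ?I" if "continuous_on S g" "t \<in> {0..r}" for g :: "complex \<Rightarrow> real" and t
    using c1[OF that] integrable_continuous_real by blast
  \<comment> \<open>\<open>m'\<close> is the derivative of \<open>m\<close>, \<open>k t = t * m' t\<close>, and \<open>k'\<close> is the derivative of \<open>k\<close>.\<close>
  define m where "m t = integral ?I (\<lambda>\<theta>. u (?z t \<theta>))" for t
  define m' where "m' t = integral ?I (\<lambda>\<theta>. 2 * Re (p (?z t \<theta>) * cis \<theta>))" for t
  define k where "k t = integral ?I (\<lambda>\<theta>. 2 * Re (p (?z t \<theta>) * ?z t \<theta>))" for t
  define k' where "k' t = integral ?I (\<lambda>\<theta>. 2 * Re (s (?z t \<theta>) * of_real t * cis \<theta> ^ 2 + p (?z t \<theta>) * cis \<theta>) + t * L (?z t \<theta>) / 2)" for t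
  have zt: "((\<lambda>t. ?z t \<theta>) has_derivative (\<lambda>v. of_real v * cis \<theta>)) (at t within A)" for t \<theta> A
    by (auto intro!: derivative_eq_intros)
  have z\<theta>: "(?z t has_derivative (\<lambda>v. of_real v * (of_real t * \<i> * cis \<theta>))) (at \<theta> within A)" for t \<theta> A
    using has_vector_derivative_cis[of \<theta> A] unfolding has_vector_derivative_def
    by (auto intro!: derivative_eq_intros simp: scaleR_conv_of_real algebra_simps)
  have ccis: "continuous_on A (\<lambda>(t::real,\<theta>). cis \<theta>)" for A :: "(real \<times> real) set"
    unfolding cis_conv_exp split_def by (intro continuous_intros)
  have ct: "continuous_on A (\<lambda>(t::real,\<theta>::real). complex_of_real t)" for A :: "(real \<times> real) set"
    unfolding split_def by (intro continuous_intros)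
  have dm: "(m has_field_derivative m' t) (at t within {0..r})" if t: "t \<in> {0..r}" for t
    unfolding m_def m'_def
  proof (rule leibniz_rule_field_derivative[where U="{0..r}" and a=0 and b="2*pi", unfolded cbox_interval])
    fix t \<theta> assume t: "t \<in> {0..r}"
    show "((\<lambda>t. u (?z t \<theta>)) has_field_derivative 2 * Re (p (?z t \<theta>) * cis \<theta>)) (at t within {0..r})"
      unfolding has_field_derivative_def
      by (rule has_derivative_eq_rhs[OF has_derivative_compose[OF zt s(2)[OF zS[OF t]]]]) (auto simp: fun_eq_iff algebra_simps)
  next
    fix t assume "t \<in> {0..r}"
    then show "(\<lambda>\<theta>. u (?z t \<theta>)) integrable_on {0..2*pi}" using int1[OF c(1)] by simp
  next
    have "continuous_on ({0..r} \<times> {0..2*pi}) (\<lambda>x. 2 * Re ((case x of (t,\<theta>) \<Rightarrow> p (?z t \<theta>)) * (case x of (t,\<theta>) \<Rightarrow> cis \<theta>)))"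
      by (intro continuous_intros cz c ccis)
    then show "continuous_on ({0..r} \<times> {0..2*pi}) (\<lambda>(t,\<theta>). 2 * Re (p (?z t \<theta>) * cis \<theta>))"
      by (simp add: split_def)
  qed (use t in auto)
  have dk: "(k has_field_derivative k' t) (at t within {0..r})" if t: "t \<in> {0..r}" for t
    unfolding k_def k'_def
  proof (rule leibniz_rule_field_derivative[where U="{0..r}" and a=0 and b="2*pi", unfolded cbox_interval])
    fix t \<theta> assume t: "t \<in> {0..r}"
    have "((\<lambda>t. p (?z t \<theta>) * ?z t \<theta>) has_derivative (\<lambda>v. of_real v * (s (?z t \<theta>) * of_real t * cis \<theta> ^ 2 + p (?z t \<theta>) * cis \<theta> + of_real (t * L (?z t \<theta>) / 4)))) (at t within {0..r})"
      apply (rule has_derivative_eq_rhs[OF has_derivative_mult[OF has_derivative_compose[OF zt s(3)[OF zS[OF t]]] zt]])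
      apply (simp add: fun_eq_iff algebra_simps power2_eq_square)
      apply (simp add: cis_cnj cis_mult algebra_simps flip: mult.assoc)
      done
    note D = bounded_linear.has_derivative[OF bounded_linear_Re this]
    show "((\<lambda>t. 2 * Re (p (?z t \<theta>) * ?z t \<theta>)) has_field_derivative 2 * Re (s (?z t \<theta>) * of_real t * cis \<theta> ^ 2 + p (?z t \<theta>) * cis \<theta>) + t * L (?z t \<theta>) / 2) (at t within {0..r})"
      unfolding has_field_derivative_def
      by (rule has_derivative_eq_rhs, rule has_derivative_mult_right, rule D) (auto simp: fun_eq_iff algebra_simps)
  next
    fix t assume t: "t \<in> {0..r}"
    have "continuous_on ?I (?z t)" unfolding cis_conv_exp by (intro continuous_intros)
    then have "continuous_on ?I (\<lambda>\<theta>. 2 * Re (p (?z t \<theta>) * ?z t \<theta>))" by (intro continuous_intros c1 c t)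
    then show "(\<lambda>\<theta>. 2 * Re (p (?z t \<theta>) * ?z t \<theta>)) integrable_on {0..2*pi}"
      using integrable_continuous_real by simp
  next
    have "continuous_on ({0..r} \<times> {0..2*pi}) (\<lambda>x. 2 * Re ((case x of (t,\<theta>) \<Rightarrow> s (?z t \<theta>)) * (case x of (t,\<theta>) \<Rightarrow> of_real t) * (case x of (t,\<theta>) \<Rightarrow> cis \<theta>)^2
        + (case x of (t,\<theta>) \<Rightarrow> p (?z t \<theta>)) * (case x of (t,\<theta>) \<Rightarrow> cis \<theta>)) + fst x * (case x of (t,\<theta>) \<Rightarrow> L (?z t \<theta>)) / 2)"
      by (intro continuous_intros cz c s ccis ct) auto
    then show "continuous_on ({0..r} \<times> {0..2*pi}) (\<lambda>(t,\<theta>). 2 * Re (s (?z t \<theta>) * of_real t * cis \<theta> ^ 2 + p (?z t \<theta>) * cis \<theta>) + t * L (?z t \<theta>) / 2)"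
      by (simp add: split_def)
  qed (use t in auto)
  have k'_eq: "k' t = t * integral ?I (\<lambda>\<theta>. L (?z t \<theta>))" if t: "t \<in> {0..r}" for t
  proof -
    let ?w = "\<lambda>\<theta>. 2 * Re (- s (?z t \<theta>) * of_real t * cis \<theta> ^ 2 - p (?z t \<theta>) * cis \<theta>) + t * L (?z t \<theta>) / 2"
    have d: "((\<lambda>\<theta>. 2 * Re (p (?z t \<theta>) * (\<i> * cis \<theta>))) has_vector_derivative ?w \<theta>) (at \<theta> within ?I)" for \<theta>
    proof -
      have dc: "((\<lambda>\<theta>. \<i> * cis \<theta>) has_derivative (\<lambda>v. - of_real v * cis \<theta>)) (at \<theta> within ?I)"
        using has_vector_derivative_cis[of \<theta> ?I] unfolding has_vector_derivative_def
        by (auto intro!: derivative_eq_intros simp: scaleR_conv_of_real algebra_simps)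
      have "((\<lambda>\<theta>. p (?z t \<theta>) * (\<i> * cis \<theta>)) has_derivative (\<lambda>v. of_real v * (- s (?z t \<theta>) * of_real t * cis \<theta> ^ 2 - p (?z t \<theta>) * cis \<theta> + of_real (t * L (?z t \<theta>) / 4)))) (at \<theta> within ?I)"
        apply (rule has_derivative_eq_rhs[OF has_derivative_mult[OF has_derivative_compose[OF z\<theta> s(3)[OF zS[OF t]]] dc]])
        apply (simp add: fun_eq_iff algebra_simps power2_eq_square)
        apply (simp add: cis_cnj cis_mult algebra_simps flip: mult.assoc)
        done
      note D = bounded_linear.has_derivative[OF bounded_linear_Re this]
      show ?thesis unfolding has_vector_derivative_def
        by (rule has_derivative_eq_rhs, rule has_derivative_mult_right, rule D) (auto simp: fun_eq_iff algebra_simps)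
    qed
    have w0: "(?w has_integral 0) ?I"
      using fundamental_theorem_of_calculus[OF _ d] by simp
    have L: "((\<lambda>\<theta>. t * L (?z t \<theta>)) has_integral t * integral ?I (\<lambda>\<theta>. L (?z t \<theta>))) ?I"
      using int1[OF c(3) t] by (intro has_integral_mult_right) auto
    have "((\<lambda>\<theta>. t * L (?z t \<theta>) - ?w \<theta>) has_integral t * integral ?I (\<lambda>\<theta>. L (?z t \<theta>)) - 0) ?I"
      by (rule has_integral_diff[OF L w0])
    moreover have "t * L (?z t \<theta>) - ?w \<theta> = 2 * Re (s (?z t \<theta>) * of_real t * cis \<theta> ^ 2 + p (?z t \<theta>) * cis \<theta>) + t * L (?z t \<theta>) / 2" for \<theta>
      by (simp add: algebra_simps)
    ultimately have "((\<lambda>\<theta>. 2 * Re (s (?z t \<theta>) * of_real t * cis \<theta> ^ 2 + p (?z t \<theta>) * cis \<theta>) + t * L (?z t \<theta>) / 2)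
        has_integral t * integral ?I (\<lambda>\<theta>. L (?z t \<theta>)) - 0) ?I"
      by (simp only:)
    then show ?thesis unfolding k'_def diff_0_right by (rule integral_unique)
  qed
  have km: "k t = t * m' t" for t
  proof -
    have "t * m' t = integral ?I (\<lambda>\<theta>. t * (2 * Re (p (?z t \<theta>) * cis \<theta>)))"
      unfolding m'_def by (rule integral_mult_right[symmetric])
    also have "\<dots> = k t" unfolding k_def by (rule integral_cong) (simp add: algebra_simps)
    finally show ?thesis by simp
  qed
  have k_int: "k t = integral {0..t} (\<lambda>\<tau>. \<tau> * integral ?I (\<lambda>\<theta>. L (?z \<tau> \<theta>)))" if t: "t \<in> {0..r}" for t
  proof -
    have "(k' has_integral k t - k 0) {0..t}"
      using t by (intro fundamental_theorem_of_calculus)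
        (auto intro: has_field_derivative_subset[OF dk] simp flip: has_real_derivative_iff_has_vector_derivative)
    then have "k t = integral {0..t} k'" using km[of 0] by (simp add: integral_unique)
    also have "\<dots> = integral {0..t} (\<lambda>\<tau>. \<tau> * integral ?I (\<lambda>\<theta>. L (?z \<tau> \<theta>)))"
      using t by (intro integral_cong k'_eq) auto
    finally show ?thesis .
  qed
  have "(m' has_integral m r - m r0) {r0..r}"
    using r0 by (intro fundamental_theorem_of_calculus)
      (auto intro: has_field_derivative_subset[OF dm] simp flip: has_real_derivative_iff_has_vector_derivative)
  then have 1: "((\<lambda>t. inverse (2*pi) * m' t) has_integral (inverse (2*pi) * (m r - m r0))) {r0..r}"
    by (rule has_integral_mult_right)
  show "((\<lambda>t. integral {0..t} (\<lambda>s. s * circle_mean L s) / t) has_integral (circle_mean u r - circle_mean u r0)) {r0..r}"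
  proof (rule has_integral_eq[rotated])
    show "((\<lambda>t. inverse (2*pi) * m' t) has_integral (circle_mean u r - circle_mean u r0)) {r0..r}"
    proof -
      have "circle_mean u t = m t / (2*pi)" for t by (simp only: circle_mean_def m_def)
      then have "inverse (2*pi) * (m r - m r0) = circle_mean u r - circle_mean u r0"
        by (simp only: divide_inverse) (simp only: left_diff_distrib right_diff_distrib mult.commute)
      then show ?thesis using 1 by (simp only:)
    qed
    fix t assume t: "t \<in> {r0..r}"
    have "integral {0..t} (\<lambda>s. s * circle_mean L s) = inverse (2*pi) * k t"
    proof -
      have "integral {0..t} (\<lambda>s. s * circle_mean L s) = integral {0..t} (\<lambda>\<tau>. inverse (2*pi) * (\<tau> * integral ?I (\<lambda>\<theta>. L (?z \<tau> \<theta>))))"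
        by (rule integral_cong) (simp add: circle_mean_def field_simps)
      also have "\<dots> = inverse (2*pi) * integral {0..t} (\<lambda>\<tau>. \<tau> * integral ?I (\<lambda>\<theta>. L (?z \<tau> \<theta>)))"
        by (rule integral_mult_right)
      finally show ?thesis using k_int[of t] t r0 by simp
    qed
    then show "inverse (2*pi) * m' t = integral {0..t} (\<lambda>s. s * circle_mean L s) / t"
      using t r0 by (simp add: km)
  qed
  have "continuous_on {0..r} (\<lambda>t. integral (cbox 0 (2*pi)) (\<lambda>\<theta>. L (?z t \<theta>)))"
    by (rule integral_continuous_on_param) (use cz[OF c(3)] in auto)
  then show "continuous_on {0..r} (circle_mean L)"
    unfolding circle_mean_def by (intro continuous_intros) auto
qed

section \<open>A flat step function\<close>

lemma power_mult_poly_div_exp_tendsto_0: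
  "((\<lambda>y::real. y ^ k * poly p y / exp y) \<longlongrightarrow> 0) at_top"
proof (induction p arbitrary: k)
  case 0
  then show ?case by simp
next
  case (pCons a p)
  have "((\<lambda>y::real. a * (y ^ k / exp y) + y ^ Suc k * poly p y / exp y) \<longlongrightarrow> a * 0 + 0) at_top"
    by (intro tendsto_add tendsto_mult tendsto_const tendsto_power_div_exp_0 pCons.IH)
  then show ?case by (simp add: algebra_simps add_divide_distrib)
qed

text \<open>
  All derivatives of \<open>exp (- 1 / x)\<close> have the form \<open>P (1 / x) * exp (- 1 / x)\<close> with a polynomial \<open>P\<close>,
  given by this recursion. Extended by \<open>0\<close>, the function is smooth; it is used to bend the end
  of a curve to another end point without losing smoothness.
\<close>

primrec flat_poly :: "nat \<Rightarrow> real poly" where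
  "flat_poly 0 = 1"
| "flat_poly (Suc n) = monom 1 2 * (flat_poly n - pderiv (flat_poly n))"

definition flat_step :: "nat \<Rightarrow> real \<Rightarrow> real" where
  "flat_step n x = (if x \<le> 0 then 0 else poly (flat_poly n) (1 / x) * exp (- (1 / x)))"

lemma flat_step_has_derivative:
  "(flat_step n has_field_derivative flat_step (Suc n) x) (at x)"
proof (cases x "0::real" rule: linorder_cases)
  case less
  have "((\<lambda>x. 0) has_field_derivative 0) (at x)" by simp
  then have "(flat_step n has_field_derivative 0) (at x)"
    by (rule has_field_derivative_transform_within_open[of _ _ _ "{..<0}"]) (use less in \<open>auto simp: flat_step_def\<close>)
  then show ?thesis using less by (simp add: flat_step_def)
next
  case greater
  have "((\<lambda>x. poly (flat_poly n) (1 / x) * exp (- (1 / x))) has_field_derivative flat_step (Suc n) x) (at x)"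
    using greater
    by (auto intro!: derivative_eq_intros DERIV_chain2[OF poly_DERIV] simp: flat_step_def poly_monom power2_eq_square field_simps)
  then show ?thesis
    by (rule has_field_derivative_transform_within_open[of _ _ _ "{0<..}"]) (use greater in \<open>auto simp: flat_step_def\<close>)
next
  case equal
  have "((\<lambda>y. y ^ 1 * poly (flat_poly n) y / exp y) \<longlongrightarrow> 0) at_top"
    by (rule power_mult_poly_div_exp_tendsto_0)
  then have "((\<lambda>h. flat_step n (inverse h) / inverse h) \<longlongrightarrow> 0) at_top"
    by (rule Lim_transform_eventually)
       (auto simp: flat_step_def exp_minus field_simps intro!: eventually_mono[OF eventually_gt_at_top[of 0]])
  then have r: "((\<lambda>h. flat_step n h / h) \<longlongrightarrow> 0) (at_right 0)"
    by (simp add: filterlim_at_right_to_top)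
  have l: "((\<lambda>h. flat_step n h / h) \<longlongrightarrow> 0) (at_left 0)"
    by (rule tendsto_eventually) (auto simp: flat_step_def eventually_at_left_field intro!: exI[of _ "-1"])
  have "((\<lambda>h. flat_step n h / h) \<longlongrightarrow> 0) (at 0)"
    using filterlim_split_at[OF l r] by simp
  then show ?thesis using equal by (simp add: DERIV_def flat_step_def)
qed

lemma flat_step_0: "x \<le> 0 \<Longrightarrow> flat_step n x = 0" by (simp add: flat_step_def)
lemma flat_step_pos: "0 < x \<Longrightarrow> 0 < flat_step 0 x" by (simp add: flat_step_def)
lemma flat_step_nonneg: "0 \<le> flat_step 0 x" by (simp add: flat_step_def)
lemma flat_step_mono: "x \<le> y \<Longrightarrow> flat_step 0 x \<le> flat_step 0 y"
  by (auto simp: flat_step_def field_simps)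

section \<open>Derivatives of composite curves\<close>

text \<open>
  Smoothness of order \<open>k\<close> on a relatively open subset \<open>K\<close> of the unit interval, by recursion on \<open>k\<close>.
  It is the form of smoothness for which closure under products and holomorphic maps is a
  simple induction; \<open>smooth_on_unit\<close> is the form with one sequence of derivatives.
\<close>

primrec derivs_upto :: "nat \<Rightarrow> real set \<Rightarrow> (real \<Rightarrow> complex) \<Rightarrow> bool" where
  "derivs_upto 0 K u = True"
| "derivs_upto (Suc k) K u = (\<exists>u'. (\<forall>s\<in>K. (u has_vector_derivative u' s) (at s within {0..1})) \<and> derivs_upto k K u')"

definition open_in_unit :: "real set \<Rightarrow> bool" where
  "open_in_unit K \<longleftrightarrow> (\<exists>U. open U \<and> K = {0..1} \<inter> U)"

lemma derivs_upto_cong_deriv: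
  assumes "open_in_unit K" "s \<in> K" "\<And>s. s \<in> K \<Longrightarrow> u s = v s" "(u has_vector_derivative d) (at s within {0..1})"
  shows "(v has_vector_derivative d) (at s within {0..1})"
proof -
  obtain U where U: "open U" "K = {0..1} \<inter> U" using assms by (auto simp: open_in_unit_def)
  then obtain e where "e > 0" "ball s e \<subseteq> U" using assms(2) openE by blast
  then show ?thesis
    using assms U by (intro has_vector_derivative_transform_within[OF assms(4), of e]) (auto simp: ball_def dist_commute)
qed

lemma derivs_upto_cong:
  assumes "open_in_unit K" "\<And>s. s \<in> K \<Longrightarrow> u s = v s" "derivs_upto k K u"
  shows "derivs_upto k K v"
proof (cases k)
  case (Suc j)
  then obtain u' where "\<forall>s\<in>K. (u has_vector_derivative u' s) (at s within {0..1})" "derivs_upto j K u'" using assms by auto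
  moreover have "\<forall>s\<in>K. (v has_vector_derivative u' s) (at s within {0..1})"
    using calculation derivs_upto_cong_deriv[OF assms(1), of _ u v] assms(2) by blast
  ultimately show ?thesis using Suc by auto
qed simp

lemma derivs_upto_mono: "derivs_upto (Suc k) K u \<Longrightarrow> derivs_upto k K u"
  by (induction k arbitrary: u) auto

lemma derivs_upto_add: "derivs_upto k K u \<Longrightarrow> derivs_upto k K v \<Longrightarrow> derivs_upto k K (\<lambda>s. u s + v s)"
proof (induction k arbitrary: u v)
  case (Suc k)
  obtain u' v' where d: "\<forall>s\<in>K. (u has_vector_derivative u' s) (at s within {0..1})" "derivs_upto k K u'"
     "\<forall>s\<in>K. (v has_vector_derivative v' s) (at s within {0..1})" "derivs_upto k K v'" using Suc.prems by auto
  then show ?case using Suc.IH[of u' v']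
    by (auto intro!: exI[of _ "\<lambda>s. u' s + v' s"] has_vector_derivative_add)
qed simp

lemma derivs_upto_mult: "derivs_upto k K u \<Longrightarrow> derivs_upto k K v \<Longrightarrow> derivs_upto k K (\<lambda>s. u s * v s)"
proof (induction k arbitrary: u v)
  case (Suc k)
  obtain u' v' where d: "\<forall>s\<in>K. (u has_vector_derivative u' s) (at s within {0..1})" "derivs_upto k K u'"
     "\<forall>s\<in>K. (v has_vector_derivative v' s) (at s within {0..1})" "derivs_upto k K v'" using Suc.prems by auto
  have "derivs_upto k K (\<lambda>s. u s * v' s + u' s * v s)"
    using Suc d derivs_upto_mono by (intro derivs_upto_add) blast+
  then show ?case using d
    by (auto intro!: exI[of _ "\<lambda>s. u s * v' s + u' s * v s"] has_vector_derivative_mult)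
qed simp

lemma derivs_upto_holomorphic_compose:
  assumes "open W" "u ` K \<subseteq> W"
  shows "\<phi> holomorphic_on W \<Longrightarrow> derivs_upto k K u \<Longrightarrow> derivs_upto k K (\<lambda>s. \<phi> (u s))"
proof (induction k arbitrary: \<phi>)
  case (Suc k)
  obtain u' where d: "\<forall>s\<in>K. (u has_vector_derivative u' s) (at s within {0..1})" "derivs_upto k K u'" using Suc.prems by auto
  have "derivs_upto k K (\<lambda>s. u' s * deriv \<phi> (u s))"
    using Suc d derivs_upto_mono holomorphic_deriv assms by (intro derivs_upto_mult) blast+
  moreover have "((\<phi> \<circ> u) has_vector_derivative u' s * deriv \<phi> (u s)) (at s within {0..1})" if "s \<in> K" for s
    using d that assms holomorphic_derivI[OF Suc.prems(1) assms(1), of "u s"]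
    by (intro field_vector_diff_chain_within) (auto intro: has_field_derivative_at_within)
  ultimately show ?case by (auto simp: o_def intro!: exI[of _ "\<lambda>s. u' s * deriv \<phi> (u s)"])
qed simp

definition smooth_on_unit :: "real set \<Rightarrow> (real \<Rightarrow> complex) \<Rightarrow> bool" where
  "smooth_on_unit K u \<longleftrightarrow> (\<exists>G :: nat \<Rightarrow> real \<Rightarrow> complex. \<forall>s\<in>K. G 0 s = u s \<and>
      (\<forall>n. (G n has_vector_derivative G (Suc n) s) (at s within {0..1})))"

lemma smooth_on_unit_subset: "smooth_on_unit K u \<Longrightarrow> K' \<subseteq> K \<Longrightarrow> smooth_on_unit K' u"
  unfolding smooth_on_unit_def by blast

lemma smooth_on_unit_imp_derivs_upto:
  assumes "open_in_unit K" "smooth_on_unit K u" shows "derivs_upto k K u"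
proof -
  obtain G where G: "\<forall>s\<in>K. G 0 s = u s \<and> (\<forall>n. (G n has_vector_derivative G (Suc n) s) (at s within {0..1}))"
    using assms by (auto simp: smooth_on_unit_def)
  have "derivs_upto k K (G n)" for n
    using G by (induction k arbitrary: n) auto
  from derivs_upto_cong[OF assms(1) _ this[of 0]] G show ?thesis by auto
qed

text \<open>
  The derivatives of different orders \<open>k\<close> fit together because a derivative relative to the unit
  interval is unique.
\<close>

lemma derivs_upto_imp_smooth_on_unit:
  assumes "K \<subseteq> {0..1}" "open_in_unit K" "\<And>k. derivs_upto k K u" shows "smooth_on_unit K u"
proof -
  define D where "D u s = vector_derivative u (at s within {0..1})" for u :: "real \<Rightarrow> complex" and s :: real
  have D: "(u has_vector_derivative D u s) (at s within {0..1})" if "derivs_upto (Suc k) K u" "s \<in> K" for u s k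
    using that unfolding D_def by (auto simp: vector_derivative_works[symmetric] intro: differentiableI_vector)
  have D2: "derivs_upto k K (D u)" if u: "derivs_upto (Suc k) K u" for u k
  proof -
    obtain u' where u': "\<forall>s\<in>K. (u has_vector_derivative u' s) (at s within {0..1})" "derivs_upto k K u'" using u by auto
    have "u' s = D u s" if "s \<in> K" for s
      unfolding D_def
      by (rule vector_derivative_within_cbox[symmetric, of 0 1, unfolded cbox_interval])
         (use u'(1) that assms(1) in auto)
    then show ?thesis using derivs_upto_cong[OF assms(2) _ u'(2)] by auto
  qed
  have all: "derivs_upto k K ((D ^^ n) u)" for n k
    by (induction n arbitrary: k) (simp_all add: assms(3) D2 del: derivs_upto.simps)
  show ?thesis unfolding smooth_on_unit_def
    by (intro exI[of _ "\<lambda>n. (D ^^ n) u"]) (use D[OF all] in auto)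
qed

lemma smooth_on_unit_holomorphic_compose:
  assumes "K \<subseteq> {0..1}" "open_in_unit K" "smooth_on_unit K u" "open W" "u ` K \<subseteq> W" "\<phi> holomorphic_on W"
  shows "smooth_on_unit K (\<lambda>s. \<phi> (u s))"
  by (rule derivs_upto_imp_smooth_on_unit[OF assms(1,2)])
     (rule derivs_upto_holomorphic_compose[OF assms(4-6) smooth_on_unit_imp_derivs_upto[OF assms(2,3)]])

lemma smooth_on_unit_add_step:
  assumes "smooth_on_unit K u"
  shows "smooth_on_unit K (\<lambda>s. u s + v * of_real (flat_step 0 (s - t1)))"
proof -
  obtain G where G: "\<forall>s\<in>K. G 0 s = u s \<and> (\<forall>n. (G n has_vector_derivative G (Suc n) s) (at s within {0..1}))"
    using assms by (auto simp: smooth_on_unit_def)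
  have d: "((\<lambda>s. complex_of_real (flat_step n (s - t1))) has_vector_derivative of_real (flat_step (Suc n) (s - t1))) (at s within {0..1})" for n s
  proof -
    have "((\<lambda>s. flat_step n (s - t1)) has_real_derivative flat_step (Suc n) (s - t1) * 1) (at s within {0..1})"
      by (rule DERIV_chain2[OF flat_step_has_derivative]) (auto intro!: derivative_eq_intros)
    then show ?thesis
      by (intro has_vector_derivative_of_real) (simp add: has_real_derivative_iff_has_vector_derivative)
  qed
  show ?thesis unfolding smooth_on_unit_def
    by (rule exI[of _ "\<lambda>n s. G n s + v * of_real (flat_step n (s - t1))"])
       (use G in \<open>auto intro!: has_vector_derivative_add has_vector_derivative_mult_right d\<close>)
qed

section \<open>Charts, smooth curves and their integrals\<close>

lemma locally_constant_predicate:
  fixes Q :: "'a::topological_space \<Rightarrow> bool"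
  assumes "connected (UNIV :: 'a set)" "\<And>x. \<exists>N. open N \<and> x \<in> N \<and> (\<forall>y\<in>N. Q y = Q x)" "Q x0"
  shows "Q x"
proof -
  have op: "open {x. P x}" if P: "\<And>x. \<exists>N. open N \<and> x \<in> N \<and> (\<forall>y\<in>N. P y = P x)" for P :: "'a \<Rightarrow> bool"
  proof (subst open_subopen, rule ballI)
    fix x assume "x \<in> {x. P x}"
    moreover obtain N where "open N" "x \<in> N" "\<forall>y\<in>N. P y = P x" using P by blast
    ultimately show "\<exists>T. open T \<and> x \<in> T \<and> T \<subseteq> {x. P x}" by blast
  qed
  have "open {x. Q x}" by (rule op) (rule assms(2))
  moreover have "open {x. \<not> Q x}" by (rule op) (use assms(2) in simp)
  ultimately have "{x. Q x} = {} \<or> {x. \<not> Q x} = {}"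
    using connectedD[OF assms(1), of "{x. Q x}" "{x. \<not> Q x}"] by auto
  then show ?thesis using assms(3) by auto
qed

locale atlas =
  fixes A :: "'a::t2_space chart set"
  assumes atlas: "complex_atlas A"
begin

lemma chart_at: "chart_at A x \<in> A" "x \<in> fst (chart_at A x)"
proof -
  have "\<exists>c. c \<in> A \<and> x \<in> fst c" using atlas unfolding complex_atlas_def by blast
  then have "chart_at A x \<in> A \<and> x \<in> fst (chart_at A x)" unfolding chart_at_def by (rule someI_ex)
  then show "chart_at A x \<in> A" "x \<in> fst (chart_at A x)" by auto
qed

lemma
  assumes "c \<in> A"
  shows open_chart_dom: "open (fst c)" and open_chart_image: "open (snd c ` fst c)"
    and chart_inj: "inj_on (snd c) (fst c)"
    and chart_continuous: "continuous_on (fst c) (snd c)"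
    and chart_inv_continuous: "continuous_on (snd c ` fst c) (chart_inv c)"
  using assms atlas unfolding complex_atlas_def is_chart_def homeomorphism_def by auto

lemma chart_inv_left: "c \<in> A \<Longrightarrow> x \<in> fst c \<Longrightarrow> chart_inv c (snd c x) = x"
  using chart_inj by (auto simp: chart_inv_def)

lemma chart_inv_right: "z \<in> snd c ` fst c \<Longrightarrow> snd c (chart_inv c z) = z"
  by (auto simp: chart_inv_def f_inv_into_f)

lemma chart_inv_in: "z \<in> snd c ` fst c \<Longrightarrow> chart_inv c z \<in> fst c"
  by (auto simp: chart_inv_def inv_into_into)

lemma chart_image_open:
  assumes "c \<in> A" "open V" shows "open (snd c ` (V \<inter> fst c))"
proof -
  have "snd c ` (V \<inter> fst c) = {z \<in> snd c ` fst c. chart_inv c z \<in> V}"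
    using chart_inv_left[OF assms(1)] by force
  also have "\<dots> = snd c ` fst c \<inter> chart_inv c -` V" by blast
  moreover have "open (snd c ` fst c \<inter> chart_inv c -` V)"
    by (rule continuous_open_preimage[OF chart_inv_continuous[OF assms(1)] open_chart_image[OF assms(1)] assms(2)])
  ultimately show ?thesis by simp
qed

lemma chart_inv_image_open:
  assumes "c \<in> A" "open W" shows "open {x \<in> fst c. snd c x \<in> W}"
  using continuous_open_preimage[OF chart_continuous[OF assms(1)] open_chart_dom[OF assms(1)] assms(2)]
  by (simp add: vimage_def Int_def)

lemma transition_holomorphic:
  "c \<in> A \<Longrightarrow> d \<in> A \<Longrightarrow> (snd d \<circ> chart_inv c) holomorphic_on (snd c ` (fst c \<inter> fst d))"
  using atlas unfolding complex_atlas_def by blast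

lemma open_transition: "c \<in> A \<Longrightarrow> d \<in> A \<Longrightarrow> open (snd c ` (fst c \<inter> fst d))"
  using chart_image_open[of c "fst d"] open_chart_dom by (simp add: Int_commute)

definition near :: "real \<Rightarrow> real \<Rightarrow> real set" where
  "near t e = {0..1} \<inter> {t - e<..<t + e}"

lemma open_in_unit_near: "open_in_unit (near t e)"
  unfolding open_in_unit_def near_def by (intro exI[of _ "{t - e<..<t + e}"]) auto

lemma near_subset: "near t e \<subseteq> {0..1}" by (auto simp: near_def)

lemma near_mono: "e \<le> e' \<Longrightarrow> near t e \<subseteq> near t e'" by (auto simp: near_def)

lemma smooth_on_unit_deriv:
  assumes "smooth_on_unit (near t e) u" "s \<in> near t e"
  shows "(u has_vector_derivative vector_derivative u (at s within {0..1})) (at s within {0..1})"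
proof -
  have "derivs_upto 1 (near t e) u" using assms smooth_on_unit_imp_derivs_upto[OF open_in_unit_near] by blast
  then obtain d where "(u has_vector_derivative d) (at s within {0..1})" using assms by auto
  then show ?thesis by (metis vector_derivative_works differentiableI_vector)
qed

lemma smooth_curve_imp_chart:
  assumes "smooth_curve_on A {0..1} g" "t \<in> {0..1}" "c \<in> A" "g t \<in> fst c"
  obtains e where "e > 0" "g ` near t e \<subseteq> fst c" "smooth_on_unit (near t e) (\<lambda>s. snd c (g s))"
proof -
  obtain e G where e: "e > 0" and G: "\<forall>s \<in> {0..1} \<inter> {t - e<..<t + e}. g s \<in> fst c \<and> G 0 s = snd c (g s) \<and>
             (\<forall>n::nat. (G n has_vector_derivative G (Suc n) s) (at s within {0..1}))"
    using assms unfolding smooth_curve_on_def by blast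
  show ?thesis
  proof
    show "g ` near t e \<subseteq> fst c" using G by (auto simp: near_def)
    show "smooth_on_unit (near t e) (\<lambda>s. snd c (g s))"
      unfolding smooth_on_unit_def near_def by (rule exI[of _ G]) (use G in auto)
  qed fact
qed

text \<open>
  Smoothness is tested in one chart at each parameter, since coordinate changes are holomorphic.
\<close>

lemma smooth_curve_onI:
  assumes "\<And>t. t \<in> {0..1} \<Longrightarrow> \<exists>c\<in>A. \<exists>e>0. g ` near t e \<subseteq> fst c \<and> smooth_on_unit (near t e) (\<lambda>s. snd c (g s))"
  shows "smooth_curve_on A {0..1} g"
  unfolding smooth_curve_on_def
proof (intro ballI impI)
  fix t d assume t: "t \<in> {0..1::real}" and d: "d \<in> A" "g t \<in> fst d"
  obtain c e where c: "c \<in> A" "e > 0" "g ` near t e \<subseteq> fst c" "smooth_on_unit (near t e) (\<lambda>s. snd c (g s))"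
    using assms[OF t] by blast
  let ?W = "snd c ` (fst c \<inter> fst d)"
  have tn: "t \<in> near t e" using t c by (auto simp: near_def)
  have cont: "continuous (at t within {0..1}) (\<lambda>s. snd c (g s))"
    using smooth_on_unit_deriv[OF c(4) tn] has_vector_derivative_continuous by blast
  have in_W: "snd c (g t) \<in> ?W" using c tn d by auto
  obtain \<delta> where \<delta>: "\<delta> > 0" "\<And>s. s \<in> {0..1} \<Longrightarrow> dist s t < \<delta> \<Longrightarrow> snd c (g s) \<in> ?W"
  proof -
    obtain \<epsilon> where \<epsilon>: "\<epsilon> > 0" "ball (snd c (g t)) \<epsilon> \<subseteq> ?W"
      using open_transition[OF c(1) d(1)] openE in_W by blast
    then obtain \<delta> where "\<delta> > 0" "\<forall>s\<in>{0..1}. dist s t < \<delta> \<longrightarrow> dist (snd c (g s)) (snd c (g t)) < \<epsilon>"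
      using cont unfolding continuous_within_eps_delta by blast
    then show ?thesis using that[of \<delta>] \<epsilon> by (auto simp: dist_commute subset_iff)
  qed
  define e' where "e' = min e \<delta>"
  have e': "e' > 0" "e' \<le> e" using c \<delta> by (auto simp: e'_def)
  have W: "snd c (g s) \<in> ?W" if "s \<in> near t e'" for s
    using that by (intro \<delta>) (auto simp: near_def e'_def dist_real_def)
  have gd: "g s \<in> fst d" if "s \<in> near t e'" for s
  proof -
    have "g s \<in> fst c" using c(3) near_mono[OF e'(2)] that by blast
    then show ?thesis using W[OF that] chart_inj[OF c(1)] by (auto dest: inj_onD)
  qed
  have "smooth_on_unit (near t e') (\<lambda>s. (snd d \<circ> chart_inv c) (snd c (g s)))"
    by (rule smooth_on_unit_holomorphic_compose[OF near_subset open_in_unit_near smooth_on_unit_subset[OF c(4) near_mono[OF e'(2)]]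
         open_transition[OF c(1) d(1)] _ transition_holomorphic[OF c(1) d(1)]]) (use W in auto)
  moreover have "(snd d \<circ> chart_inv c) (snd c (g s)) = snd d (g s)" if "s \<in> near t e'" for s
    using chart_inv_left[OF c(1), of "g s"] c(3) near_mono[OF e'(2)] that by fastforce
  ultimately obtain G where "\<forall>s\<in>near t e'. G 0 s = snd d (g s) \<and> (\<forall>n. (G n has_vector_derivative G (Suc n) s) (at s within {0..1}))"
    unfolding smooth_on_unit_def by (metis (no_types, lifting))
  then show "\<exists>e>0. \<exists>G. \<forall>s\<in>{0..1} \<inter> {t - e<..<t + e}. g s \<in> fst d \<and> G 0 s = snd d (g s) \<and>
             (\<forall>n. (G n has_vector_derivative G (Suc n) s) (at s within {0..1}))"
    using e'(1) gd unfolding near_def by blast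
qed

end

locale form_atlas = atlas A for A :: "'a::t2_space chart set" +
  fixes S :: "'a one_form"
  assumes form: "holomorphic_one_form A S"
begin

lemma form_holomorphic: "c \<in> A \<Longrightarrow> (S c \<circ> chart_inv c) holomorphic_on (snd c ` fst c)"
  using form unfolding holomorphic_one_form_def by blast

lemma form_transition: "c \<in> A \<Longrightarrow> d \<in> A \<Longrightarrow> x \<in> fst c \<Longrightarrow> x \<in> fst d \<Longrightarrow> S c x = S d x * transition_deriv c d x"
  using form unfolding holomorphic_one_form_def by blast

definition integrand :: "(real \<Rightarrow> 'a) \<Rightarrow> real \<Rightarrow> complex" where
  "integrand g t = (let c = chart_at A (g t) in S c (g t) * vector_derivative (snd c \<circ> g) (at t within {0..1}))"

lemma curve_integral_eq: "curve_integral A S g = integral {0..1} (integrand g)"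
  unfolding curve_integral_def integrand_def ..

lemma integrand_chart:
  assumes g: "smooth_curve_on A {0..1} g" and t: "t \<in> {0..1}" and c: "c \<in> A" "g t \<in> fst c"
  obtains v where "((\<lambda>s. snd c (g s)) has_vector_derivative v) (at t within {0..1})" "integrand g t = S c (g t) * v"
proof -
  define d where "d = chart_at A (g t)"
  have d: "d \<in> A" "g t \<in> fst d" using chart_at by (auto simp: d_def)
  obtain e where e: "e > 0" "g ` near t e \<subseteq> fst d" "smooth_on_unit (near t e) (\<lambda>s. snd d (g s))"
    using smooth_curve_imp_chart[OF g t d] by blast
  obtain e' where e': "e' > 0" "g ` near t e' \<subseteq> fst c" "smooth_on_unit (near t e') (\<lambda>s. snd c (g s))"
    using smooth_curve_imp_chart[OF g t c] by blast
  have tn: "t \<in> near t e" "t \<in> near t e'" using t e e' by (auto simp: near_def)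
  define w where "w = vector_derivative (\<lambda>s. snd d (g s)) (at t within {0..1})"
  define v where "v = vector_derivative (\<lambda>s. snd c (g s)) (at t within {0..1})"
  have w: "((\<lambda>s. snd d (g s)) has_vector_derivative w) (at t within {0..1})"
    unfolding w_def by (rule smooth_on_unit_deriv[OF e(3) tn(1)])
  have v: "((\<lambda>s. snd c (g s)) has_vector_derivative v) (at t within {0..1})"
    unfolding v_def by (rule smooth_on_unit_deriv[OF e'(3) tn(2)])
  have "((snd c \<circ> chart_inv d) has_field_derivative transition_deriv d c (g t)) (at (snd d (g t)))"
    unfolding transition_deriv_def
    by (rule holomorphic_derivI[OF transition_holomorphic[OF d(1) c(1)] open_transition[OF d(1) c(1)]]) (use c d in auto)
  then have "((\<lambda>s. (snd c \<circ> chart_inv d) (snd d (g s))) has_vector_derivative w * transition_deriv d c (g t)) (at t within {0..1})"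
    using field_vector_diff_chain_within[OF w, of "snd c \<circ> chart_inv d" "transition_deriv d c (g t)"]
    by (simp add: o_def has_field_derivative_at_within)
  then have vw: "((\<lambda>s. snd c (g s)) has_vector_derivative w * transition_deriv d c (g t)) (at t within {0..1})"
    using derivs_upto_cong_deriv[OF open_in_unit_near tn(1), of "\<lambda>s. (snd c \<circ> chart_inv d) (snd d (g s))" "\<lambda>s. snd c (g s)"]
      e(2) chart_inv_left[OF d(1)] by force
  have "v = w * transition_deriv d c (g t)"
    unfolding v_def by (rule vector_derivative_within_cbox[of 0 1, unfolded cbox_interval]) (use t vw in auto)
  then have "S d (g t) * w = S c (g t) * v"
    using form_transition[OF d(1) c(1) d(2) c(2)] by simp
  moreover have "integrand g t = S d (g t) * w"
    by (simp add: integrand_def d_def[symmetric] w_def o_def)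
  ultimately show ?thesis using that v by auto
qed

lemma integrand_has_integral:
  assumes g: "smooth_curve_on A {0..1} g" and c: "c \<in> A"
    and F: "\<And>z. z \<in> W \<Longrightarrow> (F has_field_derivative S c (chart_inv c z)) (at z)"
    and ab: "0 \<le> \<alpha>" "\<alpha> \<le> \<beta>" "\<beta> \<le> 1"
    and gW: "\<And>s. s \<in> {\<alpha>..\<beta>} \<Longrightarrow> g s \<in> fst c \<and> snd c (g s) \<in> W"
  shows "(integrand g has_integral F (snd c (g \<beta>)) - F (snd c (g \<alpha>))) {\<alpha>..\<beta>}"
proof -
  have "((\<lambda>s. F (snd c (g s))) has_vector_derivative integrand g s) (at s within {\<alpha>..\<beta>})" if s: "s \<in> {\<alpha>..\<beta>}" for s
  proof -
    have s1: "s \<in> {0..1}" using s ab by auto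
    obtain v where v: "((\<lambda>s. snd c (g s)) has_vector_derivative v) (at s within {0..1})" "integrand g s = S c (g s) * v"
      using integrand_chart[OF g s1 c] gW[OF s] by blast
    have "((F \<circ> (\<lambda>s. snd c (g s))) has_vector_derivative v * S c (chart_inv c (snd c (g s)))) (at s within {0..1})"
      using F[of "snd c (g s)"] gW[OF s] by (intro field_vector_diff_chain_within[OF v(1)]) (auto intro: has_field_derivative_at_within)
    then have "((\<lambda>s. F (snd c (g s))) has_vector_derivative integrand g s) (at s within {0..1})"
      using gW[OF s] chart_inv_left[OF c, of "g s"] by (simp add: o_def v(2) mult.commute)
    then show ?thesis by (rule has_vector_derivative_within_subset) (use ab in auto)
  qed
  then show ?thesis using ab by (intro fundamental_theorem_of_calculus) auto
qed

lemma local_primitive: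
  assumes "c \<in> A" "ball z0 \<rho> \<subseteq> snd c ` fst c"
  obtains F where "\<And>z. z \<in> ball z0 \<rho> \<Longrightarrow> (F has_field_derivative S c (chart_inv c z)) (at z)"
proof -
  have "(S c \<circ> chart_inv c) holomorphic_on ball z0 \<rho>"
    using form_holomorphic[OF assms(1)] assms(2) holomorphic_on_subset by blast
  then obtain F where "\<And>z. z \<in> ball z0 \<rho> \<Longrightarrow> (F has_field_derivative (S c \<circ> chart_inv c) z) (at z within ball z0 \<rho>)"
    using holomorphic_convex_primitive'[where f="S c \<circ> chart_inv c" and S="ball z0 \<rho>"] by auto
  then have "(F has_field_derivative S c (chart_inv c z)) (at z)" if "z \<in> ball z0 \<rho>" for z
    using that at_within_open[OF that open_ball] by (metis comp_apply)
  then show ?thesis by (rule that)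
qed

lemma integrand_integrable:
  assumes g: "smooth_curve_on A {0..1} g"
  shows "integrand g integrable_on {0..1}"
proof -
  have "\<exists>d>0. \<forall>u v. t \<in> cbox u v \<and> cbox u v \<subseteq> ball t d \<and> cbox u v \<subseteq> cbox 0 1 \<longrightarrow> integrand g integrable_on cbox u v"
    if t: "t \<in> cbox 0 (1::real)" for t
  proof -
    have t': "t \<in> {0..1}" using t by auto
    define c where "c = chart_at A (g t)"
    have c: "c \<in> A" "g t \<in> fst c" using chart_at by (auto simp: c_def)
    obtain e where e: "e > 0" "g ` near t e \<subseteq> fst c" "smooth_on_unit (near t e) (\<lambda>s. snd c (g s))"
      using smooth_curve_imp_chart[OF g t' c] by blast
    have tn: "t \<in> near t e" using t' e by (auto simp: near_def)
    obtain \<rho> where \<rho>: "\<rho> > 0" "ball (snd c (g t)) \<rho> \<subseteq> snd c ` fst c"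
      using open_chart_image[OF c(1)] c(2) openE by blast
    obtain F where F: "\<And>z. z \<in> ball (snd c (g t)) \<rho> \<Longrightarrow> (F has_field_derivative S c (chart_inv c z)) (at z)"
      using local_primitive[OF c(1) \<rho>(2)] by blast
    have "continuous (at t within {0..1}) (\<lambda>s. snd c (g s))"
      using smooth_on_unit_deriv[OF e(3) tn] has_vector_derivative_continuous by blast
    then obtain \<delta> where \<delta>: "\<delta> > 0" "\<And>s. s \<in> {0..1} \<Longrightarrow> dist s t < \<delta> \<Longrightarrow> dist (snd c (g s)) (snd c (g t)) < \<rho>"
      using \<rho>(1) unfolding continuous_within_eps_delta by blast
    show ?thesis
    proof (intro exI conjI allI impI)
      show "min e \<delta> > 0" using e \<delta> by simp
      fix u v assume uv: "t \<in> cbox u v \<and> cbox u v \<subseteq> ball t (min e \<delta>) \<and> cbox u v \<subseteq> cbox 0 1"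
      have m: "g s \<in> fst c \<and> snd c (g s) \<in> ball (snd c (g t)) \<rho>" if "s \<in> {u..v}" for s
      proof -
        have s: "s \<in> {0..1}" "dist s t < e" "dist s t < \<delta>" using uv that by (auto simp: dist_commute subset_iff)
        then have "s \<in> near t e" by (auto simp: near_def dist_real_def)
        then show ?thesis using e(2) \<delta>(2)[OF s(1,3)] by (auto simp: dist_commute)
      qed
      have "u \<in> {u..v}" "v \<in> {u..v}" using uv by auto
      then have "0 \<le> u" "u \<le> v" "v \<le> 1" using uv by (auto simp: subset_iff)
      then show "integrand g integrable_on cbox u v"
        using integrand_has_integral[OF g c(1) F _ _ _ m] by (auto simp: integrable_on_def)
    qed
  qed
  then show ?thesis using integrable_on_little_subintervals[of 0 1 "integrand g"] by auto
qed

text \<open>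
  Near its end the curve is changed, in the coordinate of \<open>c\<close>, by adding a multiple of a flat step
  function starting at \<open>t1\<close>. The new curve is smooth and ends at \<open>y\<close>, and on the changed part both
  integrals are computed with the local primitive \<open>F\<close>.
\<close>

lemma move_endpoint:
  assumes c: "c \<in> A" and ball: "ball z0 \<rho> \<subseteq> snd c ` fst c"
    and F: "\<And>z. z \<in> ball z0 \<rho> \<Longrightarrow> (F has_field_derivative S c (chart_inv c z)) (at z)"
    and x: "x \<in> fst c" "snd c x \<in> ball z0 (\<rho>/4)" and y: "y \<in> fst c" "snd c y \<in> ball z0 (\<rho>/4)"
    and g: "smooth_path A b x g"
  shows "\<exists>g'. smooth_path A b y g' \<and> curve_integral A S g' = curve_integral A S g + F (snd c y) - F (snd c x)"
proof -
  have gs: "smooth_curve_on A {0..1} g" and g0: "g 0 = b" and g1: "g 1 = x" using g by (auto simp: smooth_path_def)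
  have \<rho>: "\<rho> > 0" using x(2) by (metis ball_empty divide_le_0_iff empty_iff linorder_not_less not_numeral_le_zero zero_le_numeral order.trans)
  have "1 \<in> {0..1::real}" "g 1 \<in> fst c" using g1 x by auto
  then obtain e where e: "e > 0" "g ` near 1 e \<subseteq> fst c" "smooth_on_unit (near 1 e) (\<lambda>s. snd c (g s))"
    using smooth_curve_imp_chart[OF gs _ c] by blast
  have tn: "1 \<in> near 1 e" using e by (auto simp: near_def)
  have "continuous (at 1 within {0..1}) (\<lambda>s. snd c (g s))"
    using smooth_on_unit_deriv[OF e(3) tn] has_vector_derivative_continuous by blast
  then obtain \<delta> where \<delta>: "\<delta> > 0" "\<And>s. s \<in> {0..1} \<Longrightarrow> dist s 1 < \<delta> \<Longrightarrow> dist (snd c (g s)) (snd c (g 1)) < \<rho>/4"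
    using \<rho> unfolding continuous_within_eps_delta by (metis zero_less_divide_iff zero_less_numeral)
  define \<eta> where "\<eta> = min (min e \<delta>) (1/2)"
  have \<eta>: "0 < \<eta>" "\<eta> \<le> e" "\<eta> \<le> \<delta>" "\<eta> \<le> 1/2" using e \<delta> by (auto simp: \<eta>_def)
  define t0 where "t0 = 1 - \<eta>"
  define t1 where "t1 = 1 - \<eta>/2"
  have t: "0 < t0" "t0 < t1" "t1 < 1" using \<eta> by (auto simp: t0_def t1_def)
  \<comment> \<open>scaled so that the step reaches the whole displacement at time 1\<close>
  define v where "v = (snd c y - snd c x) / of_real (flat_step 0 (1 - t1))"
  define w where "w s = snd c (g s) + v * of_real (flat_step 0 (s - t1))" for s
  define g' where "g' s = (if s \<le> t1 then g s else chart_inv c (w s))" for s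
  have fpos: "0 < flat_step 0 (1 - t1)" using t by (intro flat_step_pos) auto
  have gc: "g s \<in> fst c" "dist (snd c (g s)) (snd c x) < \<rho>/4" if "t0 < s" "s \<le> 1" for s
  proof -
    have "s \<in> near 1 e" using that t \<eta> by (auto simp: near_def t0_def)
    then show "g s \<in> fst c" using e by blast
    have "s \<in> {0..1}" "dist s 1 < \<delta>" using that t \<eta> by (auto simp: dist_real_def t0_def)
    then show "dist (snd c (g s)) (snd c x) < \<rho>/4" using \<delta>(2)[of s] g1 by auto
  qed
  have w1: "w 1 = snd c y" using fpos g1 by (simp add: w_def v_def)
  have wt1: "w s = snd c (g s)" if "s \<le> t1" for s using that by (simp add: w_def flat_step_0)
  have wb: "w s \<in> ball z0 \<rho>" if "t0 < s" "s \<le> 1" for s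
  proof -
    have "norm (v * of_real (flat_step 0 (s - t1))) = norm (snd c y - snd c x) * (flat_step 0 (s - t1) / flat_step 0 (1 - t1))"
      using fpos flat_step_nonneg[of "s - t1"] by (simp add: v_def norm_mult norm_divide)
    also have "\<dots> \<le> norm (snd c y - snd c x) * 1"
      using fpos flat_step_mono[of "s - t1" "1 - t1"] that by (intro mult_left_mono) auto
    also have "\<dots> < \<rho>/2"
      using x(2) y(2) norm_triangle_ineq4[of "snd c y - z0" "snd c x - z0"] by (auto simp: dist_norm norm_minus_commute)
    finally have 1: "norm (v * of_real (flat_step 0 (s - t1))) < \<rho>/2" .
    have "norm (w s - z0) \<le> norm (snd c (g s) - snd c x) + norm (snd c x - z0) + norm (v * of_real (flat_step 0 (s - t1)))"
      unfolding w_def by norm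
    also have "\<dots> < \<rho>/4 + \<rho>/4 + \<rho>/2" using 1 gc(2)[OF that] x(2) by (auto simp: dist_norm norm_minus_commute)
    finally show ?thesis by (simp add: dist_norm norm_minus_commute)
  qed
  have g'_late: "g' s = chart_inv c (w s)" if "t0 < s" "s \<le> 1" for s
    using wt1[of s] gc(1)[OF that] chart_inv_left[OF c] by (auto simp: g'_def)
  have late: "g' s \<in> fst c \<and> snd c (g' s) = w s" if "t0 < s" "s \<le> 1" for s
    using wb[OF that] ball chart_inv_in chart_inv_right g'_late[OF that] by (metis subsetD)
  have smooth: "smooth_curve_on A {0..1} g'"
  proof (rule smooth_curve_onI)
    fix t assume t01: "t \<in> {0..1::real}"
    show "\<exists>c\<in>A. \<exists>e>0. g' ` near t e \<subseteq> fst c \<and> smooth_on_unit (near t e) (\<lambda>s. snd c (g' s))"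
    proof (cases "t < t1")
      case True
      define d where "d = chart_at A (g t)"
      have d: "d \<in> A" "g t \<in> fst d" using chart_at by (auto simp: d_def)
      obtain e where e: "e > 0" "g ` near t e \<subseteq> fst d" "smooth_on_unit (near t e) (\<lambda>s. snd d (g s))"
        using smooth_curve_imp_chart[OF gs t01 d] by blast
      define e' where "e' = min e (t1 - t)"
      have e': "e' > 0" "e' \<le> e" using e True by (auto simp: e'_def)
      have eq: "g' s = g s" if "s \<in> near t e'" for s using that by (auto simp: near_def e'_def g'_def)
      have "g' ` near t e' \<subseteq> fst d" using e(2) near_mono[OF e'(2), of t] eq by force
      moreover have "smooth_on_unit (near t e') (\<lambda>s. snd d (g' s))"
        using smooth_on_unit_subset[OF e(3) near_mono[OF e'(2)]] eq by (auto simp: smooth_on_unit_def)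
      ultimately show ?thesis using d e' by blast
    next
      case False
      have sub: "s \<in> near 1 e \<and> t0 < s \<and> s \<le> 1" if "s \<in> near t (t1 - t0)" for s
        using that False t \<eta> by (auto simp: near_def t0_def)
      have "smooth_on_unit (near t (t1 - t0)) w"
        unfolding w_def by (intro smooth_on_unit_add_step smooth_on_unit_subset[OF e(3)]) (use sub in auto)
      then have "smooth_on_unit (near t (t1 - t0)) (\<lambda>s. snd c (g' s))"
        using sub late by (auto simp: smooth_on_unit_def)
      moreover have "g' ` near t (t1 - t0) \<subseteq> fst c" using sub late by auto
      ultimately show ?thesis using c t by (intro bexI[of _ c] exI[of _ "t1 - t0"]) auto
    qed
  qed
  have path: "smooth_path A b y g'"
    using smooth g0 t w1 chart_inv_left[OF c y(1)] by (simp add: smooth_path_def g'_def)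
  have ig: "integrand g integrable_on {0..1}" "integrand g' integrable_on {0..1}"
    using integrand_integrable gs smooth by auto
  have early: "integral {0..t1} (integrand g') = integral {0..t1} (integrand g)"
  proof (rule integral_spike[of "{t1}"])
    fix s assume s: "s \<in> {0..t1} - {t1}"
    have "vector_derivative (snd d \<circ> g') (at s within {0..1}) = vector_derivative (snd d \<circ> g) (at s within {0..1})" for d :: "'a chart"
    proof (rule vector_derivative_cong_eq)
      show "\<forall>\<^sub>F x in nhds s. x \<in> {0..1} \<longrightarrow> (snd d \<circ> g') x = (snd d \<circ> g) x"
        using eventually_nhds_in_open[of "{..<t1}" s] s by (auto elim!: eventually_mono simp: g'_def)
    qed (use s t in auto)
    then show "integrand g s = integrand g' s" using s by (simp add: integrand_def g'_def)
  qed auto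
  have "(integrand g has_integral F (snd c (g 1)) - F (snd c (g t1))) {t1..1}"
  proof (rule integrand_has_integral[OF gs c F])
    show "g s \<in> fst c \<and> snd c (g s) \<in> ball z0 \<rho>" if "s \<in> {t1..1}" for s
    proof -
      have s: "t0 < s" "s \<le> 1" using that t by auto
      have "dist z0 (snd c (g s)) < \<rho>" using gc(2)[OF s] x(2) dist_triangle[of z0 "snd c (g s)" "snd c x"] \<rho> by (auto simp: dist_commute)
      then show ?thesis using gc(1)[OF s] by auto
    qed
  qed (use t in auto)
  moreover have "(integrand g' has_integral F (snd c (g' 1)) - F (snd c (g' t1))) {t1..1}"
  proof (rule integrand_has_integral[OF smooth c F])
    show "g' s \<in> fst c \<and> snd c (g' s) \<in> ball z0 \<rho>" if "s \<in> {t1..1}" for s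
      using that t late[of s] wb[of s] by auto
  qed (use t in auto)
  moreover have "g' t1 = g t1" "snd c (g' 1) = snd c y" using late[of 1] w1 t by (auto simp: g'_def)
  ultimately have "integral {t1..1} (integrand g') = integral {t1..1} (integrand g) + F (snd c y) - F (snd c x)"
    using g1 by (simp add: integral_unique)
  moreover have "integral {0..1} (integrand h) = integral {0..t1} (integrand h) + integral {t1..1} (integrand h)"
    if "integrand h integrable_on {0..1}" for h
    using t that by (intro Henstock_Kurzweil_Integration.integral_combine[symmetric]) auto
  ultimately have "curve_integral A S g' = curve_integral A S g + F (snd c y) - F (snd c x)"
    using ig early by (simp add: curve_integral_eq)
  then show ?thesis using path by blast
qed

end

section \<open>The primitive of the form\<close>

locale admissible_atlas = form_atlas A S for A :: "'a::t2_space chart set" and S +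
  fixes b :: 'a
  assumes conn: "connected (UNIV :: 'a set)"
    and nonzero: "\<And>c x. c \<in> A \<Longrightarrow> x \<in> fst c \<Longrightarrow> S c x \<noteq> 0"
    and zero_iff: "\<And>x. primitive_from A S b x = 0 \<longleftrightarrow> x = b"
    and two_points: "\<exists>x. x \<noteq> b"
begin

definition L :: "'a \<Rightarrow> complex" where "L = primitive_from A S b"

text \<open>
  The primitive is a definite description, which denotes the common value of the path integrals only
  if there is exactly one. The set of all values is therefore studied first.
\<close>

definition path_integrals :: "'a \<Rightarrow> complex set" where
  "path_integrals x = {curve_integral A S g |g. smooth_path A b x g}"

text \<open>
  A path to \<open>x\<close> can be redirected to \<open>y\<close> and conversely, so the two sets of values differ by a
  translation.
\<close>

lemma path_integrals_shift:
  assumes c: "c \<in> A" and ball: "ball z0 \<rho> \<subseteq> snd c ` fst c"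
    and F: "\<And>z. z \<in> ball z0 \<rho> \<Longrightarrow> (F has_field_derivative S c (chart_inv c z)) (at z)"
    and x: "x \<in> fst c" "snd c x \<in> ball z0 (\<rho>/4)" and y: "y \<in> fst c" "snd c y \<in> ball z0 (\<rho>/4)"
  shows "path_integrals y = (\<lambda>w. w + (F (snd c y) - F (snd c x))) ` path_integrals x"
proof -
  have sub: "(\<lambda>w. w + (F (snd c y) - F (snd c x))) ` path_integrals x \<subseteq> path_integrals y"
    if x: "x \<in> fst c" "snd c x \<in> ball z0 (\<rho>/4)" and y: "y \<in> fst c" "snd c y \<in> ball z0 (\<rho>/4)" for x y
  proof -
    have "\<exists>g'. smooth_path A b y g' \<and> curve_integral A S g' = curve_integral A S g + F (snd c y) - F (snd c x)"
      if "smooth_path A b x g" for g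
      by (rule move_endpoint[OF c ball F x y that])
    then show ?thesis unfolding path_integrals_def by (auto simp: algebra_simps) metis
  qed
  have "w \<in> (\<lambda>w. w + (F (snd c y) - F (snd c x))) ` path_integrals x" if "w \<in> path_integrals y" for w
  proof -
    have "w + (F (snd c x) - F (snd c y)) \<in> path_integrals x" using sub[OF y x] that by blast
    then show ?thesis by (intro image_eqI[of _ _ "w + (F (snd c x) - F (snd c y))"]) auto
  qed
  then show ?thesis using sub[OF x y] by blast
qed

lemma chart_nbhd:
  obtains c \<rho> F where "c \<in> A" "x \<in> fst c" "\<rho> > 0" "ball (snd c x) \<rho> \<subseteq> snd c ` fst c"
    "\<And>z. z \<in> ball (snd c x) \<rho> \<Longrightarrow> (F has_field_derivative S c (chart_inv c z)) (at z)"
    "open {y \<in> fst c. snd c y \<in> ball (snd c x) (\<rho>/4)}" "x \<in> {y \<in> fst c. snd c y \<in> ball (snd c x) (\<rho>/4)}"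
proof -
  define c where "c = chart_at A x"
  have c: "c \<in> A" "x \<in> fst c" using chart_at by (auto simp: c_def)
  obtain \<rho> where \<rho>: "\<rho> > 0" "ball (snd c x) \<rho> \<subseteq> snd c ` fst c"
    using open_chart_image[OF c(1)] c(2) openE by blast
  obtain F where F: "\<And>z. z \<in> ball (snd c x) \<rho> \<Longrightarrow> (F has_field_derivative S c (chart_inv c z)) (at z)"
    using local_primitive[OF c(1) \<rho>(2)] by blast
  show ?thesis
    using that[OF c \<rho> F chart_inv_image_open[OF c(1) open_ball]] c \<rho> by simp
qed

lemma path_integrals_locally:
  fixes x :: 'a
  obtains N :: "'a set" and k :: "'a \<Rightarrow> complex" where "open N" "x \<in> N" "\<And>y. y \<in> N \<Longrightarrow> path_integrals y = (\<lambda>w. w + k y) ` path_integrals x"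
proof -
  obtain c \<rho> F where c: "c \<in> A" "x \<in> fst c" "\<rho> > 0" "ball (snd c x) \<rho> \<subseteq> snd c ` fst c"
    "\<And>z. z \<in> ball (snd c x) \<rho> \<Longrightarrow> (F has_field_derivative S c (chart_inv c z)) (at z)"
    "open {y \<in> fst c. snd c y \<in> ball (snd c x) (\<rho>/4)}" "x \<in> {y \<in> fst c. snd c y \<in> ball (snd c x) (\<rho>/4)}"
    using chart_nbhd by blast
  show ?thesis
  proof (rule that[OF c(6,7)])
    fix y assume "y \<in> {y \<in> fst c. snd c y \<in> ball (snd c x) (\<rho>/4)}"
    then have y: "y \<in> fst c" "snd c y \<in> ball (snd c x) (\<rho>/4)" by blast+
    have x: "snd c x \<in> ball (snd c x) (\<rho>/4)" using c(3) by simp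
    show "path_integrals y = (\<lambda>w. w + (F (snd c y) - F (snd c x))) ` path_integrals x"
      by (rule path_integrals_shift[OF c(1,4,5,2) x y])
  qed
qed

lemma path_integrals_nonempty: "path_integrals x \<noteq> {}"
proof (rule locally_constant_predicate[OF conn, of _ b])
  have "smooth_curve_on A {0..1} (\<lambda>_. b)"
  proof (rule smooth_curve_onI)
    fix t :: real
    have "smooth_on_unit K (\<lambda>s. z)" for K z
      unfolding smooth_on_unit_def by (rule exI[of _ "\<lambda>n s. if n = 0 then z else 0"]) auto
    then show "\<exists>c\<in>A. \<exists>e>0. (\<lambda>_. b) ` near t e \<subseteq> fst c \<and> smooth_on_unit (near t e) (\<lambda>s. snd c b)"
      using chart_at[of b] by (intro bexI[of _ "chart_at A b"] exI[of _ 1]) auto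
  qed
  then show "path_integrals b \<noteq> {}" unfolding path_integrals_def smooth_path_def by auto
  fix x
  show "\<exists>N. open N \<and> x \<in> N \<and> (\<forall>y\<in>N. (path_integrals y \<noteq> {}) = (path_integrals x \<noteq> {}))"
    by (rule path_integrals_locally[of x]) (metis image_is_empty)
qed

text \<open>
  Whether the integrals from \<open>b\<close> to \<open>x\<close> have a single value is locally constant in \<open>x\<close>, as the
  sets of values of nearby points are translates of each other. By connectedness it holds
  everywhere or nowhere. Nowhere is impossible: all the definite descriptions would then be the
  same undefined number, so the primitive would be constant, but it vanishes at \<open>b\<close> only.
\<close>

lemma path_integrals_unique: "path_integrals x = {L x}"
proof -
  have L_eq: "L x = (THE w. path_integrals x = {w})" for x
  proof -
    have "(\<forall>g. smooth_path A b x g \<longrightarrow> curve_integral A S g = w) \<longleftrightarrow> path_integrals x = {w}" for w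
      using path_integrals_nonempty[of x] unfolding path_integrals_def by auto
    then show ?thesis unfolding L_def primitive_from_def by simp
  qed
  have "\<exists>x w. path_integrals x = {w}"
  proof (rule ccontr)
    assume "\<not> ?thesis"
    then have "L x = (THE w. False)" for x using L_eq[of x] by simp
    then have "L x = L b" for x by metis
    then show False using zero_iff two_points unfolding L_def by metis
  qed
  then obtain x0 where "\<exists>w. path_integrals x0 = {w}" by blast
  then have "\<exists>w. path_integrals x = {w}"
  proof (rule locally_constant_predicate[OF conn, rotated])
    fix x
    obtain N k where N: "open N" "x \<in> N" "\<And>y. y \<in> N \<Longrightarrow> path_integrals y = (\<lambda>w. w + k y) ` path_integrals x"
      using path_integrals_locally[of x] by blast
    have "(\<exists>w. path_integrals y = {w}) = (\<exists>w. path_integrals x = {w})" if y: "y \<in> N" for y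
    proof
      assume "\<exists>w. path_integrals y = {w}"
      then obtain w where w: "(\<lambda>w. w + k y) ` path_integrals x = {w}" using N(3)[OF y] by auto
      have "v = w - k y" if "v \<in> path_integrals x" for v
      proof -
        have "v + k y \<in> {w}" unfolding w[symmetric] using that by (rule imageI)
        then show ?thesis by (simp add: algebra_simps)
      qed
      then have "path_integrals x = {w - k y}" using path_integrals_nonempty[of x] by blast
      then show "\<exists>w. path_integrals x = {w}" by blast
    qed (use N(3)[OF y] in auto)
    then show "\<exists>N. open N \<and> x \<in> N \<and> (\<forall>y\<in>N. (\<exists>w. path_integrals y = {w}) = (\<exists>w. path_integrals x = {w}))"
      using N by blast
  qed
  then show ?thesis using L_eq[of x] by auto
qed

lemma L_deriv:
  assumes c: "c \<in> A" and z: "z \<in> snd c ` fst c"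
  shows "((\<lambda>z. L (chart_inv c z)) has_field_derivative S c (chart_inv c z)) (at z)"
proof -
  obtain \<rho> where \<rho>: "\<rho> > 0" "ball z \<rho> \<subseteq> snd c ` fst c" using open_chart_image[OF c] z openE by blast
  obtain F where F: "\<And>z'. z' \<in> ball z \<rho> \<Longrightarrow> (F has_field_derivative S c (chart_inv c z')) (at z')"
    using local_primitive[OF c \<rho>(2)] by blast
  have eq: "L (chart_inv c z) + (F z' - F z) = L (chart_inv c z')" if z': "z' \<in> ball z (\<rho>/4)" for z'
  proof -
    have "z' \<in> ball z \<rho>" using z' \<rho> by auto
    then have 1: "z' \<in> snd c ` fst c" using \<rho>(2) by blast
    have "path_integrals (chart_inv c z') = (\<lambda>w. w + (F (snd c (chart_inv c z')) - F (snd c (chart_inv c z)))) ` path_integrals (chart_inv c z)"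
      by (rule path_integrals_shift[OF c \<rho>(2) F]) (use chart_inv_in[OF 1] chart_inv_right[OF 1] chart_inv_in[OF z] chart_inv_right[OF z] z' \<rho>(1) in simp_all)
    then show ?thesis using chart_inv_right[OF 1] chart_inv_right[OF z] by (simp add: path_integrals_unique)
  qed
  have "((\<lambda>z'. L (chart_inv c z) + (F z' - F z)) has_field_derivative S c (chart_inv c z)) (at z)"
    using F[of z] \<rho> by (auto intro!: derivative_eq_intros)
  then show ?thesis
    by (rule has_field_derivative_transform_within_open[of _ _ _ "ball z (\<rho>/4)"]) (use eq \<rho> in auto)
qed

lemma L_chart_holomorphic: "c \<in> A \<Longrightarrow> (\<lambda>z. L (chart_inv c z)) holomorphic_on (snd c ` fst c)"
  using L_deriv open_chart_image holomorphic_on_open by blast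

lemma deriv_L_chart: "c \<in> A \<Longrightarrow> z \<in> snd c ` fst c \<Longrightarrow> deriv (\<lambda>z. L (chart_inv c z)) z = S c (chart_inv c z)"
  using L_deriv DERIV_imp_deriv by blast

lemma L_continuous: "continuous_on UNIV L"
proof (rule continuous_at_imp_continuous_on, rule ballI)
  fix x
  define c where "c = chart_at A x"
  have c: "c \<in> A" "x \<in> fst c" using chart_at by (auto simp: c_def)
  have "continuous_on (fst c) (\<lambda>x. L (chart_inv c (snd c x)))"
    using continuous_on_compose2[OF holomorphic_on_imp_continuous_on[OF L_chart_holomorphic[OF c(1)]] chart_continuous[OF c(1)]] by auto
  then have "continuous_on (fst c) L"
    by (rule continuous_on_eq) (simp add: chart_inv_left[OF c(1)])
  then show "isCont L x" using c open_chart_dom[OF c(1)] continuous_on_eq_continuous_at by blast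
qed

lemma L_locally_injective_open:
  assumes "open V" "x \<in> V"
  obtains N where "open N" "x \<in> N" "N \<subseteq> V" "inj_on L N" "open (L ` N)"
proof -
  define c where "c = chart_at A x"
  have c: "c \<in> A" "x \<in> fst c" using chart_at by (auto simp: c_def)
  define W where "W = snd c ` (V \<inter> fst c)"
  have W: "open W" "snd c x \<in> W" "W \<subseteq> snd c ` fst c"
    using chart_image_open[OF c(1) assms(1)] c assms(2) by (auto simp: W_def)
  have hol: "(\<lambda>z. L (chart_inv c z)) holomorphic_on W"
    using L_chart_holomorphic[OF c(1)] W(3) holomorphic_on_subset by blast
  have "deriv (\<lambda>z. L (chart_inv c z)) (snd c x) \<noteq> 0"
    using deriv_L_chart[OF c(1), of "snd c x"] c nonzero[OF c(1,2)] chart_inv_left[OF c] by auto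
  then obtain r where r: "r > 0" "ball (snd c x) r \<subseteq> W" "inj_on (\<lambda>z. L (chart_inv c z)) (ball (snd c x) r)"
    using has_complex_derivative_locally_injective[OF hol W(2) W(1)] by blast
  define N where "N = {y \<in> fst c. snd c y \<in> ball (snd c x) r}"
  have im: "L ` N = (\<lambda>z. L (chart_inv c z)) ` ball (snd c x) r"
  proof -
    have "N = chart_inv c ` ball (snd c x) r"
    proof (intro equalityI subsetI)
      fix y assume "y \<in> N"
      then show "y \<in> chart_inv c ` ball (snd c x) r"
        using chart_inv_left[OF c(1), of y] by (intro image_eqI[of _ _ "snd c y"]) (auto simp: N_def)
    next
      fix y assume "y \<in> chart_inv c ` ball (snd c x) r"
      then obtain z where z: "z \<in> ball (snd c x) r" "y = chart_inv c z" by blast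
      then have zi: "z \<in> snd c ` fst c" using r(2) W(3) by blast
      show "y \<in> N" unfolding N_def z(2) using z(1) chart_inv_in[OF zi] chart_inv_right[OF zi] by simp
    qed
    then show ?thesis by (simp add: image_image)
  qed
  show ?thesis
  proof
    show "open N" unfolding N_def by (rule chart_inv_image_open[OF c(1) open_ball])
    show "x \<in> N" using c r by (simp add: N_def)
    show "N \<subseteq> V"
    proof
      fix y assume "y \<in> N"
      then have y: "y \<in> fst c" "snd c y \<in> W" using r(2) by (auto simp: N_def)
      then obtain v where "v \<in> V" "v \<in> fst c" "snd c y = snd c v" by (auto simp: W_def)
      then show "y \<in> V" using y chart_inj[OF c(1)] by (metis inj_onD)
    qed
    show "inj_on L N"
    proof (rule inj_onI)
      fix y y' assume y: "y \<in> N" "y' \<in> N" "L y = L y'"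
      then have "L (chart_inv c (snd c y)) = L (chart_inv c (snd c y'))"
        using chart_inv_left[OF c(1)] by (auto simp: N_def)
      then have "snd c y = snd c y'" using r(3) y by (auto simp: N_def dest: inj_onD)
      then show "y = y'" using y chart_inj[OF c(1)] by (auto simp: N_def dest: inj_onD)
    qed
    show "open (L ` N)" unfolding im
      using open_mapping_thm3[OF holomorphic_on_subset[OF hol r(2)] open_ball r(3)] .
  qed
qed

end

section \<open>The primitive is a bijection onto a disc\<close>

locale exhausted_atlas = admissible_atlas A S b for A :: "'a::t2_space chart set" and S b +
  assumes disc_compact: "\<And>r. 0 < r \<Longrightarrow> ereal r < form_radius A S b \<Longrightarrow> compact (closure (disc A S b r))"
    and radius_pos: "0 < form_radius A S b"
begin

abbreviation R :: ereal where "R \<equiv> form_radius A S b"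

definition \<Omega> :: "complex set" where "\<Omega> = {w. ereal (norm w) < R}"

lemma open_\<Omega>: "open \<Omega>"
proof (cases R)
  case (real r)
  then have "\<Omega> = ball 0 r" by (auto simp: \<Omega>_def)
  then show ?thesis by simp
qed (auto simp: \<Omega>_def)

lemma ball_subset_\<Omega>: "ereal r \<le> R \<Longrightarrow> ball 0 r \<subseteq> \<Omega>"
  by (auto simp: \<Omega>_def intro: less_le_trans[of "ereal _" "ereal r"])

lemma cball_subset_\<Omega>: "ereal r < R \<Longrightarrow> cball 0 r \<subseteq> \<Omega>"
  by (auto simp: \<Omega>_def intro: le_less_trans[of "ereal _" "ereal r"])

lemma connected_\<Omega>: "connected \<Omega>"
proof (cases R)
  case (real r)
  then have "\<Omega> = ball 0 r" by (auto simp: \<Omega>_def)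
  then show ?thesis by simp
qed (auto simp: \<Omega>_def)

lemma zero_in_\<Omega>: "0 \<in> \<Omega>" using radius_pos by (simp add: \<Omega>_def zero_ereal_def)

lemma disc_eq: "disc A S b r = {x. norm (L x) < r}" by (simp add: disc_def L_def)

text \<open>
  \<open>L\<close> is open, so \<open>L x\<close> is never a value of maximal modulus.
\<close>

lemma L_in_\<Omega>: "L x \<in> \<Omega>"
proof -
  obtain N where N: "open N" "x \<in> N" "N \<subseteq> UNIV" "inj_on L N" "open (L ` N)"
    by (rule L_locally_injective_open[OF open_UNIV UNIV_I])
  then obtain e where e: "e > 0" "ball (L x) e \<subseteq> L ` N" using openE by blast
  \<comment> \<open>a point of the ball farther from the origin than \<open>L x\<close>\<close>
  define w where "w = L x + (if L x = 0 then of_real (e/2) else of_real (e / 2 / norm (L x)) * L x)"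
  have "w \<in> ball (L x) e" using e by (auto simp: w_def dist_norm norm_mult norm_divide)
  then obtain y where y: "L y = w" using e by auto
  have "norm (L x) < norm w"
  proof (cases "L x = 0")
    case False
    have "w = (1 + of_real (e / 2 / norm (L x))) * L x" using False by (simp add: w_def algebra_simps)
    then have "norm w = norm (of_real (1 + e / 2 / norm (L x)) :: complex) * norm (L x)" by (simp add: norm_mult)
    also have "\<dots> = (1 + e / 2 / norm (L x)) * norm (L x)" using e by (simp del: of_real_add)
    also have "\<dots> > norm (L x)" using e False by (simp add: field_simps)
    finally show ?thesis .
  qed (use e in \<open>simp add: w_def\<close>)
  moreover have "ereal (norm w) \<le> R"
    unfolding form_radius_def circ_def
    by (rule Sup_upper) (use y calculation norm_ge_zero[of "L x"] in \<open>auto simp: L_def intro!: imageI\<close>)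
  ultimately show ?thesis by (auto simp: \<Omega>_def intro: less_le_trans[of "ereal _" "ereal (norm w)"])
qed

lemma compact_sublevel:
  assumes "ereal \<rho> < R" shows "compact {x. norm (L x) \<le> \<rho>}"
proof -
  have "max (ereal \<rho>) 0 < R" using assms radius_pos by simp
  then obtain r where r: "max (ereal \<rho>) 0 < ereal r" "ereal r < R" using ereal_dense2 by blast
  then have r': "\<rho> < r" "0 < r" by (auto simp: zero_ereal_def)
  have "closed {x. norm (L x) \<le> \<rho>}"
    using L_continuous by (intro closed_Collect_le continuous_intros)
  moreover have "{x. norm (L x) \<le> \<rho>} \<subseteq> closure (disc A S b r)"
    using closure_subset[of "disc A S b r"] r' by (auto simp: disc_eq)
  ultimately show ?thesis
    using closed_Int_compact[OF _ disc_compact[OF r'(2) r(2)]] by (metis inf.absorb_iff1)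
qed

lemma closed_image_sublevel:
  assumes "ereal \<rho> < R" "closed C" shows "closed (L ` ({x. norm (L x) \<le> \<rho>} \<inter> C))"
  using compact_continuous_image[OF continuous_on_subset[OF L_continuous] compact_Int_closed[OF compact_sublevel[OF assms(1)] assms(2)]]
  by (auto intro: compact_imp_closed)

text \<open>
  \<open>L\<close> is a local homeomorphism, and it is proper over closed discs inside \<open>\<Omega>\<close>. So the set \<open>U\<close> of
  points with exactly one preimage is open and closed in \<open>\<Omega>\<close>, and it contains \<open>0\<close>, which is
  taken at \<open>b\<close> only.
\<close>

lemma preimage_unique:
  assumes w: "w \<in> \<Omega>" shows "\<exists>!x. L x = w"
proof -
  define U where "U = {w \<in> \<Omega>. \<exists>!x. L x = w}"
  have level: "\<exists>\<rho>. norm w < \<rho> \<and> ereal \<rho> < R" if "w \<in> \<Omega>" for w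
    using that ereal_dense2[of "ereal (norm w)" R] by (auto simp: \<Omega>_def)
  have "open U"
  proof (subst open_subopen, rule ballI)
    fix w assume "w \<in> U"
    then obtain x where x: "L x = w" "\<And>y. L y = w \<Longrightarrow> y = x" and w\<Omega>: "w \<in> \<Omega>" by (auto simp: U_def)
    obtain \<rho> where \<rho>: "norm w < \<rho>" "ereal \<rho> < R" using level[OF w\<Omega>] by blast
    obtain N where N: "open N" "x \<in> N" "N \<subseteq> UNIV" "inj_on L N" "open (L ` N)"
      by (rule L_locally_injective_open[OF open_UNIV UNIV_I])
    \<comment> \<open>values near \<open>w\<close> which are taken on \<open>N\<close> and, by compactness, not outside of \<open>N\<close>\<close>
    define T where "T = ball 0 \<rho> \<inter> L ` N - L ` ({x. norm (L x) \<le> \<rho>} \<inter> - N)"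
    have "open T" unfolding T_def using N closed_image_sublevel[OF \<rho>(2), of "- N"] by (intro open_Diff open_Int) auto
    moreover have "w \<in> T"
    proof -
      have "w \<in> L ` N" using x(1) N(2) by blast
      moreover have "w \<notin> L ` ({x. norm (L x) \<le> \<rho>} \<inter> - N)" using x(2) N(2) by blast
      ultimately show ?thesis using \<rho>(1) by (simp add: T_def)
    qed
    moreover have "T \<subseteq> U"
    proof
      fix v assume v: "v \<in> T"
      then obtain y where y: "y \<in> N" "L y = v" by (auto simp: T_def)
      have uq: "y' = y" if "L y' = v" for y'
      proof -
        have "y' \<in> N" using v that by (auto simp: T_def)
        then show ?thesis using N(4) y that by (auto dest: inj_onD)
      qed
      have "\<exists>!x. L x = v" by (rule ex1I[of _ y]) (use y uq in blast)+
      moreover have "v \<in> \<Omega>" using L_in_\<Omega>[of y] y(2) by simp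
      ultimately show "v \<in> U" by (simp add: U_def)
    qed
    ultimately show "\<exists>T. open T \<and> w \<in> T \<and> T \<subseteq> U" by (intro exI[of _ T] conjI)
  qed
  moreover have "open (\<Omega> - U)"
  proof (subst open_subopen, rule ballI)
    fix w assume w: "w \<in> \<Omega> - U"
    show "\<exists>T. open T \<and> w \<in> T \<and> T \<subseteq> \<Omega> - U"
    proof (cases "\<exists>x. L x = w")
      case True
      then obtain x y where xy: "L x = w" "L y = w" "x \<noteq> y" using w by (auto simp: U_def)
      obtain X Y where XY: "open X" "open Y" "x \<in> X" "y \<in> Y" "X \<inter> Y = {}" using hausdorff[OF xy(3)] by blast
      obtain N where N: "open N" "x \<in> N" "N \<subseteq> X" "inj_on L N" "open (L ` N)" by (rule L_locally_injective_open[OF XY(1,3)])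
      obtain M where M: "open M" "y \<in> M" "M \<subseteq> Y" "inj_on L M" "open (L ` M)" by (rule L_locally_injective_open[OF XY(2,4)])
      have "L ` N \<inter> L ` M \<subseteq> \<Omega> - U"
      proof
        fix v assume "v \<in> L ` N \<inter> L ` M"
        then obtain p q where pq: "p \<in> N" "L p = v" "q \<in> M" "L q = v" by auto
        then have "p \<noteq> q" using N M XY by auto
        then show "v \<in> \<Omega> - U" using pq L_in_\<Omega>[of p] by (auto simp: U_def)
      qed
      moreover have "w \<in> L ` N" "w \<in> L ` M" using imageI[OF N(2), of L] imageI[OF M(2), of L] xy by simp_all
      ultimately show ?thesis using N(5) M(5) by (intro exI[of _ "L ` N \<inter> L ` M"]) auto
    next
      case False
      obtain \<rho> where \<rho>: "norm w < \<rho>" "ereal \<rho> < R" using level w by blast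
      define T where "T = ball 0 \<rho> - L ` ({x. norm (L x) \<le> \<rho>} \<inter> UNIV)"
      have "open T" unfolding T_def using closed_image_sublevel[OF \<rho>(2), of UNIV] by (intro open_Diff) auto
      moreover have "w \<in> T" using False \<rho> by (auto simp: T_def)
      moreover have "T \<subseteq> \<Omega> - U"
        using ball_subset_\<Omega>[OF less_imp_le[OF \<rho>(2)]] by (auto simp: T_def U_def)
      ultimately show ?thesis by blast
    qed
  qed
  moreover have "0 \<in> U" using zero_in_\<Omega> zero_iff by (auto simp: U_def L_def)
  ultimately have "\<Omega> - U = {}"
    using connectedD[OF connected_\<Omega>, of U "\<Omega> - U"] zero_in_\<Omega> by (auto simp: U_def)
  then show ?thesis using w by (auto simp: U_def)
qed

definition \<sigma> :: "complex \<Rightarrow> 'a" where "\<sigma> w = (THE x. L x = w)"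

lemma L_\<sigma>: "w \<in> \<Omega> \<Longrightarrow> L (\<sigma> w) = w"
  unfolding \<sigma>_def by (rule theI') (rule preimage_unique)

lemma \<sigma>_L: "\<sigma> (L x) = x"
  using preimage_unique[OF L_in_\<Omega>[of x]] unfolding \<sigma>_def by (auto intro: the1_equality)

lemma inj_L: "inj L" by (metis \<sigma>_L injI)

lemma L_image_open: "open V \<Longrightarrow> open (L ` V)"
proof (subst open_subopen, rule ballI)
  fix w assume V: "open V" "w \<in> L ` V"
  then obtain x where x: "x \<in> V" "w = L x" by auto
  obtain N where "open N" "x \<in> N" "N \<subseteq> V" "inj_on L N" "open (L ` N)"
    by (rule L_locally_injective_open[OF V(1) x(1)])
  then show "\<exists>T. open T \<and> w \<in> T \<and> T \<subseteq> L ` V" using x by (intro exI[of _ "L ` N"]) auto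
qed

lemma disc_image: assumes "ereal r \<le> R" shows "L ` disc A S b r = ball 0 r"
proof (intro equalityI subsetI)
  fix w :: complex assume w: "w \<in> ball 0 r"
  then have "L (\<sigma> w) = w" using ball_subset_\<Omega>[OF assms] L_\<sigma> by blast
  then show "w \<in> L ` disc A S b r" using w by (intro image_eqI[of _ _ "\<sigma> w"]) (auto simp: disc_eq)
qed (auto simp: disc_eq)

end

section \<open>Integrals of 2-forms over the discs\<close>

context exhausted_atlas
begin

lemma chart_piece_integral:
  fixes \<eta> :: "'a two_form" and E :: "complex \<Rightarrow> real"
  assumes \<eta>: "\<forall>c\<in>A. \<forall>x\<in>fst c. \<eta> c x = E (L x) * (norm (S c x))\<^sup>2"
    and c: "c \<in> A" and P: "P \<subseteq> fst c" "snd c ` P \<in> sets lebesgue"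
  shows "L ` P \<in> sets lebesgue"
    and "set_integrable lebesgue (snd c ` P) (\<eta> c \<circ> chart_inv c) \<longleftrightarrow> set_integrable lebesgue (L ` P) E"
    and "set_integrable lebesgue (L ` P) E \<Longrightarrow> (LINT z:snd c ` P|lebesgue. (\<eta> c \<circ> chart_inv c) z) = (LINT w:L ` P|lebesgue. E w)"
proof -
  let ?\<phi> = "\<lambda>z. L (chart_inv c z)" and ?Z = "snd c ` P"
  have Z: "?Z \<subseteq> snd c ` fst c" using P by blast
  have im: "?\<phi> ` ?Z = L ` P"
  proof -
    have "?\<phi> (snd c x) = L x" if "x \<in> P" for x using chart_inv_left[OF c] P(1) that by (metis subsetD)
    then show ?thesis by (simp add: image_image)
  qed
  have der: "(?\<phi> has_derivative (\<lambda>v. S c (chart_inv c z) * v + 0 * cnj v)) (at z within ?Z)" if "z \<in> ?Z" for z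
  proof -
    have "(?\<phi> has_derivative (*) (S c (chart_inv c z))) (at z)"
      using L_deriv[OF c subsetD[OF Z that]] by (simp add: has_field_derivative_def)
    then show ?thesis by (simp add: has_derivative_at_withinI)
  qed
  have inj: "inj_on ?\<phi> ?Z"
  proof (rule inj_onI)
    fix y z assume yz: "y \<in> ?Z" "z \<in> ?Z" "?\<phi> y = ?\<phi> z"
    then have "chart_inv c y = chart_inv c z" using inj_L by (simp add: inj_eq)
    then show "y = z" using yz(1,2) Z chart_inv_right by (metis subsetD)
  qed
  have "?\<phi> differentiable_on ?Z"
    using der by (auto simp: differentiable_on_def differentiable_def)
  then have "?\<phi> ` ?Z \<in> sets lebesgue"
    by (intro differentiable_image_in_sets_lebesgue P) auto
  then show "L ` P \<in> sets lebesgue" by (simp add: im)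
  have cv: "(\<lambda>z. (norm (S c (chart_inv c z)))\<^sup>2 * E (?\<phi> z)) absolutely_integrable_on ?Z \<and>
      integral ?Z (\<lambda>z. (norm (S c (chart_inv c z)))\<^sup>2 * E (?\<phi> z)) = I
     \<longleftrightarrow> E absolutely_integrable_on (L ` P) \<and> integral (L ` P) E = I" for I
    using complex_change_of_variables[OF P(2) der inj, of E I] by (simp add: im)
  have eq: "(\<eta> c \<circ> chart_inv c) z = (norm (S c (chart_inv c z)))\<^sup>2 * E (?\<phi> z)" if "z \<in> ?Z" for z
    using \<eta> c chart_inv_in[OF subsetD[OF Z that]] by (simp add: mult.commute)
  have 1: "set_integrable lebesgue ?Z (\<eta> c \<circ> chart_inv c) \<longleftrightarrow> set_integrable lebesgue ?Z (\<lambda>z. (norm (S c (chart_inv c z)))\<^sup>2 * E (?\<phi> z))"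
    by (rule set_integrable_cong) (use eq in auto)
  show "set_integrable lebesgue ?Z (\<eta> c \<circ> chart_inv c) \<longleftrightarrow> set_integrable lebesgue (L ` P) E"
    unfolding 1 using cv by blast
  assume i: "set_integrable lebesgue (L ` P) E"
  then have i2: "set_integrable lebesgue ?Z (\<lambda>z. (norm (S c (chart_inv c z)))\<^sup>2 * E (?\<phi> z))"
    "integral ?Z (\<lambda>z. (norm (S c (chart_inv c z)))\<^sup>2 * E (?\<phi> z)) = integral (L ` P) E"
    using cv by blast+
  have "(LINT z:?Z|lebesgue. (\<eta> c \<circ> chart_inv c) z) = (LINT z:?Z|lebesgue. (norm (S c (chart_inv c z)))\<^sup>2 * E (?\<phi> z))"
    by (rule set_lebesgue_integral_cong) (use eq P(2) in auto)
  then show "(LINT z:?Z|lebesgue. (\<eta> c \<circ> chart_inv c) z) = (LINT w:L ` P|lebesgue. E w)"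
    using set_lebesgue_integral_eq_integral(2)[OF i2(1)] set_lebesgue_integral_eq_integral(2)[OF i] i2(2) by simp
qed

text \<open>
  The open images of the chart domains under the injection \<open>L\<close> cover a subset of the plane, where the
  theorem of Lindelof applies.
\<close>

lemma countable_chart_cover:
  "\<exists>c :: nat \<Rightarrow> 'a chart. (\<forall>n. c n \<in> A) \<and> (\<Union>n. fst (c n)) = UNIV"
proof -
  have op: "open (L ` fst d)" if "d \<in> A" for d using L_image_open[OF open_chart_dom[OF that]] .
  obtain \<F> where \<F>: "\<F> \<subseteq> (\<lambda>d. L ` fst d) ` A" "countable \<F>" "\<Union>\<F> = \<Union>((\<lambda>d. L ` fst d) ` A)"
    by (rule Lindelof[of "(\<lambda>d. L ` fst d) ` A"]) (use op in blast)+
  have all: "L x \<in> \<Union>\<F>" for x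
    unfolding \<F>(3) using chart_at[of x] by blast
  have ne: "\<F> \<noteq> {}" using all[of b] by blast
  have "\<exists>d\<in>A. from_nat_into \<F> n = L ` fst d" for n
    using from_nat_into[OF ne, of n] \<F>(1) by blast
  then obtain c where c: "\<And>n. c n \<in> A" "\<And>n. from_nat_into \<F> n = L ` fst (c n)" by metis
  have "x \<in> (\<Union>n. fst (c n))" for x
  proof -
    obtain X where X: "X \<in> \<F>" "L x \<in> X" using all[of x] by blast
    then obtain n where "from_nat_into \<F> n = X" using from_nat_into_surj[OF \<F>(2)] by blast
    then have "L x \<in> L ` fst (c n)" using X c(2)[of n] by simp
    then show ?thesis using inj_L by (auto simp: inj_image_mem_iff)
  qed
  then have "(\<Union>n. fst (c n)) = UNIV" by blast
  with c(1) show ?thesis by blast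
qed

text \<open>
  In the coordinate \<open>L\<close> the form is \<open>E dx \<and> dy\<close>. Any partition of the disc into pieces in charts goes
  over into a partition of the plane disc, with the same integrals over the pieces; this gives
  uniqueness of the value. The partition by a countable cover gives existence.
\<close>

theorem form_integral_disc:
  fixes \<eta> :: "'a two_form" and E :: "complex \<Rightarrow> real"
  assumes \<eta>: "\<forall>c\<in>A. \<forall>x\<in>fst c. \<eta> c x = E (L x) * (norm (S c x))\<^sup>2"
    and E: "continuous_on \<Omega> E" and r: "ereal r < R"
  shows "form_integral A \<eta> (disc A S b r) = integral (ball 0 r) E"
proof -
  let ?D = "disc A S b r"
  note piece = chart_piece_integral[where \<eta>=\<eta> and E=E, OF \<eta>]
  have LD: "L ` ?D = ball 0 r" using disc_image r by simp
  have Eint: "set_integrable lebesgue (ball 0 r) E"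
    by (rule absolutely_integrable_on_continuous_compact[of "cball 0 r"])
       (use continuous_on_subset[OF E cball_subset_\<Omega>[OF r]] in auto)
  have LINT_ball: "(LINT w:ball 0 r|lebesgue. E w) = integral (ball 0 r) E"
    by (rule set_lebesgue_integral_eq_integral(2)[OF Eint])
  have unique: "I = integral (ball 0 r) E" if "has_form_integral A \<eta> ?D I" for I
  proof -
    obtain c P where cP: "\<And>n::nat. c n \<in> A" "\<And>n. P n \<subseteq> fst (c n)" "\<And>n. snd (c n) ` P n \<in> sets lebesgue"
      "\<And>n. set_integrable lebesgue (snd (c n) ` P n) (\<eta> (c n) \<circ> chart_inv (c n))"
      and disj: "disjoint_family P" and un: "(\<Union>n. P n) = ?D"
      and I: "I = (\<Sum>n. LINT z:snd (c n) ` P n|lebesgue. (\<eta> (c n) \<circ> chart_inv (c n)) z)"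
      using \<open>has_form_integral A \<eta> ?D I\<close> unfolding has_form_integral_def by blast
    have Lun: "(\<Union>n. L ` P n) = ball 0 r" using un LD by (metis image_UN)
    have "I = (\<Sum>n. LINT w:L ` P n|lebesgue. E w)"
      unfolding I
    proof (rule suminf_cong)
      fix n
      have "set_integrable lebesgue (L ` P n) E" using piece(2)[OF cP(1,2,3)] cP(4) by blast
      then show "(LINT z:snd (c n) ` P n|lebesgue. (\<eta> (c n) \<circ> chart_inv (c n)) z) = (LINT w:L ` P n|lebesgue. E w)"
        by (rule piece(3)[OF cP(1,2,3)])
    qed
    also have "\<dots> = (LINT w:(\<Union>n. L ` P n)|lebesgue. E w)"
    proof (rule lebesgue_integral_countable_add[symmetric])
      show "L ` P n \<in> sets lebesgue" for n using piece(1)[OF cP(1,2,3)] by simp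
      show "L ` P i \<inter> L ` P j = {}" if "i \<noteq> j" for i j
        using disj that inj_L by (metis disjoint_family_onD iso_tuple_UNIV_I image_Int image_is_empty)
      show "set_integrable lebesgue (\<Union>n. L ` P n) E" unfolding Lun by (rule Eint)
    qed
    finally show ?thesis by (simp add: Lun LINT_ball)
  qed
  have exist: "has_form_integral A \<eta> ?D (integral (ball 0 r) E)"
  proof -
    obtain c :: "nat \<Rightarrow> 'a chart" where c': "(\<forall>n. c n \<in> A) \<and> (\<Union>n. fst (c n)) = UNIV"
      using countable_chart_cover by (rule exE)
    then have c: "\<And>n. c n \<in> A" "(\<Union>n. fst (c n)) = UNIV" by simp_all
    define P where "P n = ?D \<inter> (fst (c n) - (\<Union>m<n. fst (c m)))" for n
    have P_dis: "P n = ?D \<inter> disjointed (\<lambda>n. fst (c n)) n" for n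
      by (auto simp: P_def disjointed_def)
    have un: "(\<Union>n. P n) = ?D" unfolding P_dis using c(2) UN_disjointed_eq[of "\<lambda>n. fst (c n)"] by auto
    have disj: "disjoint_family P"
      unfolding P_dis using disjoint_family_disjointed[of "\<lambda>n. fst (c n)"] by (auto simp: disjoint_family_on_def)
    have Pc: "P n \<subseteq> fst (c n)" for n by (auto simp: P_def)
    have oD: "open ?D" unfolding disc_eq using L_continuous by (intro open_Collect_less continuous_intros)
    have meas: "snd (c n) ` P n \<in> sets lebesgue" for n
    proof -
      have "P n = (?D \<inter> fst (c n)) - ((\<Union>m<n. fst (c m)) \<inter> fst (c n))" by (auto simp: P_def)
      then have "snd (c n) ` P n = snd (c n) ` (?D \<inter> fst (c n)) - snd (c n) ` ((\<Union>m<n. fst (c m)) \<inter> fst (c n))"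
        by (simp only:) (rule inj_on_image_set_diff[OF chart_inj[OF c(1)]]; auto)
      moreover have "open (snd (c n) ` (?D \<inter> fst (c n)))" by (rule chart_image_open[OF c(1) oD])
      moreover have "open (snd (c n) ` ((\<Union>m<n. fst (c m)) \<inter> fst (c n)))"
        by (rule chart_image_open[OF c(1)]) (use open_chart_dom[OF c(1)] in auto)
      ultimately show ?thesis by auto
    qed
    note pc = piece[OF c(1) Pc meas]
    have LPm: "L ` P n \<in> sets lebesgue" for n using pc(1) by simp
    have LPs: "L ` P n \<subseteq> ball 0 r" for n using LD un by blast
    have LPi: "set_integrable lebesgue (L ` P n) E" for n by (rule set_integrable_subset[OF Eint LPm LPs])
    have LPd: "L ` P i \<inter> L ` P j = {}" if "i \<noteq> j" for i j
      using disj that inj_L by (metis disjoint_family_onD iso_tuple_UNIV_I image_Int image_is_empty)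
    have Lun: "(\<Union>n. L ` P n) = ball 0 r" using un LD by (metis image_UN)
    have abs: "(LINT z:snd (c n) ` P n|lebesgue. \<bar>(\<eta> (c n) \<circ> chart_inv (c n)) z\<bar>) = (LINT w:L ` P n|lebesgue. \<bar>E w\<bar>)" for n
      using chart_piece_integral(3)[where \<eta>="\<lambda>c x. \<bar>\<eta> c x\<bar>" and E="\<lambda>w. \<bar>E w\<bar>", OF _ c(1) Pc meas] \<eta> set_integrable_abs[OF LPi]
      by (simp add: o_def abs_mult)
    have aint: "set_integrable lebesgue (L ` P n) (\<lambda>w. \<bar>E w\<bar>)" for n by (rule set_integrable_abs[OF LPi])
    have summ: "summable (\<lambda>n. LINT w:L ` P n|lebesgue. \<bar>E w\<bar>)"
    proof (rule summableI_nonneg_bounded)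
      show "0 \<le> (LINT w:L ` P n|lebesgue. \<bar>E w\<bar>)" for n
        unfolding set_lebesgue_integral_def by (rule integral_nonneg_AE) auto
      show "(\<Sum>i<n. LINT w:L ` P i|lebesgue. \<bar>E w\<bar>) \<le> (LINT w:ball 0 r|lebesgue. \<bar>E w\<bar>)" for n
      proof -
        have "(\<Sum>i<n. LINT w:L ` P i|lebesgue. \<bar>E w\<bar>) = (LINT w:(\<Union>i\<in>{..<n}. L ` P i)|lebesgue. \<bar>E w\<bar>)"
          by (rule set_integral_finite_Union[symmetric]) (use aint LPm LPd in \<open>auto simp: disjoint_family_on_def\<close>)
        also have "\<dots> \<le> (LINT w:ball 0 r|lebesgue. \<bar>E w\<bar>)"
        proof -
          have b: "set_integrable lebesgue (ball 0 r) (\<lambda>w. \<bar>E w\<bar>)" by (rule set_integrable_abs[OF Eint])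
          define U where "U = (\<Union>i\<in>{..<n}. L ` P i)"
          have m: "U \<in> sets lebesgue" unfolding U_def using LPm by (intro sets.finite_UN) auto
          have sub: "U \<subseteq> ball 0 r" unfolding U_def using LPs by blast
          have "set_integrable lebesgue U (\<lambda>w. \<bar>E w\<bar>)" by (rule set_integrable_subset[OF b m sub])
          then show ?thesis using b unfolding U_def[symmetric] set_lebesgue_integral_def set_integrable_def
            by (rule integral_mono) (use sub in \<open>auto simp: indicator_def subset_iff\<close>)
        qed
        finally show ?thesis .
      qed
    qed
    have "integral (ball 0 r) E = (\<Sum>n. LINT w:L ` P n|lebesgue. E w)"
      using lebesgue_integral_countable_add[of "\<lambda>n. L ` P n" lebesgue E] LPm LPd Eint Lun LINT_ball by simp
    also have "\<dots> = (\<Sum>n. LINT z:snd (c n) ` P n|lebesgue. (\<eta> (c n) \<circ> chart_inv (c n)) z)"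
      by (intro suminf_cong pc(3)[symmetric] LPi)
    finally have eq: "integral (ball 0 r) E = (\<Sum>n. LINT z:snd (c n) ` P n|lebesgue. (\<eta> (c n) \<circ> chart_inv (c n)) z)" .
    have "summable (\<lambda>n. LINT z:snd (c n) ` P n|lebesgue. \<bar>(\<eta> (c n) \<circ> chart_inv (c n)) z\<bar>)"
      unfolding abs by (rule summ)
    moreover have "set_integrable lebesgue (snd (c n) ` P n) (\<eta> (c n) \<circ> chart_inv (c n))" for n
      using pc(2) LPi by blast
    ultimately show ?thesis unfolding has_form_integral_def
      by (intro exI[of _ c] exI[of _ P] conjI allI c(1) Pc meas disj un eq)
  qed
  show ?thesis unfolding form_integral_def
    by (intro the_equality exist unique)
qed

end

text \<open>
  The two Wirtinger operators produce \<open>cnj p\<close> and then a quarter of the Laplacian.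
\<close>

lemma dz_dzbar_laplacian:
  assumes lap: "laplacian_on W u p E" and z: "z \<in> W"
  shows "dz (dzbar (\<lambda>w. of_real (u w))) z = of_real (E z / 4)"
proof -
  obtain s where s: "open W" "\<And>z. z \<in> W \<Longrightarrow> (u has_derivative (\<lambda>v. 2 * Re (p z * v))) (at z)"
    "\<And>z. z \<in> W \<Longrightarrow> (p has_derivative (\<lambda>v. s z * v + of_real (E z / 4) * cnj v)) (at z)"
    using lap unfolding laplacian_on_def by blast
  have line: "vector_derivative (\<lambda>t. F (w + v * of_real t)) (at 0) = F' v" if "(F has_derivative F') (at w)" for F F' :: "complex \<Rightarrow> complex" and w v
  proof -
    have "((\<lambda>t::real. w + v * of_real t) has_derivative (\<lambda>t. v * of_real t)) (at 0)"
      by (auto intro!: derivative_eq_intros)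
    then have "((\<lambda>t. F (w + v * of_real t)) has_derivative (\<lambda>t. F' (v * of_real t))) (at 0)"
      using has_derivative_compose[of "\<lambda>t. w + v * of_real t" "\<lambda>t. v * of_real t" 0 UNIV F F'] that by simp
    moreover have "F' (v * of_real t) = t *\<^sub>R F' v" for t
      using linear_cmul[OF has_derivative_linear[OF that], of t v] by (simp add: scaleR_conv_of_real mult.commute)
    ultimately show ?thesis
      by (intro vector_derivative_at) (simp add: has_vector_derivative_def)
  qed
  have db: "dzbar (\<lambda>w. of_real (u w)) w = cnj (p w)" if w: "w \<in> W" for w
  proof -
    have d: "((\<lambda>w. complex_of_real (u w)) has_derivative (\<lambda>v. of_real (2 * Re (p w * v)))) (at w)"
      by (rule has_derivative_of_real[OF s(2)[OF w]])
    show ?thesis unfolding dzbar_def using line[OF d, of 1] line[OF d, of \<i>]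
      by (simp add: complex_eq_iff)
  qed
  have "((\<lambda>w. cnj (p w)) has_derivative (\<lambda>v. cnj (s z * v + of_real (E z / 4) * cnj v))) (at z)"
    by (rule has_derivative_cnj[OF s(3)[OF z]])
  then have d: "(dzbar (\<lambda>w. of_real (u w)) has_derivative (\<lambda>v. cnj (s z * v + of_real (E z / 4) * cnj v))) (at z)"
    by (rule has_derivative_transform_within_open[OF _ s(1) z]) (simp add: db)
  show ?thesis unfolding dz_def[of "dzbar _"] using line[OF d, of 1] line[OF d, of \<i>]
    by (simp add: complex_eq_iff)
qed

lemma ddc_laplacian:
  assumes "laplacian_on W (\<lambda>w. u c (chart_inv c w)) p E" "snd c x \<in> W"
  shows "ddc u c x = E (snd c x) / (4 * pi)"
  unfolding ddc_def dz_dzbar_laplacian[OF assms] by simp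

section \<open>The chordal distance and the Fubini-Study density\<close>

definition wronskian :: "(complex \<Rightarrow> complex) \<Rightarrow> (complex \<Rightarrow> complex) \<Rightarrow> complex \<Rightarrow> complex" where
  "wronskian G0 G1 w = G0 w * deriv G1 w - deriv G0 w * G1 w"

definition norm2 :: "(complex \<Rightarrow> complex) \<Rightarrow> (complex \<Rightarrow> complex) \<Rightarrow> complex \<Rightarrow> real" where
  "norm2 G0 G1 w = (norm (G0 w))\<^sup>2 + (norm (G1 w))\<^sup>2"

text \<open>
  The coefficient of the pull-back of the Fubini--Study form, by \<open>laplacian_on_ln_norm2_lift\<close> below.
\<close>

definition fs_density :: "(complex \<Rightarrow> complex) \<Rightarrow> (complex \<Rightarrow> complex) \<Rightarrow> complex \<Rightarrow> real" where
  "fs_density G0 G1 w = (norm (wronskian G0 G1 w))\<^sup>2 / (pi * (norm2 G0 G1 w)\<^sup>2)"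

definition lift_on :: "complex set \<Rightarrow> (complex \<Rightarrow> p1) \<Rightarrow> (complex \<Rightarrow> complex) \<Rightarrow> (complex \<Rightarrow> complex) \<Rightarrow> bool" where
  "lift_on V F G0 G1 \<longleftrightarrow> open V \<and> G0 holomorphic_on V \<and> G1 holomorphic_on V \<and>
     (\<forall>w\<in>V. (G0 w \<noteq> 0 \<or> G1 w \<noteq> 0) \<and> F w = p1_point (G0 w) (G1 w))"

text \<open>
  The square of the chordal distance on the sphere of diameter 1. In the comments below, the chordal
  distance always means this square.
\<close>

fun chordal :: "p1 \<Rightarrow> p1 \<Rightarrow> real" where
  "chordal (Fin s) (Fin t) = (norm (s - t))\<^sup>2 / ((1 + (norm s)\<^sup>2) * (1 + (norm t)\<^sup>2))"
| "chordal (Fin s) Infty = 1 / (1 + (norm s)\<^sup>2)"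
| "chordal Infty (Fin t) = 1 / (1 + (norm t)\<^sup>2)"
| "chordal Infty Infty = 0"

text \<open>
  \<open>coeff0 a\<close> and \<open>coeff1 a\<close> are the coefficients of a linear form on the plane of homogeneous coordinates
  which vanishes on the line \<open>a\<close>; they form a unit vector, so that the squared modulus of the form
  divided by that of the lift is the chordal distance to \<open>a\<close>.
\<close>

fun coeff0 :: "p1 \<Rightarrow> complex" where
  "coeff0 Infty = 1" | "coeff0 (Fin s) = - s / of_real (sqrt (1 + (norm s)\<^sup>2))"
fun coeff1 :: "p1 \<Rightarrow> complex" where
  "coeff1 Infty = 0" | "coeff1 (Fin s) = 1 / of_real (sqrt (1 + (norm s)\<^sup>2))"

definition lin_form :: "p1 \<Rightarrow> (complex \<Rightarrow> complex) \<Rightarrow> (complex \<Rightarrow> complex) \<Rightarrow> complex \<Rightarrow> complex" where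
  "lin_form a G0 G1 w = coeff0 a * G0 w + coeff1 a * G1 w"

definition orth_form :: "p1 \<Rightarrow> (complex \<Rightarrow> complex) \<Rightarrow> (complex \<Rightarrow> complex) \<Rightarrow> complex \<Rightarrow> complex" where
  "orth_form a G0 G1 w = - cnj (coeff1 a) * G0 w + cnj (coeff0 a) * G1 w"

lemma coeff_unit: "(norm (coeff0 a))\<^sup>2 + (norm (coeff1 a))\<^sup>2 = 1"
proof (cases a)
  case (Fin s)
  have "1 + (norm s)\<^sup>2 > 0" by (simp add: add_pos_nonneg)
  then show ?thesis by (simp add: Fin norm_divide power_divide add_divide_distrib[symmetric] add.commute)
qed simp

lemma coeff_unit': "coeff0 a * cnj (coeff0 a) + coeff1 a * cnj (coeff1 a) = 1"
  using coeff_unit[of a] by (metis complex_norm_square of_real_1 of_real_add)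

lemma norm2_pos: "G0 w \<noteq> 0 \<or> G1 w \<noteq> 0 \<Longrightarrow> 0 < norm2 G0 G1 w"
  unfolding norm2_def by (auto simp: add_pos_nonneg add_nonneg_pos)

lemma norm2_forms: "(norm (lin_form a G0 G1 w))\<^sup>2 + (norm (orth_form a G0 G1 w))\<^sup>2 = norm2 G0 G1 w"
proof -
  let ?\<alpha> = "coeff0 a" and ?\<beta> = "coeff1 a"
  have "complex_of_real ((norm (lin_form a G0 G1 w))\<^sup>2 + (norm (orth_form a G0 G1 w))\<^sup>2)
      = (?\<alpha> * cnj ?\<alpha> + ?\<beta> * cnj ?\<beta>) * (G0 w * cnj (G0 w) + G1 w * cnj (G1 w))"
    by (simp only: of_real_add complex_norm_square lin_form_def orth_form_def) (simp add: algebra_simps)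
  also have "\<dots> = complex_of_real (norm2 G0 G1 w)"
    by (simp only: coeff_unit' norm2_def of_real_add complex_norm_square mult_1)
  finally show ?thesis by (simp only: of_real_eq_iff)
qed

text \<open>
  The change from \<open>(G0, G1)\<close> to \<open>(lin_form a, orth_form a)\<close> is unitary of determinant 1.
\<close>

lemma wronskian_forms:
  assumes "G0 holomorphic_on V" "G1 holomorphic_on V" "open V" "w \<in> V"
  shows "wronskian (lin_form a G0 G1) (orth_form a G0 G1) w = wronskian G0 G1 w"
proof -
  have d: "(G0 has_field_derivative deriv G0 w) (at w)" "(G1 has_field_derivative deriv G1 w) (at w)"
    using holomorphic_derivI assms by blast+
  have 1: "deriv (lin_form a G0 G1) w = coeff0 a * deriv G0 w + coeff1 a * deriv G1 w"
    unfolding lin_form_def by (rule DERIV_imp_deriv) (auto intro!: derivative_eq_intros d)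
  have 2: "deriv (orth_form a G0 G1) w = - cnj (coeff1 a) * deriv G0 w + cnj (coeff0 a) * deriv G1 w"
    unfolding orth_form_def by (rule DERIV_imp_deriv) (auto intro!: derivative_eq_intros d)
  have "wronskian (lin_form a G0 G1) (orth_form a G0 G1) w = (coeff0 a * cnj (coeff0 a) + coeff1 a * cnj (coeff1 a)) * wronskian G0 G1 w"
    unfolding wronskian_def 1 2 by (simp add: lin_form_def orth_form_def algebra_simps)
  then show ?thesis by (simp add: coeff_unit')
qed

lemma forms_holomorphic:
  assumes "G0 holomorphic_on V" "G1 holomorphic_on V"
  shows "lin_form a G0 G1 holomorphic_on V" "orth_form a G0 G1 holomorphic_on V"
  unfolding lin_form_def orth_form_def by (intro holomorphic_intros assms)+

lemma lin_form_eq_0_iff: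
  assumes "G0 w \<noteq> 0 \<or> G1 w \<noteq> 0"
  shows "lin_form a G0 G1 w = 0 \<longleftrightarrow> p1_point (G0 w) (G1 w) = a"
proof (cases a)
  case (Fin s)
  have "sqrt (1 + (norm s)\<^sup>2) \<noteq> 0" by (smt (verit) real_sqrt_eq_zero_cancel_iff zero_le_power2)
  then show ?thesis using assms Fin
    by (auto simp: lin_form_def p1_point_def field_simps)
qed (use assms in \<open>auto simp: lin_form_def p1_point_def\<close>)

lemma chordal_lift:
  assumes "G0 w \<noteq> 0 \<or> G1 w \<noteq> 0"
  shows "chordal (p1_point (G0 w) (G1 w)) a = (norm (lin_form a G0 G1 w))\<^sup>2 / norm2 G0 G1 w"
proof (cases a)
  case (Fin s)
  have p: "1 + (norm s)\<^sup>2 > 0" by (simp add: add_pos_nonneg)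
  have l: "lin_form a G0 G1 w = (G1 w - s * G0 w) / of_real (sqrt (1 + (norm s)\<^sup>2))"
    by (simp add: Fin lin_form_def diff_divide_distrib)
  then have l2: "(norm (lin_form a G0 G1 w))\<^sup>2 = (norm (G1 w - s * G0 w))\<^sup>2 / (1 + (norm s)\<^sup>2)"
    using p by (simp add: norm_divide power_divide)
  show ?thesis
  proof (cases "G0 w = 0")
    case True
    then show ?thesis using assms p unfolding l2 by (simp add: Fin p1_point_def norm2_def)
  next
    case False
    have n: "norm2 G0 G1 w = (norm (G0 w))\<^sup>2 * (1 + (norm (G1 w / G0 w))\<^sup>2)"
      using False by (simp add: norm2_def norm_divide power_divide field_simps)
    have "G1 w - s * G0 w = G0 w * (G1 w / G0 w - s)" using False by (simp add: field_simps)
    then have "(norm (G1 w - s * G0 w))\<^sup>2 = (norm (G0 w))\<^sup>2 * (norm (G1 w / G0 w - s))\<^sup>2"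
      by (simp add: norm_mult power_mult_distrib)
    then show ?thesis unfolding l2 n using False by (simp add: Fin p1_point_def)
  qed
next
  case Infty
  show ?thesis
  proof (cases "G0 w = 0")
    case True
    then show ?thesis using assms by (simp add: Infty lin_form_def p1_point_def)
  next
    case False
    have n: "norm2 G0 G1 w = (norm (G0 w))\<^sup>2 * (1 + (norm (G1 w / G0 w))\<^sup>2)"
      using False by (simp add: norm2_def norm_divide power_divide field_simps)
    show ?thesis unfolding n using False by (simp add: Infty lin_form_def p1_point_def)
  qed
qed

lemma chordal_nonneg: "0 \<le> chordal x a" by (cases x; cases a) auto

lemma chordal_lift_le_1:
  fixes G0 G1 :: "complex \<Rightarrow> complex"
  assumes "G0 w \<noteq> 0 \<or> G1 w \<noteq> 0" shows "chordal (p1_point (G0 w) (G1 w)) a \<le> 1"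
  unfolding chordal_lift[of G0 w G1 a, OF assms] using norm2_forms[of a G0 G1 w] norm2_pos[of G0 w G1, OF assms]
  by (simp add: divide_le_eq_1) (smt (verit) zero_le_power2)

lemma lagrange_identity_complex:
  fixes a b a' b' :: complex
  shows "((norm a)\<^sup>2 + (norm b)\<^sup>2) * ((norm a')\<^sup>2 + (norm b')\<^sup>2) - (norm (a' * cnj a + b' * cnj b))\<^sup>2 = (norm (a * b' - a' * b))\<^sup>2"
  by (simp add: cmod_power2) (simp add: algebra_simps power2_eq_square)

text \<open>
  The algebra behind the Laplacian of \<open>\<bar>a\<bar>\<^sup>2 / N\<close> for holomorphic \<open>a\<close>, \<open>b\<close> with derivatives \<open>a'\<close>, \<open>b'\<close>. It is
  a polynomial identity after complex conjugates are taken as independent variables.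
\<close>

lemma chordal_laplacian_identity:
  fixes a b a' b' :: complex
  defines "N \<equiv> (norm a)\<^sup>2 + (norm b)\<^sup>2" and "q \<equiv> a' * cnj a + b' * cnj b"
  shows "- N * (norm a)\<^sup>2 * ((norm a')\<^sup>2 + (norm b')\<^sup>2) + 2 * (norm a)\<^sup>2 * (norm q)\<^sup>2 + N\<^sup>2 * (norm a')\<^sup>2
      - 2 * N * Re ((a' * cnj a) * cnj q) = (norm (a * b' - a' * b))\<^sup>2 * (N - 2 * (norm a)\<^sup>2)"
proof -
  have sq: "complex_of_real (norm z) * complex_of_real (norm z) = z * cnj z" for z
    using complex_norm_square[of z] by (simp add: power2_eq_square)
  have re: "complex_of_real (Re z) = (z + cnj z) / 2" for z by (simp add: complex_eq_iff)
  have poly: "- (a*A + b*B) * (a*A) * (x*X + y*Y) + 2 * (a*A) * ((x*A + y*B) * (X*a + Y*b)) + (a*A + b*B) * (a*A + b*B) * (x*X)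
     - 2 * (a*A + b*B) * (((x*A) * (X*a + Y*b) + (X*a) * (x*A + y*B)) / 2)
     = ((a*y - x*b) * (A*Y - X*B)) * (a*A + b*B - 2 * (a*A))" for A B x y X Y :: complex
    by (simp add: algebra_simps)
  have "complex_of_real (- N * (norm a)\<^sup>2 * ((norm a')\<^sup>2 + (norm b')\<^sup>2) + 2 * (norm a)\<^sup>2 * (norm q)\<^sup>2 + N\<^sup>2 * (norm a')\<^sup>2
      - 2 * N * Re ((a' * cnj a) * cnj q)) = complex_of_real ((norm (a * b' - a' * b))\<^sup>2 * (N - 2 * (norm a)\<^sup>2))"
    unfolding N_def power2_eq_square of_real_add of_real_diff of_real_mult of_real_minus re sq
    using poly[of "cnj a" "cnj b" a' "cnj a'" b' "cnj b'"]
    by (simp add: q_def)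
  then show ?thesis by (simp only: of_real_eq_iff)
qed

lemma laplacian_on_ln_norm2_lift:
  assumes "lift_on V F G0 G1"
  obtains p where "laplacian_on V (\<lambda>w. ln (norm2 G0 G1 w)) p (\<lambda>w. 4 * pi * fs_density G0 G1 w)"
proof -
  have h: "G0 holomorphic_on V" "G1 holomorphic_on V" "open V" and nz: "\<And>w. w \<in> V \<Longrightarrow> 0 < norm2 G0 G1 w"
    using assms norm2_pos by (auto simp: lift_on_def)
  note l = laplacian_on_add[OF laplacian_on_norm2[OF h(1,3)] laplacian_on_norm2[OF h(2,3)], folded norm2_def]
  have lap: "laplacian_on V (\<lambda>w. ln (norm2 G0 G1 w)) (\<lambda>w. of_real (inverse (norm2 G0 G1 w)) * (deriv G0 w * cnj (G0 w) + deriv G1 w * cnj (G1 w)))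
     (\<lambda>w. inverse (norm2 G0 G1 w) * (4 * (norm (deriv G0 w))\<^sup>2 + 4 * (norm (deriv G1 w))\<^sup>2)
        + 4 * (- inverse ((norm2 G0 G1 w)\<^sup>2)) * (norm (deriv G0 w * cnj (G0 w) + deriv G1 w * cnj (G1 w)))\<^sup>2)"
    apply (rule laplacian_on_compose[OF l, where k' = "\<lambda>x. inverse x" and k'' = "\<lambda>x. - inverse (x\<^sup>2)"])
    subgoal for w using nz[of w] by (auto intro!: derivative_eq_intros simp: field_simps)
    subgoal for w using nz[of w] by (auto intro!: derivative_eq_intros simp: field_simps power2_eq_square)
    subgoal using nz laplacian_on_continuous(1)[OF l] by (force intro!: continuous_intros)
    done
  have eq: "inverse (norm2 G0 G1 w) * (4 * (norm (deriv G0 w))\<^sup>2 + 4 * (norm (deriv G1 w))\<^sup>2)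
        + 4 * (- inverse ((norm2 G0 G1 w)\<^sup>2)) * (norm (deriv G0 w * cnj (G0 w) + deriv G1 w * cnj (G1 w)))\<^sup>2
      = 4 * pi * fs_density G0 G1 w" if "w \<in> V" for w
  proof -
    have id: "norm2 G0 G1 w * ((norm (deriv G0 w))\<^sup>2 + (norm (deriv G1 w))\<^sup>2) - (norm (deriv G0 w * cnj (G0 w) + deriv G1 w * cnj (G1 w)))\<^sup>2
       = (norm (wronskian G0 G1 w))\<^sup>2"
      using lagrange_identity_complex[of "G0 w" "G1 w" "deriv G0 w" "deriv G1 w"] by (simp only: norm2_def wronskian_def)
    have n: "norm2 G0 G1 w > 0" using nz that by blast
    have "inverse (norm2 G0 G1 w) * (4 * (norm (deriv G0 w))\<^sup>2 + 4 * (norm (deriv G1 w))\<^sup>2)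
        + 4 * (- inverse ((norm2 G0 G1 w)\<^sup>2)) * (norm (deriv G0 w * cnj (G0 w) + deriv G1 w * cnj (G1 w)))\<^sup>2
      = 4 * (norm2 G0 G1 w * ((norm (deriv G0 w))\<^sup>2 + (norm (deriv G1 w))\<^sup>2) - (norm (deriv G0 w * cnj (G0 w) + deriv G1 w * cnj (G1 w)))\<^sup>2) / (norm2 G0 G1 w)\<^sup>2"
      using n by (simp add: field_simps power2_eq_square)
    then show ?thesis unfolding id fs_density_def using n by simp
  qed
  show ?thesis by (rule that[OF laplacian_on_cong[OF lap refl refl eq]])
qed

text \<open>
  Besides the Laplacian, the gradient of the chordal distance is a function of the distance and of the
  density. So every smooth function of the distance has a Laplacian which is the density times a
  function of the distance.
\<close>

lemma laplacian_on_chordal: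
  assumes lift: "lift_on V F G0 G1"
  obtains p where "laplacian_on V (\<lambda>w. chordal (F w) a) p (\<lambda>w. 4 * pi * fs_density G0 G1 w * (1 - 2 * chordal (F w) a))"
    "\<And>w. w \<in> V \<Longrightarrow> (norm (p w))\<^sup>2 = pi * fs_density G0 G1 w * chordal (F w) a * (1 - chordal (F w) a)"
proof -
  have h: "G0 holomorphic_on V" "G1 holomorphic_on V" "open V" and nz: "\<And>w. w \<in> V \<Longrightarrow> 0 < norm2 G0 G1 w"
    using lift norm2_pos by (auto simp: lift_on_def)
  define A where "A = lin_form a G0 G1"
  define B where "B = orth_form a G0 G1"
  have hA: "A holomorphic_on V" and hB: "B holomorphic_on V"
    using forms_holomorphic[OF h(1,2)] by (auto simp: A_def B_def)
  have N: "norm2 G0 G1 w = (norm (A w))\<^sup>2 + (norm (B w))\<^sup>2" for w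
    by (simp add: A_def B_def norm2_forms)
  have W: "wronskian A B w = wronskian G0 G1 w" if "w \<in> V" for w
    unfolding A_def B_def by (rule wronskian_forms[OF h that])
  have \<chi>: "chordal (F w) a = (norm (A w))\<^sup>2 / norm2 G0 G1 w" if "w \<in> V" for w
    using lift that chordal_lift[of G0 w G1 a] by (auto simp: lift_on_def A_def)
  let ?N = "norm2 G0 G1"
  note lA = laplacian_on_norm2[OF hA h(3)] and lB = laplacian_on_norm2[OF hB h(3)]
  note lN = laplacian_on_add[OF lA lB, folded N]
  define q where "q w = deriv A w * cnj (A w) + deriv B w * cnj (B w)" for w
  have lI: "laplacian_on V (\<lambda>w. inverse (?N w)) (\<lambda>w. of_real (- inverse ((?N w)\<^sup>2)) * q w)
     (\<lambda>w. - inverse ((?N w)\<^sup>2) * (4 * (norm (deriv A w))\<^sup>2 + 4 * (norm (deriv B w))\<^sup>2) + 4 * (2 * inverse ((?N w)^3)) * (norm (q w))\<^sup>2)"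
    unfolding q_def
    apply (rule laplacian_on_compose[OF lN, where k' = "\<lambda>x. - inverse (x\<^sup>2)" and k'' = "\<lambda>x. 2 * inverse (x^3)"])
    subgoal for w using nz[of w] by (auto intro!: derivative_eq_intros simp: field_simps power2_eq_square)
    subgoal for w using nz[of w] by (auto intro!: derivative_eq_intros simp: field_simps power2_eq_square power3_eq_cube)
    subgoal using nz laplacian_on_continuous(1)[OF lN] by (force intro!: continuous_intros)
    done
  define p where "p w = - cnj (A w) * cnj (B w) * wronskian G0 G1 w / of_real ((?N w)\<^sup>2)" for w
  have Nc: "complex_of_real (?N w) = A w * cnj (A w) + B w * cnj (B w)" for w
    by (simp only: N of_real_add complex_norm_square)
  have p_eq: "of_real ((norm (A w))\<^sup>2) * (of_real (- inverse ((?N w)\<^sup>2)) * q w) + of_real (inverse (?N w)) * (deriv A w * cnj (A w)) = p w"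
    if "w \<in> V" for w
  proof -
    have n: "complex_of_real (?N w) \<noteq> 0" using nz[OF that] by simp
    have "of_real ((norm (A w))\<^sup>2) * (of_real (- inverse ((?N w)\<^sup>2)) * q w) + of_real (inverse (?N w)) * (deriv A w * cnj (A w))
      = (complex_of_real (?N w) * (deriv A w * cnj (A w)) - A w * cnj (A w) * q w) / (complex_of_real (?N w))\<^sup>2"
      using n by (simp add: complex_norm_square[symmetric] field_simps power2_eq_square)
    also have "complex_of_real (?N w) * (deriv A w * cnj (A w)) - A w * cnj (A w) * q w = - cnj (A w) * cnj (B w) * wronskian G0 G1 w"
      unfolding W[OF that, symmetric] unfolding Nc q_def wronskian_def by (simp add: algebra_simps)
    finally show ?thesis by (simp add: p_def)
  qed
  have L_eq: "(norm (A w))\<^sup>2 * (- inverse ((?N w)\<^sup>2) * (4 * (norm (deriv A w))\<^sup>2 + 4 * (norm (deriv B w))\<^sup>2) + 4 * (2 * inverse ((?N w)^3)) * (norm (q w))\<^sup>2)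
      + inverse (?N w) * (4 * (norm (deriv A w))\<^sup>2)
      + 8 * Re ((deriv A w * cnj (A w)) * cnj (of_real (- inverse ((?N w)\<^sup>2)) * q w))
      = 4 * pi * fs_density G0 G1 w * (1 - 2 * chordal (F w) a)" (is "?lhs = ?rhs") if "w \<in> V" for w
  proof -
    have n: "?N w \<noteq> 0" using nz[OF that] by simp
    define X where "X = - ?N w * (norm (A w))\<^sup>2 * ((norm (deriv A w))\<^sup>2 + (norm (deriv B w))\<^sup>2) + 2 * (norm (A w))\<^sup>2 * (norm (q w))\<^sup>2
       + (?N w)\<^sup>2 * (norm (deriv A w))\<^sup>2 - 2 * ?N w * Re ((deriv A w * cnj (A w)) * cnj (q w))"
    have 1: "?lhs = 4 * X / (?N w)^3"
      unfolding X_def using n by (simp add: field_simps power2_eq_square power3_eq_cube)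
    have X: "X = (norm (wronskian G0 G1 w))\<^sup>2 * (?N w - 2 * (norm (A w))\<^sup>2)"
      unfolding X_def W[OF that, symmetric] unfolding wronskian_def N q_def by (rule chordal_laplacian_identity)
    show ?thesis unfolding 1 X \<chi>[OF that] fs_density_def using n by (simp add: field_simps power2_eq_square power3_eq_cube)
  qed
  have "laplacian_on V (\<lambda>w. chordal (F w) a) p (\<lambda>w. 4 * pi * fs_density G0 G1 w * (1 - 2 * chordal (F w) a))"
    by (rule laplacian_on_cong[OF laplacian_on_mult[OF lA lI]])
       (use \<chi> p_eq L_eq in \<open>auto simp: divide_inverse\<close>)
  moreover have "(norm (p w))\<^sup>2 = pi * fs_density G0 G1 w * chordal (F w) a * (1 - chordal (F w) a)" if "w \<in> V" for w
  proof -
    have n: "?N w \<noteq> 0" using nz[OF that] by simp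
    have "(norm (p w))\<^sup>2 = (norm (A w))\<^sup>2 * (norm (B w))\<^sup>2 * (norm (wronskian G0 G1 w))\<^sup>2 / (?N w)^4"
      by (simp add: p_def norm_mult norm_divide power_mult_distrib power_divide norm_power flip: power_mult)
    moreover have c: "1 - chordal (F w) a = (norm (B w))\<^sup>2 / ?N w"
    proof -
      have "1 - (norm (A w))\<^sup>2 / ?N w = (?N w - (norm (A w))\<^sup>2) / ?N w" using n by (simp add: diff_divide_distrib)
      also have "?N w - (norm (A w))\<^sup>2 = (norm (B w))\<^sup>2" using N[of w] by simp
      finally show ?thesis unfolding \<chi>[OF that] .
    qed
    moreover have "x * y * u / m ^ 4 = pi * (u / (pi * m\<^sup>2)) * (x / m) * (y / m)" if "m \<noteq> 0" for x y u m :: real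
      using that by (simp add: field_simps eval_nat_numeral)
    ultimately show ?thesis unfolding c unfolding \<chi>[OF that] fs_density_def using n by (simp only: not_False_eq_True)
  qed
  ultimately show ?thesis by (rule that)
qed

section \<open>Circle means and iterated integrals\<close>

lemma continuous_on_circle:
  assumes "continuous_on (sphere 0 t) f" "0 \<le> t"
  shows "continuous_on A (\<lambda>\<theta>. f (of_real t * cis \<theta>))"
proof -
  have "continuous_on A (\<lambda>\<theta>. of_real t * cis \<theta>)" unfolding cis_conv_exp by (intro continuous_intros)
  then show ?thesis
    by (rule continuous_on_compose2[OF assms(1)]) (use assms(2) in \<open>auto simp: norm_mult\<close>)
qed

lemma circle_integrable:
  fixes f :: "complex \<Rightarrow> real"
  assumes "continuous_on (sphere 0 t) f" "0 \<le> t"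
  shows "(\<lambda>\<theta>. f (of_real t * cis \<theta>)) integrable_on {0..2*pi}"
  using continuous_on_circle[OF assms] integrable_continuous_real by blast

lemma circle_mean_cong:
  assumes "\<And>z. z \<in> sphere 0 t \<Longrightarrow> f z = g z" "0 \<le> t"
  shows "circle_mean f t = circle_mean g t"
  unfolding circle_mean_def using assms by (intro arg_cong2[where f="(/)"] integral_cong) (auto simp: norm_mult)

lemma circle_mean_mono:
  assumes "continuous_on (sphere 0 t) f" "continuous_on (sphere 0 t) g" "0 \<le> t" "\<And>z. z \<in> sphere 0 t \<Longrightarrow> f z \<le> g z"
  shows "circle_mean f t \<le> circle_mean g t"
  unfolding circle_mean_def using assms
  by (intro divide_right_mono integral_le circle_integrable) (auto simp: norm_mult)

lemma circle_mean_add: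
  assumes "continuous_on (sphere 0 t) f" "continuous_on (sphere 0 t) g" "0 \<le> t"
  shows "circle_mean (\<lambda>z. f z + g z) t = circle_mean f t + circle_mean g t"
  unfolding circle_mean_def using assms
  by (subst Henstock_Kurzweil_Integration.integral_add) (auto intro: circle_integrable simp: add_divide_distrib)

lemma circle_mean_cmult: "circle_mean (\<lambda>z. c * f z) t = c * circle_mean f t"
  unfolding circle_mean_def by simp

lemma circle_mean_minus: "circle_mean (\<lambda>z. - f z) t = - circle_mean f t"
  using circle_mean_cmult[of "-1" f t] by simp

lemma circle_mean_const [simp]: "circle_mean (\<lambda>z. c) t = c"
  by (simp add: circle_mean_def)

lemma circle_mean_sum:
  assumes "finite I" "\<And>i. i \<in> I \<Longrightarrow> continuous_on (sphere 0 t) (f i)" "0 \<le> t"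
  shows "circle_mean (\<lambda>z. \<Sum>i\<in>I. f i z) t = (\<Sum>i\<in>I. circle_mean (f i) t)"
  using assms
proof (induction I rule: finite_induct)
  case (insert i I)
  have "circle_mean (\<lambda>z. f i z + (\<Sum>i\<in>I. f i z)) t = circle_mean (f i) t + circle_mean (\<lambda>z. \<Sum>i\<in>I. f i z) t"
    by (rule circle_mean_add) (use insert in \<open>auto intro!: continuous_on_sum\<close>)
  then show ?case using insert by simp
qed simp

lemma continuous_on_circle_mean:
  assumes "continuous_on (cball 0 r) E"
  shows "continuous_on {0..r} (circle_mean E)"
proof -
  have "continuous_on ({0..r} \<times> cbox 0 (2*pi)) (\<lambda>(t,\<theta>). E (of_real t * cis \<theta>))"
    by (rule continuous_on_circle_param[OF assms]) (auto simp: norm_mult)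
  then have "continuous_on {0..r} (\<lambda>t. integral (cbox 0 (2*pi)) (\<lambda>\<theta>. E (of_real t * cis \<theta>)))"
    by (rule integral_continuous_on_param)
  then show ?thesis unfolding circle_mean_def by (intro continuous_intros) auto
qed

text \<open>
  Up to the factor \<open>2 * pi\<close>, \<open>disc_mass E t\<close> is the integral of \<open>E\<close> over the disc of radius \<open>t\<close>, and
  \<open>iterated\<close> is the integral of \<open>dt / t\<close> against it which occurs in all characteristic functions.
\<close>

definition disc_mass :: "(complex \<Rightarrow> real) \<Rightarrow> real \<Rightarrow> real" where
  "disc_mass E t = integral {0..t} (\<lambda>u. u * circle_mean E u)"

definition iterated :: "(complex \<Rightarrow> real) \<Rightarrow> real \<Rightarrow> real \<Rightarrow> real" where
  "iterated E s r = integral {s..r} (\<lambda>t. disc_mass E t / t)"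

lemma disc_mass_integrable:
  assumes "continuous_on (cball 0 r) E" "t \<le> r"
  shows "(\<lambda>u. u * circle_mean E u) integrable_on {0..t}"
  using continuous_on_subset[OF continuous_on_circle_mean[OF assms(1)], of "{0..t}"] assms(2)
  by (intro integrable_continuous_real continuous_intros) auto

lemma continuous_on_disc_mass:
  assumes "continuous_on (cball 0 r) E"
  shows "continuous_on {0..r} (disc_mass E)"
  unfolding disc_mass_def by (rule indefinite_integral_continuous_1[OF disc_mass_integrable[OF assms]]) simp

lemma iterated_integrable:
  assumes "continuous_on (cball 0 r) E" "0 < s"
  shows "(\<lambda>t. disc_mass E t / t) integrable_on {s..r}"
  using continuous_on_subset[OF continuous_on_disc_mass[OF assms(1)], of "{s..r}"] assms(2)
  by (intro integrable_continuous_real continuous_intros) auto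

lemma disc_mass_mono:
  assumes "continuous_on (cball 0 r) E" "continuous_on (cball 0 r) E'" "\<And>z. z \<in> cball 0 r \<Longrightarrow> E z \<le> E' z" "t \<le> r"
  shows "disc_mass E t \<le> disc_mass E' t"
  unfolding disc_mass_def
proof (rule integral_le)
  fix u assume u: "u \<in> {0..t}"
  have "sphere 0 u \<subseteq> cball (0::complex) r" using u assms(4) by auto
  then have "circle_mean E u \<le> circle_mean E' u"
    using assms(1-3) u by (intro circle_mean_mono) (auto intro: continuous_on_subset)
  then show "u * circle_mean E u \<le> u * circle_mean E' u" using u by (intro mult_left_mono) auto
qed (use disc_mass_integrable assms in blast)+

lemma iterated_mono:
  assumes "continuous_on (cball 0 r) E" "continuous_on (cball 0 r) E'" "\<And>z. z \<in> cball 0 r \<Longrightarrow> E z \<le> E' z" "0 < s"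
  shows "iterated E s r \<le> iterated E' s r"
  unfolding iterated_def
  by (rule integral_le) (use assms in \<open>auto intro!: iterated_integrable divide_right_mono disc_mass_mono[OF assms(1-3)]\<close>)

lemma disc_mass_cmult: "disc_mass (\<lambda>z. c * E z) t = c * disc_mass E t"
proof -
  have "disc_mass (\<lambda>z. c * E z) t = integral {0..t} (\<lambda>u. c * (u * circle_mean E u))"
    unfolding disc_mass_def circle_mean_cmult by (rule integral_cong) simp
  also have "\<dots> = c * disc_mass E t" unfolding disc_mass_def by (rule integral_mult_right)
  finally show ?thesis .
qed

lemma iterated_cmult: "iterated (\<lambda>z. c * E z) s r = c * iterated E s r"
proof -
  have "iterated (\<lambda>z. c * E z) s r = integral {s..r} (\<lambda>t. c * (disc_mass E t / t))"
    unfolding iterated_def disc_mass_cmult by (rule integral_cong) simp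
  also have "\<dots> = c * iterated E s r" unfolding iterated_def by (rule integral_mult_right)
  finally show ?thesis .
qed

lemma disc_mass_add:
  assumes "continuous_on (cball 0 r) E" "continuous_on (cball 0 r) E'" "t \<le> r"
  shows "disc_mass (\<lambda>z. E z + E' z) t = disc_mass E t + disc_mass E' t"
proof -
  have "disc_mass (\<lambda>z. E z + E' z) t = integral {0..t} (\<lambda>u. u * circle_mean E u + u * circle_mean E' u)"
    unfolding disc_mass_def
  proof (rule integral_cong)
    fix u assume u: "u \<in> {0..t}"
    have "sphere 0 u \<subseteq> cball (0::complex) r" using u assms(3) by auto
    then show "u * circle_mean (\<lambda>z. E z + E' z) u = u * circle_mean E u + u * circle_mean E' u"
      using assms(1,2) u by (subst circle_mean_add) (auto intro: continuous_on_subset simp: algebra_simps)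
  qed
  also have "\<dots> = disc_mass E t + disc_mass E' t"
    unfolding disc_mass_def by (rule Henstock_Kurzweil_Integration.integral_add) (use disc_mass_integrable assms in blast)+
  finally show ?thesis .
qed

lemma iterated_add:
  assumes "continuous_on (cball 0 r) E" "continuous_on (cball 0 r) E'" "0 < s"
  shows "iterated (\<lambda>z. E z + E' z) s r = iterated E s r + iterated E' s r"
proof -
  have "iterated (\<lambda>z. E z + E' z) s r = integral {s..r} (\<lambda>t. disc_mass E t / t + disc_mass E' t / t)"
    unfolding iterated_def by (rule integral_cong) (use disc_mass_add[OF assms(1,2)] in \<open>auto simp: add_divide_distrib\<close>)
  also have "\<dots> = iterated E s r + iterated E' s r"
    unfolding iterated_def by (rule Henstock_Kurzweil_Integration.integral_add) (use iterated_integrable assms in blast)+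
  finally show ?thesis .
qed

lemma iterated_nonneg:
  assumes "continuous_on (cball 0 r) E" "\<And>z. z \<in> cball 0 r \<Longrightarrow> 0 \<le> E z" "0 < s"
  shows "0 \<le> iterated E s r"
  using iterated_mono[of r "\<lambda>_. 0" E s] assms iterated_cmult[of 0 "\<lambda>_. 0" s r] by simp

lemma iterated_laplacian:
  assumes "laplacian_on S u p E" "cball 0 r \<subseteq> S" "0 < s" "s \<le> r"
  shows "iterated E s r = circle_mean u r - circle_mean u s"
  using circle_mean_laplacian(2)[OF assms] unfolding iterated_def disc_mass_def by (rule integral_unique)

section \<open>Maps of a disc to the sphere\<close>

lemma p1_lift_proportional:
  assumes "p1_point x0 x1 = p1_point y0 y1" "x0 \<noteq> 0 \<or> x1 \<noteq> 0" "y0 \<noteq> 0 \<or> y1 \<noteq> 0"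
  shows "x0 * y1 = y0 * x1"
  using assms by (auto simp: p1_point_def field_simps split: if_splits)

text \<open>
  Two lifts differ by a nowhere vanishing holomorphic factor, whose square comes out of the Wronskian.
\<close>

lemma fs_density_unique:
  assumes G: "lift_on V F G0 G1" and H: "lift_on W F H0 H1" and w: "w \<in> V" "w \<in> W"
  shows "fs_density G0 G1 w = fs_density H0 H1 w"
proof -
  have hG: "G0 holomorphic_on V" "G1 holomorphic_on V" "open V" and hH: "H0 holomorphic_on W" "H1 holomorphic_on W" "open W"
    using G H by (auto simp: lift_on_def)
  have dG: "(G0 has_field_derivative deriv G0 w) (at w)" "(G1 has_field_derivative deriv G1 w) (at w)"
    using hG w holomorphic_derivI by blast+
  have dH: "(H0 has_field_derivative deriv H0 w) (at w)" "(H1 has_field_derivative deriv H1 w) (at w)"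
    using hH w holomorphic_derivI by blast+
  have prp: "G0 v * H1 v = H0 v * G1 v" if "v \<in> V \<inter> W" for v
    using G H that by (intro p1_lift_proportional) (auto simp: lift_on_def)
  have "((\<lambda>v. G0 v * H1 v) has_field_derivative (deriv G0 w * H1 w + deriv H1 w * G0 w)) (at w)"
    by (auto intro!: derivative_eq_intros dG dH)
  then have "((\<lambda>v. H0 v * G1 v) has_field_derivative (deriv G0 w * H1 w + deriv H1 w * G0 w)) (at w)"
    by (rule has_field_derivative_transform_within_open[of _ _ _ "V \<inter> W"]) (use hG hH w prp in auto)
  moreover have "((\<lambda>v. H0 v * G1 v) has_field_derivative (deriv H0 w * G1 w + deriv G1 w * H0 w)) (at w)"
    by (auto intro!: derivative_eq_intros dG dH)
  ultimately have D: "deriv G0 w * H1 w + deriv H1 w * G0 w = deriv H0 w * G1 w + deriv G1 w * H0 w"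
    by (rule DERIV_unique)
  have P: "G0 w * H1 w = H0 w * G1 w" using prp w by blast
  have nG: "G0 w \<noteq> 0 \<or> G1 w \<noteq> 0" and nH: "H0 w \<noteq> 0 \<or> H1 w \<noteq> 0" using G H w by (auto simp: lift_on_def)
  obtain k where k: "H0 w = k * G0 w" "H1 w = k * G1 w"
  proof (cases "G0 w = 0")
    case True
    then have "H0 w = 0" "G1 w \<noteq> 0" using P nG by auto
    then show ?thesis using that[of "H1 w / G1 w"] True by simp
  next
    case False
    then show ?thesis using that[of "H0 w / G0 w"] P by (simp add: field_simps)
  qed
  have Wr: "wronskian H0 H1 w = k\<^sup>2 * wronskian G0 G1 w"
  proof -
    define a b a' b' c' d' where "a = G0 w" and "b = G1 w" and "a' = deriv G0 w" and "b' = deriv G1 w" and "c' = deriv H0 w" and "d' = deriv H1 w"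
    note ds = this
    have "a' * (k * b) + d' * a = c' * b + b' * (k * a)" using D unfolding k ds by (simp add: algebra_simps)
    then have e: "d' * a - c' * b = k * (b' * a - a' * b)" by (simp add: algebra_simps)
    have "wronskian H0 H1 w = k * (d' * a - c' * b)" unfolding wronskian_def k ds[symmetric] by (simp add: algebra_simps)
    also have "\<dots> = k\<^sup>2 * wronskian G0 G1 w" unfolding e wronskian_def ds[symmetric] by (simp add: algebra_simps power2_eq_square)
    finally show ?thesis .
  qed
  have k0: "k \<noteq> 0" using k nH by auto
  have "norm2 H0 H1 w = (norm k)\<^sup>2 * norm2 G0 G1 w"
    by (simp add: norm2_def k norm_mult power_mult_distrib algebra_simps)
  then show ?thesis using k0 norm2_pos[of G0 w G1, OF nG]
    by (simp add: fs_density_def Wr norm_mult norm_power power_mult_distrib flip: power_mult)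
qed

lemma fs_density_continuous:
  assumes "lift_on V F G0 G1" shows "continuous_on V (fs_density G0 G1)"
proof -
  obtain p where "laplacian_on V (\<lambda>w. ln (norm2 G0 G1 w)) p (\<lambda>w. 4 * pi * fs_density G0 G1 w)"
    using laplacian_on_ln_norm2_lift[OF assms] by blast
  then have "continuous_on V (\<lambda>w. inverse (4*pi) * (4 * pi * fs_density G0 G1 w))"
    by (intro continuous_intros laplacian_on_continuous(3))
  then show ?thesis by (rule continuous_on_eq) simp
qed

lemma fs_density_nonneg: "0 \<le> fs_density G0 G1 w" by (simp add: fs_density_def)

lemma chordal_continuous:
  assumes "lift_on V F G0 G1" shows "continuous_on V (\<lambda>w. chordal (F w) a)"
proof -
  obtain p where "laplacian_on V (\<lambda>w. chordal (F w) a) p (\<lambda>w. 4 * pi * fs_density G0 G1 w * (1 - 2 * chordal (F w) a))"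
    using laplacian_on_chordal[OF assms] by blast
  then show ?thesis by (rule laplacian_on_continuous(1))
qed

lemma chordal_bounds:
  assumes "lift_on V F G0 G1" "w \<in> V"
  shows "0 \<le> chordal (F w) a" "chordal (F w) a \<le> 1" "chordal (F w) a = 0 \<longleftrightarrow> F w = a"
proof -
  have G: "G0 w \<noteq> 0 \<or> G1 w \<noteq> 0" "F w = p1_point (G0 w) (G1 w)" using assms by (auto simp: lift_on_def)
  show "0 \<le> chordal (F w) a" by (rule chordal_nonneg)
  show "chordal (F w) a \<le> 1" using chordal_lift_le_1[of G0 w G1 a, OF G(1)] G(2) by simp
  show "chordal (F w) a = 0 \<longleftrightarrow> F w = a"
    using chordal_lift[of G0 w G1 a, OF G(1)] lin_form_eq_0_iff[of G0 w G1 a, OF G(1)] norm2_pos[of G0 w G1, OF G(1)] G(2) by auto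
qed

lemma laplacian_on_function_of_chordal:
  assumes lift: "lift_on V F G0 G1"
    and k: "\<And>x. 0 \<le> x \<Longrightarrow> x \<le> 1 \<Longrightarrow> (k has_field_derivative k' x) (at x)"
    and k': "\<And>x. 0 \<le> x \<Longrightarrow> x \<le> 1 \<Longrightarrow> (k' has_field_derivative k'' x) (at x)"
    and k'': "continuous_on {0..1} k''"
  obtains p where "laplacian_on V (\<lambda>w. k (chordal (F w) a)) p
    (\<lambda>w. 4 * pi * fs_density G0 G1 w * (k' (chordal (F w) a) * (1 - 2 * chordal (F w) a)
        + k'' (chordal (F w) a) * chordal (F w) a * (1 - chordal (F w) a)))"
proof -
  obtain p where p: "laplacian_on V (\<lambda>w. chordal (F w) a) p (\<lambda>w. 4 * pi * fs_density G0 G1 w * (1 - 2 * chordal (F w) a))"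
    "\<And>w. w \<in> V \<Longrightarrow> (norm (p w))\<^sup>2 = pi * fs_density G0 G1 w * chordal (F w) a * (1 - chordal (F w) a)"
    using laplacian_on_chordal[OF lift] by blast
  note b = chordal_bounds[OF lift, of _ a]
  have c: "continuous_on V (\<lambda>w. k'' (chordal (F w) a))"
    by (rule continuous_on_compose2[OF k'' laplacian_on_continuous(1)[OF p(1)]]) (use b in auto)
  note l = laplacian_on_compose[OF p(1) k k' c, OF b(1,2) b(1,2)]
  show ?thesis
  proof (rule that, rule laplacian_on_cong[OF l refl refl])
    fix w assume w: "w \<in> V"
    show "k' (chordal (F w) a) * (4 * pi * fs_density G0 G1 w * (1 - 2 * chordal (F w) a)) + 4 * k'' (chordal (F w) a) * (norm (p w))\<^sup>2
      = 4 * pi * fs_density G0 G1 w * (k' (chordal (F w) a) * (1 - 2 * chordal (F w) a)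
        + k'' (chordal (F w) a) * chordal (F w) a * (1 - chordal (F w) a))"
      unfolding p(2)[OF w] by (simp only: algebra_simps)
  qed
qed

text \<open>
  A nonconstant meromorphic function on the disc \<open>\<bar>w\<bar> < R\<close>, with global homogeneous coordinates on
  each smaller disc; \<open>rho\<close> is the density of the pull-back of the Fubini--Study form.
\<close>

locale sphere_map =
  fixes R :: ereal and F :: "complex \<Rightarrow> p1" and rho :: "complex \<Rightarrow> real"
  assumes lift_ball: "\<And>r. 0 < r \<Longrightarrow> ereal r < R \<Longrightarrow> \<exists>G0 G1. lift_on (ball 0 r) F G0 G1"
    and rho_eq: "\<And>r G0 G1 w. ereal r < R \<Longrightarrow> lift_on (ball 0 r) F G0 G1 \<Longrightarrow> w \<in> ball 0 r \<Longrightarrow> rho w = fs_density G0 G1 w"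
    and R_pos: "0 < R"
    and nonconst: "\<exists>w w'. ereal (norm w) < R \<and> ereal (norm w') < R \<and> F w \<noteq> F w'"
begin

lemma lift_around:
  assumes "ereal r < R"
  obtains r' G0 G1 where "r < r'" "0 < r'" "ereal r' < R" "lift_on (ball 0 r') F G0 G1"
proof -
  have "max (ereal r) 0 < R" using assms R_pos by simp
  then obtain r' where r': "max (ereal r) 0 < ereal r'" "ereal r' < R" using ereal_dense2 by blast
  then have "r < r'" "0 < r'" by (auto simp: zero_ereal_def)
  then show ?thesis using lift_ball[of r'] r' that by blast
qed

lemma chord_continuous: "ereal r < R \<Longrightarrow> continuous_on (cball 0 r) (\<lambda>w. chordal (F w) a)"
  by (rule lift_around[of r], assumption, rule continuous_on_subset[OF chordal_continuous]) auto

lemma chord_bounds: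
  assumes "ereal (norm w) < R"
  shows "0 \<le> chordal (F w) a" "chordal (F w) a \<le> 1" "chordal (F w) a = 0 \<longleftrightarrow> F w = a"
proof -
  obtain r' G0 G1 where "norm w < r'" "lift_on (ball 0 r') F G0 G1" using lift_around[OF assms] by blast
  then show "0 \<le> chordal (F w) a" "chordal (F w) a \<le> 1" "chordal (F w) a = 0 \<longleftrightarrow> F w = a"
    using chordal_bounds[of "ball 0 r'" F G0 G1 w a] by auto
qed

lemma rho_continuous: assumes "ereal r < R" shows "continuous_on (cball 0 r) rho"
proof -
  obtain r' G0 G1 where l: "r < r'" "ereal r' < R" "lift_on (ball 0 r') F G0 G1" using lift_around[OF assms] by blast
  have "continuous_on (cball 0 r) (fs_density G0 G1)"
    by (rule continuous_on_subset[OF fs_density_continuous[OF l(3)]]) (use l(1) in auto)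
  then show ?thesis by (rule continuous_on_eq) (use rho_eq[OF l(2,3)] l(1) in auto)
qed

lemma rho_nonneg: assumes "ereal (norm w) < R" shows "0 \<le> rho w"
proof -
  obtain r' G0 G1 where l: "norm w < r'" "ereal r' < R" "lift_on (ball 0 r') F G0 G1" using lift_around[OF assms] by blast
  then show ?thesis using rho_eq[OF l(2,3), of w] fs_density_nonneg by auto
qed

definition char_T :: "real \<Rightarrow> real \<Rightarrow> real" where
  "char_T s r = iterated (\<lambda>w. 2 * pi * rho w) s r"

lemma norm_less_R: "ereal r < R \<Longrightarrow> norm (w::complex) \<le> r \<Longrightarrow> ereal (norm w) < R"
  by (auto intro: le_less_trans[of "ereal _" "ereal r"])

lemma char_T_nonneg:
  assumes "ereal r < R" "0 < s" shows "0 \<le> char_T s r"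
  unfolding char_T_def using assms rho_continuous rho_nonneg norm_less_R
  by (intro iterated_nonneg continuous_intros) auto

lemma iterated_4pi_rho: "iterated (\<lambda>w. 4 * pi * rho w) s r = 2 * char_T s r"
  unfolding char_T_def iterated_cmult[symmetric] by (simp add: mult.assoc)

lemma function_of_chordal_growth:
  assumes r: "0 < s" "s \<le> r" "ereal r < R"
    and k: "\<And>x. 0 \<le> x \<Longrightarrow> x \<le> 1 \<Longrightarrow> (k has_field_derivative k' x) (at x)"
    and k': "\<And>x. 0 \<le> x \<Longrightarrow> x \<le> 1 \<Longrightarrow> (k' has_field_derivative k'' x) (at x)"
    and k'': "continuous_on {0..1} k''"
  defines "Lk \<equiv> \<lambda>x. k' x * (1 - 2 * x) + k'' x * x * (1 - x)"
  shows "iterated (\<lambda>w. 4 * pi * rho w * Lk (chordal (F w) a)) s r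
     = circle_mean (\<lambda>w. k (chordal (F w) a)) r - circle_mean (\<lambda>w. k (chordal (F w) a)) s"
proof -
  obtain r' G0 G1 where l: "r < r'" "ereal r' < R" "lift_on (ball 0 r') F G0 G1" using lift_around[OF r(3)] by blast
  obtain p where p: "laplacian_on (ball 0 r') (\<lambda>w. k (chordal (F w) a)) p
    (\<lambda>w. 4 * pi * fs_density G0 G1 w * (k' (chordal (F w) a) * (1 - 2 * chordal (F w) a)
        + k'' (chordal (F w) a) * chordal (F w) a * (1 - chordal (F w) a)))"
    using laplacian_on_function_of_chordal[OF l(3) k k' k''] by blast
  have "laplacian_on (ball 0 r') (\<lambda>w. k (chordal (F w) a)) p (\<lambda>w. 4 * pi * rho w * Lk (chordal (F w) a))"
    by (rule laplacian_on_cong[OF p refl refl]) (use rho_eq[OF l(2,3)] in \<open>simp add: Lk_def\<close>)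
  then show ?thesis by (rule iterated_laplacian) (use l(1) r in auto)
qed

lemma circle_pos_lower:
  assumes "ereal r < R" "0 \<le> r" "\<And>w. norm w = r \<Longrightarrow> F w \<noteq> a"
  obtains m where "0 < m" "\<And>w. norm w = r \<Longrightarrow> m \<le> chordal (F w) a"
proof -
  have c: "continuous_on (sphere 0 r) (\<lambda>w. chordal (F w) a)"
    using chord_continuous[OF assms(1)] by (rule continuous_on_subset) auto
  have "sphere (0::complex) r \<noteq> {}" using assms(2) by simp
  then obtain w0 where w0: "w0 \<in> sphere 0 r" "\<And>w. w \<in> sphere 0 r \<Longrightarrow> chordal (F w0) a \<le> chordal (F w) a"
    using continuous_attains_inf[OF compact_sphere _ c] by blast
  have n0: "ereal (norm w0) < R" using w0(1) norm_less_R[OF assms(1), of w0] by simp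
  have "0 < chordal (F w0) a"
    using chord_bounds[OF n0, of a] assms(3)[of w0] w0(1) by simp
  then show ?thesis using w0(2) by (intro that[of "chordal (F w0) a"]) auto
qed

lemma circle_continuous:
  assumes "ereal r < R" "\<And>w. norm w = r \<Longrightarrow> F w \<noteq> a"
  shows "continuous_on (sphere 0 r) (\<lambda>w. ln (chordal (F w) a))"
proof -
  have c: "continuous_on (sphere 0 r) (\<lambda>w. chordal (F w) a)"
    using chord_continuous[OF assms(1)] by (rule continuous_on_subset) auto
  show ?thesis using chord_bounds(3)[of _ a] norm_less_R[OF assms(1)] assms(2) by (intro continuous_on_ln c) auto
qed

text \<open>
  The first main theorem as an inequality: the Laplacian of \<open>- ln (x + e)\<close> in the chordal distance \<open>x\<close>
  is at most \<open>4 pi rho\<close>, for every \<open>e > 0\<close>. On the circle of radius \<open>r\<close> the distance is bounded below, so \<open>e\<close>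
  can be removed at the cost of \<open>\<epsilon>\<close>.
\<close>

theorem proximity_bound:
  assumes r: "0 < s" "s \<le> r" "ereal r < R"
    and gen: "\<And>w. norm w = r \<or> norm w = s \<Longrightarrow> F w \<noteq> a"
  shows "circle_mean (\<lambda>w. - ln (chordal (F w) a)) r \<le> 2 * char_T s r + circle_mean (\<lambda>w. - ln (chordal (F w) a)) s"
proof -
  have sR: "ereal s < R" using r by (metis ereal_less_eq(3) le_less_trans)
  obtain m where m: "0 < m" "\<And>w. norm w = r \<Longrightarrow> m \<le> chordal (F w) a"
    using circle_pos_lower[OF r(3), of a] r gen by auto
  have step: "circle_mean (\<lambda>w. - ln (chordal (F w) a)) r - \<epsilon> \<le> 2 * char_T s r + circle_mean (\<lambda>w. - ln (chordal (F w) a)) s"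
    if \<epsilon>: "0 < \<epsilon>" for \<epsilon>
  proof -
    \<comment> \<open>then \<open>ln (x + e) \<le> ln x + ln (1 + \<epsilon>)\<close> for \<open>x \<ge> m\<close>\<close>
    define e where "e = \<epsilon> * m"
    have e: "0 < e" using \<epsilon> m by (simp add: e_def)
    let ?k = "\<lambda>x. - ln (x + e)" and ?k' = "\<lambda>x. - inverse (x + e)" and ?k'' = "\<lambda>x. inverse ((x + e)\<^sup>2)"
    have it: "iterated (\<lambda>w. 4 * pi * rho w * (?k' (chordal (F w) a) * (1 - 2 * chordal (F w) a) + ?k'' (chordal (F w) a) * chordal (F w) a * (1 - chordal (F w) a))) s r
      = circle_mean (\<lambda>w. ?k (chordal (F w) a)) r - circle_mean (\<lambda>w. ?k (chordal (F w) a)) s"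
    proof (rule function_of_chordal_growth[OF r])
      fix x :: real assume x: "0 \<le> x" "x \<le> 1"
      show "(?k has_field_derivative ?k' x) (at x)" using x e by (auto intro!: derivative_eq_intros simp: field_simps)
      show "(?k' has_field_derivative ?k'' x) (at x)" using x e by (auto intro!: derivative_eq_intros simp: field_simps power2_eq_square)
    next
      show "continuous_on {0..1} ?k''" using e by (intro continuous_intros) (auto simp: add_nonneg_eq_0_iff)
    qed
    have alg: "?k' x * (1 - 2 * x) + ?k'' x * x * (1 - x) \<le> 1" if x: "0 \<le> x" "x \<le> 1" for x
    proof -
      have xe: "x + e > 0" using x e by simp
      have "x * (1 - x) \<le> (x + e) * (1 - x)" using x e by (intro mult_right_mono) auto
      then have "- (1 - 2 * x) * (x + e) + x * (1 - x) \<le> x * (x + e)" by (simp add: algebra_simps)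
      also have "\<dots> \<le> (x + e) * (x + e)" using x e by (intro mult_right_mono) auto
      finally have "(- (1 - 2 * x) * (x + e) + x * (1 - x)) / (x + e)\<^sup>2 \<le> 1"
        using xe by (simp add: divide_le_eq power2_eq_square)
      moreover have "?k' x * (1 - 2 * x) + ?k'' x * x * (1 - x) = (- (1 - 2 * x) * (x + e) + x * (1 - x)) / (x + e)\<^sup>2"
      proof -
        have "- inverse d * A + inverse (d\<^sup>2) * x * B = (- A * d + x * B) / d\<^sup>2" if "d \<noteq> 0" for d A B :: real
          using that by (simp add: field_simps power2_eq_square)
        then show ?thesis using xe by (simp only:)
      qed
      ultimately show ?thesis by simp
    qed
    have cc: "continuous_on (cball 0 r) (\<lambda>w. chordal (F w) a)" by (rule chord_continuous[OF r(3)])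
    have b: "0 \<le> chordal (F w) a" "chordal (F w) a \<le> 1" "0 \<le> rho w" if "w \<in> cball 0 r" for w
      using chord_bounds[of w a] rho_nonneg[of w] norm_less_R[OF r(3), of w] that by auto
    have ne: "chordal (F w) a + e \<noteq> 0" if "w \<in> cball 0 r" for w using b(1)[OF that] e by auto
    have "circle_mean (\<lambda>w. ?k (chordal (F w) a)) r - circle_mean (\<lambda>w. ?k (chordal (F w) a)) s \<le> iterated (\<lambda>w. 4 * pi * rho w) s r"
      unfolding it[symmetric]
    proof (rule iterated_mono)
      show "continuous_on (cball 0 r) (\<lambda>w. 4 * pi * rho w)" using rho_continuous[OF r(3)] by (intro continuous_intros)
      show "continuous_on (cball 0 r) (\<lambda>w. 4 * pi * rho w * (?k' (chordal (F w) a) * (1 - 2 * chordal (F w) a) + ?k'' (chordal (F w) a) * chordal (F w) a * (1 - chordal (F w) a)))"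
        using rho_continuous[OF r(3)] cc ne by (intro continuous_intros) auto
      fix w :: complex assume w: "w \<in> cball 0 r"
      have "4 * pi * rho w * (?k' (chordal (F w) a) * (1 - 2 * chordal (F w) a) + ?k'' (chordal (F w) a) * chordal (F w) a * (1 - chordal (F w) a)) \<le> 4 * pi * rho w * 1"
        using b[OF w] by (intro mult_left_mono alg) auto
      then show "4 * pi * rho w * (?k' (chordal (F w) a) * (1 - 2 * chordal (F w) a) + ?k'' (chordal (F w) a) * chordal (F w) a * (1 - chordal (F w) a)) \<le> 4 * pi * rho w" by simp
    qed (use r in auto)
    then have 1: "circle_mean (\<lambda>w. ?k (chordal (F w) a)) r \<le> 2 * char_T s r + circle_mean (\<lambda>w. ?k (chordal (F w) a)) s"
      unfolding iterated_4pi_rho by simp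
    have cs: "continuous_on (sphere 0 t) (\<lambda>w. ?k (chordal (F w) a))" if "t \<le> r" for t
    proof -
      have "sphere (0::complex) t \<subseteq> cball 0 r" using that by auto
      moreover have "continuous_on (cball 0 r) (\<lambda>w. ?k (chordal (F w) a))"
        using ne cc by (intro continuous_intros) auto
      ultimately show ?thesis using continuous_on_subset by blast
    qed
    have 2: "circle_mean (\<lambda>w. ?k (chordal (F w) a)) s \<le> circle_mean (\<lambda>w. - ln (chordal (F w) a)) s"
    proof (rule circle_mean_mono)
      show "continuous_on (sphere 0 s) (\<lambda>w. - ln (chordal (F w) a))"
        by (intro continuous_on_minus circle_continuous sR) (use gen in auto)
      fix w :: complex assume w: "w \<in> sphere 0 s"
      then have "w \<in> cball 0 r" "F w \<noteq> a" using r gen by auto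
      then have "0 < chordal (F w) a" using b(1)[of w] chord_bounds(3)[of w a] norm_less_R[OF r(3), of w] by auto
      then show "?k (chordal (F w) a) \<le> - ln (chordal (F w) a)" using e by simp
    qed (use cs[of s] r in auto)
    have 3: "circle_mean (\<lambda>w. - ln (chordal (F w) a) + - \<epsilon>) r \<le> circle_mean (\<lambda>w. ?k (chordal (F w) a)) r"
    proof (rule circle_mean_mono)
      show "continuous_on (sphere 0 r) (\<lambda>w. - ln (chordal (F w) a) + - \<epsilon>)"
        by (intro continuous_on_add continuous_on_minus continuous_on_const circle_continuous r) (use gen in auto)
      fix w :: complex assume w: "w \<in> sphere 0 r"
      then have c: "m \<le> chordal (F w) a" using m(2) by simp
      then have cp: "0 < chordal (F w) a" using m by linarith
      have "ln (chordal (F w) a + e) \<le> ln (chordal (F w) a * (1 + \<epsilon>))"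
        using c cp e \<epsilon> m add_pos_pos[OF mult_pos_pos[OF \<epsilon> m(1)] cp] by (intro ln_mono) (auto simp: e_def algebra_simps intro: mult_left_mono)
      also have "\<dots> = ln (chordal (F w) a) + ln (1 + \<epsilon>)" using cp \<epsilon> by (simp add: ln_mult)
      also have "ln (1 + \<epsilon>) \<le> \<epsilon>" using \<epsilon> by (simp add: ln_add_one_self_le_self)
      finally show "- ln (chordal (F w) a) + - \<epsilon> \<le> ?k (chordal (F w) a)" by simp
    qed (use cs[of r] r in auto)
    have "circle_mean (\<lambda>w. - ln (chordal (F w) a) + - \<epsilon>) r = circle_mean (\<lambda>w. - ln (chordal (F w) a)) r + circle_mean (\<lambda>w. - \<epsilon>) r"
      by (intro circle_mean_add continuous_on_minus continuous_on_const circle_continuous r) (use gen r in auto)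
    then show ?thesis using 1 2 3 by simp
  qed
  show ?thesis
  proof (rule field_le_epsilon)
    fix \<epsilon> :: real assume "0 < \<epsilon>"
    then show "circle_mean (\<lambda>w. - ln (chordal (F w) a)) r \<le> 2 * char_T s r + circle_mean (\<lambda>w. - ln (chordal (F w) a)) s + \<epsilon>"
      using step[of \<epsilon>] by simp
  qed
qed

text \<open>
  For \<open>e\<close> tending to \<open>0\<close> this behaves like \<open>1 / (x (ln x)\<^sup>2)\<close> near \<open>x = 0\<close>. As \<open>x\<close> is a squared
  distance, this singularity is integrable on the sphere, but only just.
\<close>

definition spike :: "real \<Rightarrow> real \<Rightarrow> real" where
  "spike e x = x * (1 - x) / ((x + e)\<^sup>2 * (2 - ln (x + e))\<^sup>2)"

text \<open>
  The function \<open>- ln (2 - ln (x + e))\<close> of the chordal distance is bounded above by \<open>0\<close>, and its Laplacian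
  is \<open>4 pi rho\<close> times the spike, up to an error of at least \<open>- 4 pi rho\<close>. So the Jensen formula bounds
  the iterated integral of the spike by the characteristic function and initial data.
\<close>

theorem spike_bound:
  assumes r: "0 < s" "s \<le> r" "ereal r < R" and e: "0 < e" "e \<le> 1"
    and gen: "\<And>w. norm w = s \<Longrightarrow> F w \<noteq> a"
  shows "iterated (\<lambda>w. 4 * pi * rho w * spike e (chordal (F w) a)) s r
      \<le> 2 * char_T s r + circle_mean (\<lambda>w. ln (2 - ln (chordal (F w) a))) s"
proof -
  have sR: "ereal s < R" using r by (metis ereal_less_eq(3) le_less_trans)
  define Y where "Y x = 2 - ln (x + e)" for x
  have Y: "1 \<le> Y x" if "0 \<le> x" "x \<le> 1" for x
  proof -
    have "ln (x + e) \<le> ln 2" using that e by simp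
    also have "ln 2 \<le> (1::real)" using ln_2_less_1 by simp
    finally show ?thesis by (simp add: Y_def)
  qed
  let ?k = "\<lambda>x. - ln (Y x)" and ?k' = "\<lambda>x. inverse ((x + e) * Y x)"
    and ?k'' = "\<lambda>x. - inverse ((x + e)\<^sup>2 * Y x) + inverse ((x + e)\<^sup>2 * (Y x)\<^sup>2)"
  have dY: "(Y has_field_derivative - inverse (x + e)) (at x)" if "0 \<le> x" for x
    unfolding Y_def using that e by (auto intro!: derivative_eq_intros simp: field_simps)
  have cY: "continuous_on {0..1} Y"
    unfolding Y_def using e by (intro continuous_intros) auto
  have it: "iterated (\<lambda>w. 4 * pi * rho w * (?k' (chordal (F w) a) * (1 - 2 * chordal (F w) a) + ?k'' (chordal (F w) a) * chordal (F w) a * (1 - chordal (F w) a))) s r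
      = circle_mean (\<lambda>w. ?k (chordal (F w) a)) r - circle_mean (\<lambda>w. ?k (chordal (F w) a)) s"
  proof (rule function_of_chordal_growth[OF r])
    fix x :: real assume x: "0 \<le> x" "x \<le> 1"
    have p: "x + e > 0" "Y x > 0" using x e Y[OF x] by auto
    show "(?k has_field_derivative ?k' x) (at x)"
      using p by (auto intro!: derivative_eq_intros dY x simp: field_simps)
    have "((\<lambda>x. (x + e) * Y x) has_field_derivative 1 * Y x + - inverse (x + e) * (x + e)) (at x)"
      by (rule DERIV_mult) (auto intro!: derivative_eq_intros dY x)
    then have "((\<lambda>x. (x + e) * Y x) has_field_derivative (Y x - 1)) (at x)"
      using p by simp
    then have "(?k' has_field_derivative - (inverse ((x + e) * Y x) * (Y x - 1) * inverse ((x + e) * Y x))) (at x)"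
      using p by (intro DERIV_inverse') auto
    moreover have "- (inverse (d * y) * (y - 1) * inverse (d * y)) = - inverse (d\<^sup>2 * y) + inverse (d\<^sup>2 * y\<^sup>2)"
      if "d \<noteq> 0" "y \<noteq> 0" for d y :: real
      using that by (simp add: field_simps power2_eq_square)
    ultimately show "(?k' has_field_derivative ?k'' x) (at x)" using p by simp
  next
    have "(x + e)\<^sup>2 * Y x \<noteq> 0" "(x + e)\<^sup>2 * (Y x)\<^sup>2 \<noteq> 0" if "x \<in> {0..1}" for x using that e Y[of x] by auto
    then show "continuous_on {0..1} ?k''" by (intro continuous_intros cY) auto
  qed
  have alg: "spike e x - 1 \<le> ?k' x * (1 - 2 * x) + ?k'' x * x * (1 - x)" if x: "0 \<le> x" "x \<le> 1" for x
  proof -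
    have p: "x + e > 0" "Y x \<ge> 1" using x e Y[OF x] by auto
    have "?k' x * (1 - 2 * x) + ?k'' x * x * (1 - x) = spike e x + (1 - 2 * x - x * (1 - x) / (x + e)) / ((x + e) * Y x)"
    proof -
      have "inverse (d * y) * (1 - 2 * x) + (- inverse (d\<^sup>2 * y) + inverse (d\<^sup>2 * y\<^sup>2)) * x * (1 - x)
        = x * (1 - x) / (d\<^sup>2 * y\<^sup>2) + (1 - 2 * x - x * (1 - x) / d) / (d * y)" if "d \<noteq> 0" "y \<noteq> 0" for d y :: real
        using that by (simp add: field_simps power2_eq_square)
      from this[of "x + e" "Y x"] show ?thesis using p unfolding spike_def Y_def[symmetric] by simp
    qed
    moreover have "- 1 \<le> (1 - 2 * x - x * (1 - x) / (x + e)) / ((x + e) * Y x)"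
    proof -
      have "x * (1 - x) / (x + e) \<le> 1 - x" 
      proof -
        have "x * (1 - x) \<le> (1 - x) * (x + e)"
          using mult_right_mono[of x "x + e" "1 - x"] x e by (simp add: mult.commute)
        then show ?thesis using p by (simp add: divide_le_eq)
      qed
      then have "- x \<le> 1 - 2 * x - x * (1 - x) / (x + e)" by simp
      moreover have "- ((x + e) * Y x) \<le> - x"
      proof -
        have "x * 1 \<le> (x + e) * Y x" using x e p by (intro mult_mono) auto
        then show ?thesis by simp
      qed
      ultimately have "- ((x + e) * Y x) \<le> 1 - 2 * x - x * (1 - x) / (x + e)" by linarith
      moreover have "0 < (x + e) * Y x" using p by simp
      ultimately show ?thesis by (simp add: le_divide_eq)
    qed
    ultimately show ?thesis by simp
  qed
  have cc: "continuous_on (cball 0 r) (\<lambda>w. chordal (F w) a)" by (rule chord_continuous[OF r(3)])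
  have b: "0 \<le> chordal (F w) a" "chordal (F w) a \<le> 1" "0 \<le> rho w" if "w \<in> cball 0 r" for w
    using chord_bounds[of w a] rho_nonneg[of w] norm_less_R[OF r(3), of w] that by auto
  have cYc: "continuous_on (cball 0 r) (\<lambda>w. Y (chordal (F w) a))"
    by (rule continuous_on_compose2[OF cY cc]) (use b in auto)
  have Yb: "1 \<le> Y (chordal (F w) a)" if "w \<in> cball 0 r" for w using Y b that by blast
  have ne: "(chordal (F w) a + e)\<^sup>2 * Y (chordal (F w) a) \<noteq> 0" "(chordal (F w) a + e)\<^sup>2 * (Y (chordal (F w) a))\<^sup>2 \<noteq> 0"
     "(chordal (F w) a + e) * Y (chordal (F w) a) \<noteq> 0" if "w \<in> cball 0 r" for w
    using b(1)[OF that] e Yb[OF that] by auto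
  have c1: "continuous_on (cball 0 r) (\<lambda>w. 4 * pi * rho w * (spike e (chordal (F w) a) - 1))"
    unfolding spike_def Y_def[symmetric] using rho_continuous[OF r(3)] cc cYc ne by (intro continuous_intros) auto
  have c2: "continuous_on (cball 0 r) (\<lambda>w. 4 * pi * rho w)" using rho_continuous[OF r(3)] by (intro continuous_intros)
  have "iterated (\<lambda>w. 4 * pi * rho w * (spike e (chordal (F w) a) - 1)) s r
     \<le> circle_mean (\<lambda>w. ?k (chordal (F w) a)) r - circle_mean (\<lambda>w. ?k (chordal (F w) a)) s"
    unfolding it[symmetric]
  proof (rule iterated_mono[OF c1])
    show "continuous_on (cball 0 r) (\<lambda>w. 4 * pi * rho w * (?k' (chordal (F w) a) * (1 - 2 * chordal (F w) a) + ?k'' (chordal (F w) a) * chordal (F w) a * (1 - chordal (F w) a)))"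
      using rho_continuous[OF r(3)] cc cYc ne by (intro continuous_intros) auto
    fix w :: complex assume w: "w \<in> cball 0 r"
    show "4 * pi * rho w * (spike e (chordal (F w) a) - 1)
       \<le> 4 * pi * rho w * (?k' (chordal (F w) a) * (1 - 2 * chordal (F w) a) + ?k'' (chordal (F w) a) * chordal (F w) a * (1 - chordal (F w) a))"
      using b[OF w] by (intro mult_left_mono alg) auto
  qed (use r in auto)
  moreover have "circle_mean (\<lambda>w. ?k (chordal (F w) a)) r \<le> 0"
  proof -
    have "continuous_on (sphere 0 r) (\<lambda>w. ?k (chordal (F w) a))"
      using continuous_on_subset[OF cYc, of "sphere 0 r"] Yb by (intro continuous_intros) (auto, force)
    then have "circle_mean (\<lambda>w. ?k (chordal (F w) a)) r \<le> circle_mean (\<lambda>w. 0) r"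
      by (rule circle_mean_mono) (use Yb r in auto)
    then show ?thesis by simp
  qed
  moreover have "- circle_mean (\<lambda>w. ?k (chordal (F w) a)) s \<le> circle_mean (\<lambda>w. ln (2 - ln (chordal (F w) a))) s"
    unfolding circle_mean_minus[symmetric] minus_minus
  proof (rule circle_mean_mono)
    have sub: "sphere (0::complex) s \<subseteq> cball 0 r" using r by auto
    show "continuous_on (sphere 0 s) (\<lambda>w. ln (Y (chordal (F w) a)))"
      using continuous_on_subset[OF cYc sub] Yb sub by (intro continuous_intros) (auto, force)
    have pos: "0 < chordal (F w) a" "chordal (F w) a \<le> 1" if "w \<in> sphere 0 s" for w
      using that sub b[of w] gen chord_bounds(3)[of w a] norm_less_R[OF r(3), of w] by force+
    then have l: "0 < 2 - ln (chordal (F w) a)" if "w \<in> sphere 0 s" for w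
      using that ln_le_zero_iff[of "chordal (F w) a"] by fastforce
    show "continuous_on (sphere 0 s) (\<lambda>w. ln (2 - ln (chordal (F w) a)))"
      by (intro continuous_on_ln continuous_on_diff continuous_on_const circle_continuous sR ballI) (use gen l in force)+
    fix w :: complex assume w: "w \<in> sphere 0 s"
    have "Y (chordal (F w) a) \<le> 2 - ln (chordal (F w) a)"
      unfolding Y_def using pos[OF w] e by simp
    moreover have "0 < Y (chordal (F w) a)" using Yb[of w] w sub by force
    ultimately show "ln (Y (chordal (F w) a)) \<le> ln (2 - ln (chordal (F w) a))" by simp
  qed (use r in auto)
  moreover have "iterated (\<lambda>w. 4 * pi * rho w * (spike e (chordal (F w) a) - 1) + 4 * pi * rho w) s r
     = iterated (\<lambda>w. 4 * pi * rho w * (spike e (chordal (F w) a) - 1)) s r + iterated (\<lambda>w. 4 * pi * rho w) s r"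
    using c1 c2 r by (intro iterated_add) auto
  ultimately show ?thesis unfolding iterated_4pi_rho by (simp add: algebra_simps)
qed

end

section \<open>Means of logarithms of holomorphic functions\<close>

lemma circle_mean_0 [simp]: "circle_mean u 0 = u 0"
  by (simp add: circle_mean_def)

lemma circle_mean_ln_norm2_nonvanishing:
  assumes H: "H holomorphic_on ball 0 \<rho>" "\<And>w. w \<in> ball 0 \<rho> \<Longrightarrow> H w \<noteq> 0" and t: "0 < t" "t < \<rho>"
  shows "circle_mean (\<lambda>w. ln ((norm (H w))\<^sup>2)) t = ln ((norm (H 0))\<^sup>2)"
proof -
  let ?u = "\<lambda>w. ln ((norm (H w))\<^sup>2)"
  have lap: "laplacian_on (ball 0 \<rho>) ?u (\<lambda>z. deriv H z / H z) (\<lambda>z. 0)"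
    by (rule laplacian_on_ln_norm2[OF H(1) open_ball H(2)])
  have const: "circle_mean ?u t = circle_mean ?u s" if "0 < s" "s \<le> t" for s
  proof -
    have "iterated (\<lambda>z. 0) s t = circle_mean ?u t - circle_mean ?u s"
      by (rule iterated_laplacian[OF lap]) (use that t in auto)
    then show ?thesis using iterated_cmult[of 0 "\<lambda>_. 0" s t] by simp
  qed
  have "continuous_on {0..t} (circle_mean ?u)"
    by (rule continuous_on_circle_mean, rule continuous_on_subset[OF laplacian_on_continuous(1)[OF lap]]) (use t in auto)
  then have "((circle_mean ?u) \<longlongrightarrow> circle_mean ?u 0) (at 0 within {0..t})"
    using t unfolding continuous_on_def by (meson atLeastAtMost_iff less_imp_le order_refl)
  moreover have "((circle_mean ?u) \<longlongrightarrow> circle_mean ?u t) (at 0 within {0..t})"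
  proof (rule tendsto_eventually)
    have "circle_mean ?u x = circle_mean ?u t" if "x \<noteq> 0" "x \<in> {0..t}" for x using const[of x] that by auto
    then show "\<forall>\<^sub>F x in at 0 within {0..t}. circle_mean ?u x = circle_mean ?u t"
      unfolding eventually_at_filter by (intro always_eventually) blast
  qed
  moreover have "at 0 within {0..t} \<noteq> bot"
    using t by (simp add: at_within_Icc_at_right)
  ultimately have "circle_mean ?u t = circle_mean ?u 0"
    using tendsto_unique by blast
  then show ?thesis by simp
qed

text \<open>
  For \<open>\<bar>p\<bar> < t\<close> the distance \<open>\<bar>w - p\<bar>\<close> is replaced on the circle by the modulus of a linear function whose
  zero is the reflection of \<open>p\<close>, outside of the disc.
\<close>

lemma circle_mean_ln_dist:
  assumes t: "0 < t" "norm p \<noteq> t"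
  shows "circle_mean (\<lambda>w. ln ((norm (w - p))\<^sup>2)) t = 2 * ln (max t (norm p))"
proof (cases "t < norm p")
  case True
  have "circle_mean (\<lambda>w. ln ((norm (w - p))\<^sup>2)) t = ln ((norm (0 - p))\<^sup>2)"
    by (rule circle_mean_ln_norm2_nonvanishing[of _ "norm p"]) (use True t in \<open>auto intro!: holomorphic_intros\<close>)
  then show ?thesis using True t by (simp add: ln_realpow)
next
  case False
  then have p: "norm p < t" using t by simp
  define H where "H w = of_real t - cnj p / of_real t * w" for w
  have eq: "norm (w - p) = norm (H w)" if "w \<in> sphere 0 t" for w
  proof -
    have nw: "norm w = t" using that by simp
    have "w * cnj w = of_real (t\<^sup>2)" using nw complex_norm_square[of w] by simp
    then have "w * cnj (H w) = of_real t * (w - p)"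
      using t by (simp add: H_def field_simps power2_eq_square)
    then have "norm w * norm (H w) = t * norm (w - p)"
      using t by (metis complex_mod_cnj norm_mult norm_of_real abs_of_pos)
    then show ?thesis using nw t by simp
  qed
  have "circle_mean (\<lambda>w. ln ((norm (w - p))\<^sup>2)) t = circle_mean (\<lambda>w. ln ((norm (H w))\<^sup>2)) t"
    by (rule circle_mean_cong) (use eq t in auto)
  also have "\<dots> = ln ((norm (H 0))\<^sup>2)"
  proof (rule circle_mean_ln_norm2_nonvanishing[of _ "if p = 0 then 2 * t else t * t / norm p"])
    show "H holomorphic_on S" for S unfolding H_def using t by (intro holomorphic_intros) auto
    show "H w \<noteq> 0" if "w \<in> ball 0 (if p = 0 then 2 * t else t * t / norm p)" for w
    proof
      assume "H w = 0"
      then have "of_real t * of_real t = cnj p * w" using t by (simp add: H_def field_simps)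
      then have "t * t = norm p * norm w" using t by (metis complex_mod_cnj norm_mult norm_of_real abs_of_pos)
      then show False using that t by (auto simp: field_simps split: if_splits)
    qed
    show "t < (if p = 0 then 2 * t else t * t / norm p)" using p t by (auto simp: field_simps)
  qed (use t in auto)
  also have "\<dots> = 2 * ln t" using t by (simp add: H_def ln_realpow)
  finally show ?thesis using p by (simp add: max_def)
qed

text \<open>
  Subharmonicity of \<open>ln \<bar>H\<bar>\<^sup>2\<close>, obtained from the smooth functions \<open>ln (\<bar>H\<bar>\<^sup>2 + e)\<close>, whose Laplacian is
  nonnegative.
\<close>

lemma circle_mean_ln_norm2_mono:
  assumes H: "H holomorphic_on ball 0 \<rho>" and st: "0 < s" "s \<le> t" "t < \<rho>"
    and nz: "\<And>w. norm w = s \<or> norm w = t \<Longrightarrow> H w \<noteq> 0"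
  shows "circle_mean (\<lambda>w. ln ((norm (H w))\<^sup>2)) s \<le> circle_mean (\<lambda>w. ln ((norm (H w))\<^sup>2)) t"
proof -
  let ?N = "\<lambda>w. (norm (H w))\<^sup>2"
  have cH: "continuous_on (ball 0 \<rho>) H" using H holomorphic_on_imp_continuous_on by blast
  have cN: "continuous_on (sphere 0 v) ?N" if "v \<le> t" for v
    by (intro continuous_intros continuous_on_subset[OF cH]) (use that st in auto)
  have cl: "continuous_on (sphere 0 v) (\<lambda>w. ln (?N w))" if "v = s \<or> v = t" for v
    by (rule continuous_on_ln[OF cN]) (use that st nz in auto)
  have cle: "continuous_on (sphere 0 v) (\<lambda>w. ln (?N w + e))" if "v \<le> t" "0 < e" for v e
    by (rule continuous_on_ln, intro continuous_on_add cN that continuous_on_const)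
       (use that in \<open>auto simp: add_nonneg_eq_0_iff\<close>)
  have "sphere (0::complex) t \<noteq> {}" using st by simp
  then obtain w0 where w0: "w0 \<in> sphere 0 t" "\<And>w. w \<in> sphere 0 t \<Longrightarrow> ?N w0 \<le> ?N w"
    using continuous_attains_inf[OF compact_sphere _ cN[of t]] by auto
  define m where "m = ?N w0"
  have m: "0 < m" "\<And>w. norm w = t \<Longrightarrow> m \<le> ?N w" using w0 nz[of w0] by (auto simp: m_def)
  have step: "circle_mean (\<lambda>w. ln (?N w)) s \<le> circle_mean (\<lambda>w. ln (?N w)) t + \<epsilon>" if \<epsilon>: "0 < \<epsilon>" for \<epsilon>
  proof -
    \<comment> \<open>then \<open>ln (x + e) \<le> ln x + ln (1 + \<epsilon>)\<close> for \<open>x \<ge> m\<close>\<close>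
    define e where "e = \<epsilon> * m"
    have e: "0 < e" using \<epsilon> m by (simp add: e_def)
    have "continuous_on (ball 0 \<rho>) (\<lambda>w. - inverse ((?N w + e)\<^sup>2))"
    proof -
      have "?N w + e \<noteq> 0" for w using e by (simp add: add_nonneg_eq_0_iff)
      then show ?thesis by (intro continuous_intros cH) auto
    qed
    then have lap: "laplacian_on (ball 0 \<rho>) (\<lambda>w. ln (?N w + e)) (\<lambda>w. of_real (inverse (?N w + e)) * (deriv H w * cnj (H w)))
      (\<lambda>w. inverse (?N w + e) * (4 * (norm (deriv H w))\<^sup>2) + 4 * (- inverse ((?N w + e)\<^sup>2)) * (norm (deriv H w * cnj (H w)))\<^sup>2)"
    proof (intro laplacian_on_compose[OF laplacian_on_norm2[OF H open_ball], where k = "\<lambda>x. ln (x + e)" and k' = "\<lambda>x. inverse (x + e)" and k'' = "\<lambda>x. - inverse ((x + e)\<^sup>2)"])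
      fix w
      have p: "?N w + e > 0" using e by (simp add: add_nonneg_pos)
      show "((\<lambda>x. ln (x + e)) has_field_derivative inverse (?N w + e)) (at (?N w))"
        using p by (auto intro!: derivative_eq_intros simp: divide_inverse)
      show "((\<lambda>x. inverse (x + e)) has_field_derivative - inverse ((?N w + e)\<^sup>2)) (at (?N w))"
        using p by (auto intro!: derivative_eq_intros simp: field_simps power2_eq_square)
    qed
    have sub: "cball 0 t \<subseteq> ball (0::complex) \<rho>" using st by auto
    have "0 \<le> iterated (\<lambda>w. inverse (?N w + e) * (4 * (norm (deriv H w))\<^sup>2) + 4 * (- inverse ((?N w + e)\<^sup>2)) * (norm (deriv H w * cnj (H w)))\<^sup>2) s t"
    proof (rule iterated_nonneg)
      show "continuous_on (cball 0 t) (\<lambda>w. inverse (?N w + e) * (4 * (norm (deriv H w))\<^sup>2) + 4 * (- inverse ((?N w + e)\<^sup>2)) * (norm (deriv H w * cnj (H w)))\<^sup>2)"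
        by (rule continuous_on_subset[OF laplacian_on_continuous(3)[OF lap] sub])
      fix w :: complex
      have p: "?N w + e > 0" using e by (simp add: add_nonneg_pos)
      have "inverse d * (4 * x) + 4 * (- inverse (d\<^sup>2)) * (x * y) = 4 * x * (d - y) / d\<^sup>2" if "d \<noteq> 0" for d x y :: real
        using that by (simp add: field_simps power2_eq_square)
      from this[of "?N w + e" "(norm (deriv H w))\<^sup>2" "?N w"]
      show "0 \<le> inverse (?N w + e) * (4 * (norm (deriv H w))\<^sup>2) + 4 * (- inverse ((?N w + e)\<^sup>2)) * (norm (deriv H w * cnj (H w)))\<^sup>2"
        using p e by (simp add: norm_mult power_mult_distrib)
    qed (use st in auto)
    then have 1: "circle_mean (\<lambda>w. ln (?N w + e)) s \<le> circle_mean (\<lambda>w. ln (?N w + e)) t"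
      using iterated_laplacian[OF lap sub st(1,2)] by simp
    have 2: "circle_mean (\<lambda>w. ln (?N w)) s \<le> circle_mean (\<lambda>w. ln (?N w + e)) s"
    proof (rule circle_mean_mono)
      fix w :: complex assume "w \<in> sphere 0 s"
      then have "0 < ?N w" using nz[of w] by simp
      then show "ln (?N w) \<le> ln (?N w + e)" using e by (intro ln_mono) auto
    qed (use cl cle st e in auto)
    have 3: "circle_mean (\<lambda>w. ln (?N w + e)) t \<le> circle_mean (\<lambda>w. ln (?N w) + \<epsilon>) t"
    proof (rule circle_mean_mono)
      fix w :: complex assume w: "w \<in> sphere 0 t"
      then have c: "m \<le> ?N w" using m(2) by simp
      then have cp: "0 < ?N w" using m by linarith
      have "e \<le> \<epsilon> * ?N w" unfolding e_def using c \<epsilon> by (intro mult_left_mono) auto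
      then have "ln (?N w + e) \<le> ln (?N w * (1 + \<epsilon>))"
        using cp e add_pos_pos[OF cp e] by (intro ln_mono) (auto simp: algebra_simps)
      also have "\<dots> = ln (?N w) + ln (1 + \<epsilon>)" using cp \<epsilon> by (intro ln_mult_pos) auto
      also have "ln (1 + \<epsilon>) \<le> \<epsilon>" using \<epsilon> by (simp add: ln_add_one_self_le_self)
      finally show "ln (?N w + e) \<le> ln (?N w) + \<epsilon>" by simp
    qed (use cl cle st e in \<open>auto intro!: continuous_on_add\<close>)
    have "circle_mean (\<lambda>w. ln (?N w) + \<epsilon>) t = circle_mean (\<lambda>w. ln (?N w)) t + circle_mean (\<lambda>w. \<epsilon>) t"
      by (rule circle_mean_add) (use cl st in auto)
    then show ?thesis using 1 2 3 by simp
  qed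
  show ?thesis by (rule field_le_epsilon) (rule step)
qed

section \<open>Extending quotients of holomorphic functions\<close>

lemma quotient_holomorphic_extension:
  assumes "open S" "N holomorphic_on S" "D holomorphic_on S"
    and local: "\<And>p. p \<in> S \<Longrightarrow> D p = 0 \<Longrightarrow> \<exists>e>0. \<exists>h. ball p e \<subseteq> S \<and> h holomorphic_on ball p e \<and> (\<forall>w\<in>ball p e - {p}. N w = h w * D w \<and> D w \<noteq> 0)"
  shows "\<exists>H. H holomorphic_on S \<and> (\<forall>w\<in>S. D w \<noteq> 0 \<longrightarrow> H w = N w / D w)"
proof -
  obtain e h where eh: "\<And>p. p \<in> S \<Longrightarrow> D p = 0 \<Longrightarrow> 0 < e p \<and> ball p (e p) \<subseteq> S \<and> h p holomorphic_on ball p (e p) \<and> (\<forall>w\<in>ball p (e p) - {p}. N w = h p w * D w \<and> D w \<noteq> 0)"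
    using local by metis
  define H where "H w = (if D w = 0 then h w w else N w / D w)" for w
  have "H field_differentiable (at p)" if p: "p \<in> S" for p
  proof (cases "D p = 0")
    case True
    note e = eh[OF p True]
    have "h p field_differentiable (at p)"
      using e holomorphic_on_imp_differentiable_at[of "h p" "ball p (e p)" p] by auto
    then obtain d where "(h p has_field_derivative d) (at p)" by (auto simp: field_differentiable_def)
    then have "(H has_field_derivative d) (at p)"
    proof (rule has_field_derivative_transform_within_open)
      fix w assume w: "w \<in> ball p (e p)"
      show "h p w = H w"
      proof (cases "w = p")
        case False
        then have "N w = h p w * D w \<and> D w \<noteq> 0" using e w by blast
        then show ?thesis by (simp add: H_def)
      qed (use True in \<open>simp add: H_def\<close>)
    qed (use e in auto)
    then show ?thesis by (auto simp: field_differentiable_def)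
  next
    case False
    have "continuous_on S D" using assms(3) holomorphic_on_imp_continuous_on by blast
    then have op: "open (S \<inter> D -` (- {0}))" using assms(1) by (intro continuous_open_preimage) auto
    have "(\<lambda>w. N w / D w) holomorphic_on (S \<inter> D -` (- {0}))"
      by (intro holomorphic_intros holomorphic_on_subset[OF assms(2)] holomorphic_on_subset[OF assms(3)]) auto
    then have "(\<lambda>w. N w / D w) field_differentiable (at p)"
      using op p False holomorphic_on_imp_differentiable_at by blast
    then obtain d where "((\<lambda>w. N w / D w) has_field_derivative d) (at p)" by (auto simp: field_differentiable_def)
    then have "(H has_field_derivative d) (at p)"
      by (rule has_field_derivative_transform_within_open[OF _ op]) (use p False in \<open>auto simp: H_def\<close>)
    then show ?thesis by (auto simp: field_differentiable_def)
  qed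
  then have "H holomorphic_on S"
    by (auto simp: holomorphic_on_def intro: field_differentiable_at_within)
  then show ?thesis by (intro exI[of _ H]) (simp add: H_def)
qed

section \<open>Counting integrals\<close>

lemma sum_UN_le_sum:
  fixes f :: "'b \<Rightarrow> real"
  assumes "finite I" "\<And>i. i \<in> I \<Longrightarrow> finite (A i)" "\<And>x. 0 \<le> f x"
  shows "sum f (\<Union>i\<in>I. A i) \<le> (\<Sum>i\<in>I. sum f (A i))"
  using assms(1,2)
proof (induction I rule: finite_induct)
  case (insert i I)
  have "sum f (A i \<union> (\<Union>i\<in>I. A i)) = sum f (A i) + sum f (\<Union>i\<in>I. A i) - sum f (A i \<inter> (\<Union>i\<in>I. A i))"
    using insert by (intro sum_Un) auto
  also have "\<dots> \<le> sum f (A i) + sum f (\<Union>i\<in>I. A i)" using sum_nonneg[of _ f] assms(3) by simp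
  finally show ?case using insert by simp
qed simp

lemma counting_weight_has_integral:
  fixes s r c :: real
  assumes "0 < s" "s \<le> r" "0 \<le> c" "c \<le> r"
  shows "((\<lambda>t. (if c < t then 1 else 0) / t) has_integral (ln r - ln (max s c))) {s..r}"
proof -
  define m where "m = max s c"
  have m: "s \<le> m" "m \<le> r" "0 < m" "c \<le> m" using assms by (auto simp: m_def)
  have "((\<lambda>t. 1 / t) has_integral (ln r - ln m)) {m..r}"
    using m by (intro fundamental_theorem_of_calculus)
      (auto intro!: derivative_eq_intros simp: divide_inverse simp flip: has_real_derivative_iff_has_vector_derivative)
  then have "((\<lambda>t. (if c < t then 1 else 0) / t) has_integral (ln r - ln m)) {m..r}"
    by (rule has_integral_spike_finite[of "{m}", rotated 2]) (use m in auto)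
  then have "((\<lambda>t. if t \<in> {m..r} then (if c < t then 1 else 0) / t else 0) has_integral (ln r - ln m)) {s..r}"
    using m by (subst has_integral_restrict) auto
  then show ?thesis unfolding m_def[symmetric]
    by (rule has_integral_spike_finite[of "{m}", rotated 2]) (use m in \<open>auto simp: m_def\<close>)
qed

lemma counting_integral:
  fixes P :: "complex set"
  assumes r: "0 < s" "s \<le> r" and fin: "finite {p \<in> P. norm p \<le> r}"
  shows "integral {s..r} (\<lambda>t. real (card {p \<in> P. norm p < t}) / t) = (\<Sum>p\<in>{p \<in> P. norm p \<le> r}. ln (max r (norm p)) - ln (max s (norm p)))"
proof (rule integral_unique)
  let ?Z = "{p \<in> P. norm p \<le> r}"
  have "((\<lambda>t. \<Sum>p\<in>?Z. (if norm p < t then 1 else 0) / t) has_integral (\<Sum>p\<in>?Z. ln r - ln (max s (norm p)))) {s..r}"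
    by (rule has_integral_sum[OF fin]) (rule counting_weight_has_integral, use r in auto)
  moreover have "(\<Sum>p\<in>?Z. ln r - ln (max s (norm p))) = (\<Sum>p\<in>?Z. ln (max r (norm p)) - ln (max s (norm p)))"
    by (rule sum.cong) (auto simp: max_def)
  moreover have "(\<Sum>p\<in>?Z. (if norm p < t then 1 else 0) / t) = real (card {p \<in> P. norm p < t}) / t" if "t \<in> {s..r}" for t
  proof -
    have "{p \<in> P. norm p < t} = {p \<in> ?Z. norm p < t}" using that by auto
    then have "real (card {p \<in> P. norm p < t}) = (\<Sum>p\<in>?Z. if norm p < t then 1 else 0)"
      using fin by (simp add: sum.If_cases Int_def)
    then show ?thesis by (simp add: sum_divide_distrib)
  qed
  ultimately show "((\<lambda>t. real (card {p \<in> P. norm p < t}) / t) has_integral (\<Sum>p\<in>?Z. ln (max r (norm p)) - ln (max s (norm p)))) {s..r}"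
    by (metis (no_types, lifting) has_integral_cong)
qed

section \<open>Truncated counting by the Wronskian\<close>

lemma holomorphic_zero_on_ball:
  assumes "h holomorphic_on ball 0 r" "open U" "U \<noteq> {}" "U \<subseteq> ball 0 r" "\<And>w. w \<in> U \<Longrightarrow> h w = 0" "w \<in> ball 0 r"
  shows "h w = 0"
  using analytic_continuation_open[of U "ball 0 r" h "\<lambda>_. 0" w] assms by auto

lemma wronskian_holomorphic:
  assumes "G0 holomorphic_on V" "G1 holomorphic_on V" "open V"
  shows "wronskian G0 G1 holomorphic_on V"
  unfolding wronskian_def by (intro holomorphic_intros assms holomorphic_deriv)

context sphere_map
begin

text \<open>
  If the Wronskian vanishes on a disc, so does \<open>rho\<close> there, hence the Wronskian on each larger disc. Then
  the quotient of the coordinates has derivative \<open>0\<close> and the map is constant.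
\<close>

lemma wronskian_nonzero:
  assumes r: "0 < r" "ereal r < R" and G: "lift_on (ball 0 r) F G0 G1"
  shows "\<exists>w\<in>ball 0 r. wronskian G0 G1 w \<noteq> 0"
proof (rule ccontr)
  assume "\<not> ?thesis"
  then have W0: "wronskian G0 G1 w = 0" if "w \<in> ball 0 r" for w using that by blast
  then have rho0: "rho w = 0" if "w \<in> ball 0 r" for w
    using rho_eq[OF r(2) G that] that by (simp add: fs_density_def)
  obtain x y where xy: "ereal (norm x) < R" "ereal (norm y) < R" "F x \<noteq> F y" using nonconst by blast
  have "ereal (max (max (norm x) (norm y)) r) < R" using xy r by (simp add: max_def)
  then obtain r' H0 H1 where r': "max (max (norm x) (norm y)) r < r'" "0 < r'" "ereal r' < R" and H: "lift_on (ball 0 r') F H0 H1"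
    by (rule lift_around)
  have hol: "H0 holomorphic_on ball 0 r'" "H1 holomorphic_on ball 0 r'" using H by (auto simp: lift_on_def)
  have nH: "H0 w \<noteq> 0 \<or> H1 w \<noteq> 0" "F w = p1_point (H0 w) (H1 w)" if "w \<in> ball 0 r'" for w using H that by (auto simp: lift_on_def)
  have WH: "wronskian H0 H1 w = 0" if w: "w \<in> ball 0 r'" for w
  proof (rule holomorphic_zero_on_ball[OF wronskian_holomorphic[OF hol open_ball] _ _ _ _ w])
    show "open (ball (0::complex) r)" "ball (0::complex) r \<noteq> {}" "ball (0::complex) r \<subseteq> ball 0 r'" using r r' by auto
    fix v :: complex assume v: "v \<in> ball 0 r"
    then have v': "v \<in> ball 0 r'" using r' by auto
    have "fs_density H0 H1 v = 0" using rho_eq[OF r'(3) H v'] rho0[OF v] by simp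
    then show "wronskian H0 H1 v = 0" using norm2_pos[of H0 v H1, OF nH(1)[OF v']] by (simp add: fs_density_def)
  qed
  have "F x = F y"
  proof (cases "\<forall>w\<in>ball 0 r'. H0 w = 0")
    case True
    then show ?thesis using nH(2)[of x] nH(2)[of y] r' by (simp add: p1_point_def)
  next
    case False
    then obtain p where p: "p \<in> ball 0 r'" "H0 p \<noteq> 0" by blast
    define c where "c = H1 p / H0 p"
    have cont: "continuous_on (ball 0 r') H0" using hol holomorphic_on_imp_continuous_on by blast
    have "open (ball 0 r' \<inter> H0 -` (- {0}))" by (rule continuous_open_preimage[OF cont]) auto
    then obtain d where d: "d > 0" "ball p d \<subseteq> ball 0 r' \<inter> H0 -` (- {0})" using p openE by (metis ComplI IntI singletonD vimageI)
    have const: "H1 w / H0 w = c" if w: "w \<in> ball p d" for w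
    proof -
      have der: "((\<lambda>w. H1 w / H0 w) has_field_derivative 0) (at v within ball p d)" if v: "v \<in> ball p d" for v
      proof -
        have v': "v \<in> ball 0 r'" "H0 v \<noteq> 0" using d v by auto
        have "((\<lambda>w. H1 w / H0 w) has_field_derivative (deriv H1 v * H0 v - H1 v * deriv H0 v) / (H0 v * H0 v)) (at v)"
          by (rule DERIV_divide) (use holomorphic_derivI hol v' in auto)
        moreover have "deriv H1 v * H0 v - H1 v * deriv H0 v = 0" using WH[OF v'(1)] by (simp add: wronskian_def algebra_simps)
        ultimately show ?thesis by (simp add: has_field_derivative_at_within)
      qed
      have "\<exists>k. \<forall>v\<in>ball p d. H1 v / H0 v = k"
        by (rule has_field_derivative_zero_constant[OF convex_ball der])
      then show ?thesis unfolding c_def using w d(1) by (metis centre_in_ball)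
    qed
    have l0: "H1 w - c * H0 w = 0" if w: "w \<in> ball 0 r'" for w
    proof (rule holomorphic_zero_on_ball[where U="ball p d" and h="\<lambda>w. H1 w - c * H0 w", OF _ _ _ _ _ w])
      show "(\<lambda>w. H1 w - c * H0 w) holomorphic_on ball 0 r'" by (intro holomorphic_intros hol)
      show "H1 v - c * H0 v = 0" if v: "v \<in> ball p d" for v
      proof -
        have "H0 v \<noteq> 0" using d(2) v by blast
        then show ?thesis using const[OF v] by (simp add: field_simps)
      qed
    qed (use d in auto)
    have "F w = Fin c" if w: "w \<in> ball 0 r'" for w
    proof -
      have "H0 w \<noteq> 0" using nH(1)[OF w] l0[OF w] by auto
      then show ?thesis using nH(2)[OF w] l0[OF w] by (simp add: p1_point_def field_simps)
    qed
    then show ?thesis using r' by auto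
  qed
  then show False using xy by simp
qed

lemma lin_form_nonzero:
  assumes r: "0 < r" "ereal r < R" and G: "lift_on (ball 0 r) F G0 G1"
  shows "\<exists>w\<in>ball 0 r. lin_form a G0 G1 w \<noteq> 0"
proof (rule ccontr)
  assume "\<not> ?thesis"
  then have l0: "lin_form a G0 G1 w = 0" if "w \<in> ball 0 r" for w using that by blast
  have hol: "G0 holomorphic_on ball 0 r" "G1 holomorphic_on ball 0 r" using G by (auto simp: lift_on_def)
  have "wronskian G0 G1 w = 0" if w: "w \<in> ball 0 r" for w
  proof -
    have "(lin_form a G0 G1 has_field_derivative 0) (at w)"
      by (rule has_field_derivative_transform_within_open[of "\<lambda>_. 0" _ _ "ball 0 r"]) (use w l0 in auto)
    then have "deriv (lin_form a G0 G1) w = 0" by (rule DERIV_imp_deriv)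
    then show ?thesis
      using wronskian_forms[OF hol open_ball w, of a] l0[OF w] by (simp add: wronskian_def)
  qed
  then show False using wronskian_nonzero[OF r G] by blast
qed

lemma finite_zeros_in_cball:
  assumes "h holomorphic_on ball 0 r'" "r < r'" "\<exists>w\<in>ball 0 r'. h w \<noteq> 0"
  shows "finite {w \<in> cball 0 r. h w = 0}"
proof (cases "h constant_on ball 0 r'")
  case True
  then obtain k where k: "\<And>w. w \<in> ball 0 r' \<Longrightarrow> h w = k" by (auto simp: constant_on_def)
  then have "k \<noteq> 0" using assms(3) by auto
  then have "{w \<in> cball 0 r. h w = 0} = {}" using k assms(2) by force
  then show ?thesis by (simp only: finite.emptyI)
next
  case False
  have "cball (0::complex) r \<subseteq> ball 0 r'" using assms(2) by auto
  then show ?thesis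
    by (rule holomorphic_compact_finite_zeros[OF assms(1) open_ball connected_ball compact_cball _ False])
qed

lemma finite_value_points:
  assumes "ereal r < R" shows "finite {w \<in> cball 0 r. F w = a}"
proof -
  obtain r' G0 G1 where l: "r < r'" "0 < r'" "ereal r' < R" "lift_on (ball 0 r') F G0 G1" by (rule lift_around[OF assms])
  have hol: "G0 holomorphic_on ball 0 r'" "G1 holomorphic_on ball 0 r'" using l(4) by (auto simp: lift_on_def)
  have "finite {w \<in> cball 0 r. lin_form a G0 G1 w = 0}"
    by (rule finite_zeros_in_cball[OF forms_holomorphic(1)[OF hol] l(1) lin_form_nonzero[OF l(2-4)]])
  moreover have "{w \<in> cball 0 r. F w = a} \<subseteq> {w \<in> cball 0 r. lin_form a G0 G1 w = 0}"
  proof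
    fix w assume w: "w \<in> {w \<in> cball 0 r. F w = a}"
    then have "w \<in> ball 0 r'" using l(1) by auto
    then have "G0 w \<noteq> 0 \<or> G1 w \<noteq> 0" "F w = p1_point (G0 w) (G1 w)" using l(4) by (auto simp: lift_on_def)
    then show "w \<in> {w \<in> cball 0 r. lin_form a G0 G1 w = 0}" using lin_form_eq_0_iff[of G0 w G1 a] w by auto
  qed
  ultimately show ?thesis by (rule finite_subset[rotated])
qed

lemma finite_branch_points:
  assumes "ereal r < R" shows "finite {w \<in> cball 0 r. rho w = 0}"
proof -
  obtain r' G0 G1 where l: "r < r'" "0 < r'" "ereal r' < R" "lift_on (ball 0 r') F G0 G1" by (rule lift_around[OF assms])
  have hol: "G0 holomorphic_on ball 0 r'" "G1 holomorphic_on ball 0 r'" using l(4) by (auto simp: lift_on_def)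
  have "finite {w \<in> cball 0 r. wronskian G0 G1 w = 0}"
    by (rule finite_zeros_in_cball[OF wronskian_holomorphic[OF hol open_ball] l(1) wronskian_nonzero[OF l(2-4)]])
  moreover have "{w \<in> cball 0 r. rho w = 0} \<subseteq> {w \<in> cball 0 r. wronskian G0 G1 w = 0}"
  proof
    fix w assume w: "w \<in> {w \<in> cball 0 r. rho w = 0}"
    then have w': "w \<in> ball 0 r'" using l(1) by auto
    then have "G0 w \<noteq> 0 \<or> G1 w \<noteq> 0" using l(4) by (auto simp: lift_on_def)
    then show "w \<in> {w \<in> cball 0 r. wronskian G0 G1 w = 0}"
      using norm2_pos[of G0 w G1] rho_eq[OF l(3,4) w'] w by (auto simp: fs_density_def)
  qed
  ultimately show ?thesis by (rule finite_subset[rotated])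
qed

text \<open>
  At a zero of order \<open>n\<close> of the form of \<open>a j\<close> the Wronskian vanishes to order at least \<open>n - 1\<close>, because it can be
  computed from this form and its orthogonal one. The factor \<open>w - p\<close> of the product over \<open>Z\<close> makes up
  for the missing order, and the other forms do not vanish at \<open>p\<close>, as the values are distinct.
\<close>

lemma local_quotient:
  fixes a :: "nat \<Rightarrow> p1"
  assumes r: "0 < r" "ereal r < R" and G: "lift_on (ball 0 r) F G0 G1"
    and inj: "inj_on a {1..q}" and Z: "finite Z" "\<And>w j. w \<in> ball 0 r \<Longrightarrow> j \<in> {1..q} \<Longrightarrow> F w = a j \<Longrightarrow> w \<in> Z"
    and p: "p \<in> ball 0 r" "(\<Prod>j=1..q. lin_form (a j) G0 G1 p) = 0"
  shows "\<exists>e>0. \<exists>h. ball p e \<subseteq> ball 0 r \<and> h holomorphic_on ball p e \<and>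
     (\<forall>w\<in>ball p e - {p}. (\<Prod>z\<in>Z. w - z) * wronskian G0 G1 w = h w * (\<Prod>j=1..q. lin_form (a j) G0 G1 w) \<and> (\<Prod>j=1..q. lin_form (a j) G0 G1 w) \<noteq> 0)"
proof -
  have hol: "G0 holomorphic_on ball 0 r" "G1 holomorphic_on ball 0 r" using G by (auto simp: lift_on_def)
  let ?l = "\<lambda>j. lin_form (a j) G0 G1"
  have Gw: "?l j w = 0 \<longleftrightarrow> F w = a j" if "w \<in> ball 0 r" for j w
    using lin_form_eq_0_iff[of G0 w G1 "a j"] G that by (auto simp: lift_on_def)
  obtain j where j: "j \<in> {1..q}" "?l j p = 0" using p(2) by auto
  have Fp: "F p = a j" using Gw[OF p(1)] j by blast
  have pZ: "p \<in> Z" using Z(2)[OF p(1) j(1) Fp] .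
  have hl: "?l i holomorphic_on ball 0 r" for i by (rule forms_holomorphic(1)[OF hol])
  define B where "B = orth_form (a j) G0 G1"
  have hB: "B holomorphic_on ball 0 r" unfolding B_def by (rule forms_holomorphic(2)[OF hol])
  have "\<not> ?l j constant_on ball 0 r"
  proof
    assume "?l j constant_on ball 0 r"
    then obtain k where k: "\<forall>w\<in>ball 0 r. ?l j w = k" by (auto simp: constant_on_def)
    then have "k = 0" using p(1) j(2) by force
    then show False using lin_form_nonzero[OF r G, of "a j"] k by blast
  qed
  then obtain g e n where g: "0 < n" "0 < e" "ball p e \<subseteq> ball 0 r" "g holomorphic_on ball p e"
     "\<And>w. w \<in> ball p e \<Longrightarrow> ?l j w = (w - p) ^ n * g w" "\<And>w. w \<in> ball p e \<Longrightarrow> g w \<noteq> 0"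
    using holomorphic_factor_zero_nonconstant[OF hl open_ball connected_ball p(1) j(2)] by metis
  define Q where "Q w = (\<Prod>i\<in>{1..q} - {j}. ?l i w)" for w
  have hQ: "Q holomorphic_on ball 0 r" unfolding Q_def by (intro holomorphic_on_prod hl)
  have "?l i p \<noteq> 0" if "i \<in> {1..q} - {j}" for i
    using Gw[OF p(1), of i] Fp inj j(1) that by (auto dest: inj_onD)
  then have Qp: "Q p \<noteq> 0" by (simp add: Q_def)
  have "open (ball 0 r \<inter> Q -` (- {0}))"
    by (rule continuous_open_preimage[OF holomorphic_on_imp_continuous_on[OF hQ]]) auto
  then obtain e2 where e2: "0 < e2" "ball p e2 \<subseteq> ball 0 r \<inter> Q -` (- {0})" using p(1) Qp openE by (metis ComplI IntI singletonD vimageI)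
  define d where "d = min e e2"
  have d: "0 < d" "ball p d \<subseteq> ball p e" "ball p d \<subseteq> ball p e2" using g e2 by (auto simp: d_def)
  define k where "k w = (w - p) * g w * deriv B w - of_nat n * g w * B w - (w - p) * deriv g w * B w" for w
  define W' where "W' w = (\<Prod>z\<in>Z - {p}. w - z)" for w
  define h where "h w = W' w * k w / (g w * Q w)" for w
  have hh: "h holomorphic_on ball p d"
    unfolding h_def k_def W'_def
    by (intro holomorphic_intros holomorphic_on_prod holomorphic_deriv holomorphic_on_subset[OF g(4)] holomorphic_on_subset[OF hQ] holomorphic_on_subset[OF hB])
       (use d g e2 in auto)
  have prodQ: "(\<Prod>j=1..q. ?l j w) = ?l j w * Q w" for w
    unfolding Q_def by (rule prod.remove) (use j in auto)
  have main: "(\<Prod>z\<in>Z. w - z) * wronskian G0 G1 w = h w * (\<Prod>j=1..q. ?l j w) \<and> (\<Prod>j=1..q. ?l j w) \<noteq> 0"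
    if w: "w \<in> ball p d - {p}" for w
  proof -
    have wd: "w \<in> ball p d" using w by blast
    have "w \<in> ball p e" "w \<in> ball p e2" using subsetD[OF d(2) wd] subsetD[OF d(3) wd] by auto
    then have we: "w \<in> ball p e" "w \<in> ball 0 r" "Q w \<noteq> 0" "w \<noteq> p" "g w \<noteq> 0"
      using w subsetD[OF g(3), of w] subsetD[OF e2(2), of w] g(6)[of w] by auto
    have "((\<lambda>w. (w - p) ^ n * g w) has_field_derivative (of_nat n * (w - p) ^ (n - 1) * g w + deriv g w * (w - p) ^ n)) (at w)"
      by (auto intro!: derivative_eq_intros holomorphic_derivI[OF g(4) open_ball we(1)])
    then have "(?l j has_field_derivative (of_nat n * (w - p) ^ (n - 1) * g w + deriv g w * (w - p) ^ n)) (at w)"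
      by (rule has_field_derivative_transform_within_open[of _ _ _ "ball p e"]) (use we g(5) in auto)
    then have dl: "deriv (?l j) w = of_nat n * (w - p) ^ (n - 1) * g w + deriv g w * (w - p) ^ n" by (rule DERIV_imp_deriv)
    obtain n' where n': "n = Suc n'" using g(1) gr0_conv_Suc by blast
    have "wronskian G0 G1 w = ?l j w * deriv B w - deriv (?l j) w * B w"
      using wronskian_forms[OF hol open_ball we(2), of "a j"] by (simp add: wronskian_def B_def)
    also have "\<dots> = (w - p) ^ n' * k w"
      unfolding dl g(5)[OF we(1)] k_def n' by (simp add: algebra_simps)
    finally have 1: "wronskian G0 G1 w = (w - p) ^ n' * k w" .
    have 2: "(\<Prod>z\<in>Z. w - z) = (w - p) * W' w" unfolding W'_def by (rule prod.remove[OF Z(1) pZ])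
    have 3: "(\<Prod>j=1..q. ?l j w) = (w - p) ^ n * (g w * Q w)" unfolding prodQ g(5)[OF we(1)] by simp
    have "h w * ((w - p) ^ n * (g w * Q w)) = W' w * k w * (w - p) ^ n" using we by (simp add: h_def)
    also have "\<dots> = (w - p) * W' w * ((w - p) ^ n' * k w)" unfolding n' by simp
    finally show ?thesis unfolding 1 2 3 using we by simp
  qed
  show ?thesis
    by (rule exI[of _ d], intro conjI d(1) exI[of _ h] hh ballI main) (use d g(3) in auto)
qed

definition count_int :: "p1 \<Rightarrow> real \<Rightarrow> real \<Rightarrow> real" where
  "count_int a s r = integral {s..r} (\<lambda>t. real (card {w. norm w < t \<and> F w = a}) / t)"

lemma count_int_eq:
  assumes "0 < s" "s \<le> r" "ereal r < R"
  shows "count_int a s r = (\<Sum>p\<in>{w \<in> cball 0 r. F w = a}. ln (max r (norm p)) - ln (max s (norm p)))"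
proof -
  have "{p \<in> {w. F w = a}. norm p \<le> r} = {w \<in> cball 0 r. F w = a}" "{p \<in> {w. F w = a}. norm p < t} = {w. norm w < t \<and> F w = a}" for t by auto
  then show ?thesis
    using counting_integral[OF assms(1,2), of "{w. F w = a}"] finite_value_points[OF assms(3), of a] by (simp add: count_int_def)
qed

text \<open>
  Apart from constants, its mean over a circle is the sum of the proximity functions plus the mean of the
  logarithm of the density, that is the error term of the second main theorem before estimation.
\<close>

definition \<Phi> :: "(nat \<Rightarrow> p1) \<Rightarrow> nat \<Rightarrow> complex \<Rightarrow> real" where
  "\<Phi> a q w = ln (rho w) - (\<Sum>j=1..q. ln (chordal (F w) (a j)))"

text \<open>
  With \<open>Z\<close> the set of points where some value \<open>a j\<close> is taken, the function
  \<open>H = (\<Prod>z\<in>Z. w - z) * wronskian / (\<Prod>j. lin_form (a j))\<close> is holomorphic, so the means of \<open>ln \<bar>H\<bar>\<^sup>2\<close> do not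
  decrease. Apart from a constant, the logarithm consists of three kinds of terms: the product over \<open>Z\<close> yields the
  counting functions without multiplicity, the powers of \<open>\<bar>G\<bar>\<^sup>2\<close> yield \<open>2 - q\<close> times twice the
  characteristic function, and the rest is \<open>\<Phi>\<close>.
\<close>

theorem truncated_main_inequality:
  fixes a :: "nat \<Rightarrow> p1"
  assumes r: "0 < s" "s \<le> r" "ereal r < R" and inj: "inj_on a {1..q}"
    and gen: "\<And>w. norm w = r \<or> norm w = s \<Longrightarrow> rho w \<noteq> 0 \<and> (\<forall>j\<in>{1..q}. F w \<noteq> a j)"
  shows "(real q - 2) * (2 * char_T s r) \<le> circle_mean (\<Phi> a q) r - circle_mean (\<Phi> a q) s + 2 * (\<Sum>j=1..q. count_int (a j) s r)"
proof -
  obtain r' G0 G1 where l: "r < r'" "0 < r'" "ereal r' < R" and G: "lift_on (ball 0 r') F G0 G1" by (rule lift_around[OF r(3)])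
  \<comment> \<open>A radius between \<open>r\<close> and \<open>r'\<close>: the closed disc of radius \<open>r2\<close>, in which values are taken finitely
      often, lies in the domain of the lift.\<close>
  define r2 where "r2 = (r + r') / 2"
  have r2: "r < r2" "r2 < r'" "0 < r2" using l r by (auto simp: r2_def)
  have r2R: "ereal r2 < R" using l(3) r2(2) by (metis ereal_less_eq(3) le_less_trans less_imp_le)
  have G2: "lift_on (ball 0 r2) F G0 G1"
    using G r2 unfolding lift_on_def by (auto intro: holomorphic_on_subset)
  have hol: "G0 holomorphic_on ball 0 r2" "G1 holomorphic_on ball 0 r2" using G2 by (auto simp: lift_on_def)
  let ?l = "\<lambda>j. lin_form (a j) G0 G1" and ?Wr = "wronskian G0 G1" and ?N = "norm2 G0 G1"
  have nz: "G0 w \<noteq> 0 \<or> G1 w \<noteq> 0" "F w = p1_point (G0 w) (G1 w)" "0 < ?N w" if "w \<in> ball 0 r2" for w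
    using G2 that norm2_pos[of G0 w G1] by (auto simp: lift_on_def)
  have lz: "?l j w = 0 \<longleftrightarrow> F w = a j" if "w \<in> ball 0 r2" for j w
    using lin_form_eq_0_iff[of G0 w G1 "a j"] nz[OF that] by simp
  define Z where "Z = (\<Union>j\<in>{1..q}. {w \<in> cball 0 r2. F w = a j})"
  have finZ: "finite Z" unfolding Z_def using finite_value_points[OF r2R] by auto
  have hl: "?l i holomorphic_on ball 0 r2" for i by (rule forms_holomorphic(1)[OF hol])
  define Wp where "Wp w = (\<Prod>z\<in>Z. w - z)" for w
  define D where "D w = (\<Prod>j=1..q. ?l j w)" for w
  have hN: "(\<lambda>w. Wp w * ?Wr w) holomorphic_on ball 0 r2"
    unfolding Wp_def by (intro holomorphic_intros holomorphic_on_prod wronskian_holomorphic[OF hol open_ball])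
  have hD: "D holomorphic_on ball 0 r2" unfolding D_def by (intro holomorphic_on_prod hl)
  have loc: "\<exists>e>0. \<exists>h. ball p e \<subseteq> ball 0 r2 \<and> h holomorphic_on ball p e \<and> (\<forall>w\<in>ball p e - {p}. Wp w * ?Wr w = h w * D w \<and> D w \<noteq> 0)"
    if "p \<in> ball 0 r2" "D p = 0" for p
    unfolding Wp_def D_def
    by (rule local_quotient[OF r2(3) r2R G2 inj finZ]) (use that in \<open>auto simp: Z_def D_def\<close>)
  obtain H where H: "H holomorphic_on ball 0 r2" "\<And>w. w \<in> ball 0 r2 \<Longrightarrow> D w \<noteq> 0 \<Longrightarrow> H w = Wp w * ?Wr w / D w"
    using quotient_holomorphic_extension[OF open_ball hN hD loc] by blast
  define T where "T = {w::complex. norm w = r \<or> norm w = s}"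
  have Tsub: "w \<in> ball 0 r2" if "w \<in> T" for w using that r r2 by (auto simp: T_def)
  have TZ: "w \<notin> Z" if "w \<in> T" for w using gen that by (auto simp: T_def Z_def)
  have Tl: "?l j w \<noteq> 0" if "w \<in> T" "j \<in> {1..q}" for w j
    using lz[OF Tsub[OF that(1)], of j] gen[of w] that by (auto simp: T_def)
  have TW: "?Wr w \<noteq> 0" if "w \<in> T" for w
  proof -
    have "w \<in> ball 0 r'" using Tsub[OF that] r2 by auto
    then have "rho w = fs_density G0 G1 w" using rho_eq[OF l(3) G] by blast
    then show ?thesis using gen[of w] that by (auto simp: T_def fs_density_def)
  qed
  have TWp: "Wp w \<noteq> 0" if "w \<in> T" for w unfolding Wp_def using TZ[OF that] finZ by auto
  have TD: "D w \<noteq> 0" if "w \<in> T" for w unfolding D_def using Tl[OF that] by auto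
  have TH: "H w \<noteq> 0" if "w \<in> T" for w using H(2)[OF Tsub[OF that] TD[OF that]] TWp[OF that] TW[OF that] TD[OF that] by simp
  have identity: "ln ((norm (H w))\<^sup>2) = (\<Sum>z\<in>Z. ln ((norm (w - z))\<^sup>2)) + \<Phi> a q w + (2 - real q) * ln (?N w) + ln pi"
    if w: "w \<in> T" for w
  proof -
    have wb: "w \<in> ball 0 r2" using Tsub[OF w] .
    have N: "0 < ?N w" using nz wb by blast
    have wr: "w \<in> ball 0 r'" using wb r2 by auto
    have "(norm (H w))\<^sup>2 = (norm (Wp w))\<^sup>2 * (norm (?Wr w))\<^sup>2 / (norm (D w))\<^sup>2"
      using H(2)[OF wb TD[OF w]] by (simp add: norm_mult norm_divide power_mult_distrib power_divide)
    then have 1: "ln ((norm (H w))\<^sup>2) = ln ((norm (Wp w))\<^sup>2) + ln ((norm (?Wr w))\<^sup>2) - ln ((norm (D w))\<^sup>2)"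
      using TWp[OF w] TW[OF w] TD[OF w] by (simp add: ln_div ln_mult)
    have 2: "ln ((norm (Wp w))\<^sup>2) = (\<Sum>z\<in>Z. ln ((norm (w - z))\<^sup>2))"
      unfolding Wp_def prod_norm[symmetric] prod_power_distrib
      by (rule ln_prod) (use finZ TZ[OF w] in auto)
    have 3: "ln ((norm (D w))\<^sup>2) = (\<Sum>j=1..q. ln ((norm (?l j w))\<^sup>2))"
      unfolding D_def prod_norm[symmetric] prod_power_distrib
      by (rule ln_prod) (use Tl[OF w] in auto)
    have ch: "chordal (F w) (a j) = (norm (?l j w))\<^sup>2 / ?N w" for j
      using chordal_lift[of G0 w G1 "a j", OF nz(1)[OF wb]] nz(2)[OF wb] by simp
    have 4: "(\<Sum>j=1..q. ln (chordal (F w) (a j))) = (\<Sum>j=1..q. ln ((norm (?l j w))\<^sup>2)) - real q * ln (?N w)"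
    proof -
      have "(\<Sum>j=1..q. ln (chordal (F w) (a j))) = (\<Sum>j=1..q. ln ((norm (?l j w))\<^sup>2) - ln (?N w))"
        by (rule sum.cong[OF refl]) (use Tl[OF w] N in \<open>auto simp: ch ln_div\<close>)
      then show ?thesis by (simp add: sum_subtractf)
    qed
    have "rho w = (norm (?Wr w))\<^sup>2 / (pi * (?N w)\<^sup>2)" using rho_eq[OF l(3) G wr] by (simp add: fs_density_def)
    then have "ln (rho w) = ln ((norm (?Wr w))\<^sup>2) - (ln pi + ln ((?N w)\<^sup>2))"
      using TW[OF w] N by (simp add: ln_div ln_mult)
    then have 5: "ln (rho w) = ln ((norm (?Wr w))\<^sup>2) - ln pi - 2 * ln (?N w)" using N by (simp add: ln_realpow)
    show ?thesis unfolding 1 2 3 \<Phi>_def 4 5 by (simp add: algebra_simps)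
  qed
  have cN: "continuous_on (ball 0 r2) ?N"
    unfolding norm2_def using hol by (intro continuous_intros holomorphic_on_imp_continuous_on)
  have csub: "sphere 0 t \<subseteq> ball (0::complex) r2" if "t = r \<or> t = s" for t using that r r2 by auto
  have clN: "continuous_on (sphere 0 t) (\<lambda>w. ln (?N w))" if "t = r \<or> t = s" for t
    by (rule continuous_on_ln[OF continuous_on_subset[OF cN csub[OF that]]]) (use nz(3) csub[OF that] in force)
  have crho: "continuous_on (sphere 0 t) (\<lambda>w. ln (rho w))" if "t = r \<or> t = s" for t
    by (rule continuous_on_ln[OF continuous_on_subset[OF rho_continuous[OF r(3)]]]) (use gen that r in auto)
  have tR: "ereal t < R" if "t = r \<or> t = s" for t using that r by (metis ereal_less_eq(3) le_less_trans)
  have c\<Phi>: "continuous_on (sphere 0 t) (\<Phi> a q)" if "t = r \<or> t = s" for t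
    unfolding \<Phi>_def by (intro continuous_on_diff continuous_on_sum crho circle_continuous tR that) (use gen that in auto)
  have cZ: "continuous_on (sphere 0 t) (\<lambda>w. ln ((norm (w - z))\<^sup>2))" if "t = r \<or> t = s" "z \<in> Z" for t z
  proof (rule continuous_on_ln)
    show "continuous_on (sphere 0 t) (\<lambda>w. (norm (w - z))\<^sup>2)" by (intro continuous_intros)
    show "\<forall>w\<in>sphere 0 t. (norm (w - z))\<^sup>2 \<noteq> 0" using TZ that by (auto simp: T_def)
  qed
  have mean: "circle_mean (\<lambda>w. ln ((norm (H w))\<^sup>2)) t = (\<Sum>z\<in>Z. 2 * ln (max t (norm z))) + circle_mean (\<Phi> a q) t
      + (2 - real q) * circle_mean (\<lambda>w. ln (?N w)) t + ln pi" if t: "t = r \<or> t = s" for t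
  proof -
    have t0: "0 < t" using t r by auto
    have "circle_mean (\<lambda>w. ln ((norm (H w))\<^sup>2)) t = circle_mean (\<lambda>w. (((\<Sum>z\<in>Z. ln ((norm (w - z))\<^sup>2)) + \<Phi> a q w) + (2 - real q) * ln (?N w)) + ln pi) t"
      by (rule circle_mean_cong) (use identity t t0 in \<open>auto simp: T_def\<close>)
    also have "\<dots> = circle_mean (\<lambda>w. \<Sum>z\<in>Z. ln ((norm (w - z))\<^sup>2)) t + circle_mean (\<Phi> a q) t + (2 - real q) * circle_mean (\<lambda>w. ln (?N w)) t + ln pi"
    proof -
      have cs: "continuous_on (sphere 0 t) (\<lambda>w. \<Sum>z\<in>Z. ln ((norm (w - z))\<^sup>2))" by (intro continuous_on_sum cZ t)
      have cn: "continuous_on (sphere 0 t) (\<lambda>w. (2 - real q) * ln (?N w))" by (intro continuous_on_mult continuous_on_const clN t)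
      have c12: "continuous_on (sphere 0 t) (\<lambda>w. (\<Sum>z\<in>Z. ln ((norm (w - z))\<^sup>2)) + \<Phi> a q w)" by (intro continuous_on_add cs c\<Phi> t)
      show ?thesis
        using circle_mean_add[OF continuous_on_add[OF c12 cn] continuous_on_const[of _ "ln pi"]] circle_mean_add[OF c12 cn]
          circle_mean_add[OF cs c\<Phi>[OF t]] circle_mean_cmult[of "2 - real q" "\<lambda>w. ln (?N w)" t] t0
        by simp
    qed
    also have "circle_mean (\<lambda>w. \<Sum>z\<in>Z. ln ((norm (w - z))\<^sup>2)) t = (\<Sum>z\<in>Z. circle_mean (\<lambda>w. ln ((norm (w - z))\<^sup>2)) t)"
      by (rule circle_mean_sum[OF finZ cZ]) (use t t0 in auto)
    also have "\<dots> = (\<Sum>z\<in>Z. 2 * ln (max t (norm z)))"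
      by (rule sum.cong[OF refl], rule circle_mean_ln_dist[OF t0]) (use TZ t in \<open>auto simp: T_def\<close>)
    finally show ?thesis .
  qed
  have mono: "circle_mean (\<lambda>w. ln ((norm (H w))\<^sup>2)) s \<le> circle_mean (\<lambda>w. ln ((norm (H w))\<^sup>2)) r"
    by (rule circle_mean_ln_norm2_mono[OF H(1) r(1,2) r2(1)]) (use TH in \<open>auto simp: T_def\<close>)
  have TN: "circle_mean (\<lambda>w. ln (?N w)) r - circle_mean (\<lambda>w. ln (?N w)) s = 2 * char_T s r"
  proof -
    obtain p where p: "laplacian_on (ball 0 r2) (\<lambda>w. ln (?N w)) p (\<lambda>w. 4 * pi * fs_density G0 G1 w)"
      by (rule laplacian_on_ln_norm2_lift[OF G2])
    have "laplacian_on (ball 0 r2) (\<lambda>w. ln (?N w)) p (\<lambda>w. 4 * pi * rho w)"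
      by (rule laplacian_on_cong[OF p refl refl]) (use rho_eq[OF r2R G2] in simp)
    moreover have "cball 0 r \<subseteq> ball (0::complex) r2" using r2 by auto
    ultimately show ?thesis using iterated_laplacian[OF _ _ r(1,2)] iterated_4pi_rho by metis
  qed
  have count: "(\<Sum>z\<in>Z. ln (max r (norm z)) - ln (max s (norm z))) \<le> (\<Sum>j=1..q. count_int (a j) s r)"
  proof -
    let ?w = "\<lambda>z. ln (max r (norm z)) - ln (max s (norm z))"
    have w0: "0 \<le> ?w z" for z
    proof -
      have "ln (max s (norm z)) \<le> ln (max r (norm z))" using r by (intro ln_mono) auto
      then show ?thesis by simp
    qed
    have "(\<Sum>z\<in>Z. ?w z) \<le> (\<Sum>j\<in>{1..q}. \<Sum>z\<in>{w \<in> cball 0 r2. F w = a j}. ?w z)"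
      unfolding Z_def by (rule sum_UN_le_sum) (use finite_value_points[OF r2R] w0 in auto)
    also have "\<dots> = (\<Sum>j=1..q. count_int (a j) s r)"
    proof (rule sum.cong[OF refl])
      fix j
      have "(\<Sum>z\<in>{w \<in> cball 0 r2. F w = a j}. ?w z) = (\<Sum>z\<in>{w \<in> cball 0 r. F w = a j}. ?w z)"
        by (rule sum.mono_neutral_right[OF finite_value_points[OF r2R]]) (use r r2 in auto)
      then show "(\<Sum>z\<in>{w \<in> cball 0 r2. F w = a j}. ?w z) = count_int (a j) s r" by (simp add: count_int_eq[OF r])
    qed
    finally show ?thesis .
  qed
  have "0 \<le> 2 * (\<Sum>z\<in>Z. ln (max r (norm z)) - ln (max s (norm z))) + circle_mean (\<Phi> a q) r - circle_mean (\<Phi> a q) s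
     + (2 - real q) * (2 * char_T s r)"
    using mono mean[of r] mean[of s] unfolding TN[symmetric] by (simp add: sum_subtractf sum_distrib_left algebra_simps)
  then show ?thesis using count by (simp add: algebra_simps)
qed

end

section \<open>A weight singular at the given values\<close>

lemma spike_denominator:
  fixes x e :: real
  assumes "0 \<le> x" "x \<le> 1" "0 < e" "e \<le> 1"
  shows "0 < x + e" "1 \<le> 2 - ln (x + e)"
proof -
  show p: "0 < x + e" using assms by linarith
  have "ln (x + e) \<le> ln 2" using assms p by (intro ln_mono) auto
  also have "ln 2 \<le> (1::real)" using ln_2_less_1 by simp
  finally show "1 \<le> 2 - ln (x + e)" by simp
qed

lemma ennreal_mult_liminf_le: "(c::ennreal) * liminf X \<le> liminf (\<lambda>n. c * X n)"
proof -
  have "c * liminf X = (SUP n. c * (INF m\<in>{n..}. X m))"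
    by (simp add: liminf_SUP_INF SUP_mult_left_ennreal)
  also have "\<dots> \<le> (SUP n. INF m\<in>{n..}. c * X m)"
    by (intro SUP_mono' INF_greatest mult_left_mono INF_lower) auto
  finally show ?thesis by (simp add: liminf_SUP_INF)
qed

context sphere_map
begin

lemma spike_nonneg: "0 \<le> x \<Longrightarrow> x \<le> 1 \<Longrightarrow> 0 \<le> spike e x"
  by (simp add: spike_def)

lemma spike_continuous:
  assumes "0 < e" "e \<le> 1" shows "continuous_on {0..1} (spike e)"
proof -
  have "(x + e)\<^sup>2 * (2 - ln (x + e))\<^sup>2 \<noteq> 0" "x + e \<noteq> 0" if "x \<in> {0..1}" for x
    using spike_denominator[of x e] that assms by auto
  then show ?thesis unfolding spike_def[abs_def] by (intro continuous_intros) auto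
qed

lemma spike_lower:
  assumes "0 < e" "e \<le> x" "x \<le> 1"
  shows "(1/4) * ((1 - x) / (x * (2 - ln x)\<^sup>2)) \<le> spike e x"
proof -
  have x: "0 < x" using assms by simp
  have Y: "1 \<le> 2 - ln (x + e)" using spike_denominator[of x e] assms by simp
  have "ln x \<le> ln (x + e)" using assms x by (intro ln_mono) auto
  then have "(2 - ln (x + e))\<^sup>2 \<le> (2 - ln x)\<^sup>2" using Y by (intro power_mono) auto
  moreover have "(x + e)\<^sup>2 \<le> (2 * x)\<^sup>2" using assms x by (intro power_mono) auto
  ultimately have "(x + e)\<^sup>2 * (2 - ln (x + e))\<^sup>2 \<le> (2 * x)\<^sup>2 * (2 - ln x)\<^sup>2" by (intro mult_mono) auto
  moreover have "0 < (x + e)\<^sup>2 * (2 - ln (x + e))\<^sup>2" using Y x assms by auto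
  ultimately have "x * (1 - x) / ((2 * x)\<^sup>2 * (2 - ln x)\<^sup>2) \<le> spike e x"
    unfolding spike_def using x assms by (intro divide_left_mono) auto
  moreover have "x * (1 - x) / ((2 * x)\<^sup>2 * y) = (1/4) * ((1 - x) / (x * y))" for y
    using x by (simp add: power2_eq_square)
  ultimately show ?thesis by simp
qed

end

lemma iterated_sum:
  assumes "finite I" "\<And>i. i \<in> I \<Longrightarrow> continuous_on (cball 0 r) (f i)" "0 < s"
  shows "iterated (\<lambda>w. \<Sum>i\<in>I. f i w) s r = (\<Sum>i\<in>I. iterated (f i) s r)"
  using assms(1,2)
proof (induction I rule: finite_induct)
  case empty
  show ?case using iterated_cmult[of 0 "\<lambda>_. 0" s r] by simp
next
  case (insert i I)
  have "iterated (\<lambda>w. f i w + (\<Sum>i\<in>I. f i w)) s r = iterated (f i) s r + iterated (\<lambda>w. \<Sum>i\<in>I. f i w) s r"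
    by (rule iterated_add) (use insert assms(3) in \<open>auto intro!: continuous_on_sum\<close>)
  then show ?case using insert by simp
qed

text \<open>
  The initial radius \<open>s\<close> avoids branch points and the given values, so that all initial data are finite.
\<close>

locale weighted_map = sphere_map R F rho for R F rho +
  fixes a :: "nat \<Rightarrow> p1" and q :: nat and s :: real
  assumes s: "0 < s" "ereal s < R"
    and s_generic: "\<And>w. norm w = s \<Longrightarrow> rho w \<noteq> 0 \<and> (\<forall>j\<in>{1..q}. F w \<noteq> a j)"
begin

text \<open>
  The density with spikes at the given values, regularized by \<open>1 / (n + 1)\<close>. Each weight is
  continuous, so that the Jensen formula applies, and its iterated integral has a bound independent of \<open>n\<close>.
\<close>

definition weight :: "nat \<Rightarrow> complex \<Rightarrow> real" where
  "weight n w = rho w * (1 + (\<Sum>j=1..q. spike (1 / (real n + 1)) (chordal (F w) (a j))))"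

lemma eps_bounds: "0 < 1 / (real n + 1)" "1 / (real n + 1) \<le> 1" by auto

lemma spike_chord_continuous:
  "ereal r < R \<Longrightarrow> continuous_on (cball 0 r) (\<lambda>w. spike (1 / (real n + 1)) (chordal (F w) c))"
  by (rule continuous_on_compose2[OF spike_continuous[OF eps_bounds] chord_continuous])
     (use chord_bounds norm_less_R in auto)

lemma weight_continuous: "ereal r < R \<Longrightarrow> continuous_on (cball 0 r) (weight n)"
  unfolding weight_def by (intro continuous_intros rho_continuous spike_chord_continuous) auto

lemma rho_le_weight: assumes "ereal (norm w) < R" shows "rho w \<le> weight n w"
proof -
  have "0 \<le> (\<Sum>j=1..q. spike (1 / (real n + 1)) (chordal (F w) (a j)))"
    by (intro sum_nonneg spike_nonneg chord_bounds assms)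
  then have "rho w * 1 \<le> weight n w" unfolding weight_def by (intro mult_left_mono rho_nonneg assms) auto
  then show ?thesis by simp
qed

lemma weight_nonneg: "ereal (norm w) < R \<Longrightarrow> 0 \<le> weight n w"
  using rho_le_weight[of w n] rho_nonneg[of w] by simp

definition init_const :: real where
  "init_const = (2 + 2 * real q + (\<Sum>j=1..q. circle_mean (\<lambda>w. ln (2 - ln (chordal (F w) (a j)))) s)) / (4 * pi)"

lemma less_R: "ereal r < R \<Longrightarrow> t \<le> r \<Longrightarrow> ereal t < R"
  by (auto intro: le_less_trans[of "ereal _" "ereal r"])

lemma chord_pos_s: "norm w = s \<Longrightarrow> j \<in> {1..q} \<Longrightarrow> 0 < chordal (F w) (a j) \<and> chordal (F w) (a j) \<le> 1"
  using chord_bounds[of w "a j"] s_generic[of w] s by force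

lemma init_log_nonneg:
  assumes "j \<in> {1..q}" shows "0 \<le> circle_mean (\<lambda>w. ln (2 - ln (chordal (F w) (a j)))) s"
proof -
  have l: "ln (chordal (F w) (a j)) \<le> 0" if "norm w = s" for w
    using chord_pos_s[OF that assms] by simp
  have "circle_mean (\<lambda>w. 0) s \<le> circle_mean (\<lambda>w. ln (2 - ln (chordal (F w) (a j)))) s"
  proof (rule circle_mean_mono)
    show "continuous_on (sphere 0 s) (\<lambda>w. ln (2 - ln (chordal (F w) (a j))))"
    proof (rule continuous_on_ln)
      show "continuous_on (sphere 0 s) (\<lambda>w. 2 - ln (chordal (F w) (a j)))"
        by (intro continuous_on_diff continuous_on_const circle_continuous s) (use s_generic assms in auto)
      show "\<forall>w\<in>sphere 0 s. 2 - ln (chordal (F w) (a j)) \<noteq> 0" using l by force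
    qed
    fix w :: complex assume "w \<in> sphere 0 s"
    then show "0 \<le> ln (2 - ln (chordal (F w) (a j)))" using l[of w] by (intro ln_ge_zero) auto
  qed (use s in auto)
  then show ?thesis by simp
qed

lemma init_const_pos: "0 < init_const"
proof -
  have "0 \<le> (\<Sum>j=1..q. circle_mean (\<lambda>w. ln (2 - ln (chordal (F w) (a j)))) s)"
    by (intro sum_nonneg init_log_nonneg)
  then have "0 < 2 + 2 * real q + (\<Sum>j=1..q. circle_mean (\<lambda>w. ln (2 - ln (chordal (F w) (a j)))) s)"
    using of_nat_0_le_iff[of q] by linarith
  then show ?thesis unfolding init_const_def by (intro divide_pos_pos) auto
qed

lemma iterated_weight_le:
  assumes r: "s \<le> r" "ereal r < R"
  shows "iterated (weight n) s r \<le> init_const * (char_T s r + 1)"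
proof -
  let ?e = "1 / (real n + 1)" and ?c = "\<lambda>j. circle_mean (\<lambda>w. ln (2 - ln (chordal (F w) (a j)))) s"
  let ?f = "\<lambda>j w. 4 * pi * rho w * spike ?e (chordal (F w) (a j))"
  have T: "0 \<le> char_T s r" using char_T_nonneg r s by blast
  have cf: "continuous_on (cball 0 r) (?f j)" for j
    by (intro continuous_intros rho_continuous spike_chord_continuous r)
  have "4 * pi * iterated (weight n) s r = iterated (\<lambda>w. 4 * pi * weight n w) s r"
    by (rule iterated_cmult[symmetric])
  also have "(\<lambda>w. 4 * pi * weight n w) = (\<lambda>w. 4 * pi * rho w + (\<Sum>j=1..q. ?f j w))"
    unfolding weight_def by (auto simp: algebra_simps sum_distrib_left)
  also have "iterated \<dots> s r = iterated (\<lambda>w. 4 * pi * rho w) s r + iterated (\<lambda>w. \<Sum>j=1..q. ?f j w) s r"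
    by (rule iterated_add) (intro continuous_on_mult continuous_on_const rho_continuous continuous_on_sum cf r s)+
  also have "iterated (\<lambda>w. \<Sum>j=1..q. ?f j w) s r = (\<Sum>j=1..q. iterated (?f j) s r)"
    by (rule iterated_sum) (use s cf in auto)
  also have "\<dots> \<le> (\<Sum>j=1..q. 2 * char_T s r + ?c j)"
    by (intro sum_mono spike_bound) (use s s_generic r in auto)
  also have "iterated (\<lambda>w. 4 * pi * rho w) s r + (\<Sum>j=1..q. 2 * char_T s r + ?c j) = (2 + 2 * real q) * char_T s r + (\<Sum>j=1..q. ?c j)"
    unfolding iterated_4pi_rho by (simp add: sum.distrib algebra_simps)
  also have "\<dots> \<le> (2 + 2 * real q + (\<Sum>j=1..q. ?c j)) * (char_T s r + 1)"
  proof -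
    have "0 \<le> (\<Sum>j=1..q. ?c j)" by (intro sum_nonneg init_log_nonneg)
    then have "0 \<le> (\<Sum>j=1..q. ?c j) * char_T s r" using T by simp
    then show ?thesis using T by (simp add: algebra_simps)
  qed
  also have "\<dots> = 4 * pi * (init_const * (char_T s r + 1))" by (simp add: init_const_def)
  finally show ?thesis by simp
qed

definition mass :: "nat \<Rightarrow> real \<Rightarrow> real" where "mass n u = u * circle_mean (weight n) u"

definition radii :: "real set" where "radii = {u. 0 \<le> u \<and> ereal u < R}"

text \<open>
  Up to constants, \<open>dens\<close>, \<open>area\<close> and \<open>height\<close> are the circle integral, the disc integral and the iterated integral of
  the limit of the weights. The limit is formed on the level of radii, by the lower limit of the
  circle integrals and the lemma of Fatou, so that the singular weight is never integrated.
\<close>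

definition dens :: "real \<Rightarrow> ennreal" where
  "dens u = liminf (\<lambda>n. ennreal (mass n u) * indicator radii u)"

definition area :: "real \<Rightarrow> ennreal" where "area t = (\<integral>\<^sup>+u. dens u * indicator {0..t} u \<partial>lborel)"

definition height :: "real \<Rightarrow> ennreal" where "height r = (\<integral>\<^sup>+t. area t * ennreal (1 / t) * indicator {s..r} t \<partial>lborel)"

lemma mass_nonneg: assumes "u \<in> radii" shows "0 \<le> mass n u"
proof -
  have u: "0 \<le> u" "ereal u < R" using assms by (auto simp: radii_def)
  have "circle_mean (\<lambda>w. 0) u \<le> circle_mean (weight n) u"
    by (rule circle_mean_mono)
       (use u weight_nonneg continuous_on_subset[OF weight_continuous[OF u(2)], of "sphere 0 u"] in auto)
  then show ?thesis using u by (simp add: mass_def)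
qed

lemma mass_measurable: "(\<lambda>u. ennreal (mass n u) * indicator radii u) \<in> borel_measurable borel"
proof -
  have "s \<in> {r. 0 < r \<and> ereal r < R}" using s by simp
  then have ne: "{r. 0 < r \<and> ereal r < R} \<noteq> {}" by blast
  obtain f :: "nat \<Rightarrow> real" where f: "incseq f" "\<And>n. f n \<in> {r. 0 < r \<and> ereal r < R}" "\<And>x. x \<in> {r. 0 < r \<and> ereal r < R} \<Longrightarrow> \<exists>n. x \<le> f n"
    by (rule down_closed_cofinal_sequence[OF ne, of 0]) (use less_R in auto)
  have eq: "ennreal (mass n u) * indicator radii u = (SUP m. ennreal (mass n u) * indicator {0..f m} u)" for u
  proof (cases "u \<in> radii")
    case True
    obtain m where m: "u \<le> f m"
    proof (cases "u = 0")
      case True then show ?thesis using f(2)[of 0] that[of 0] by auto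
    next
      case False then show ?thesis using f(3)[of u] True that by (auto simp: radii_def)
    qed
    have "(SUP m. ennreal (mass n u) * indicator {0..f m} u) = ennreal (mass n u)"
    proof (rule antisym)
      show "(SUP m. ennreal (mass n u) * indicator {0..f m} u) \<le> ennreal (mass n u)"
        by (rule SUP_least) (simp add: indicator_def)
      have "ennreal (mass n u) = ennreal (mass n u) * indicator {0..f m} u" using m True by (simp add: radii_def)
      also have "\<dots> \<le> (SUP m. ennreal (mass n u) * indicator {0..f m} u)" by (rule SUP_upper) simp
      finally show "ennreal (mass n u) \<le> (SUP m. ennreal (mass n u) * indicator {0..f m} u)" .
    qed
    then show ?thesis using True by simp
  next
    case False
    then have "u \<notin> {0..f m}" for m using f(2)[of m] less_R[of "f m" u] by (auto simp: radii_def)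
    then show ?thesis using False by simp
  qed
  have "(\<lambda>u. ennreal (mass n u) * indicator {0..f m} u) \<in> borel_measurable borel" for m
  proof -
    have "continuous_on {0..f m} (mass n)"
      unfolding mass_def using f(2)[of m] by (intro continuous_intros continuous_on_circle_mean weight_continuous) auto
    then have "(\<lambda>u. indicator {0..f m} u *\<^sub>R mass n u) \<in> borel_measurable borel"
      by (intro borel_measurable_continuous_on_indicator) auto
    then have "(\<lambda>u. ennreal (indicator {0..f m} u *\<^sub>R mass n u)) \<in> borel_measurable borel" by measurable
    then show ?thesis by (rule measurable_cong[THEN iffD1, rotated]) (auto simp: indicator_def)
  qed
  then show ?thesis unfolding eq by (intro borel_measurable_SUP) auto
qed

lemma dens_measurable [measurable]: "dens \<in> borel_measurable borel"
  unfolding dens_def[abs_def] by (intro borel_measurable_liminf mass_measurable)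

lemma area_measurable [measurable]: "area \<in> borel_measurable borel"
proof -
  have "(\<lambda>t. \<integral>\<^sup>+u. dens u * indicator {(t, u). 0 \<le> u \<and> u \<le> t} (t, u) \<partial>lborel) \<in> borel_measurable borel"
    by measurable
  moreover have "indicator {(t, u). 0 \<le> u \<and> u \<le> t} (t, u) = (indicator {0..t} u :: ennreal)" for t u :: real
    by (auto simp: indicator_def)
  ultimately show ?thesis by (simp add: area_def[abs_def])
qed

lemma nn_integral_mass:
  assumes "0 \<le> t" "ereal t < R"
  shows "(\<integral>\<^sup>+u. ennreal (mass n u) * indicator radii u * indicator {0..t} u \<partial>lborel) = ennreal (disc_mass (weight n) t)"
proof -
  have sub: "u \<in> radii" if "u \<in> {0..t}" for u using that less_R[OF assms(2)] by (auto simp: radii_def)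
  have "((mass n) has_integral disc_mass (weight n) t) {0..t}"
    unfolding mass_def disc_mass_def
    by (rule integrable_integral, rule disc_mass_integrable[OF weight_continuous[OF assms(2)]]) simp
  then have "(\<integral>\<^sup>+u. ennreal (indicator {0..t} u * mass n u) \<partial>lborel) = ennreal (disc_mass (weight n) t)"
    by (intro nn_integral_has_integral_lebesgue) (use mass_nonneg sub in auto)
  moreover have "ennreal (mass n u) * indicator radii u * indicator {0..t} u = ennreal (indicator {0..t} u * mass n u)" for u
    using sub[of u] by (auto simp: indicator_def)
  ultimately show ?thesis by simp
qed

lemma area_le:
  assumes "0 \<le> t" "ereal t < R" "0 \<le> c"
  shows "area t * ennreal c \<le> liminf (\<lambda>n. ennreal (c * disc_mass (weight n) t))"
proof -
  have "area t * ennreal c = (\<integral>\<^sup>+u. liminf (\<lambda>n. ennreal (mass n u) * indicator radii u) * (indicator {0..t} u * ennreal c) \<partial>lborel)"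
    unfolding area_def dens_def[symmetric] by (subst nn_integral_multc[symmetric]) (auto simp: mult.assoc)
  also have "\<dots> \<le> (\<integral>\<^sup>+u. liminf (\<lambda>n. ennreal (mass n u) * indicator radii u * (indicator {0..t} u * ennreal c)) \<partial>lborel)"
  proof (rule nn_integral_mono)
    fix u :: real
    let ?X = "\<lambda>n. ennreal (mass n u) * indicator radii u" and ?k = "indicator {0..t} u * ennreal c :: ennreal"
    show "liminf ?X * ?k \<le> liminf (\<lambda>n. ?X n * ?k)"
      using ennreal_mult_liminf_le[of ?k ?X] by (simp add: mult.commute)
  qed
  also have "\<dots> \<le> liminf (\<lambda>n. \<integral>\<^sup>+u. ennreal (mass n u) * indicator radii u * (indicator {0..t} u * ennreal c) \<partial>lborel)"
    by (rule nn_integral_liminf) (use mass_measurable in measurable)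
  also have "(\<lambda>n. \<integral>\<^sup>+u. ennreal (mass n u) * indicator radii u * (indicator {0..t} u * ennreal c) \<partial>lborel) = (\<lambda>n. ennreal (c * disc_mass (weight n) t))"
  proof
    fix n
    have "(\<integral>\<^sup>+u. ennreal (mass n u) * indicator radii u * (indicator {0..t} u * ennreal c) \<partial>lborel)
       = (\<integral>\<^sup>+u. ennreal (mass n u) * indicator radii u * indicator {0..t} u \<partial>lborel) * ennreal c"
    proof -
      have m: "(\<lambda>u. ennreal (mass n u) * indicator radii u * indicator {0..t} u) \<in> borel_measurable lborel"
        using mass_measurable[of n] by measurable
      show ?thesis unfolding mult.assoc[of _ "indicator {0..t} _", symmetric] by (rule nn_integral_multc[OF m])
    qed
    then show "(\<integral>\<^sup>+u. ennreal (mass n u) * indicator radii u * (indicator {0..t} u * ennreal c) \<partial>lborel) = ennreal (c * disc_mass (weight n) t)"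
      using nn_integral_mass[OF assms(1,2)] assms(3) by (simp add: ennreal_mult' mult.commute)
  qed
  finally show ?thesis .
qed

lemma height_le:
  assumes r: "s \<le> r" "ereal r < R"
  shows "height r \<le> ennreal (init_const * (char_T s r + 1))"
proof -
  have tR: "0 < t" "ereal t < R" if "t \<in> {s..r}" for t using that s r less_R[OF r(2)] by auto
  have c: "continuous_on {s..r} (disc_mass (weight n))" for n
    using continuous_on_subset[OF continuous_on_disc_mass[OF weight_continuous[OF r(2)]], of "{s..r}"] s by auto
  have "height r \<le> (\<integral>\<^sup>+t. liminf (\<lambda>n. ennreal (indicator {s..r} t * (disc_mass (weight n) t / t))) \<partial>lborel)"
    unfolding height_def
  proof (rule nn_integral_mono)
    fix t
    show "area t * ennreal (1 / t) * indicator {s..r} t \<le> liminf (\<lambda>n. ennreal (indicator {s..r} t * (disc_mass (weight n) t / t)))"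
      using area_le[of t "1/t"] tR[of t] by (cases "t \<in> {s..r}") auto
  qed
  also have "\<dots> \<le> liminf (\<lambda>n. \<integral>\<^sup>+t. ennreal (indicator {s..r} t * (disc_mass (weight n) t / t)) \<partial>lborel)"
  proof (rule nn_integral_liminf)
    fix n
    have "(\<lambda>t. indicator {s..r} t *\<^sub>R (disc_mass (weight n) t / t)) \<in> borel_measurable borel"
      by (intro borel_measurable_continuous_on_indicator continuous_intros c) (use s in auto)
    then show "(\<lambda>t. ennreal (indicator {s..r} t * (disc_mass (weight n) t / t))) \<in> borel_measurable lborel" by simp
  qed
  also have "(\<lambda>n. \<integral>\<^sup>+t. ennreal (indicator {s..r} t * (disc_mass (weight n) t / t)) \<partial>lborel) = (\<lambda>n. ennreal (iterated (weight n) s r))"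
  proof
    fix n
    show "(\<integral>\<^sup>+t. ennreal (indicator {s..r} t * (disc_mass (weight n) t / t)) \<partial>lborel) = ennreal (iterated (weight n) s r)"
    proof (rule nn_integral_has_integral_lebesgue)
      show "((\<lambda>t. disc_mass (weight n) t / t) has_integral iterated (weight n) s r) {s..r}"
        unfolding iterated_def by (rule integrable_integral[OF iterated_integrable[OF weight_continuous[OF r(2)] s(1)]])
      fix t assume t: "t \<in> {s..r}"
      have "0 \<le> disc_mass (weight n) t" unfolding disc_mass_def
      proof (rule integral_nonneg[OF disc_mass_integrable[OF weight_continuous[OF r(2)]]])
        fix u assume u: "u \<in> {0..t}"
        then have "u \<in> radii" using tR[OF t] less_R by (auto simp: radii_def)
        then show "0 \<le> u * circle_mean (weight n) u" using mass_nonneg[of u n] by (simp add: mass_def)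
      qed (use t in auto)
      then show "0 \<le> disc_mass (weight n) t / t" using tR[OF t] by simp
    qed
  qed
  also have "liminf (\<lambda>n. ennreal (iterated (weight n) s r)) \<le> liminf (\<lambda>n::nat. ennreal (init_const * (char_T s r + 1)))"
    by (intro Liminf_mono always_eventually allI ennreal_leI iterated_weight_le r)
  also have "\<dots> = ennreal (init_const * (char_T s r + 1))" by (rule Liminf_const) simp
  finally show ?thesis .
qed

lemma area_mono: "t \<le> t' \<Longrightarrow> area t \<le> area t'"
  unfolding area_def by (intro nn_integral_mono) (auto simp: indicator_def)

text \<open>
  The finite height at a larger radius contains a multiple of the area.
\<close>

lemma area_finite:
  assumes "s \<le> t" "ereal t < R" shows "area t < \<infinity>"
proof -
  obtain r where r: "ereal t < ereal r" "ereal r < R" using ereal_dense2[OF assms(2)] by blast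
  then have tr: "t < r" by simp
  have "area t * ennreal (1 / r) * ennreal (r - t) = (\<integral>\<^sup>+u. area t * ennreal (1 / r) * indicator {t..r} u \<partial>lborel)"
    using tr by (subst nn_integral_cmult_indicator) auto
  also have "\<dots> \<le> height r"
    unfolding height_def
  proof (rule nn_integral_mono)
    fix u
    show "area t * ennreal (1 / r) * indicator {t..r} u \<le> area u * ennreal (1 / u) * indicator {s..r} u"
    proof (cases "u \<in> {t..r}")
      case True
      have "area t * ennreal (1 / r) \<le> area u * ennreal (1 / u)"
        using True s assms tr by (intro mult_mono area_mono ennreal_leI divide_left_mono) auto
      then show ?thesis using True assms by simp
    qed simp
  qed
  also have "\<dots> \<le> ennreal (init_const * (char_T s r + 1))" using tr assms r by (intro height_le) auto
  also have "\<dots> < \<infinity>" by simp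
  finally have "area t * (ennreal (1 / r) * ennreal (r - t)) < \<infinity>" by (simp add: mult.assoc)
  moreover have "ennreal (1 / r) * ennreal (r - t) \<noteq> 0" using tr assms s by (simp add: ennreal_eq_0_iff)
  ultimately show ?thesis by (auto simp: ennreal_mult_less_top less_top)
qed

lemma dens_lower:
  assumes "u \<in> radii" "\<And>n. n \<ge> n0 \<Longrightarrow> c \<le> mass n u"
  shows "ennreal c \<le> dens u"
  unfolding dens_def using assms
  by (intro Liminf_bounded) (auto simp: eventually_sequentially intro!: exI[of _ n0] ennreal_leI)

lemma area_s_pos: "0 < area s"
proof -
  have c: "continuous_on {0..s} (circle_mean rho)"
    by (rule continuous_on_circle_mean[OF rho_continuous[OF s(2)]])
  have sub: "u \<in> radii" if "u \<in> {0..s}" for u using that less_R[OF s(2)] by (auto simp: radii_def)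
  have csp: "continuous_on (sphere 0 u) rho" if "u \<in> {0..s}" for u
    by (rule continuous_on_subset[OF rho_continuous[OF s(2)]]) (use that in auto)
  have cm0: "0 \<le> circle_mean rho u" if "u \<in> {0..s}" for u
  proof -
    have "circle_mean (\<lambda>w. 0) u \<le> circle_mean rho u"
      by (rule circle_mean_mono) (use csp[OF that] that rho_nonneg sub[OF that] in \<open>auto simp: radii_def\<close>)
    then show ?thesis by simp
  qed
  have "sphere (0::complex) s \<noteq> {}" using s by simp
  then obtain w0 where w0: "w0 \<in> sphere 0 s" "\<And>w. w \<in> sphere 0 s \<Longrightarrow> rho w0 \<le> rho w"
    using continuous_attains_inf[OF compact_sphere _ csp[of s]] s by auto
  have "0 < rho w0" using s_generic[of w0] rho_nonneg[of w0] w0(1) s by force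
  moreover have "circle_mean (\<lambda>w. rho w0) s \<le> circle_mean rho s"
    by (rule circle_mean_mono) (use csp[of s] w0 s in auto)
  ultimately have pos: "0 < circle_mean rho s" by simp
  have ci: "continuous_on {0..s} (\<lambda>u. u * circle_mean rho u)" by (intro continuous_intros c)
  have "0 < integral {0..s} (\<lambda>u. u * circle_mean rho u)"
  proof -
    have "0 \<le> integral {0..s} (\<lambda>u. u * circle_mean rho u)"
      by (rule integral_nonneg) (use ci cm0 integrable_continuous_real in auto)
    moreover have "integral {0..s} (\<lambda>u. u * circle_mean rho u) \<noteq> 0"
    proof
      assume z: "integral {0..s} (\<lambda>u. u * circle_mean rho u) = 0"
      have "\<forall>u\<in>{0..s}. u * circle_mean rho u = 0"
        by (rule iffD1[OF integral_eq_0_iff[OF ci s(1)] z]) (use cm0 in auto)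
      then have "s * circle_mean rho s = 0" by (rule bspec) (use s in simp)
      then show False using pos s by simp
    qed
    ultimately show ?thesis by simp
  qed
  then have "0 < ennreal (integral {0..s} (\<lambda>u. u * circle_mean rho u))" by simp
  also have "\<dots> = (\<integral>\<^sup>+u. ennreal (indicator {0..s} u * (u * circle_mean rho u)) \<partial>lborel)"
    by (rule nn_integral_has_integral_lebesgue[symmetric])
       (use ci cm0 integrable_continuous_real in \<open>auto intro!: integrable_integral\<close>)
  also have "\<dots> \<le> area s" unfolding area_def
  proof (rule nn_integral_mono)
    fix u
    show "ennreal (indicator {0..s} u * (u * circle_mean rho u)) \<le> dens u * indicator {0..s} u"
    proof (cases "u \<in> {0..s}")
      case True
      have "u * circle_mean rho u \<le> mass n u" for n
        unfolding mass_def
        by (intro mult_left_mono circle_mean_mono csp[OF True] continuous_on_subset[OF weight_continuous[OF s(2)]] rho_le_weight)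
           (use True sub[OF True] in \<open>auto simp: radii_def\<close>)
      then have "ennreal (u * circle_mean rho u) \<le> dens u" by (intro dens_lower[OF sub[OF True]])
      then show ?thesis using True by simp
    qed simp
  qed
  finally show ?thesis .
qed

lemma area_split:
  assumes "s \<le> r" shows "area r = area s + (\<integral>\<^sup>+u\<in>{s..r}. dens u \<partial>lebesgue)"
proof -
  have "area r = (\<integral>\<^sup>+u. dens u * indicator {0..s} u + dens u * indicator {s<..r} u \<partial>lborel)"
    unfolding area_def using assms s by (intro nn_integral_cong) (auto simp: indicator_def)
  also have "\<dots> = area s + (\<integral>\<^sup>+u. dens u * indicator {s<..r} u \<partial>lborel)"
    unfolding area_def by (rule nn_integral_add) auto
  also have "(\<integral>\<^sup>+u. dens u * indicator {s<..r} u \<partial>lborel) = (\<integral>\<^sup>+u. dens u * indicator {s..r} u \<partial>lborel)"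
    by (rule nn_integral_cong_AE) (rule AE_I[of _ _ "{s}"], auto simp: indicator_def)
  also have "\<dots> = (\<integral>\<^sup>+u\<in>{s..r}. dens u \<partial>lebesgue)" by (simp add: nn_integral_completion)
  finally show ?thesis .
qed

text \<open>
  The growth lemma is used twice: for \<open>area / r\<close>, the derivative of the height, against the height, and for
  \<open>dens\<close>, the derivative of the area, against the area.
\<close>

theorem growth_of_density:
  fixes \<gamma> :: "real \<Rightarrow> real" and \<delta> :: real
  defines "J \<equiv> {r. s < r \<and> ereal r < R}"
  assumes \<gamma>: "set_borel_measurable lebesgue J \<gamma>" "\<And>r. r \<in> J \<Longrightarrow> 0 < \<gamma> r" and \<delta>: "0 < \<delta>"
  shows "\<exists>E. E \<subseteq> J \<and> E \<in> sets lebesgue \<and> (\<integral>\<^sup>+r\<in>E. ennreal (\<gamma> r) \<partial>lebesgue) < \<infinity> \<and>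
     (\<forall>r\<in>J - E. dens r \<le> ennreal (\<gamma> r * (r * \<gamma> r * (1 + init_const * (char_T s r + 1)) powr (1 + \<delta>)) powr (1 + \<delta>)))"
proof -
  define A where "A r = enn2real (area r)" for r
  have A: "ennreal (A r) = area r" if "r = s \<or> r \<in> J" for r
    using area_finite[of r] that s unfolding A_def J_def by (intro ennreal_enn2real) auto
  \<comment> \<open>\<open>1\<close> is added because the growth lemma needs a positive initial value, and the height starts at \<open>0\<close>.\<close>
  define B where "B r = 1 + enn2real (height r)" for r
  have h: "height r < \<infinity>" if "r \<in> J" for r
    using height_le[of r] that by (auto simp: J_def intro: le_less_trans[of _ "ennreal _"])
  have B: "ennreal (B r) = ennreal 1 + (\<integral>\<^sup>+t\<in>{s..r}. area t * ennreal (1 / t) \<partial>lebesgue)" if "r \<in> J" for r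
  proof -
    have "ennreal (B r) = ennreal 1 + height r"
      using h[OF that] unfolding B_def by (subst ennreal_plus) auto
    then show ?thesis by (simp add: height_def nn_integral_completion)
  qed
  define E1 where "E1 = {r \<in> J. ennreal (\<gamma> r * A r powr (1 + \<delta>)) < dens r}"
  define E2 where "E2 = {r \<in> J. ennreal (\<gamma> r * B r powr (1 + \<delta>)) < area r * ennreal (1 / r)}"
  have m1: "dens \<in> borel_measurable lebesgue" "(\<lambda>t. area t * ennreal (1 / t)) \<in> borel_measurable lebesgue"
    by (intro measurable_completion; measurable)+
  have Apos: "0 < A s" using area_s_pos A[of s] by (metis ennreal_0 ennreal_less_zero_iff A_def enn2real_nonneg less_irrefl order_le_less)
  have E1: "E1 \<in> sets lebesgue" "(\<integral>\<^sup>+r\<in>E1. ennreal (\<gamma> r) \<partial>lebesgue) < \<infinity>"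
    unfolding E1_def J_def
  proof -
    have b: "ennreal (A r) = ennreal (A s) + (\<integral>\<^sup>+x\<in>{s..r}. dens x \<partial>lebesgue)" if "r \<in> {r. s < r \<and> ereal r < R}" for r
      using A[of r] A[of s] area_split[of r] that unfolding J_def by simp
    note g = growth_lemma[OF m1(1) b Apos \<delta> \<gamma>[unfolded J_def]]
    show "{r \<in> {r. s < r \<and> ereal r < R}. ennreal (\<gamma> r * A r powr (1 + \<delta>)) < dens r} \<in> sets lebesgue"
      by (rule g(1))
    show "(\<integral>\<^sup>+r\<in>{r \<in> {r. s < r \<and> ereal r < R}. ennreal (\<gamma> r * A r powr (1 + \<delta>)) < dens r}. ennreal (\<gamma> r) \<partial>lebesgue) < \<infinity>"
      by (rule g(2))
  qed
  have E2: "E2 \<in> sets lebesgue" "(\<integral>\<^sup>+r\<in>E2. ennreal (\<gamma> r) \<partial>lebesgue) < \<infinity>"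
    unfolding E2_def J_def
  proof -
    note g = growth_lemma[OF m1(2) B[unfolded J_def] zero_less_one \<delta> \<gamma>[unfolded J_def]]
    show "{r \<in> {r. s < r \<and> ereal r < R}. ennreal (\<gamma> r * B r powr (1 + \<delta>)) < area r * ennreal (1 / r)} \<in> sets lebesgue"
      by (rule g(1))
    show "(\<integral>\<^sup>+r\<in>{r \<in> {r. s < r \<and> ereal r < R}. ennreal (\<gamma> r * B r powr (1 + \<delta>)) < area r * ennreal (1 / r)}. ennreal (\<gamma> r) \<partial>lebesgue) < \<infinity>"
      by (rule g(2))
  qed
  show ?thesis
  proof (intro exI[of _ "E1 \<union> E2"] conjI ballI)
    show "E1 \<union> E2 \<subseteq> J" by (auto simp: E1_def E2_def)
    show "E1 \<union> E2 \<in> sets lebesgue" using E1 E2 by auto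
    have "(\<integral>\<^sup>+r\<in>E1 \<union> E2. ennreal (\<gamma> r) \<partial>lebesgue) \<le> (\<integral>\<^sup>+r. ennreal (indicator J r * \<gamma> r) * indicator E1 r + ennreal (indicator J r * \<gamma> r) * indicator E2 r \<partial>lebesgue)"
      by (intro nn_integral_mono) (auto simp: indicator_def E1_def E2_def)
    also have "\<dots> = (\<integral>\<^sup>+r. ennreal (indicator J r * \<gamma> r) * indicator E1 r \<partial>lebesgue) + (\<integral>\<^sup>+r. ennreal (indicator J r * \<gamma> r) * indicator E2 r \<partial>lebesgue)"
      using E1(1) E2(1) \<gamma>(1) unfolding set_borel_measurable_def by (intro nn_integral_add) auto
    also have "\<dots> = (\<integral>\<^sup>+r\<in>E1. ennreal (\<gamma> r) \<partial>lebesgue) + (\<integral>\<^sup>+r\<in>E2. ennreal (\<gamma> r) \<partial>lebesgue)"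
      by (intro arg_cong2[where f="(+)"] nn_integral_cong) (auto simp: indicator_def E1_def E2_def)
    also have "\<dots> < \<infinity>" using E1 E2 by (simp add: ennreal_add_less_top)
    finally show "(\<integral>\<^sup>+r\<in>E1 \<union> E2. ennreal (\<gamma> r) \<partial>lebesgue) < \<infinity>" .
    fix r assume r: "r \<in> J - (E1 \<union> E2)"
    then have rJ: "r \<in> J" "s < r" "0 < r" "0 < \<gamma> r" using s \<gamma>(2)[of r] by (auto simp: J_def)
    have d: "dens r \<le> ennreal (\<gamma> r * A r powr (1 + \<delta>))" using r by (auto simp: E1_def not_less)
    have "area r * ennreal (1 / r) \<le> ennreal (\<gamma> r * B r powr (1 + \<delta>))" using r by (auto simp: E2_def not_less)
    moreover have "ennreal (A r * (1 / r)) = area r * ennreal (1 / r)"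
      using A[of r] rJ by (subst ennreal_mult) (auto simp: A_def)
    ultimately have "ennreal (A r * (1 / r)) \<le> ennreal (\<gamma> r * B r powr (1 + \<delta>))" by (simp only:)
    then have "A r * (1 / r) \<le> \<gamma> r * B r powr (1 + \<delta>)" using rJ by (subst (asm) ennreal_le_iff) auto
    then have A1: "A r \<le> r * \<gamma> r * B r powr (1 + \<delta>)" using rJ by (simp add: field_simps)
    have "enn2real (height r) \<le> init_const * (char_T s r + 1)"
      using enn2real_mono[OF height_le[of r]] rJ init_const_pos char_T_nonneg[of r s] s by (auto simp: J_def)
    then have "B r \<le> 1 + init_const * (char_T s r + 1)" by (simp add: B_def)
    then have "B r powr (1 + \<delta>) \<le> (1 + init_const * (char_T s r + 1)) powr (1 + \<delta>)"
      using \<delta> by (intro powr_mono2) (auto simp: B_def)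
    then have "r * \<gamma> r * B r powr (1 + \<delta>) \<le> r * \<gamma> r * (1 + init_const * (char_T s r + 1)) powr (1 + \<delta>)"
      using rJ by (intro mult_left_mono) auto
    then have "A r powr (1 + \<delta>) \<le> (r * \<gamma> r * (1 + init_const * (char_T s r + 1)) powr (1 + \<delta>)) powr (1 + \<delta>)"
      using A1 \<delta> by (intro powr_mono2) (auto simp: A_def)
    then have "ennreal (\<gamma> r * A r powr (1 + \<delta>)) \<le> ennreal (\<gamma> r * (r * \<gamma> r * (1 + init_const * (char_T s r + 1)) powr (1 + \<delta>)) powr (1 + \<delta>))"
      using rJ by (intro ennreal_leI mult_left_mono) auto
    then show "dens r \<le> ennreal (\<gamma> r * (r * \<gamma> r * (1 + init_const * (char_T s r + 1)) powr (1 + \<delta>)) powr (1 + \<delta>))"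
      using d by (rule order_trans[rotated])
  qed
qed

end

section \<open>Means of logarithms and separation of the values\<close>

text \<open>
  Concavity of the logarithm, from the tangent at the mean value.
\<close>

lemma circle_mean_ln_le:
  assumes t: "0 < t" and c: "continuous_on (sphere 0 t) f" and pos: "\<And>w. norm w = t \<Longrightarrow> 0 < f w"
  shows "circle_mean (\<lambda>w. ln (f w)) t \<le> ln (circle_mean f t)" and "0 < circle_mean f t"
proof -
  have "sphere (0::complex) t \<noteq> {}" using t by simp
  then obtain w0 where w0: "w0 \<in> sphere 0 t" "\<And>w. w \<in> sphere 0 t \<Longrightarrow> f w0 \<le> f w"
    using continuous_attains_inf[OF compact_sphere _ c] by blast
  have "circle_mean (\<lambda>w. f w0) t \<le> circle_mean f t"
    by (rule circle_mean_mono) (use c w0 t in auto)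
  then show m: "0 < circle_mean f t" using pos[of w0] w0(1) by simp
  define m where "m = circle_mean f t"
  have m0: "0 < m" using m by (simp add: m_def)
  have cl: "continuous_on (sphere 0 t) (\<lambda>w. ln (f w))" by (rule continuous_on_ln[OF c]) (use pos in force)
  have "circle_mean (\<lambda>w. ln (f w)) t \<le> circle_mean (\<lambda>w. inverse m * f w + (ln m - 1)) t"
  proof (rule circle_mean_mono[OF cl])
    show "continuous_on (sphere 0 t) (\<lambda>w. inverse m * f w + (ln m - 1))" by (intro continuous_intros c)
    fix w :: complex assume "w \<in> sphere 0 t"
    then have f: "0 < f w" using pos by simp
    have "ln (f w / m) \<le> f w / m - 1" using f m0 by (intro ln_le_minus_one) auto
    then show "ln (f w) \<le> inverse m * f w + (ln m - 1)" using f m0 by (simp add: ln_div field_simps)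
  qed (use t in auto)
  also have "\<dots> = inverse m * m + (ln m - 1)"
    using circle_mean_add[of t "\<lambda>w. inverse m * f w" "\<lambda>w. ln m - 1"] circle_mean_cmult[of "inverse m" f t] c t
    by (simp add: continuous_on_mult m_def)
  also have "\<dots> = ln m" using m0 by simp
  finally show "circle_mean (\<lambda>w. ln (f w)) t \<le> ln (circle_mean f t)" by (simp add: m_def)
qed

text \<open>
  Two different values are given by independent linear forms, so the homogeneous coordinates can be
  recovered from the values of the two forms; the constant involves the determinant \<open>d\<close> of the forms.
\<close>

lemma chordal_separation:
  assumes "a \<noteq> b" shows "\<exists>c>0. \<forall>x. c \<le> chordal x a + chordal x b"
proof -
  define d where "d = coeff0 a * coeff1 b - coeff1 a * coeff0 b"
  have d0: "d \<noteq> 0"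
  proof (cases a)
    case (Fin s)
    have ps: "sqrt (1 + (norm s)\<^sup>2) \<noteq> 0" by (smt (verit) real_sqrt_eq_zero_cancel_iff zero_le_power2)
    show ?thesis
    proof (cases b)
      case (Fin t)
      have pt: "sqrt (1 + (norm t)\<^sup>2) \<noteq> 0" by (smt (verit) real_sqrt_eq_zero_cancel_iff zero_le_power2)
      have "d = (t - s) / (of_real (sqrt (1 + (norm s)\<^sup>2)) * of_real (sqrt (1 + (norm t)\<^sup>2)))"
        unfolding d_def \<open>a = Fin s\<close> Fin by (simp add: diff_divide_distrib)
      then show ?thesis using assms \<open>a = Fin s\<close> Fin ps pt by simp
    qed (use Fin ps in \<open>simp add: d_def\<close>)
  next
    case Infty
    then obtain t where t: "b = Fin t" using assms by (cases b) auto
    have pt: "sqrt (1 + (norm t)\<^sup>2) \<noteq> 0" by (smt (verit) real_sqrt_eq_zero_cancel_iff zero_le_power2)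
    then show ?thesis using Infty t by (simp add: d_def)
  qed
  have le1: "norm (coeff0 y) \<le> 1" "norm (coeff1 y) \<le> 1" for y
    using coeff_unit[of y] by (smt (verit) norm_ge_zero one_le_power power2_le_imp_le power_one zero_le_power2)+
  show ?thesis
  proof (intro exI[of _ "(norm d)\<^sup>2 / 4"] conjI allI)
    show "0 < (norm d)\<^sup>2 / 4" using d0 by simp
    fix x
    define G0 G1 :: "complex \<Rightarrow> complex" where "G0 = (\<lambda>_. if x = Infty then 0 else 1)" and "G1 = (\<lambda>_. case x of Infty \<Rightarrow> 1 | Fin z \<Rightarrow> z)"
    have nz: "G0 0 \<noteq> 0 \<or> G1 0 \<noteq> 0" and x: "x = p1_point (G0 0) (G1 0)"
      by (cases x; simp add: G0_def G1_def p1_point_def)+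
    let ?l = "lin_form a G0 G1 0" and ?k = "lin_form b G0 G1 0"
    have "d * G0 0 = coeff1 b * ?l - coeff1 a * ?k" "d * G1 0 = coeff0 a * ?k - coeff0 b * ?l"
      by (simp_all add: d_def lin_form_def algebra_simps)
    then have "norm d * norm (G0 0) \<le> norm ?l + norm ?k" "norm d * norm (G1 0) \<le> norm ?l + norm ?k"
      using norm_triangle_ineq4[of "coeff1 b * ?l" "coeff1 a * ?k"] norm_triangle_ineq4[of "coeff0 a * ?k" "coeff0 b * ?l"]
        mult_right_mono[OF le1(1)[of a], of "norm ?k"] mult_right_mono[OF le1(1)[of b], of "norm ?l"]
        mult_right_mono[OF le1(2)[of a], of "norm ?k"] mult_right_mono[OF le1(2)[of b], of "norm ?l"]
      by (simp_all only: norm_mult[symmetric]) (simp_all add: norm_mult)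
    then have "(norm d * norm (G0 0))\<^sup>2 \<le> (norm ?l + norm ?k)\<^sup>2" "(norm d * norm (G1 0))\<^sup>2 \<le> (norm ?l + norm ?k)\<^sup>2"
      by (intro power_mono; simp)+
    moreover have "(norm ?l + norm ?k)\<^sup>2 \<le> 2 * ((norm ?l)\<^sup>2 + (norm ?k)\<^sup>2)"
      using sum_squares_bound[of "norm ?l" "norm ?k"] by (simp add: power2_eq_square algebra_simps)
    ultimately have "(norm d)\<^sup>2 * norm2 G0 G1 0 \<le> 4 * ((norm ?l)\<^sup>2 + (norm ?k)\<^sup>2)"
      unfolding norm2_def by (simp add: power_mult_distrib algebra_simps)
    moreover have "0 < norm2 G0 G1 0" by (rule norm2_pos) (rule nz)
    ultimately have "(norm d)\<^sup>2 / 4 \<le> (norm ?l)\<^sup>2 / norm2 G0 G1 0 + (norm ?k)\<^sup>2 / norm2 G0 G1 0"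
      by (simp add: field_simps)
    then show "(norm d)\<^sup>2 / 4 \<le> chordal x a + chordal x b"
      using chordal_lift[where a=a, of G0 0 G1] chordal_lift[where a=b, of G0 0 G1] nz x by simp
  qed
qed

lemma chordal_uniform_separation:
  fixes a :: "nat \<Rightarrow> p1"
  assumes "inj_on a {1..q}"
  shows "\<exists>d. 0 < d \<and> d \<le> 1/2 \<and> (\<forall>x. \<forall>i\<in>{1..q}. \<forall>j\<in>{1..q}. i \<noteq> j \<longrightarrow> chordal x (a i) < d \<longrightarrow> d \<le> chordal x (a j))"
proof -
  let ?I = "{(i, j). i \<in> {1..q} \<and> j \<in> {1..q} \<and> i \<noteq> j}"
  have fin: "finite ?I" by (rule finite_subset[of _ "{1..q} \<times> {1..q}"]) auto
  have "\<forall>p\<in>?I. \<exists>c>0. \<forall>x. c \<le> chordal x (a (fst p)) + chordal x (a (snd p))"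
  proof
    fix p assume "p \<in> ?I"
    then have "a (fst p) \<noteq> a (snd p)" using inj_onD[OF assms, of "fst p" "snd p"] by auto
    then show "\<exists>c>0. \<forall>x. c \<le> chordal x (a (fst p)) + chordal x (a (snd p))" by (rule chordal_separation)
  qed
  from bchoice[OF this] obtain c where c: "\<forall>p\<in>?I. 0 < c p \<and> (\<forall>x. c p \<le> chordal x (a (fst p)) + chordal x (a (snd p)))" by blast
  define d where "d = Min (insert 1 (c ` ?I)) / 2"
  have "0 < Min (insert 1 (c ` ?I))" using fin c by (subst Min_gr_iff) auto
  then have d: "0 < d" "d \<le> 1/2" using fin by (auto simp: d_def)
  have "d \<le> chordal x (a j)" if "i \<in> {1..q}" "j \<in> {1..q}" "i \<noteq> j" "chordal x (a i) < d" for x i j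
  proof -
    have ij: "(i, j) \<in> ?I" using that by simp
    have "2 * d \<le> c (i, j)" unfolding d_def using fin ij by (simp add: Min_le)
    also have "\<dots> \<le> chordal x (a i) + chordal x (a j)" using bspec[OF c ij] by simp
    finally show ?thesis using that by simp
  qed
  then show ?thesis using d by blast
qed

text \<open>
  At most one factor is singular at a time; all others are at most \<open>1 / d\<close>. For the singular index
  \<open>1 - x i \<ge> 1/2\<close>, which accounts for the factor \<open>8\<close>.
\<close>

lemma prod_singular_le_sum:
  fixes x :: "nat \<Rightarrow> real"
  assumes x: "\<And>j. j \<in> {1..q} \<Longrightarrow> 0 < x j \<and> x j \<le> 1"
    and d: "0 < d" "d \<le> 1/2" and sep: "\<And>i j. i \<in> {1..q} \<Longrightarrow> j \<in> {1..q} \<Longrightarrow> i \<noteq> j \<Longrightarrow> x i < d \<Longrightarrow> d \<le> x j"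
  shows "(\<Prod>j=1..q. 1 / (x j * (2 - ln (x j))\<^sup>2)) \<le> 8 * (1 / d) ^ q * (1 + (\<Sum>j=1..q. (1/4) * ((1 - x j) / (x j * (2 - ln (x j))\<^sup>2))))"
proof -
  let ?P = "\<lambda>j. 1 / (x j * (2 - ln (x j))\<^sup>2)" and ?S = "\<lambda>j. (1/4) * ((1 - x j) / (x j * (2 - ln (x j))\<^sup>2))"
  have Y: "1 \<le> (2 - ln (x j))\<^sup>2" if "j \<in> {1..q}" for j
  proof -
    have "ln (x j) \<le> 0" using x[OF that] by simp
    then show ?thesis using power_mono[of 1 "2 - ln (x j)" 2] by simp
  qed
  have P0: "0 \<le> ?P j" if "j \<in> {1..q}" for j using x[OF that] by simp
  have S0: "0 \<le> ?S j" if "j \<in> {1..q}" for j using x[OF that] by simp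
  have Pd: "?P j \<le> 1 / d" if "j \<in> {1..q}" "d \<le> x j" for j
  proof -
    have "d * 1 \<le> x j * (2 - ln (x j))\<^sup>2" using that Y[OF that(1)] d by (intro mult_mono) auto
    then show ?thesis using d by (intro divide_left_mono) (auto intro!: mult_pos_pos)
  qed
  have d1: "1 \<le> 1 / d" using d by simp
  have sumS: "0 \<le> (\<Sum>j=1..q. ?S j)" by (rule sum_nonneg) (use S0 in auto)
  show ?thesis
  proof (cases "\<exists>i\<in>{1..q}. x i < d")
    case False
    then have "(\<Prod>j=1..q. ?P j) \<le> (\<Prod>j=1..q. 1 / d)" by (intro prod_mono conjI P0 Pd) (auto simp: not_less)
    also have "\<dots> = (1 / d) ^ q * 1" by simp
    also have "\<dots> \<le> 8 * (1 / d) ^ q * (1 + (\<Sum>j=1..q. ?S j))" using sumS d by (intro mult_mono) auto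
    finally show ?thesis .
  next
    case True
    then obtain i where i: "i \<in> {1..q}" "x i < d" by blast
    have "(\<Prod>j=1..q. ?P j) = ?P i * (\<Prod>j\<in>{1..q} - {i}. ?P j)" by (rule prod.remove) (use i in auto)
    also have "\<dots> \<le> (8 * ?S i) * (1 / d) ^ q"
    proof (rule mult_mono)
      have "1 \<le> 2 * (1 - x i)" using i d by simp
      then have "1 * ?P i \<le> 2 * (1 - x i) * ?P i" using P0[OF i(1)] by (intro mult_right_mono) auto
      also have "\<dots> = 8 * ?S i"
      proof -
        have "2 * t * (1 / D) = 8 * ((1/4) * (t / D))" for t D :: real by simp
        then show ?thesis by (simp only:)
      qed
      finally show "?P i \<le> 8 * ?S i" by simp
      have "(\<Prod>j\<in>{1..q} - {i}. ?P j) \<le> (\<Prod>j\<in>{1..q} - {i}. 1 / d)"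
        by (intro prod_mono conjI P0 Pd sep[OF i(1) _ _ i(2)]) auto
      also have "\<dots> = (1 / d) ^ card ({1..q} - {i})" by simp
      also have "\<dots> \<le> (1 / d) ^ q" by (rule power_increasing) (use d1 i in auto)
      finally show "(\<Prod>j\<in>{1..q} - {i}. ?P j) \<le> (1 / d) ^ q" .
      show "0 \<le> (\<Prod>j\<in>{1..q} - {i}. ?P j)" by (rule prod_nonneg) (use P0 in auto)
      show "0 \<le> 8 * ?S i" by (rule mult_nonneg_nonneg) (use S0[OF i(1)] in simp_all)
    qed
    also have "\<dots> \<le> (8 * (1 + (\<Sum>j=1..q. ?S j))) * (1 / d) ^ q"
    proof -
      have "?S i \<le> (\<Sum>j=1..q. ?S j)" by (rule member_le_sum) (use i S0 in auto)
      then have "?S i \<le> 1 + (\<Sum>j=1..q. ?S j)" by (rule order_trans) simp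
      then have "8 * ?S i \<le> 8 * (1 + (\<Sum>j=1..q. ?S j))" by (rule mult_left_mono) simp
      then show ?thesis by (rule mult_right_mono) (use d in simp)
    qed
    finally show ?thesis by (simp only: mult.commute mult.left_commute)
  qed
qed

lemma ln_one_plus_le: "0 \<le> x \<Longrightarrow> ln (1 + x) \<le> ln 2 + pos_part (ln x)"
proof (cases "x \<le> 1")
  case True
  assume "0 \<le> x"
  then have "ln (1 + x) \<le> ln 2" using True by (intro ln_mono) auto
  then show ?thesis by (simp add: pos_part_def)
next
  case False
  then have "ln (1 + x) \<le> ln (2 * x)" by (intro ln_mono) auto
  also have "\<dots> = ln 2 + ln x" using False by (intro ln_mult_pos) auto
  finally show ?thesis by (simp add: pos_part_def)
qed

lemma pos_part_ge: "x \<le> pos_part x" "0 \<le> pos_part x"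
  by (auto simp: pos_part_def)

section \<open>The second main theorem on a disc\<close>

context sphere_map
begin

definition generic_for :: "(nat \<Rightarrow> p1) \<Rightarrow> nat \<Rightarrow> real \<Rightarrow> bool" where
  "generic_for a q r \<longleftrightarrow> (\<forall>w. norm w = r \<longrightarrow> rho w \<noteq> 0 \<and> (\<forall>j\<in>{1..q}. F w \<noteq> a j))"

lemma countable_not_generic: "countable {r. ereal r < R \<and> \<not> generic_for a q r}"
proof -
  let ?B = "\<lambda>x. {w \<in> cball 0 x. rho w = 0} \<union> (\<Union>j\<in>{1..q}. {w \<in> cball 0 x. F w = a j})"
  have "{r. ereal r < R \<and> \<not> generic_for a q r} \<subseteq> (\<Union>x\<in>{x\<in>\<rat>. ereal x < R}. norm ` ?B x)"
  proof
    fix r assume r: "r \<in> {r. ereal r < R \<and> \<not> generic_for a q r}"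
    then obtain w where w: "norm w = r" "rho w = 0 \<or> (\<exists>j\<in>{1..q}. F w = a j)" by (auto simp: generic_for_def)
    obtain r' where r': "ereal r < ereal r'" "ereal r' < R" using r ereal_dense2 by blast
    then obtain x where x: "x \<in> \<rat>" "r < x" "x < r'" using Rats_dense_in_real[of r r'] by auto
    then have "ereal x < R" using r'(2) by (auto intro: less_trans[of "ereal x" "ereal r'"])
    moreover have "w \<in> ?B x" using w x by auto
    ultimately show "r \<in> (\<Union>x\<in>{x\<in>\<rat>. ereal x < R}. norm ` ?B x)" using w(1) x(1) by blast
  qed
  moreover have "countable (\<Union>x\<in>{x\<in>\<rat>. ereal x < R}. norm ` ?B x)"
  proof (rule countable_UN)
    show "countable {x \<in> \<rat>. ereal x < R}" by (rule countable_subset[OF _ countable_rat]) auto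
    fix x assume "x \<in> {x \<in> \<rat>. ereal x < R}"
    then have "finite (?B x)" using finite_branch_points finite_value_points by auto
    then show "countable (norm ` ?B x)" by (intro countable_finite finite_imageI)
  qed
  ultimately show ?thesis by (rule countable_subset)
qed

end

context weighted_map
begin

text \<open>
  A lower bound for the limit of the weights, by \<open>spike_lower\<close>.
\<close>

definition limit_weight :: "complex \<Rightarrow> real" where
  "limit_weight w = rho w * (1 + (\<Sum>j=1..q. (1/4) * ((1 - chordal (F w) (a j)) / (chordal (F w) (a j) * (2 - ln (chordal (F w) (a j)))\<^sup>2))))"

abbreviation generic :: "real \<Rightarrow> bool" where "generic \<equiv> generic_for a q"

lemma generic_circle:
  assumes "generic r" "ereal r < R" "norm w = r"
  shows "0 < rho w" "\<And>j. j \<in> {1..q} \<Longrightarrow> 0 < chordal (F w) (a j) \<and> chordal (F w) (a j) \<le> 1"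
    "\<And>j. j \<in> {1..q} \<Longrightarrow> 2 \<le> 2 - ln (chordal (F w) (a j))"
proof -
  have w: "ereal (norm w) < R" using assms by simp
  show "0 < rho w" using assms rho_nonneg[OF w] by (auto simp: generic_for_def order_le_less)
  show c: "0 < chordal (F w) (a j) \<and> chordal (F w) (a j) \<le> 1" if "j \<in> {1..q}" for j
    using chord_bounds[OF w, of "a j"] assms that by (force simp: generic_for_def)
  show "2 \<le> 2 - ln (chordal (F w) (a j))" if "j \<in> {1..q}" for j using c[OF that] by simp
qed

lemma generic_continuous:
  assumes "generic r" "ereal r < R" "j \<in> {1..q}"
  shows "continuous_on (sphere 0 r) (\<lambda>w. chordal (F w) (a j))" "continuous_on (sphere 0 r) (\<lambda>w. ln (chordal (F w) (a j)))"
    "continuous_on (sphere 0 r) rho"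
  using continuous_on_subset[OF chord_continuous[OF assms(2)], of "sphere 0 r"] continuous_on_subset[OF rho_continuous[OF assms(2)], of "sphere 0 r"]
    circle_continuous[OF assms(2), of "a j"] assms by (auto simp: generic_for_def)

lemma limit_weight_continuous:
  assumes g: "generic r" and r: "ereal r < R"
  shows "continuous_on (sphere 0 r) limit_weight"
proof -
  have "chordal (F w) (a j) * (2 - ln (chordal (F w) (a j)))\<^sup>2 \<noteq> 0" if "w \<in> sphere 0 r" "j \<in> {1..q}" for w j
  proof -
    have w: "norm w = r" using that by simp
    show ?thesis using generic_circle(2)[OF g r w that(2)] generic_circle(3)[OF g r w that(2)] by (intro no_zero_divisors power_not_zero) linarith+
  qed
  then show ?thesis unfolding limit_weight_def
    by (intro continuous_on_mult continuous_on_add continuous_on_const continuous_on_sum continuous_on_divide continuous_on_diff continuous_on_power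
         continuous_on_subset[OF rho_continuous[OF r]] generic_continuous[OF g r]) auto
qed

lemma limit_weight_pos:
  assumes "generic r" "ereal r < R" "norm w = r" shows "0 < limit_weight w"
proof -
  have "0 \<le> (\<Sum>j=1..q. (1/4) * ((1 - chordal (F w) (a j)) / (chordal (F w) (a j) * (2 - ln (chordal (F w) (a j)))\<^sup>2)))"
    by (intro sum_nonneg mult_nonneg_nonneg divide_nonneg_nonneg) (use generic_circle(2)[OF assms] in \<open>auto intro!: less_imp_le\<close>)
  then show ?thesis unfolding limit_weight_def using generic_circle(1)[OF assms] by (intro mult_pos_pos) auto
qed

lemma limit_weight_le_dens:
  assumes g: "generic r" and r: "0 < r" "ereal r < R"
  shows "ennreal (r * circle_mean limit_weight r) \<le> dens r"
proof -
  have "\<exists>m>0. \<forall>w. norm w = r \<longrightarrow> (\<forall>j\<in>{1..q}. m \<le> chordal (F w) (a j))"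
  proof -
    have "\<exists>m>0. \<forall>w. norm w = r \<longrightarrow> m \<le> chordal (F w) (a j)" if "j \<in> {1..q}" for j
      using circle_pos_lower[OF r(2), of "a j"] g that r unfolding generic_for_def by (metis less_imp_le)
    then obtain m where m: "\<And>j. j \<in> {1..q} \<Longrightarrow> 0 < m j \<and> (\<forall>w. norm w = r \<longrightarrow> m j \<le> chordal (F w) (a j))" by metis
    show ?thesis
    proof (intro exI[of _ "Min (insert 1 (m ` {1..q}))"] conjI allI impI ballI)
      show "0 < Min (insert 1 (m ` {1..q}))" using m by (subst Min_gr_iff) auto
      fix w :: complex and j assume w: "norm w = r" and j: "j \<in> {1..q}"
      have "Min (insert 1 (m ` {1..q})) \<le> m j" using j by (intro Min_le) auto
      also have "\<dots> \<le> chordal (F w) (a j)" using m[OF j] w by blast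
      finally show "Min (insert 1 (m ` {1..q})) \<le> chordal (F w) (a j)" .
    qed
  qed
  then obtain m where m: "0 < m" "\<And>w j. norm w = r \<Longrightarrow> j \<in> {1..q} \<Longrightarrow> m \<le> chordal (F w) (a j)" by blast
  obtain n0 :: nat where n0: "1 / m < real n0" using reals_Archimedean2 by blast
  show ?thesis
  proof (rule dens_lower[of r n0])
    show "r \<in> radii" using r by (simp add: radii_def)
    fix n assume n: "n0 \<le> n"
    have e: "1 / (real n + 1) \<le> m"
    proof -
      have "1 / m < real n + 1" using n0 n by linarith
      then show ?thesis using m(1) by (simp add: field_simps)
    qed
    have "circle_mean limit_weight r \<le> circle_mean (weight n) r"
    proof (rule circle_mean_mono[OF limit_weight_continuous[OF g r(2)]])
      show "continuous_on (sphere 0 r) (weight n)" by (rule continuous_on_subset[OF weight_continuous[OF r(2)]]) auto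
      fix w :: complex assume "w \<in> sphere 0 r"
      then have w: "norm w = r" by simp
      show "limit_weight w \<le> weight n w" unfolding limit_weight_def weight_def
      proof (intro mult_left_mono add_left_mono sum_mono)
        fix j assume j: "j \<in> {1..q}"
        show "(1/4) * ((1 - chordal (F w) (a j)) / (chordal (F w) (a j) * (2 - ln (chordal (F w) (a j)))\<^sup>2)) \<le> spike (1 / (real n + 1)) (chordal (F w) (a j))"
          by (rule spike_lower) (use e m(2)[OF w j] generic_circle(2)[OF g r(2) w j] in auto)
      qed (use generic_circle(1)[OF g r(2) w] in auto)
    qed (use r in auto)
    then show "r * circle_mean limit_weight r \<le> mass n r" unfolding mass_def using r by (intro mult_left_mono) auto
  qed
qed

definition prox :: "nat \<Rightarrow> real \<Rightarrow> real" where
  "prox j r = circle_mean (\<lambda>w. - ln (chordal (F w) (a j))) r"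

lemma prox_nonneg:
  assumes "generic r" "0 \<le> r" "ereal r < R" "j \<in> {1..q}" shows "0 \<le> prox j r"
proof -
  have "circle_mean (\<lambda>w. 0) r \<le> prox j r" unfolding prox_def
  proof (rule circle_mean_mono)
    show "continuous_on (sphere 0 r) (\<lambda>w. - ln (chordal (F w) (a j)))"
      by (intro continuous_on_minus generic_continuous(2) assms)
    fix w :: complex assume "w \<in> sphere 0 r"
    then show "0 \<le> - ln (chordal (F w) (a j))" using generic_circle(2)[OF assms(1,3) _ assms(4), of w] by simp
  qed (use assms in auto)
  then show ?thesis by simp
qed

lemma generic_s: "generic s" using s_generic by (simp add: generic_for_def)

text \<open>
  With \<open>Y j = 2 - ln (chordal (F w) (a j))\<close>, the sum \<open>\<Phi>\<close> is the logarithm of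
  \<open>rho * (\<Prod>j. 1 / (chordal (F w) (a j) * (Y j)\<^sup>2))\<close> plus \<open>2 * (\<Sum>j. ln (Y j))\<close>. The first product is dominated by the
  singular weight, and for both terms the mean of the logarithm is at most the logarithm of the mean.
\<close>

lemma \<Phi>_mean_le:
  assumes inj: "inj_on a {1..q}"
  shows "\<exists>k. \<forall>r. generic r \<longrightarrow> s \<le> r \<longrightarrow> ereal r < R \<longrightarrow>
    circle_mean (\<Phi> a q) r \<le> k + ln (circle_mean limit_weight r) + 2 * (\<Sum>j=1..q. ln (2 + prox j r))"
proof -
  obtain d where d: "0 < d" "d \<le> 1/2"
    and sep: "\<And>x i j. i \<in> {1..q} \<Longrightarrow> j \<in> {1..q} \<Longrightarrow> i \<noteq> j \<Longrightarrow> chordal x (a i) < d \<Longrightarrow> d \<le> chordal x (a j)"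
    using chordal_uniform_separation[OF inj] by blast
  define k where "k = ln (8 * (1 / d) ^ q)"
  have K: "0 < 8 * (1 / d) ^ q" using d by simp
  have "circle_mean (\<Phi> a q) r \<le> k + ln (circle_mean limit_weight r) + 2 * (\<Sum>j=1..q. ln (2 + prox j r))"
    if g: "generic r" and r: "s \<le> r" "ereal r < R" for r
  proof -
    have r0: "0 < r" using r s by simp
    let ?Y = "\<lambda>j w. 2 - ln (chordal (F w) (a j))"
    have cY: "continuous_on (sphere 0 r) (?Y j)" if "j \<in> {1..q}" for j
      by (intro continuous_on_diff continuous_on_const generic_continuous(2) g r that)
    have Y2: "2 \<le> ?Y j w" if "j \<in> {1..q}" "norm w = r" for j w using generic_circle(3)[OF g r(2) that(2,1)] .
    have clY: "continuous_on (sphere 0 r) (\<lambda>w. ln (?Y j w))" if "j \<in> {1..q}" for j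
      by (intro continuous_on_ln cY that ballI) (use Y2[OF that] in force)
    have cl: "continuous_on (sphere 0 r) (\<lambda>w. ln (limit_weight w))"
      by (intro continuous_on_ln limit_weight_continuous g r ballI) (use limit_weight_pos[OF g r(2)] in force)
    have cS: "continuous_on (sphere 0 r) (\<lambda>w. \<Sum>j=1..q. ln (?Y j w))" by (intro continuous_on_sum clY) auto
    have c\<Phi>: "continuous_on (sphere 0 r) (\<Phi> a q)" unfolding \<Phi>_def
    proof (intro continuous_on_diff continuous_on_sum generic_continuous(2)[OF g r(2)])
      have "continuous_on (sphere 0 r) rho" by (rule continuous_on_subset[OF rho_continuous[OF r(2)]]) auto
      then show "continuous_on (sphere 0 r) (\<lambda>w. ln (rho w))"
        using generic_circle(1)[OF g r(2)] by (intro continuous_on_ln ballI) force+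
    qed auto
    have pw: "\<Phi> a q w \<le> (k + ln (limit_weight w)) + 2 * (\<Sum>j=1..q. ln (?Y j w))" if w: "norm w = r" for w
    proof -
      let ?x = "\<lambda>j. chordal (F w) (a j)"
      have x: "0 < ?x j \<and> ?x j \<le> 1" if "j \<in> {1..q}" for j using generic_circle(2)[OF g r(2) w that] .
      have rho: "0 < rho w" using generic_circle(1)[OF g r(2) w] .
      have P0: "0 < 1 / (?x j * (?Y j w)\<^sup>2)" if "j \<in> {1..q}" for j using x[OF that] Y2[OF that w] by (intro divide_pos_pos mult_pos_pos zero_less_power) linarith+
      have "(\<Prod>j=1..q. 1 / (?x j * (?Y j w)\<^sup>2)) \<le> 8 * (1 / d) ^ q * (1 + (\<Sum>j=1..q. (1/4) * ((1 - ?x j) / (?x j * (?Y j w)\<^sup>2))))"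
        by (rule prod_singular_le_sum[OF x d sep])
      then have "rho w * (\<Prod>j=1..q. 1 / (?x j * (?Y j w)\<^sup>2)) \<le> rho w * (8 * (1 / d) ^ q * (1 + (\<Sum>j=1..q. (1/4) * ((1 - ?x j) / (?x j * (?Y j w)\<^sup>2)))))"
        using rho by (intro mult_left_mono) auto
      also have "\<dots> = 8 * (1 / d) ^ q * limit_weight w" by (simp only: limit_weight_def mult_ac)
      finally have "ln (rho w * (\<Prod>j=1..q. 1 / (?x j * (?Y j w)\<^sup>2))) \<le> ln (8 * (1 / d) ^ q * limit_weight w)"
        by (intro ln_mono mult_pos_pos rho prod_pos P0) auto
      also have "\<dots> = k + ln (limit_weight w)" unfolding k_def by (rule ln_mult_pos[OF K limit_weight_pos[OF g r(2) w]])
      finally have 1: "ln (rho w * (\<Prod>j=1..q. 1 / (?x j * (?Y j w)\<^sup>2))) \<le> k + ln (limit_weight w)" .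
      have "ln (rho w * (\<Prod>j=1..q. 1 / (?x j * (?Y j w)\<^sup>2))) = ln (rho w) + ln (\<Prod>j=1..q. 1 / (?x j * (?Y j w)\<^sup>2))"
        by (rule ln_mult_pos[OF rho prod_pos]) (use P0 in auto)
      also have "ln (\<Prod>j=1..q. 1 / (?x j * (?Y j w)\<^sup>2)) = (\<Sum>j=1..q. ln (1 / (?x j * (?Y j w)\<^sup>2)))"
        by (rule ln_prod) (use P0 in \<open>force dest: less_imp_neq\<close>)+
      also have "\<dots> = (\<Sum>j=1..q. - ln (?x j) - 2 * ln (?Y j w))"
      proof (rule sum.cong[OF refl])
        fix j assume j: "j \<in> {1..q}"
        have "ln (1 / (u * y\<^sup>2)) = - ln u - 2 * ln y" if "0 < u" "0 < y" for u y :: real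
          using that by (simp add: ln_div ln_mult_pos ln_realpow)
        then show "ln (1 / (?x j * (?Y j w)\<^sup>2)) = - ln (?x j) - 2 * ln (?Y j w)"
          using x[OF j] Y2[OF j w] by (meson less_le_trans zero_less_numeral)
      qed
      also have "\<dots> = - (\<Sum>j=1..q. ln (?x j)) - 2 * (\<Sum>j=1..q. ln (?Y j w))"
        by (simp add: sum_subtractf sum_negf sum_distrib_left)
      finally show ?thesis using 1 unfolding \<Phi>_def by linarith
    qed
    have "circle_mean (\<Phi> a q) r \<le> circle_mean (\<lambda>w. (k + ln (limit_weight w)) + 2 * (\<Sum>j=1..q. ln (?Y j w))) r"
      by (rule circle_mean_mono[OF c\<Phi>]) (use cl cS pw r0 in \<open>auto intro!: continuous_on_add continuous_on_mult\<close>)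
    also have "\<dots> = k + circle_mean (\<lambda>w. ln (limit_weight w)) r + 2 * (\<Sum>j=1..q. circle_mean (\<lambda>w. ln (?Y j w)) r)"
      using circle_mean_add[of r "\<lambda>w. k + ln (limit_weight w)" "\<lambda>w. 2 * (\<Sum>j=1..q. ln (?Y j w))"]
        circle_mean_add[of r "\<lambda>w. k" "\<lambda>w. ln (limit_weight w)"] cl cS r0
        circle_mean_cmult[of 2 "\<lambda>w. \<Sum>j=1..q. ln (?Y j w)" r] circle_mean_sum[of "{1..q}" r "\<lambda>j w. ln (?Y j w)"] clY
      by (simp add: continuous_on_add continuous_on_mult)
    also have "\<dots> \<le> k + ln (circle_mean limit_weight r) + 2 * (\<Sum>j=1..q. ln (2 + prox j r))"
    proof (intro add_mono mult_left_mono sum_mono order_refl)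
      show "circle_mean (\<lambda>w. ln (limit_weight w)) r \<le> ln (circle_mean limit_weight r)"
        by (rule circle_mean_ln_le(1)[OF r0 limit_weight_continuous[OF g r(2)] limit_weight_pos[OF g r(2)]])
      fix j assume j: "j \<in> {1..q}"
      have "circle_mean (\<lambda>w. ln (?Y j w)) r \<le> ln (circle_mean (?Y j) r)"
        by (rule circle_mean_ln_le(1)[OF r0 cY[OF j]]) (use Y2[OF j] in force)
      also have "circle_mean (?Y j) r = 2 + prox j r" unfolding prox_def
        using circle_mean_add[of r "\<lambda>w. 2" "\<lambda>w. - ln (chordal (F w) (a j))"] generic_continuous(2)[OF g r(2) j] r0
        by (simp add: continuous_on_minus)
      finally show "circle_mean (\<lambda>w. ln (?Y j w)) r \<le> ln (2 + prox j r)" .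
    qed simp
    finally show ?thesis .
  qed
  then show ?thesis by blast
qed

text \<open>
  The logarithm of the bound in \<open>growth_of_density\<close>. The restriction \<open>\<delta> \<le> 1\<close> keeps the coefficients
  \<open>2 + \<delta>\<close> and \<open>(1 + \<delta>)\<^sup>2\<close> bounded independently of \<open>\<delta>\<close>.
\<close>

lemma ln_mean_weight_le:
  assumes g: "generic r" and r: "s < r" "ereal r < R" and \<gamma>: "0 < \<gamma>" and \<delta>: "0 < \<delta>" "\<delta> \<le> 1"
    and dens: "dens r \<le> ennreal (\<gamma> * (r * \<gamma> * (1 + init_const * (char_T s r + 1)) powr (1 + \<delta>)) powr (1 + \<delta>))"
  shows "ln (circle_mean limit_weight r) \<le> pos_part (\<delta> * ln r) + 3 * pos_part (ln \<gamma>)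
     + 4 * (ln (1 + init_const) + ln 2 + pos_part (ln (char_T s r)))"
proof -
  have r0: "0 < r" using r s by simp
  let ?M = "circle_mean limit_weight r" and ?T = "char_T s r"
  define B where "B = 1 + init_const * (?T + 1)"
  have M: "0 < ?M" by (rule circle_mean_ln_le(2)[OF r0 limit_weight_continuous[OF g r(2)] limit_weight_pos[OF g r(2)]])
  have T0: "0 \<le> ?T" by (rule char_T_nonneg[OF r(2) s(1)])
  have B1: "1 \<le> B" unfolding B_def using T0 init_const_pos by simp
  have "ennreal (r * ?M) \<le> ennreal (\<gamma> * (r * \<gamma> * B powr (1 + \<delta>)) powr (1 + \<delta>))"
    using limit_weight_le_dens[OF g r0 r(2)] dens unfolding B_def by (rule order_trans)
  then have "r * ?M \<le> \<gamma> * (r * \<gamma> * B powr (1 + \<delta>)) powr (1 + \<delta>)" using \<gamma> by (subst (asm) ennreal_le_iff) auto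
  then have "ln (r * ?M) \<le> ln (\<gamma> * (r * \<gamma> * B powr (1 + \<delta>)) powr (1 + \<delta>))" using r0 M by (intro ln_mono) auto
  also have "\<dots> = ln \<gamma> + (1 + \<delta>) * (ln r + ln \<gamma> + (1 + \<delta>) * ln B)"
    using \<gamma> r0 B1 by (simp add: ln_mult_pos ln_powr)
  finally have "ln ?M \<le> ln \<gamma> + (1 + \<delta>) * (ln r + ln \<gamma> + (1 + \<delta>) * ln B) - ln r"
    using r0 M by (simp add: ln_mult_pos)
  also have "\<dots> = \<delta> * ln r + (2 + \<delta>) * ln \<gamma> + (1 + \<delta>)\<^sup>2 * ln B" by (simp add: power2_eq_square algebra_simps)
  also have "\<dots> \<le> pos_part (\<delta> * ln r) + 3 * pos_part (ln \<gamma>) + 4 * ln B"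
  proof (intro add_mono pos_part_ge)
    have "(2 + \<delta>) * ln \<gamma> \<le> (2 + \<delta>) * pos_part (ln \<gamma>)" using \<delta> pos_part_ge by (intro mult_left_mono) auto
    also have "\<dots> \<le> 3 * pos_part (ln \<gamma>)" using \<delta> pos_part_ge by (intro mult_right_mono) auto
    finally show "(2 + \<delta>) * ln \<gamma> \<le> 3 * pos_part (ln \<gamma>)" .
    have "(1 + \<delta>)\<^sup>2 \<le> 2\<^sup>2" using \<delta> by (intro power_mono) auto
    then show "(1 + \<delta>)\<^sup>2 * ln B \<le> 4 * ln B" using B1 by (intro mult_right_mono) auto
  qed
  also have "ln B \<le> ln (1 + init_const) + ln (1 + ?T)"
  proof -
    have "B \<le> (1 + init_const) * (1 + ?T)" unfolding B_def using T0 init_const_pos by (simp add: algebra_simps)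
    then have "ln B \<le> ln ((1 + init_const) * (1 + ?T))" using B1 by (intro ln_mono) auto
    also have "\<dots> = ln (1 + init_const) + ln (1 + ?T)" using T0 init_const_pos by (intro ln_mult_pos) auto
    finally show ?thesis .
  qed
  also have "ln (1 + ?T) \<le> ln 2 + pos_part (ln ?T)" by (rule ln_one_plus_le[OF T0])
  finally show ?thesis by simp
qed

text \<open>
  Apart from the choice of the exceptional set, all estimates are uniform in \<open>\<delta> \<le> 1\<close>. Radii that are not generic
  are countably many, and are put into the exceptional set.
\<close>

theorem second_main_theorem_disc:
  fixes \<gamma> :: "real \<Rightarrow> real"
  defines "J \<equiv> {r. s < r \<and> ereal r < R}"
  assumes \<gamma>: "set_borel_measurable lebesgue J \<gamma>" "\<And>r. r \<in> J \<Longrightarrow> 0 < \<gamma> r" and inj: "inj_on a {1..q}"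
  shows "\<exists>C\<ge>0. \<forall>\<delta>. 0 < \<delta> \<longrightarrow> \<delta> \<le> 1 \<longrightarrow> (\<exists>E. E \<subseteq> J \<and> E \<in> sets lebesgue \<and> (\<integral>\<^sup>+r\<in>E. ennreal (\<gamma> r) \<partial>lebesgue) < \<infinity> \<and>
     (\<forall>r\<in>J - E. (real q - 2) * char_T s r \<le> (\<Sum>j=1..q. count_int (a j) s r)
        + C * (1 + pos_part (ln (char_T s r)) + pos_part (ln (\<gamma> r)) + pos_part (\<delta> * ln r))))"
proof -
  obtain k where k: "\<And>r. generic r \<Longrightarrow> s \<le> r \<Longrightarrow> ereal r < R \<Longrightarrow>
    circle_mean (\<Phi> a q) r \<le> k + ln (circle_mean limit_weight r) + 2 * (\<Sum>j=1..q. ln (2 + prox j r))"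
    using \<Phi>_mean_le[OF inj] by blast
  define C0 where "C0 = k + 4 * (ln (1 + init_const) + ln 2) + 2 * (\<Sum>j=1..q. ln (2 + prox j s) + ln 2) - circle_mean (\<Phi> a q) s"
  \<comment> \<open>\<open>4 + 2 * q\<close> is the coefficient of \<open>ln T\<close>: \<open>4\<close> from the density and \<open>2\<close> from each proximity function\<close>
  define C where "C = \<bar>C0\<bar> + 4 + 2 * real q"
  have main: "(real q - 2) * char_T s r \<le> (\<Sum>j=1..q. count_int (a j) s r)
        + C * (1 + pos_part (ln (char_T s r)) + pos_part (ln (\<gamma> r)) + pos_part (\<delta> * ln r))"
    if rJ: "r \<in> J" and g: "generic r" and \<delta>: "0 < \<delta>" "\<delta> \<le> 1"
      and dens: "dens r \<le> ennreal (\<gamma> r * (r * \<gamma> r * (1 + init_const * (char_T s r + 1)) powr (1 + \<delta>)) powr (1 + \<delta>))" for r \<delta>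
  proof -
    have r: "s < r" "ereal r < R" "s \<le> r" using rJ by (auto simp: J_def)
    let ?T = "char_T s r"
    have T0: "0 \<le> ?T" by (rule char_T_nonneg[OF r(2) s(1)])
    have pr: "ln (2 + prox j r) \<le> (ln (2 + prox j s) + ln 2) + pos_part (ln ?T)" if j: "j \<in> {1..q}" for j
    proof -
      have ms: "0 \<le> prox j s" by (rule prox_nonneg[OF generic_s _ s(2) j]) (use s in simp)
      have mr: "0 \<le> prox j r" by (rule prox_nonneg[OF g _ r(2) j]) (use s r in simp)
      have "prox j r \<le> 2 * ?T + prox j s" unfolding prox_def
        by (rule proximity_bound[OF s(1) r(3,2)]) (use g generic_s j in \<open>auto simp: generic_for_def\<close>)
      also have "2 + (2 * ?T + prox j s) \<le> (2 + prox j s) * (1 + ?T)" using T0 ms by (simp add: algebra_simps)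
      finally have "ln (2 + prox j r) \<le> ln ((2 + prox j s) * (1 + ?T))" using mr by (intro ln_mono) auto
      also have "\<dots> = ln (2 + prox j s) + ln (1 + ?T)" using T0 ms by (intro ln_mult_pos) auto
      finally show ?thesis using ln_one_plus_le[OF T0] by simp
    qed
    have "(\<Sum>j=1..q. ln (2 + prox j r)) \<le> (\<Sum>j=1..q. (ln (2 + prox j s) + ln 2) + pos_part (ln ?T))"
      by (rule sum_mono) (use pr in auto)
    also have "\<dots> = (\<Sum>j=1..q. ln (2 + prox j s) + ln 2) + real q * pos_part (ln ?T)" by (simp add: sum.distrib)
    finally have S: "(\<Sum>j=1..q. ln (2 + prox j r)) \<le> (\<Sum>j=1..q. ln (2 + prox j s) + ln 2) + real q * pos_part (ln ?T)" .
    have gp: "0 < \<gamma> r" using \<gamma>(2) rJ .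
    have "(real q - 2) * (2 * ?T) \<le> circle_mean (\<Phi> a q) r - circle_mean (\<Phi> a q) s + 2 * (\<Sum>j=1..q. count_int (a j) s r)"
      by (rule truncated_main_inequality[OF s(1) r(3,2) inj]) (use g generic_s in \<open>auto simp: generic_for_def\<close>)
    then have "2 * ((real q - 2) * ?T) \<le> 2 * (\<Sum>j=1..q. count_int (a j) s r) + C0 + (4 + 2 * real q) * pos_part (ln ?T)
        + 3 * pos_part (ln (\<gamma> r)) + pos_part (\<delta> * ln r)"
      using k[OF g r(3,2)] ln_mean_weight_le[OF g r(1,2) gp \<delta> dens] S unfolding C0_def by (simp add: algebra_simps)
    also have "\<dots> \<le> 2 * (\<Sum>j=1..q. count_int (a j) s r) + 2 * (C * (1 + pos_part (ln ?T) + pos_part (ln (\<gamma> r)) + pos_part (\<delta> * ln r)))"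
    proof -
      have "C0 \<le> 2 * C" "(4 + 2 * real q) * pos_part (ln ?T) \<le> 2 * C * pos_part (ln ?T)"
        "3 * pos_part (ln (\<gamma> r)) \<le> 2 * C * pos_part (ln (\<gamma> r))" "1 * pos_part (\<delta> * ln r) \<le> 2 * C * pos_part (\<delta> * ln r)"
        unfolding C_def by (simp, (rule mult_right_mono[OF _ pos_part_ge(2)], simp)+)
      then show ?thesis by (simp add: algebra_simps)
    qed
    finally show ?thesis by simp
  qed
  define N where "N = {r \<in> J. \<not> generic r}"
  have "countable N" unfolding N_def
    by (rule countable_subset[OF _ countable_not_generic[of a q]]) (auto simp: J_def)
  then have N0: "N \<in> null_sets lebesgue" by (intro null_sets_completionI countable_imp_null_set_lborel)
  show ?thesis
  proof (intro exI[of _ C] conjI allI impI)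
    show "0 \<le> C" by (simp add: C_def)
    fix \<delta> :: real assume \<delta>: "0 < \<delta>" "\<delta> \<le> 1"
    obtain E where E: "E \<subseteq> J" "E \<in> sets lebesgue" "(\<integral>\<^sup>+r\<in>E. ennreal (\<gamma> r) \<partial>lebesgue) < \<infinity>"
      and dens: "\<And>r. r \<in> J - E \<Longrightarrow> dens r \<le> ennreal (\<gamma> r * (r * \<gamma> r * (1 + init_const * (char_T s r + 1)) powr (1 + \<delta>)) powr (1 + \<delta>))"
      using growth_of_density[OF \<gamma>[unfolded J_def] \<delta>(1)] unfolding J_def by blast
    have "(\<integral>\<^sup>+r\<in>E \<union> N. ennreal (\<gamma> r) \<partial>lebesgue) = (\<integral>\<^sup>+r\<in>E. ennreal (\<gamma> r) \<partial>lebesgue)"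
      by (rule nn_integral_cong_AE) (use AE_not_in[OF N0] in \<open>auto elim!: eventually_mono simp: indicator_def\<close>)
    then show "\<exists>E. E \<subseteq> J \<and> E \<in> sets lebesgue \<and> (\<integral>\<^sup>+r\<in>E. ennreal (\<gamma> r) \<partial>lebesgue) < \<infinity> \<and>
     (\<forall>r\<in>J - E. (real q - 2) * char_T s r \<le> (\<Sum>j=1..q. count_int (a j) s r)
        + C * (1 + pos_part (ln (char_T s r)) + pos_part (ln (\<gamma> r)) + pos_part (\<delta> * ln r)))"
    proof (intro exI[of _ "E \<union> N"] conjI ballI)
      fix r assume r: "r \<in> J - (E \<union> N)"
      then have "r \<in> J - E" "r \<in> J" "generic r" by (auto simp: N_def)
      then show "(real q - 2) * char_T s r \<le> (\<Sum>j=1..q. count_int (a j) s r)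
        + C * (1 + pos_part (ln (char_T s r)) + pos_part (ln (\<gamma> r)) + pos_part (\<delta> * ln r))"
        using main[OF _ _ \<delta> dens] by blast
    qed (use E N0 in \<open>auto simp: N_def\<close>)
  qed
qed

end

section \<open>Global homogeneous coordinates on a disc\<close>

text \<open>
  If the first coordinate vanished on a disc, the map would be infinite there, hence by continuation along
  the connected domain everywhere, which \<open>w0\<close> excludes. So it has a zero of finite order, and the
  remaining unit can be divided out of both coordinates.
\<close>

lemma local_normal_lift:
  assumes \<Omega>: "open \<Omega>" "connected \<Omega>"
    and loc: "\<And>w. w \<in> \<Omega> \<Longrightarrow> \<exists>W G0 G1. w \<in> W \<and> lift_on W F G0 G1"
    and fin: "w0 \<in> \<Omega>" "F w0 \<noteq> Infty" and p: "p \<in> \<Omega>"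
  shows "\<exists>e m K. 0 < e \<and> lift_on (ball p e) F (\<lambda>w. (w - p) ^ m) K"
proof -
  have ball: "\<exists>e G0 G1. 0 < e \<and> ball w e \<subseteq> \<Omega> \<and> lift_on (ball w e) F G0 G1" if w: "w \<in> \<Omega>" for w
  proof -
    obtain W G0 G1 where W: "w \<in> W" "lift_on W F G0 G1" using loc[OF w] by blast
    then have "open (W \<inter> \<Omega>)" using \<Omega>(1) by (auto simp: lift_on_def)
    then obtain e where e: "0 < e" "ball w e \<subseteq> W \<inter> \<Omega>" using W(1) w openE by (metis IntI)
    have "lift_on (ball w e) F G0 G1"
      using W(2) e(2) unfolding lift_on_def by (auto intro: holomorphic_on_subset)
    then show ?thesis using e by blast
  qed
  define U where "U = {w. \<exists>e>0. \<forall>v\<in>ball w e. F v = Infty}"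
  have opU: "open U"
  proof (subst open_contains_ball, intro ballI)
    fix w assume "w \<in> U"
    then obtain e where e: "0 < e" "\<And>v. v \<in> ball w e \<Longrightarrow> F v = Infty" by (auto simp: U_def)
    have "ball w e \<subseteq> U"
    proof
      fix v assume v: "v \<in> ball w e"
      then obtain d where d: "0 < d" "ball v d \<subseteq> ball w e" using open_ball openE by metis
      show "v \<in> U" unfolding U_def mem_Collect_eq using d e(2) by (meson subsetD)
    qed
    then show "\<exists>e>0. ball w e \<subseteq> U" using e(1) by blast
  qed
  have avoid: "\<exists>e>0. ball w e \<inter> U = {}" if w: "w \<in> \<Omega>" "w \<notin> U" for w
  proof -
    obtain e G0 G1 where e: "0 < e" "lift_on (ball w e) F G0 G1" using ball[OF w(1)] by blast
    have "ball w e \<inter> U = {}"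
    proof (rule ccontr)
      assume "ball w e \<inter> U \<noteq> {}"
      then obtain v where v: "v \<in> ball w e" "v \<in> U" by blast
      have ne: "open (ball w e \<inter> U)" "ball w e \<inter> U \<noteq> {}" using v opU by auto
      have z: "G0 x = 0" if x: "x \<in> ball w e \<inter> U" for x
      proof -
        obtain d where "0 < d" "\<forall>v\<in>ball x d. F v = Infty" using x by (auto simp: U_def)
        then have "F x = Infty" by simp
        then show ?thesis using x e(2) unfolding lift_on_def p1_point_def by (metis IntD1 p1.distinct(1))
      qed
      have hol: "G0 holomorphic_on ball w e" using e(2) by (simp add: lift_on_def)
      have "G0 x = 0" if "x \<in> ball w e" for x
        using analytic_continuation_open[OF ne(1) open_ball ne(2) connected_ball _ hol holomorphic_on_const z that] by auto
      then have "\<forall>x\<in>ball w e. F x = Infty" using e(2) by (auto simp: lift_on_def p1_point_def)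
      then show False using w(2) e(1) by (auto simp: U_def)
    qed
    then show ?thesis using e(1) by blast
  qed
  have "U \<inter> \<Omega> = {}"
  proof -
    define V where "V = (\<Union>{ball w e |w e. w \<in> \<Omega> \<and> ball w e \<inter> U = {}})"
    have "open V" unfolding V_def by (rule open_Union) auto
    moreover have "\<Omega> \<subseteq> U \<union> V"
    proof
      fix w assume w: "w \<in> \<Omega>"
      show "w \<in> U \<union> V"
      proof (cases "w \<in> U")
        case False
        then obtain e where "0 < e" "ball w e \<inter> U = {}" using avoid[OF w] by blast
        then have "w \<in> ball w e" "ball w e \<subseteq> V" using w unfolding V_def by auto
        then show ?thesis by blast
      qed simp
    qed
    moreover have "U \<inter> V \<inter> \<Omega> = {}" unfolding V_def by blast
    ultimately have "U \<inter> \<Omega> = {} \<or> V \<inter> \<Omega> = {}" using connectedD[OF \<Omega>(2) opU, of V] by blast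
    moreover have "w0 \<notin> U"
    proof
      assume "w0 \<in> U"
      then obtain e where "0 < e" "\<forall>v\<in>ball w0 e. F v = Infty" by (auto simp: U_def)
      then show False using fin(2) by simp
    qed
    ultimately show ?thesis using \<open>\<Omega> \<subseteq> U \<union> V\<close> fin(1) by blast
  qed
  then have pU: "p \<notin> U" using p by blast
  obtain e G0 G1 where e: "0 < e" "lift_on (ball p e) F G0 G1" using ball[OF p] by blast
  have hol: "G0 holomorphic_on ball p e" "G1 holomorphic_on ball p e"
    and nz: "\<And>w. w \<in> ball p e \<Longrightarrow> (G0 w \<noteq> 0 \<or> G1 w \<noteq> 0) \<and> F w = p1_point (G0 w) (G1 w)"
    using e(2) by (auto simp: lift_on_def)
  have fact: "\<exists>g r n. 0 < r \<and> ball p r \<subseteq> ball p e \<and> g holomorphic_on ball p r \<and>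
      (\<forall>w\<in>ball p r. G0 w = (w - p) ^ n * g w \<and> g w \<noteq> 0)"
  proof (cases "G0 p = 0")
    case True
    have "\<not> G0 constant_on ball p e"
    proof
      assume "G0 constant_on ball p e"
      then have "\<forall>w\<in>ball p e. G0 w = 0" using True e(1) unfolding constant_on_def by (metis centre_in_ball)
      then have "\<forall>w\<in>ball p e. F w = Infty" using nz by (simp add: p1_point_def)
      then show False using pU e(1) by (auto simp: U_def)
    qed
    then show ?thesis
      using holomorphic_factor_zero_nonconstant[OF hol(1) open_ball connected_ball _ True] e(1) by (metis centre_in_ball)
  next
    case False
    have "open (ball p e \<inter> G0 -` (- {0}))"
      by (rule continuous_open_preimage[OF holomorphic_on_imp_continuous_on[OF hol(1)]]) auto
    then obtain r where r: "0 < r" "ball p r \<subseteq> ball p e \<inter> G0 -` (- {0})" using False e(1) openE by (metis ComplI IntI centre_in_ball singletonD vimageI)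
    show ?thesis
      by (rule exI[of _ G0], rule exI[of _ r], rule exI[of _ 0]) (use r hol(1) in \<open>auto intro: holomorphic_on_subset\<close>)
  qed
  then obtain g r n where g: "0 < r" "ball p r \<subseteq> ball p e" "g holomorphic_on ball p r"
    "\<And>w. w \<in> ball p r \<Longrightarrow> G0 w = (w - p) ^ n * g w \<and> g w \<noteq> 0" by blast
  have "lift_on (ball p r) F (\<lambda>w. (w - p) ^ n) (\<lambda>w. G1 w / g w)"
    unfolding lift_on_def
  proof (intro conjI ballI)
    show "(\<lambda>w. (w - p) ^ n) holomorphic_on ball p r" by (intro holomorphic_intros)
    show "(\<lambda>w. G1 w / g w) holomorphic_on ball p r"
      by (intro holomorphic_on_divide g holomorphic_on_subset[OF hol(2)]) (use g in auto)
    fix w assume w: "w \<in> ball p r"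
    have gw: "G0 w = (w - p) ^ n * g w" "g w \<noteq> 0" using g(4)[OF w] by auto
    have we: "w \<in> ball p e" using w g(2) by blast
    show "(w - p) ^ n \<noteq> 0 \<or> G1 w / g w \<noteq> 0" using nz[OF we] gw by auto
    have "F w = p1_point (G0 w) (G1 w)" using nz[OF we] by blast
    then show "F w = p1_point ((w - p) ^ n) (G1 w / g w)" unfolding gw(1) using gw(2) by (simp add: p1_point_def mult.commute)
  qed auto
  then show ?thesis using g(1) by blast
qed

text \<open>
  By compactness there are finitely many poles in the closed disc. The product of \<open>(w - p) ^ m p\<close> over the
  poles is a global first coordinate, and the second one is the product of it with the function,
  which extends over the poles.
\<close>

theorem lift_on_disc:
  assumes \<Omega>: "open \<Omega>" "connected \<Omega>" "cball 0 r \<subseteq> \<Omega>"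
    and loc: "\<And>w. w \<in> \<Omega> \<Longrightarrow> \<exists>W G0 G1. w \<in> W \<and> lift_on W F G0 G1"
    and fin: "w0 \<in> \<Omega>" "F w0 \<noteq> Infty"
  shows "\<exists>G0 G1. lift_on (ball 0 r) F G0 G1"
proof -
  have "\<forall>p\<in>\<Omega>. \<exists>e m K. 0 < e \<and> lift_on (ball p e) F (\<lambda>w. (w - p) ^ m) K"
    using local_normal_lift[OF \<Omega>(1,2) loc fin] by blast
  then obtain e m K where loc': "\<And>p. p \<in> \<Omega> \<Longrightarrow> 0 < e p \<and> lift_on (ball p (e p)) F (\<lambda>w. (w - p) ^ m p) (K p)" by metis
  have e: "0 < e p" and holK: "K p holomorphic_on ball p (e p)"
    and nz: "\<And>w. w \<in> ball p (e p) \<Longrightarrow> (w - p) ^ m p \<noteq> 0 \<or> K p w \<noteq> 0"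
    and Fp: "\<And>w. w \<in> ball p (e p) \<Longrightarrow> F w = p1_point ((w - p) ^ m p) (K p w)" if "p \<in> \<Omega>" for p
    using loc'[OF that] by (auto simp: lift_on_def)
  have pole: "w = p \<and> m p \<noteq> 0" if "p \<in> \<Omega>" "w \<in> ball p (e p)" "F w = Infty" for p w
    using Fp[OF that(1,2)] that(3) by (auto simp: p1_point_def split: if_splits)
  define P where "P = {w \<in> cball 0 r. F w = Infty}"
  have "finite P"
  proof -
    obtain D where D: "D \<subseteq> cball 0 r" "finite D" "cball 0 r \<subseteq> (\<Union>p\<in>D. ball p (e p))"
      by (rule compactE_image[of "cball (0::complex) r" "cball 0 r" "\<lambda>p. ball p (e p)"]) (use e \<Omega>(3) in \<open>auto, force\<close>)
    have "P \<subseteq> D"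
    proof
      fix w assume w: "w \<in> P"
      then obtain p where "p \<in> D" "w \<in> ball p (e p)" using D(3) by (auto simp: P_def)
      then show "w \<in> D" using pole[of p w] w D(1) \<Omega>(3) by (auto simp: P_def)
    qed
    then show ?thesis using D(2) finite_subset by blast
  qed
  \<comment> \<open>the product without the factor of \<open>p\<close>; near \<open>p\<close> the second coordinate is \<open>A p * K p\<close>\<close>
  define A where "A p w = (\<Prod>q\<in>P - {p}. (w - q) ^ m q)" for p w
  define G0 where "G0 w = (\<Prod>q\<in>P. (w - q) ^ m q)" for w
  define G1 where "G1 w = (if w \<in> P then A w w * K w w else G0 w * (case F w of Fin z \<Rightarrow> z | Infty \<Rightarrow> 0))" for w
  have G0A: "G0 w = (w - p) ^ m p * A p w" if p: "p \<in> \<Omega>" "p \<in> cball 0 r" for p w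
  proof (cases "p \<in> P")
    case True
    then show ?thesis unfolding G0_def A_def using \<open>finite P\<close> by (subst prod.remove[of P p]) auto
  next
    case False
    then have "F p \<noteq> Infty" using p by (simp add: P_def)
    then have "m p = 0" using Fp[OF p(1), of p] e[OF p(1)] by (auto simp: p1_point_def split: if_splits)
    then show ?thesis using False by (simp add: G0_def A_def)
  qed
  have G1A: "G1 w = A p w * K p w" if p: "p \<in> \<Omega>" "p \<in> cball 0 r" and w: "w \<in> ball p (e p)" "w \<in> cball 0 r" for p w
  proof (cases "w \<in> P")
    case True
    then have "w = p" using pole[OF p(1) w(1)] by (simp add: P_def)
    then show ?thesis using True by (simp add: G1_def)
  next
    case False
    then have "F w \<noteq> Infty" using w by (simp add: P_def)
    then have n: "(w - p) ^ m p \<noteq> 0" and "F w = Fin (K p w / (w - p) ^ m p)"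
      using Fp[OF p(1) w(1)] by (auto simp: p1_point_def split: if_splits)
    then have "G1 w = G0 w * (K p w / (w - p) ^ m p)" using False by (simp add: G1_def)
    also have "\<dots> = A p w * K p w" unfolding G0A[OF p, of w] using n by (simp del: power_eq_0_iff)
    finally show ?thesis .
  qed
  have An: "A p p \<noteq> 0" for p unfolding A_def using \<open>finite P\<close> by (subst prod_zero_iff) auto
  have "lift_on (ball 0 r) F G0 G1" unfolding lift_on_def
  proof (intro conjI ballI)
    show "G0 holomorphic_on ball 0 r" unfolding G0_def by (intro holomorphic_intros)
    show "G1 holomorphic_on ball 0 r"
    proof (subst holomorphic_on_open[OF open_ball], intro ballI)
      fix p :: complex assume p: "p \<in> ball 0 r"
      then have p': "p \<in> \<Omega>" "p \<in> cball 0 r" using \<Omega>(3) by auto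
      have op: "open (ball p (e p) \<inter> ball 0 r)" by auto
      have h: "(\<lambda>w. A p w * K p w) holomorphic_on (ball p (e p) \<inter> ball 0 r)" unfolding A_def
        by (intro holomorphic_intros holomorphic_on_subset[OF holK[OF p'(1)]]) auto
      have "p \<in> ball p (e p) \<inter> ball 0 r" using p e[OF p'(1)] by simp
      then have "((\<lambda>w. A p w * K p w) has_field_derivative deriv (\<lambda>w. A p w * K p w) p) (at p)"
        by (rule holomorphic_derivI[OF h op])
      then have "(G1 has_field_derivative deriv (\<lambda>w. A p w * K p w) p) (at p)"
        by (rule has_field_derivative_transform_within_open[OF _ op]) (use p e[OF p'(1)] G1A[OF p'] in auto)
      then show "\<exists>f'. (G1 has_field_derivative f') (at p)" by blast
    qed
    fix p :: complex assume p: "p \<in> ball 0 r"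
    then have p': "p \<in> \<Omega>" "p \<in> cball 0 r" using \<Omega>(3) by auto
    have pb: "p \<in> ball p (e p)" using e[OF p'(1)] by simp
    note G = G0A[OF p', of p] G1A[OF p' pb p'(2)]
    show "G0 p \<noteq> 0 \<or> G1 p \<noteq> 0" using nz[OF p'(1) pb] An[of p] unfolding G by auto
    show "F p = p1_point (G0 p) (G1 p)" unfolding G Fp[OF p'(1) pb] using An[of p] by (simp add: p1_point_def)
  qed auto
  then show ?thesis by blast
qed

section \<open>Uniqueness and gluing of Laplacians\<close>

lemma laplacian_on_unique:
  assumes "laplacian_on W u p E" "laplacian_on W' u p' E'" "w \<in> W" "w \<in> W'"
  shows "p w = p' w" "E w = E' w"
proof -
  obtain s where s: "open W" "\<And>z. z \<in> W \<Longrightarrow> (u has_derivative (\<lambda>v. 2 * Re (p z * v))) (at z)"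
    "\<And>z. z \<in> W \<Longrightarrow> (p has_derivative (\<lambda>v. s z * v + of_real (E z / 4) * cnj v)) (at z)"
    using assms(1) unfolding laplacian_on_def by blast
  obtain s' where s': "open W'" "\<And>z. z \<in> W' \<Longrightarrow> (u has_derivative (\<lambda>v. 2 * Re (p' z * v))) (at z)"
    "\<And>z. z \<in> W' \<Longrightarrow> (p' has_derivative (\<lambda>v. s' z * v + of_real (E' z / 4) * cnj v)) (at z)"
    using assms(2) unfolding laplacian_on_def by blast
  have pp: "p z = p' z" if "z \<in> W" "z \<in> W'" for z
  proof -
    have "(\<lambda>v. 2 * Re (p z * v)) = (\<lambda>v. 2 * Re (p' z * v))" by (rule has_derivative_unique[OF s(2) s'(2)]) (use that in auto)
    from fun_cong[OF this, of 1] fun_cong[OF this, of \<i>] show ?thesis by (simp add: complex_eq_iff)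
  qed
  show "p w = p' w" using pp assms by blast
  have "(p' has_derivative (\<lambda>v. s w * v + of_real (E w / 4) * cnj v)) (at w)"
    by (rule has_derivative_transform_within_open[OF s(3)[OF assms(3)], of "W \<inter> W'"]) (use s s' pp assms in auto)
  then have "(\<lambda>v. s w * v + of_real (E w / 4) * cnj v) = (\<lambda>v. s' w * v + of_real (E' w / 4) * cnj v)"
    by (rule has_derivative_unique) (rule s'(3)[OF assms(4)])
  from fun_cong[OF this, of 1] fun_cong[OF this, of \<i>] show "E w = E' w" by (simp add: complex_eq_iff)
qed

text \<open>
  Local Laplacians agree on overlaps; the diagonal functions \<open>p z z\<close> and \<open>E z z\<close> are the glued ones.
\<close>

lemma laplacian_on_glue:
  assumes \<Omega>: "open \<Omega>" and loc: "\<And>w. w \<in> \<Omega> \<Longrightarrow> \<exists>W p E. w \<in> W \<and> laplacian_on W u p E"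
  shows "\<exists>p E. laplacian_on \<Omega> u p E"
proof -
  obtain W p E where l: "\<And>w. w \<in> \<Omega> \<Longrightarrow> w \<in> W w \<and> laplacian_on (W w) u (p w) (E w)" using loc by metis
  then have "\<forall>w\<in>\<Omega>. \<exists>s. open (W w) \<and> (\<forall>z\<in>W w. (u has_derivative (\<lambda>v. 2 * Re (p w z * v))) (at z)) \<and>
     (\<forall>z\<in>W w. (p w has_derivative (\<lambda>v. s z * v + of_real (E w z / 4) * cnj v)) (at z)) \<and>
     continuous_on (W w) s \<and> continuous_on (W w) (E w)"
    unfolding laplacian_on_def by blast
  from bchoice[OF this] obtain s where "\<forall>w\<in>\<Omega>. open (W w) \<and> (\<forall>z\<in>W w. (u has_derivative (\<lambda>v. 2 * Re (p w z * v))) (at z)) \<and>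
     (\<forall>z\<in>W w. (p w has_derivative (\<lambda>v. s w z * v + of_real (E w z / 4) * cnj v)) (at z)) \<and>
     continuous_on (W w) (s w) \<and> continuous_on (W w) (E w)" ..
  note s = bspec[OF this]
  have eq: "p w z = p z z" "E w z = E z z" if "w \<in> \<Omega>" "z \<in> W w" "z \<in> \<Omega>" for w z
    using laplacian_on_unique[of "W w" u "p w" "E w" "W z" "p z" "E z" z] l that by auto
  have p': "((\<lambda>z. p z z) has_derivative (\<lambda>v. s w z * v + of_real (E w z / 4) * cnj v)) (at z)" if "w \<in> \<Omega>" "z \<in> W w" "z \<in> \<Omega>" for w z
    by (rule has_derivative_transform_within_open[of "p w" _ _ UNIV "W w \<inter> \<Omega>"]) (use s[OF that(1)] that \<Omega> eq in auto)
  have eqs: "s w z = s z z" if "w \<in> \<Omega>" "z \<in> W w" "z \<in> \<Omega>" for w z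
  proof -
    have "(\<lambda>v. s w z * v + of_real (E w z / 4) * cnj v) = (\<lambda>v. s z z * v + of_real (E z z / 4) * cnj v)"
      by (rule has_derivative_unique[OF p'[OF that] p'[OF that(3) _ that(3)]]) (use l that in auto)
    from fun_cong[OF this, of 1] eq(2)[OF that] show ?thesis by simp
  qed
  have cont: "continuous_on \<Omega> (\<lambda>z. g z z)" if c: "\<And>w. w \<in> \<Omega> \<Longrightarrow> continuous_on (W w) (g w)"
    and e: "\<And>w z. w \<in> \<Omega> \<Longrightarrow> z \<in> W w \<Longrightarrow> z \<in> \<Omega> \<Longrightarrow> g w z = g z z" for g :: "complex \<Rightarrow> complex \<Rightarrow> 'b::t2_space"
  proof (rule continuous_at_imp_continuous_on, rule ballI)
    fix w assume w: "w \<in> \<Omega>"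
    have op: "open (W w \<inter> \<Omega>)" using s[OF w] \<Omega> by auto
    have "continuous_on (W w \<inter> \<Omega>) (\<lambda>z. g z z)"
      by (rule continuous_on_eq[OF continuous_on_subset[OF c[OF w]]]) (use e[OF w] in auto)
    then show "isCont (\<lambda>z. g z z) w" using op l[OF w] w by (simp add: continuous_on_eq_continuous_at)
  qed
  have "laplacian_on \<Omega> u (\<lambda>z. p z z) (\<lambda>z. E z z)"
  proof (rule laplacian_onI[of _ _ _ "\<lambda>z. s z z"])
    show "continuous_on \<Omega> (\<lambda>z. s z z)" by (rule cont) (use s eqs in auto)
    show "continuous_on \<Omega> (\<lambda>z. E z z)" by (rule cont) (use s eq in auto)
    fix z assume z: "z \<in> \<Omega>"
    show "(u has_derivative (\<lambda>v. 2 * Re (p z z * v))) (at z)" using s[OF z] l[OF z] by blast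
    show "((\<lambda>z. p z z) has_derivative (\<lambda>v. s z z * v + of_real (E z z / 4) * cnj v)) (at z)"
      by (rule p'[OF z _ z]) (use l z in auto)
  qed (rule \<Omega>)
  then show ?thesis by blast
qed

lemma smooth_fun_laplacian:
  assumes "smooth_fun_on U u" "open U"
  shows "\<exists>p E. laplacian_on U u p E"
proof -
  obtain H where H: "\<And>z. z \<in> U \<Longrightarrow> H 0 0 z = u z"
    "\<And>z m n. z \<in> U \<Longrightarrow> (H m n has_derivative (\<lambda>v. Re v * H (Suc m) n z + Im v * H m (Suc n) z)) (at z)"
    using assms(1) unfolding smooth_fun_on_def by blast
  have cH: "continuous_on U (H m n)" for m n
    by (rule continuous_at_imp_continuous_on) (use H(2) has_derivative_continuous in blast)
  let ?p = "\<lambda>z. Complex (H 1 0 z / 2) (- H 0 1 z / 2)"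
  let ?s = "\<lambda>z. Complex ((H 2 0 z - H 0 2 z) / 4) (- H 1 1 z / 2)"
  let ?E = "\<lambda>z. H 2 0 z + H 0 2 z"
  have "laplacian_on U u ?p ?E"
  proof (rule laplacian_onI[OF assms(2), of _ _ ?s])
    fix z assume z: "z \<in> U"
    have "(H 0 0 has_derivative (\<lambda>v. 2 * Re (?p z * v))) (at z)"
      by (rule has_derivative_eq_rhs[OF H(2)[OF z]]) (simp add: fun_eq_iff algebra_simps)
    then show "(u has_derivative (\<lambda>v. 2 * Re (?p z * v))) (at z)"
      by (rule has_derivative_transform_within_open[OF _ assms(2) z]) (use H(1) in auto)
    have "(\<lambda>z. complex_of_real (H 1 0 z / 2) - \<i> * complex_of_real (H 0 1 z / 2)) = ?p"
      by (simp add: fun_eq_iff complex_eq_iff)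
    moreover have "((\<lambda>z. complex_of_real (H 1 0 z / 2) - \<i> * complex_of_real (H 0 1 z / 2)) has_derivative
       (\<lambda>v. of_real ((Re v * H (Suc 1) 0 z + Im v * H 1 (Suc 0) z) / 2) - \<i> * of_real ((Re v * H (Suc 0) 1 z + Im v * H 0 (Suc 1) z) / 2))) (at z)"
      by (intro has_derivative_diff has_derivative_mult_right has_derivative_of_real) (auto intro!: derivative_eq_intros H(2)[OF z])
    ultimately have d: "(?p has_derivative
       (\<lambda>v. of_real ((Re v * H (Suc 1) 0 z + Im v * H 1 (Suc 0) z) / 2) - \<i> * of_real ((Re v * H (Suc 0) 1 z + Im v * H 0 (Suc 1) z) / 2))) (at z)"
      by simp
    show "(?p has_derivative (\<lambda>v. ?s z * v + of_real (?E z / 4) * cnj v)) (at z)"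
      by (rule has_derivative_eq_rhs[OF d]) (simp add: fun_eq_iff complex_eq_iff numeral_2_eq_2 field_simps)
  next
    have "continuous_on U (\<lambda>z. complex_of_real ((H 2 0 z - H 0 2 z) / 4) + \<i> * complex_of_real (- H 1 1 z / 2))"
      by (intro continuous_intros cH) auto
    moreover have "(\<lambda>z. complex_of_real ((H 2 0 z - H 0 2 z) / 4) + \<i> * complex_of_real (- H 1 1 z / 2)) = ?s"
      by (simp add: fun_eq_iff complex_eq_iff)
    ultimately show "continuous_on U ?s" by (simp only:)
    show "continuous_on U ?E" by (intro continuous_intros cH)
  qed
  then show ?thesis by blast
qed

section \<open>Transfer from the surface to the disc\<close>

context exhausted_atlas
begin

lemma \<sigma>_in: assumes "w \<in> L ` V" shows "\<sigma> w \<in> V" "L (\<sigma> w) = w"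
  using assms \<sigma>_L by auto

text \<open>
  A chart read in the coordinate \<open>L\<close>. Its derivative is the inverse of the coefficient of the form,
  since the derivative of \<open>L\<close> is this coefficient.
\<close>

lemma chart_coordinate:
  assumes c: "c \<in> A"
  shows "(\<lambda>w. snd c (\<sigma> w)) holomorphic_on (L ` fst c)" "open (L ` fst c)"
    and "\<And>w. w \<in> L ` fst c \<Longrightarrow> chart_inv c (snd c (\<sigma> w)) = \<sigma> w"
    and "\<And>w. w \<in> L ` fst c \<Longrightarrow> S c (\<sigma> w) * deriv (\<lambda>w. snd c (\<sigma> w)) w = 1"
proof -
  let ?U = "snd c ` fst c" and ?l = "\<lambda>z. L (chart_inv c z)"
  have img: "?l ` ?U = L ` fst c" using chart_inv_left[OF c] by force
  show op: "open (L ` fst c)" by (rule L_image_open[OF open_chart_dom[OF c]])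
  show inv: "chart_inv c (snd c (\<sigma> w)) = \<sigma> w" if "w \<in> L ` fst c" for w
    by (rule chart_inv_left[OF c \<sigma>_in(1)[OF that]])
  have inj: "inj_on ?l ?U"
    by (rule inj_onI) (metis chart_inv_right \<sigma>_L)
  obtain g where g: "g holomorphic_on ?l ` ?U" "\<And>z. z \<in> ?U \<Longrightarrow> deriv ?l z * deriv g (?l z) = 1" "\<And>z. z \<in> ?U \<Longrightarrow> g (?l z) = z"
    by (rule holomorphic_has_inverse[OF L_chart_holomorphic[OF c] open_chart_image[OF c] inj]) blast
  have geq: "g w = snd c (\<sigma> w)" if w: "w \<in> L ` fst c" for w
    using g(3)[of "snd c (\<sigma> w)"] \<sigma>_in[OF w] inv[OF w] by auto
  show hol: "(\<lambda>w. snd c (\<sigma> w)) holomorphic_on (L ` fst c)"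
    by (rule holomorphic_transform[OF g(1)[unfolded img] geq])
  show "S c (\<sigma> w) * deriv (\<lambda>w. snd c (\<sigma> w)) w = 1" if w: "w \<in> L ` fst c" for w
  proof -
    have x: "\<sigma> w \<in> fst c" "snd c (\<sigma> w) \<in> ?U" using \<sigma>_in[OF w] by auto
    have "deriv (\<lambda>w. snd c (\<sigma> w)) w = deriv g w"
      by (rule deriv_cong_ev) (use op w geq in \<open>auto simp: eventually_nhds\<close>)
    then show ?thesis using g(2)[OF x(2)] deriv_L_chart[OF c x(2)] inv[OF w] \<sigma>_in(2)[OF w] by simp
  qed
qed

lemma form_integral_polar:
  assumes \<eta>: "\<forall>c\<in>A. \<forall>x\<in>fst c. \<eta> c x = E (L x) * (norm (S c x))\<^sup>2"
    and E: "continuous_on \<Omega> E" and r: "0 < r" "ereal r < R"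
  shows "form_integral A \<eta> (disc A S b r) = 2 * pi * disc_mass E r"
proof -
  have "form_integral A \<eta> (disc A S b r) = integral (ball 0 r) E" by (rule form_integral_disc[OF \<eta> E r(2)])
  also have "\<dots> = integral {0..r} (\<lambda>s. s * integral {0..2*pi} (\<lambda>\<theta>. E (of_real s * cis \<theta>)))"
    by (rule polar_coordinates[OF r(1) continuous_on_subset[OF E cball_subset_\<Omega>[OF r(2)]]])
  also have "\<dots> = integral {0..r} (\<lambda>s. 2 * pi * (s * circle_mean E s))" by (simp add: circle_mean_def)
  finally show ?thesis unfolding disc_mass_def by simp
qed

lemma char_form_eq_iterated:
  assumes \<eta>: "\<forall>c\<in>A. \<forall>x\<in>fst c. \<eta> c x = E (L x) * (norm (S c x))\<^sup>2"
    and E: "continuous_on \<Omega> E" and r: "0 < s" "ereal r < R"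
  shows "char_form A S b s \<eta> r = 2 * pi * iterated E s r"
proof -
  have "char_form A S b s \<eta> r = integral {s..r} (\<lambda>t. 2 * pi * (disc_mass E t / t))"
    unfolding char_form_def
  proof (rule integral_cong)
    fix t assume t: "t \<in> {s..r}"
    then have "ereal t < R" using r(2) by (auto intro: le_less_trans[of _ "ereal r"])
    then show "form_integral A \<eta> (disc A S b t) / t = 2 * pi * (disc_mass E t / t)"
      using form_integral_polar[OF \<eta> E] t r(1) by simp
  qed
  also have "\<dots> = 2 * pi * integral {s..r} (\<lambda>t. disc_mass E t / t)" by (rule integral_mult_right)
  finally show ?thesis unfolding iterated_def .
qed

end

locale target_map = exhausted_atlas A S b for A :: "'a::t2_space chart set" and S b +
  fixes f :: "'a \<Rightarrow> p1"
  assumes mero: "meromorphic_fun A f" and nonconstant: "\<not> f constant_on UNIV"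
begin

definition F :: "complex \<Rightarrow> p1" where "F w = f (\<sigma> w)"

lemma lift_transfer:
  assumes l: "p1_lift A f V F0 F1" and c: "c \<in> A"
  shows "lift_on (L ` (V \<inter> fst c)) F (\<lambda>w. F0 (\<sigma> w)) (\<lambda>w. F1 (\<sigma> w))"
proof -
  have V: "open V" "holomorphic_fun_on A V F0" "holomorphic_fun_on A V F1"
    "\<And>x. x \<in> V \<Longrightarrow> (F0 x \<noteq> 0 \<or> F1 x \<noteq> 0) \<and> f x = p1_point (F0 x) (F1 x)"
    using l unfolding p1_lift_def by auto
  have sub: "L ` (V \<inter> fst c) \<subseteq> L ` fst c" by auto
  have hol: "(\<lambda>w. G (\<sigma> w)) holomorphic_on L ` (V \<inter> fst c)" if G: "holomorphic_fun_on A V G" for G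
  proof -
    have "(G \<circ> chart_inv c) holomorphic_on (snd c ` (V \<inter> fst c))" using G c unfolding holomorphic_fun_on_def by blast
    then have "((G \<circ> chart_inv c) \<circ> (\<lambda>w. snd c (\<sigma> w))) holomorphic_on L ` (V \<inter> fst c)"
      by (rule holomorphic_on_compose_gen[OF holomorphic_on_subset[OF chart_coordinate(1)[OF c] sub]]) (auto simp: \<sigma>_L)
    then show ?thesis
      by (rule holomorphic_transform) (use chart_coordinate(3)[OF c] sub in auto)
  qed
  show ?thesis unfolding lift_on_def
    using L_image_open[of "V \<inter> fst c"] open_chart_dom[OF c] V(1) hol[OF V(2)] hol[OF V(3)] V(4)
    by (auto simp: F_def \<sigma>_L)
qed

lemma local_lift: "w \<in> \<Omega> \<Longrightarrow> \<exists>W G0 G1. w \<in> W \<and> lift_on W F G0 G1"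
proof -
  assume w: "w \<in> \<Omega>"
  obtain V F0 F1 where l: "\<sigma> w \<in> V" "p1_lift A f V F0 F1" using mero unfolding meromorphic_fun_def by blast
  note c = chart_at[of "\<sigma> w"]
  have "L (\<sigma> w) \<in> L ` (V \<inter> fst (chart_at A (\<sigma> w)))" by (intro imageI IntI l(1) c(2))
  then have "w \<in> L ` (V \<inter> fst (chart_at A (\<sigma> w)))" by (simp only: L_\<sigma>[OF w])
  then show ?thesis using lift_transfer[OF l(2) c(1)] by (intro exI conjI)
qed

definition rho :: "complex \<Rightarrow> real" where
  "rho w = (THE d. \<exists>W G0 G1. w \<in> W \<and> lift_on W F G0 G1 \<and> d = fs_density G0 G1 w)"

lemma rho_lift: assumes "lift_on W F G0 G1" "w \<in> W" shows "rho w = fs_density G0 G1 w"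
  unfolding rho_def
  by (rule the_equality) (use assms fs_density_unique in blast)+

lemma rho_continuous_\<Omega>: "continuous_on \<Omega> rho"
proof (rule continuous_at_imp_continuous_on, rule ballI)
  fix w assume "w \<in> \<Omega>"
  then obtain W G0 G1 where W: "w \<in> W" "lift_on W F G0 G1" using local_lift by blast
  have "continuous_on W rho"
    by (rule continuous_on_eq[OF fs_density_continuous[OF W(2)]]) (use rho_lift[OF W(2)] in auto)
  then show "isCont rho w" using W by (simp add: lift_on_def continuous_on_eq_continuous_at)
qed

sublocale sphere_map R F rho
proof
  show "\<exists>G0 G1. lift_on (ball 0 r) F G0 G1" if "0 < r" "ereal r < R" for r
  proof -
    obtain x where x: "f x \<noteq> Infty" using mero unfolding meromorphic_fun_def by blast
    show ?thesis
      by (rule lift_on_disc[OF open_\<Omega> connected_\<Omega> cball_subset_\<Omega>[OF that(2)] local_lift L_in_\<Omega>[of x]])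
         (use x in \<open>auto simp: F_def \<sigma>_L\<close>)
  qed
  show "rho w = fs_density G0 G1 w" if "ereal r < R" "lift_on (ball 0 r) F G0 G1" "w \<in> ball 0 r" for r G0 G1 w
    using that rho_lift by blast
  show "0 < R" by (rule radius_pos)
  obtain x y where xy: "f x \<noteq> f y" using nonconstant unfolding constant_on_def by blast
  show "\<exists>w w'. ereal (norm w) < R \<and> ereal (norm w') < R \<and> F w \<noteq> F w'"
    by (rule exI[of _ "L x"], rule exI[of _ "L y"]) (use xy L_in_\<Omega> in \<open>auto simp: F_def \<sigma>_L \<Omega>_def\<close>)
qed

text \<open>
  The composition of a local lift with \<open>L\<close> inverse is a lift of the map on the plane disc, for which the
  Laplacian is known; it is then moved to the chart by conformal covariance. As the density does not
  depend on the lift, neither does the value in the definition of \<open>fs_pullback\<close>.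
\<close>

lemma fs_pullback_eq:
  assumes c: "c \<in> A" and x: "x \<in> fst c"
  shows "fs_pullback A f c x = rho (L x) * (norm (S c x))\<^sup>2"
proof -
  have val: "ddc (\<lambda>_ y. ln ((norm (F0 y))\<^sup>2 + (norm (F1 y))\<^sup>2)) c x = rho (L x) * (norm (S c x))\<^sup>2"
    if xV: "x \<in> V" and l: "p1_lift A f V F0 F1" for V F0 F1
  proof -
    let ?G0 = "\<lambda>w. F0 (\<sigma> w)" and ?G1 = "\<lambda>w. F1 (\<sigma> w)" and ?W = "L ` (V \<inter> fst c)" and ?T = "snd c ` (V \<inter> fst c)"
    let ?l = "\<lambda>z. L (chart_inv c z)"
    have lo: "lift_on ?W F ?G0 ?G1" by (rule lift_transfer[OF l c])
    obtain p where p: "laplacian_on ?W (\<lambda>w. ln (norm2 ?G0 ?G1 w)) p (\<lambda>w. 4 * pi * fs_density ?G0 ?G1 w)"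
      using laplacian_on_ln_norm2_lift[OF lo] by blast
    have T: "open ?T" using chart_image_open[OF c] l unfolding p1_lift_def by blast
    have "laplacian_on ?T (\<lambda>z. ln (norm2 ?G0 ?G1 (?l z))) (\<lambda>z. p (?l z) * deriv ?l z)
       (\<lambda>z. 4 * pi * fs_density ?G0 ?G1 (?l z) * (norm (deriv ?l z))\<^sup>2)"
    proof (rule laplacian_on_holomorphic_compose[OF p _ T])
      show "?l holomorphic_on ?T" by (rule holomorphic_on_subset[OF L_chart_holomorphic[OF c]]) auto
      show "?l ` ?T \<subseteq> ?W" using chart_inv_left[OF c] by auto
    qed
    then have "laplacian_on ?T (\<lambda>z. ln ((norm (F0 (chart_inv c z)))\<^sup>2 + (norm (F1 (chart_inv c z)))\<^sup>2)) (\<lambda>z. p (?l z) * deriv ?l z)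
       (\<lambda>z. 4 * pi * fs_density ?G0 ?G1 (?l z) * (norm (deriv ?l z))\<^sup>2)"
      by (simp only: norm2_def \<sigma>_L)
    then have "ddc (\<lambda>_ y. ln ((norm (F0 y))\<^sup>2 + (norm (F1 y))\<^sup>2)) c x
        = 4 * pi * fs_density ?G0 ?G1 (?l (snd c x)) * (norm (deriv ?l (snd c x)))\<^sup>2 / (4 * pi)"
      by (rule ddc_laplacian) (use xV x in auto)
    also have "\<dots> = fs_density ?G0 ?G1 (L x) * (norm (S c x))\<^sup>2"
      using deriv_L_chart[OF c, of "snd c x"] x by (simp add: chart_inv_left[OF c x])
    also have "fs_density ?G0 ?G1 (L x) = rho (L x)" using rho_lift[OF lo, of "L x"] xV x by auto
    finally show ?thesis .
  qed
  obtain V F0 F1 where l: "x \<in> V" "p1_lift A f V F0 F1" using mero unfolding meromorphic_fun_def by blast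
  show ?thesis unfolding fs_pullback_def
  proof (rule the_equality)
    show "\<exists>V F0 F1. x \<in> V \<and> p1_lift A f V F0 F1 \<and> rho (L x) * (norm (S c x))\<^sup>2 = ddc (\<lambda>_ y. ln ((norm (F0 y))\<^sup>2 + (norm (F1 y))\<^sup>2)) c x"
      by (rule exI[of _ V], rule exI[of _ F0], rule exI[of _ F1], intro conjI l val[OF l, symmetric])
  qed (use val in blast)
qed

lemma nevanlinna_T_eq:
  assumes "0 < s" "ereal r < R" shows "nevanlinna_T A S b s f r = char_T s r"
proof -
  have "nevanlinna_T A S b s f r = 2 * pi * iterated rho s r"
    unfolding nevanlinna_T_def by (rule char_form_eq_iterated[OF _ rho_continuous_\<Omega> assms]) (use fs_pullback_eq in auto)
  then show ?thesis by (simp add: char_T_def iterated_cmult)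
qed

lemma Nbar_eq:
  assumes "ereal r < R" shows "Nbar A S b s f a r = count_int a s r"
  unfolding Nbar_def count_int_def
proof (rule integral_cong)
  fix t assume t: "t \<in> {s..r}"
  then have tR: "ereal t < R" using assms by (auto intro: le_less_trans[of _ "ereal r"])
  have "{w. norm w < t \<and> F w = a} = L ` {x \<in> disc A S b t. f x = a}"
  proof (intro equalityI subsetI)
    fix w assume w: "w \<in> {w. norm w < t \<and> F w = a}"
    then have "L (\<sigma> w) = w" using norm_less_R[OF tR, of w] by (intro L_\<sigma>) (simp add: \<Omega>_def)
    then show "w \<in> L ` {x \<in> disc A S b t. f x = a}" using w by (intro image_eqI[of _ _ "\<sigma> w"]) (auto simp: disc_eq F_def)
  qed (auto simp: disc_eq F_def \<sigma>_L)
  then show "real (nbar A S b f a t) / t = real (card {w. norm w < t \<and> F w = a}) / t"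
    unfolding nbar_def by (simp add: card_image[OF inj_on_subset[OF inj_L]])
qed

end

section \<open>The Ricci form\<close>

locale metric_atlas = exhausted_atlas A S b for A :: "'a::t2_space chart set" and S b +
  fixes h :: "'a metric_coeff"
  assumes metric: "hermitian_metric A h"
begin

lemma h_pos: "c \<in> A \<Longrightarrow> x \<in> fst c \<Longrightarrow> 0 < h c x"
  and h_smooth: "c \<in> A \<Longrightarrow> smooth_fun_on (snd c ` fst c) (h c \<circ> chart_inv c)"
  and h_transition: "c \<in> A \<Longrightarrow> d \<in> A \<Longrightarrow> x \<in> fst c \<Longrightarrow> x \<in> fst d \<Longrightarrow> h c x = h d x * (norm (transition_deriv c d x))\<^sup>2"
  using metric unfolding hermitian_metric_def by blast+

text \<open>
  The coefficient of the metric in the coordinate \<open>L\<close>. The norm of the form \<open>dL\<close> is then \<open>1 / sqrt (2 * H)\<close>.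
\<close>

definition H :: "complex \<Rightarrow> real" where
  "H w = h (chart_at A (\<sigma> w)) (\<sigma> w) / (norm (S (chart_at A (\<sigma> w)) (\<sigma> w)))\<^sup>2"

lemma H_chart:
  assumes "c \<in> A" "\<sigma> w \<in> fst c" shows "H w = h c (\<sigma> w) / (norm (S c (\<sigma> w)))\<^sup>2"
proof -
  let ?d = "chart_at A (\<sigma> w)" and ?x = "\<sigma> w"
  note d = chart_at[of ?x]
  have "S c ?x = S ?d ?x * transition_deriv c ?d ?x" by (rule form_transition[OF assms(1) d(1) assms(2) d(2)])
  moreover have "h c ?x = h ?d ?x * (norm (transition_deriv c ?d ?x))\<^sup>2" by (rule h_transition[OF assms(1) d(1) assms(2) d(2)])
  moreover have "S c ?x \<noteq> 0" by (rule nonzero[OF assms])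
  ultimately show ?thesis by (simp add: H_def norm_mult power_mult_distrib)
qed

lemma H_pos: "0 < H w"
  unfolding H_def using h_pos nonzero chart_at by simp

text \<open>
  \<open>ln H\<close> differs from the logarithm of the coefficient in the chart by the harmonic function
  \<open>ln \<bar>\<psi>'\<bar>\<^sup>2\<close>, where \<open>\<psi>\<close> is the chart read in the coordinate \<open>L\<close>.
\<close>

lemma laplacian_ln_H_chart:
  assumes c: "c \<in> A"
  shows "\<exists>p E. laplacian_on (L ` fst c) (\<lambda>w. ln (H w)) p E \<and>
    (\<forall>x\<in>fst c. ricci_form h c x = - E (L x) / (4 * pi) * (norm (S c x))\<^sup>2)"
proof -
  let ?U = "snd c ` fst c" and ?\<psi> = "\<lambda>w. snd c (\<sigma> w)" and ?W = "L ` fst c"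
  obtain p E where pE: "laplacian_on ?U (h c \<circ> chart_inv c) p E"
    using smooth_fun_laplacian[OF h_smooth[OF c] open_chart_image[OF c]] by blast
  have hp: "0 < h c (chart_inv c z)" if "z \<in> ?U" for z using h_pos[OF c chart_inv_in[OF that]] .
  have ch: "continuous_on ?U (\<lambda>z. h c (chart_inv c z))" using laplacian_on_continuous(1)[OF pE] by (simp add: comp_def)
  obtain p2 E2 where l2: "laplacian_on ?U (\<lambda>z. ln (h c (chart_inv c z))) p2 E2"
  proof -
    have "laplacian_on ?U (\<lambda>z. ln (h c (chart_inv c z))) (\<lambda>z. of_real (inverse (h c (chart_inv c z))) * p z)
      (\<lambda>z. inverse (h c (chart_inv c z)) * E z + 4 * (- inverse ((h c (chart_inv c z))\<^sup>2)) * (norm (p z))\<^sup>2)"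
    proof (rule laplacian_on_compose[OF pE[unfolded comp_def], where k=ln and k'=inverse and k''="\<lambda>x. - inverse (x\<^sup>2)"])
      fix z assume z: "z \<in> ?U"
      show "(ln has_field_derivative inverse (h c (chart_inv c z))) (at (h c (chart_inv c z)))"
        using hp[OF z] by (rule DERIV_ln)
      show "(inverse has_field_derivative - inverse ((h c (chart_inv c z))\<^sup>2)) (at (h c (chart_inv c z)))"
        using hp[OF z] by (auto intro!: derivative_eq_intros simp: power2_eq_square)
    next
      have "h c (chart_inv c z) \<noteq> 0" if "z \<in> ?U" for z using hp[OF that] by simp
      then show "continuous_on ?U (\<lambda>z. - inverse ((h c (chart_inv c z))\<^sup>2))" by (intro continuous_intros ch) auto
    qed
    then show ?thesis by (rule that)
  qed
  note cc = chart_coordinate[OF c]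
  have d\<psi>: "deriv ?\<psi> w \<noteq> 0" if "w \<in> ?W" for w using cc(4)[OF that] by auto
  have "laplacian_on ?W (\<lambda>w. ln (h c (chart_inv c (?\<psi> w)))) (\<lambda>w. p2 (?\<psi> w) * deriv ?\<psi> w) (\<lambda>w. E2 (?\<psi> w) * (norm (deriv ?\<psi> w))\<^sup>2)"
    by (rule laplacian_on_holomorphic_compose[OF l2 cc(1,2)]) (use \<sigma>_in in auto)
  moreover have "laplacian_on ?W (\<lambda>w. ln ((norm (deriv ?\<psi> w))\<^sup>2)) (\<lambda>z. deriv (deriv ?\<psi>) z / deriv ?\<psi> z) (\<lambda>z. 0)"
    by (rule laplacian_on_ln_norm2[OF holomorphic_deriv[OF cc(1,2)] cc(2) d\<psi>])
  ultimately have sum: "laplacian_on ?W (\<lambda>w. ln (h c (chart_inv c (?\<psi> w))) + ln ((norm (deriv ?\<psi> w))\<^sup>2))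
     (\<lambda>w. p2 (?\<psi> w) * deriv ?\<psi> w + deriv (deriv ?\<psi>) w / deriv ?\<psi> w) (\<lambda>w. E2 (?\<psi> w) * (norm (deriv ?\<psi> w))\<^sup>2 + 0)"
    by (rule laplacian_on_add)
  have lap: "laplacian_on ?W (\<lambda>w. ln (H w)) (\<lambda>w. p2 (?\<psi> w) * deriv ?\<psi> w + deriv (deriv ?\<psi>) w / deriv ?\<psi> w) (\<lambda>w. E2 (?\<psi> w) * (norm (deriv ?\<psi> w))\<^sup>2)"
  proof (rule laplacian_on_cong[OF sum _ refl])
    fix w assume w: "w \<in> ?W"
    have x: "\<sigma> w \<in> fst c" by (rule \<sigma>_in(1)[OF w])
    have "norm (S c (\<sigma> w)) * norm (deriv ?\<psi> w) = 1" using cc(4)[OF w] by (metis norm_mult norm_one)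
    then have "norm (deriv ?\<psi> w) = 1 / norm (S c (\<sigma> w))" using nonzero[OF c x] by (simp add: field_simps)
    then have "H w = h c (\<sigma> w) * (norm (deriv ?\<psi> w))\<^sup>2" unfolding H_chart[OF c x] by (simp add: power_divide)
    then show "ln (h c (chart_inv c (?\<psi> w))) + ln ((norm (deriv ?\<psi> w))\<^sup>2) = ln (H w)"
      unfolding cc(3)[OF w] using h_pos[OF c x] d\<psi>[OF w] by (simp add: ln_mult_pos)
  qed simp
  have ricci: "ricci_form h c x = - (E2 (?\<psi> (L x)) * (norm (deriv ?\<psi> (L x)))\<^sup>2) / (4 * pi) * (norm (S c x))\<^sup>2" if x: "x \<in> fst c" for x
  proof -
    have "ddc (\<lambda>d y. ln (h d y)) c x = E2 (snd c x) / (4 * pi)" by (rule ddc_laplacian[where u="\<lambda>d y. ln (h d y)"], rule l2) (use x in auto)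
    moreover have "L x \<in> ?W" using x by simp
    from cc(4)[OF this] have "norm (S c x) * norm (deriv ?\<psi> (L x)) = 1" unfolding \<sigma>_L by (metis norm_mult norm_one)
    then have "(norm (deriv ?\<psi> (L x)))\<^sup>2 * (norm (S c x))\<^sup>2 = 1" by (metis mult.commute power_mult_distrib power_one)
    then have "- (E2 (?\<psi> (L x)) * (norm (deriv ?\<psi> (L x)))\<^sup>2) / (4 * pi) * (norm (S c x))\<^sup>2 = - E2 (snd c x) / (4 * pi)"
      by (simp add: \<sigma>_L mult.assoc)
    ultimately show ?thesis by (simp add: ricci_form_def)
  qed
  show ?thesis using lap ricci by (intro exI conjI ballI) auto
qed

lemma \<Omega>_in_chart: assumes "w \<in> \<Omega>" shows "w \<in> L ` fst (chart_at A (\<sigma> w))"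
  using L_\<sigma>[OF assms] chart_at(2)[of "\<sigma> w"] by (metis image_eqI)

lemma laplacian_ln_H:
  obtains p E where "laplacian_on \<Omega> (\<lambda>w. ln (H w)) p E"
    "\<forall>c\<in>A. \<forall>x\<in>fst c. ricci_form h c x = (- E (L x) / (4 * pi)) * (norm (S c x))\<^sup>2"
proof -
  have "\<exists>p E. laplacian_on \<Omega> (\<lambda>w. ln (H w)) p E"
  proof (rule laplacian_on_glue[OF open_\<Omega>])
    fix w assume "w \<in> \<Omega>"
    then show "\<exists>W p E. w \<in> W \<and> laplacian_on W (\<lambda>w. ln (H w)) p E"
      using \<Omega>_in_chart laplacian_ln_H_chart[OF chart_at(1)[of "\<sigma> w"]] by blast
  qed
  then obtain p E where pE: "laplacian_on \<Omega> (\<lambda>w. ln (H w)) p E" by blast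
  have "ricci_form h c x = (- E (L x) / (4 * pi)) * (norm (S c x))\<^sup>2" if c: "c \<in> A" and x: "x \<in> fst c" for c x
  proof -
    obtain p' E' where l: "laplacian_on (L ` fst c) (\<lambda>w. ln (H w)) p' E'"
      "\<forall>x\<in>fst c. ricci_form h c x = - E' (L x) / (4 * pi) * (norm (S c x))\<^sup>2" using laplacian_ln_H_chart[OF c] by blast
    have "E (L x) = E' (L x)" by (rule laplacian_on_unique(2)[OF pE l(1) L_in_\<Omega>]) (use x in auto)
    then show ?thesis using l(2) x by simp
  qed
  then show ?thesis using pE that by blast
qed

lemma ricci_T_eq:
  assumes "0 < s" "s \<le> r" "ereal r < R"
  shows "ricci_T A S b s h r = (circle_mean (\<lambda>w. ln (H w)) s - circle_mean (\<lambda>w. ln (H w)) r) / 2"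
proof -
  obtain p E where pE: "laplacian_on \<Omega> (\<lambda>w. ln (H w)) p E"
    and ricci: "\<forall>c\<in>A. \<forall>x\<in>fst c. ricci_form h c x = (- E (L x) / (4 * pi)) * (norm (S c x))\<^sup>2" by (rule laplacian_ln_H)
  have cE: "continuous_on \<Omega> (\<lambda>w. - E w / (4 * pi))" using laplacian_on_continuous(3)[OF pE] by (intro continuous_intros) auto
  have "ricci_T A S b s h r = 2 * pi * iterated (\<lambda>w. - E w / (4 * pi)) s r"
    unfolding ricci_T_def by (rule char_form_eq_iterated[OF ricci cE assms(1,3)])
  also have "\<dots> = 2 * pi * iterated (\<lambda>w. (- 1 / (4 * pi)) * E w) s r" by simp
  also have "\<dots> = - iterated E s r / 2" unfolding iterated_cmult by simp
  also have "iterated E s r = circle_mean (\<lambda>w. ln (H w)) r - circle_mean (\<lambda>w. ln (H w)) s"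
    by (rule iterated_laplacian[OF pE cball_subset_\<Omega>[OF assms(3)] assms(1,2)])
  finally show ?thesis by simp
qed

lemma ln_H_continuous: "continuous_on \<Omega> (\<lambda>w. ln (H w))"
  using laplacian_ln_H laplacian_on_continuous(1) by metis

lemma form_norm_eq: "form_norm A h S x = exp (- (ln 2 + ln (H (L x))) / 2)"
proof -
  let ?c = "chart_at A x"
  note c = chart_at[of x]
  have H: "H (L x) = h ?c x / (norm (S ?c x))\<^sup>2" by (simp add: H_def \<sigma>_L)
  have p: "0 < h ?c x" "0 < norm (S ?c x)" using h_pos[OF c] nonzero[OF c] by auto
  have "norm (S ?c x) / sqrt (2 * h ?c x) = 1 / sqrt (2 * H (L x))"
    unfolding H using p by (simp add: real_sqrt_divide real_sqrt_mult)
  also have "\<dots> = exp (ln (1 / sqrt (2 * H (L x))))" using H_pos[of "L x"] by simp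
  also have "ln (1 / sqrt (2 * H (L x))) = - (ln 2 + ln (H (L x))) / 2"
  proof -
    have "ln (1 / sqrt (2 * H (L x))) = - ln (2 * H (L x)) / 2" using H_pos[of "L x"] by (simp add: ln_div ln_sqrt)
    then show ?thesis using H_pos[of "L x"] by (simp only: ln_mult_pos zero_less_numeral)
  qed
  finally show ?thesis by (simp add: form_norm_def Let_def)
qed

text \<open>
  The supremum is over the open disc; by continuity it bounds the norm on the boundary circle as well.
\<close>

lemma ln_sup_norm_ge:
  assumes w: "norm w = r" and r: "0 < r" "ereal r < R"
  shows "- (ln 2 + ln (H w)) / 2 \<le> ln (sup_norm A h S b r)"
proof -
  let ?g = "\<lambda>w. exp (- (ln 2 + ln (H w)) / 2)"
  have cg: "continuous_on (cball 0 r) ?g"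
    by (intro continuous_intros continuous_on_subset[OF ln_H_continuous cball_subset_\<Omega>[OF r(2)]]) auto
  then have "bounded (?g ` cball 0 r)" by (intro compact_imp_bounded compact_continuous_image) auto
  then have bdd: "bdd_above (?g ` cball 0 r)" by (rule bounded_imp_bdd_above)
  have le: "?g v \<le> sup_norm A h S b r" if v: "v \<in> ball 0 r" for v
  proof -
    have "v \<in> \<Omega>" using v cball_subset_\<Omega>[OF r(2)] by auto
    then have v': "\<sigma> v \<in> disc A S b r" "L (\<sigma> v) = v" using L_\<sigma> v by (auto simp: disc_eq)
    have "bdd_above (form_norm A h S ` disc A S b r)"
      by (rule bdd_above_mono[OF bdd]) (auto simp: form_norm_eq disc_eq)
    then have "form_norm A h S (\<sigma> v) \<le> sup_norm A h S b r" unfolding sup_norm_def by (rule cSUP_upper[OF v'(1)])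
    then show ?thesis by (simp add: form_norm_eq v'(2))
  qed
  have "w \<in> closure (ball 0 r)" using w r by simp
  then have "?g w \<le> sup_norm A h S b r"
    by (rule continuous_le_on_closure[OF cg[folded closure_ball[OF r(1), of 0]]])
       (use le in auto)
  then have "ln (?g w) \<le> ln (sup_norm A h S b r)" by (intro ln_mono) auto
  then show ?thesis by simp
qed

text \<open>
  By the Jensen formula the Ricci term is half the decrease of the mean of \<open>ln H\<close>, and \<open>- ln H\<close> is
  \<open>2 ln \<parallel>S\<parallel> + ln 2\<close>.
\<close>

lemma ricci_T_le:
  assumes "0 < s" "s \<le> r" "ereal r < R"
  shows "ricci_T A S b s h r \<le> (circle_mean (\<lambda>w. ln (H w)) s + ln 2) / 2 + pos_part (ln (sup_norm A h S b r))"
proof -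
  have r: "0 < r" using assms by simp
  have c: "continuous_on (sphere 0 r) (\<lambda>w. ln (H w))"
    by (rule continuous_on_subset[OF ln_H_continuous]) (use cball_subset_\<Omega>[OF assms(3)] in auto)
  have "circle_mean (\<lambda>w. - 2 * ln (sup_norm A h S b r) - ln 2) r \<le> circle_mean (\<lambda>w. ln (H w)) r"
  proof (rule circle_mean_mono[OF continuous_on_const c])
    fix w :: complex assume "w \<in> sphere 0 r"
    then show "- 2 * ln (sup_norm A h S b r) - ln 2 \<le> ln (H w)"
      using ln_sup_norm_ge[of w r] r assms(3) by simp
  qed (use r in simp)
  then have "- 2 * ln (sup_norm A h S b r) - ln 2 \<le> circle_mean (\<lambda>w. ln (H w)) r" by simp
  moreover have "ln (sup_norm A h S b r) \<le> pos_part (ln (sup_norm A h S b r))" by (simp add: pos_part_def)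
  ultimately show ?thesis unfolding ricci_T_eq[OF assms] by argo
qed

end

section \<open>The second main theorem on the surface\<close>

lemma count_int_mono_start:
  assumes "sphere_map R F rho" "0 < s" "s \<le> t" "t \<le> r" "ereal r < R"
  shows "sphere_map.count_int F a t r \<le> sphere_map.count_int F a s r"
proof -
  interpret sphere_map R F rho by fact
  have "(\<Sum>p\<in>{w \<in> cball 0 r. F w = a}. ln (max r (norm p)) - ln (max t (norm p)))
     \<le> (\<Sum>p\<in>{w \<in> cball 0 r. F w = a}. ln (max r (norm p)) - ln (max s (norm p)))"
    by (intro sum_mono diff_left_mono ln_mono) (use assms in auto)
  then show ?thesis using assms by (simp add: count_int_eq)
qed

lemma char_T_split:
  assumes "sphere_map R F rho" "0 < s" "s \<le> t" "t \<le> r" "ereal r < R"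
  shows "sphere_map.char_T rho s r = sphere_map.char_T rho s t + sphere_map.char_T rho t r"
proof -
  interpret sphere_map R F rho by fact
  let ?E = "\<lambda>w. 2 * pi * rho w"
  have c: "continuous_on {0..r} (disc_mass ?E)"
    by (rule continuous_on_disc_mass) (intro continuous_intros rho_continuous assms)
  have "continuous_on {s..r} (\<lambda>t. disc_mass ?E t / t)"
    by (intro continuous_on_divide continuous_on_subset[OF c] continuous_on_id) (use assms in auto)
  then have "(\<lambda>t. disc_mass ?E t / t) integrable_on {s..r}" by (rule integrable_continuous_real)
  from Henstock_Kurzweil_Integration.integral_combine[OF assms(3,4) this] show ?thesis unfolding char_T_def iterated_def by simp
qed

locale nevanlinna_data = target_map A S b f + metric_atlas A S b h
  for A :: "'a::t2_space chart set" and S b f h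
begin

text \<open>
  The given radius \<open>r0\<close> need not be generic. The inequality is taken with a generic initial radius \<open>s\<close> slightly
  larger than \<open>r0\<close>: the characteristic function changes by a constant, the counting functions only
  decrease, and the interval up to \<open>s\<close> has finite weight. For \<open>\<delta> > 1\<close> the exceptional set for \<open>1\<close> is taken.
\<close>

theorem second_main_theorem:
  fixes \<gamma> :: "real \<Rightarrow> real" and a :: "nat \<Rightarrow> p1"
  defines "J \<equiv> {r. 0 < r \<and> ereal r < R}"
  assumes r0: "0 < r0" "ereal r0 < R" and \<gamma>pos: "\<forall>r\<in>J. \<gamma> r > 0" and \<gamma>m: "set_borel_measurable lebesgue J \<gamma>"
    and \<gamma>i: "\<forall>r\<in>J. set_integrable lebesgue {0<..<r} \<gamma>" and inj: "inj_on a {1..q}"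
  shows "\<exists>C::real. \<forall>\<delta>>0. \<exists>E. E \<subseteq> J \<and> E \<in> sets lebesgue \<and> {0<..r0} \<subseteq> E \<and>
           (\<integral>\<^sup>+r\<in>E. ennreal (\<gamma> r) \<partial>lebesgue) < \<infinity> \<and>
           (\<forall>r\<in>J - E.
              (real q - 2) * nevanlinna_T A S b r0 f r + ricci_T A S b r0 h r
              \<le> (\<Sum>j=1..q. Nbar A S b r0 f (a j) r)
                + C * (1 + pos_part (ln (nevanlinna_T A S b r0 f r))
                         + pos_part (ln (sup_norm A h S b r))
                         + pos_part (ln (\<gamma> r))
                         + pos_part (\<delta> * ln r)))"
proof -
  obtain r1 where r1: "ereal r0 < ereal r1" "ereal r1 < R" using r0(2) ereal_dense2 by blast
  have "\<exists>s. r0 < s \<and> s < r1 \<and> generic_for a q s"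
  proof (rule ccontr)
    assume n: "\<not> ?thesis"
    have "{r0<..<r1} \<subseteq> {r. ereal r < R \<and> \<not> generic_for a q r}"
      using n r1 by (auto intro: less_trans[of "ereal _" "ereal r1"])
    then have "countable {r0<..<r1}" by (rule countable_subset[OF _ countable_not_generic])
    then show False using r1(1) uncountable_open_interval[of r0 r1] by simp
  qed
  then obtain s where s: "r0 < s" "s < r1" "generic_for a q s" by blast
  have sR: "ereal s < R" using s(2) r1(2) by (auto intro: less_trans[of "ereal s" "ereal r1"])
  have s0: "0 < s" using s r0 by simp
  have sJ: "s \<in> J" using s0 sR by (simp add: J_def)
  interpret W: weighted_map R F rho a q s
    by unfold_locales (use s s0 sR in \<open>auto simp: generic_for_def\<close>)
  let ?J' = "{r. s < r \<and> ereal r < R}"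
  have J'J: "?J' \<subseteq> J" using s0 by (auto simp: J_def)
  have J'm: "?J' \<in> sets lebesgue"
  proof -
    have "?J' = {r. s < r} \<inter> {r. ereal r < R}" by auto
    moreover have "open {r. ereal r < R}" by (intro open_Collect_less continuous_intros)
    ultimately show ?thesis by (simp add: open_Collect_less)
  qed
  have \<gamma>m': "set_borel_measurable lebesgue ?J' \<gamma>"
    by (rule set_borel_measurable_subset[OF \<gamma>m J'm J'J])
  have \<gamma>pos': "\<And>r. r \<in> ?J' \<Longrightarrow> 0 < \<gamma> r" using \<gamma>pos J'J by blast
  from W.second_main_theorem_disc[OF \<gamma>m' \<gamma>pos' inj]
  obtain C1 where C1: "0 \<le> C1" and main: "\<forall>\<delta>. 0 < \<delta> \<longrightarrow> \<delta> \<le> 1 \<longrightarrow> (\<exists>E. E \<subseteq> ?J' \<and> E \<in> sets lebesgue \<and> (\<integral>\<^sup>+r\<in>E. ennreal (\<gamma> r) \<partial>lebesgue) < \<infinity> \<and>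
     (\<forall>r\<in>?J' - E. (real q - 2) * char_T s r \<le> (\<Sum>j=1..q. count_int (a j) s r)
        + C1 * (1 + pos_part (ln (char_T s r)) + pos_part (ln (\<gamma> r)) + pos_part (\<delta> * ln r))))" by blast
  \<comment> \<open>the change of the characteristic function when the initial radius is moved, and the initial value
      in \<open>ricci_T_le\<close>\<close>
  define k where "k = \<bar>(real q - 2) * char_T r0 s\<bar> + \<bar>(circle_mean (\<lambda>w. ln (H w)) r0 + ln 2) / 2\<bar>"
  define C where "C = C1 + k + 1"
  have k0: "0 \<le> k" by (simp add: k_def)
  show ?thesis
  proof (intro exI[of _ C] allI impI)
    fix \<delta> :: real assume \<delta>: "0 < \<delta>"
    obtain E where E: "E \<subseteq> ?J'" "E \<in> sets lebesgue" "(\<integral>\<^sup>+r\<in>E. ennreal (\<gamma> r) \<partial>lebesgue) < \<infinity>"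
      and ineq: "\<And>r. r \<in> ?J' - E \<Longrightarrow> (real q - 2) * char_T s r \<le> (\<Sum>j=1..q. count_int (a j) s r)
        + C1 * (1 + pos_part (ln (char_T s r)) + pos_part (ln (\<gamma> r)) + pos_part (min \<delta> 1 * ln r))"
      using mp[OF mp[OF spec[OF main, of "min \<delta> 1"]]] \<delta> by auto
    have I: "{0<..s} \<subseteq> J" using sR by (auto simp: J_def intro: le_less_trans[of "ereal _" "ereal s"])
    have "(\<integral>\<^sup>+r\<in>{0<..s}. ennreal (\<gamma> r) \<partial>lebesgue) < \<infinity>"
    proof -
      have "s < r1" "ereal r1 < R" using s r1 by auto
      then have "set_integrable lebesgue {0<..<r1} \<gamma>" using \<gamma>i s0 by (auto simp: J_def)
      then have i: "integrable lebesgue (\<lambda>r. indicator {0<..<r1} r * \<gamma> r)" by (simp add: set_integrable_def)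
      have "(\<integral>\<^sup>+r\<in>{0<..s}. ennreal (\<gamma> r) \<partial>lebesgue) \<le> (\<integral>\<^sup>+r. ennreal (norm (indicator {0<..<r1} r * \<gamma> r)) \<partial>lebesgue)"
        by (intro nn_integral_mono) (use s in \<open>auto simp: indicator_def intro!: ennreal_leI\<close>)
      also have "\<dots> < \<infinity>" using i by (simp add: integrable_iff_bounded)
      finally show ?thesis .
    qed
    moreover have "(\<integral>\<^sup>+r\<in>{0<..s} \<union> E. ennreal (\<gamma> r) \<partial>lebesgue) = (\<integral>\<^sup>+r\<in>{0<..s}. ennreal (\<gamma> r) \<partial>lebesgue) + (\<integral>\<^sup>+r\<in>E. ennreal (\<gamma> r) \<partial>lebesgue)"
    proof -
      let ?g = "\<lambda>r. ennreal (indicator J r * \<gamma> r)"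
      have g: "?g \<in> borel_measurable lebesgue" using \<gamma>m unfolding set_borel_measurable_def by simp
      have eq: "(\<integral>\<^sup>+r\<in>B. ennreal (\<gamma> r) \<partial>lebesgue) = (\<integral>\<^sup>+r. ?g r * indicator B r \<partial>lebesgue)" if "B \<subseteq> J" for B
        by (rule nn_integral_cong) (use that in \<open>auto simp: indicator_def\<close>)
      have "(\<integral>\<^sup>+r\<in>{0<..s} \<union> E. ennreal (\<gamma> r) \<partial>lebesgue) = (\<integral>\<^sup>+r. ?g r * indicator {0<..s} r + ?g r * indicator E r \<partial>lebesgue)"
        using E(1) J'J I by (subst eq) (auto simp: indicator_def intro!: nn_integral_cong)
      also have "\<dots> = (\<integral>\<^sup>+r. ?g r * indicator {0<..s} r \<partial>lebesgue) + (\<integral>\<^sup>+r. ?g r * indicator E r \<partial>lebesgue)"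
      proof -
        have "(\<integral>\<^sup>+r. ?g r * indicator B r + ?g r * indicator E r \<partial>lebesgue) = (\<integral>\<^sup>+r. ?g r * indicator B r \<partial>lebesgue) + (\<integral>\<^sup>+r. ?g r * indicator E r \<partial>lebesgue)"
          if "B \<in> sets lebesgue" for B using that g E(2) by (intro nn_integral_add) auto
        then show ?thesis by simp
      qed
      finally show ?thesis using eq[OF I] eq[of E] E(1) J'J by auto
    qed
    ultimately have fin: "(\<integral>\<^sup>+r\<in>{0<..s} \<union> E. ennreal (\<gamma> r) \<partial>lebesgue) < \<infinity>" using E(3) by (simp add: ennreal_add_less_top)
    have "(real q - 2) * nevanlinna_T A S b r0 f r + ricci_T A S b r0 h r
              \<le> (\<Sum>j=1..q. Nbar A S b r0 f (a j) r)
                + C * (1 + pos_part (ln (nevanlinna_T A S b r0 f r)) + pos_part (ln (sup_norm A h S b r))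
                         + pos_part (ln (\<gamma> r)) + pos_part (\<delta> * ln r))" if r: "r \<in> J - ({0<..s} \<union> E)" for r
    proof -
      have rs: "s < r" "ereal r < R" "r \<in> ?J' - E" using r by (auto simp: J_def)
      have T: "nevanlinna_T A S b r0 f r = char_T r0 s + char_T s r"
        using nevanlinna_T_eq[OF r0(1) rs(2)] char_T_split[OF sphere_map_axioms r0(1) _ _ rs(2), of s] s rs(1) by simp
      have T0: "0 \<le> char_T r0 s" "0 \<le> char_T s r" using char_T_nonneg[OF sR r0(1)] char_T_nonneg[OF rs(2) s0] by auto
      have N: "(\<Sum>j=1..q. count_int (a j) s r) \<le> (\<Sum>j=1..q. Nbar A S b r0 f (a j) r)"
        unfolding Nbar_eq[OF rs(2)]
        by (intro sum_mono count_int_mono_start[OF sphere_map_axioms r0(1)]) (use s rs in auto)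
      have ric: "ricci_T A S b r0 h r \<le> k - \<bar>(real q - 2) * char_T r0 s\<bar> + pos_part (ln (sup_norm A h S b r))"
      proof -
        have "r0 \<le> r" using s rs(1) by simp
        from ricci_T_le[OF r0(1) this rs(2)] abs_ge_self[of "(circle_mean (\<lambda>w. ln (H w)) r0 + ln 2) / 2"]
        show ?thesis unfolding k_def by linarith
      qed
      let ?P = "pos_part (ln (nevanlinna_T A S b r0 f r))"
      have P1: "pos_part (ln (char_T s r)) \<le> ?P"
      proof (cases "char_T s r = 0")
        case False
        then have "ln (char_T s r) \<le> ln (nevanlinna_T A S b r0 f r)" unfolding T using T0 by (intro ln_mono) auto
        then show ?thesis by (auto simp: pos_part_def)
      qed (simp add: pos_part_def)
      have P2: "pos_part (min \<delta> 1 * ln r) \<le> pos_part (\<delta> * ln r)"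
      proof (cases "0 \<le> ln r")
        case True
        then have "min \<delta> 1 * ln r \<le> \<delta> * ln r" by (intro mult_right_mono) auto
        then show ?thesis by (auto simp: pos_part_def)
      next
        case False
        then have "min \<delta> 1 * ln r \<le> 0" using \<delta> by (intro mult_nonneg_nonpos) auto
        then show ?thesis by (auto simp: pos_part_def)
      qed
      let ?A = "1 + ?P + pos_part (ln (\<gamma> r)) + pos_part (\<delta> * ln r)"
      have "C1 * (1 + pos_part (ln (char_T s r)) + pos_part (ln (\<gamma> r)) + pos_part (min \<delta> 1 * ln r)) \<le> C1 * ?A"
        using P1 P2 C1 by (intro mult_left_mono) auto
      then have "(real q - 2) * char_T s r \<le> (\<Sum>j=1..q. Nbar A S b r0 f (a j) r) + C1 * ?A"
        using ineq[OF rs(3)] N by linarith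
      moreover have "(real q - 2) * char_T r0 s \<le> \<bar>(real q - 2) * char_T r0 s\<bar>" by simp
      ultimately have "(real q - 2) * nevanlinna_T A S b r0 f r + ricci_T A S b r0 h r
          \<le> (\<Sum>j=1..q. Nbar A S b r0 f (a j) r) + C1 * ?A + k + pos_part (ln (sup_norm A h S b r))"
        using ric unfolding T by (simp add: distrib_left)
      also have "\<dots> \<le> (\<Sum>j=1..q. Nbar A S b r0 f (a j) r) + C * (?A + pos_part (ln (sup_norm A h S b r)))"
      proof -
        have "1 \<le> ?A" using pos_part_ge(2) by (simp add: add_nonneg_nonneg)
        then have "k * 1 \<le> k * ?A" using k0 by (intro mult_left_mono)
        moreover have "0 \<le> ?A" using \<open>1 \<le> ?A\<close> by linarith
        moreover have "1 * pos_part (ln (sup_norm A h S b r)) \<le> C * pos_part (ln (sup_norm A h S b r))"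
          unfolding C_def using C1 k0 by (intro mult_right_mono pos_part_ge) auto
        ultimately show ?thesis by (simp only: C_def distrib_left distrib_right)
      qed
      finally show ?thesis by (simp add: algebra_simps)
    qed
    then show "\<exists>E. E \<subseteq> J \<and> E \<in> sets lebesgue \<and> {0<..r0} \<subseteq> E \<and> (\<integral>\<^sup>+r\<in>E. ennreal (\<gamma> r) \<partial>lebesgue) < \<infinity> \<and>
           (\<forall>r\<in>J - E. (real q - 2) * nevanlinna_T A S b r0 f r + ricci_T A S b r0 h r
              \<le> (\<Sum>j=1..q. Nbar A S b r0 f (a j) r)
                + C * (1 + pos_part (ln (nevanlinna_T A S b r0 f r)) + pos_part (ln (sup_norm A h S b r))
                         + pos_part (ln (\<gamma> r)) + pos_part (\<delta> * ln r)))"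
      by (intro exI[of _ "{0<..s} \<union> E"] conjI ballI) (use E J'J I fin s(1) in auto)
  qed
qed

end

theorem theoremI:
  fixes A :: "'a::t2_space chart set"
    and S :: "'a one_form"
    and b :: 'a
    and h :: "'a metric_coeff"
    and \<gamma> :: "real \<Rightarrow> real"
    and f :: "'a \<Rightarrow> p1"
    and a :: "nat \<Rightarrow> p1"
    and q :: nat
    and r0 :: real
  defines "J \<equiv> {r. 0 < r \<and> ereal r < form_radius A S b}"
  assumes "riemann_surface A"
    and "\<not> compact (UNIV :: 'a set)"
    and "admissible_form A S b"
    and "exhausted A S b"
    and "hermitian_metric A h"
    and "0 < r0" and "ereal r0 < form_radius A S b"
    and "\<forall>r\<in>J. \<gamma> r > 0"
    and "set_borel_measurable lebesgue J \<gamma>"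
    and "\<forall>r\<in>J. set_integrable lebesgue {0<..<r} \<gamma>"
    and "(\<integral>\<^sup>+r\<in>J. ennreal (\<gamma> r) \<partial>lebesgue) = \<infinity>"
    and "meromorphic_fun A f"
    and "\<not> f constant_on UNIV"
    and "inj_on a {1..q}"
  shows "\<exists>C::real. \<forall>\<delta>>0. \<exists>E. E \<subseteq> J \<and> E \<in> sets lebesgue \<and> {0<..r0} \<subseteq> E \<and>
           (\<integral>\<^sup>+r\<in>E. ennreal (\<gamma> r) \<partial>lebesgue) < \<infinity> \<and>
           (\<forall>r\<in>J - E.
              (real q - 2) * nevanlinna_T A S b r0 f r + ricci_T A S b r0 h r
              \<le> (\<Sum>j=1..q. Nbar A S b r0 f (a j) r)
                + C * (1 + pos_part (ln (nevanlinna_T A S b r0 f r))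
                         + pos_part (ln (sup_norm A h S b r))
                         + pos_part (ln (\<gamma> r))
                         + pos_part (\<delta> * ln r)))"
proof -
  have "\<exists>x. x \<noteq> b"
  proof (rule ccontr)
    assume "\<not> ?thesis"
    then have "(UNIV :: 'a set) = {b}" by auto
    then show False using \<open>\<not> compact (UNIV :: 'a set)\<close> by (metis compact_sing)
  qed
  moreover have "0 < form_radius A S b" using \<open>0 < r0\<close> \<open>ereal r0 < form_radius A S b\<close>
    by (auto intro: less_trans[of 0 "ereal r0"])
  ultimately interpret nevanlinna_data A S b f h
    using assms(2,4-6,13,14)
    by unfold_locales (auto simp: riemann_surface_def admissible_form_def exhausted_def)
  show ?thesis unfolding J_def
    by (rule second_main_theorem) (use assms in auto)
qed

end
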